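(* Let $(\Omega^d,W_\kappa^\Omega)$ be either $(B^d,W_\kappa^B)$ or $(T^d,W_\kappa^T)$. Let $1\le p\le\infty$ and $0<\delta\le\delta_\kappa(p)$, where $$\delta_\kappa(p):=\max\left\{(2\sigma_\kappa+1)\left|\tfrac1p-\tfrac12\right|-\tfrac12,\,0\right\}.$$ Then there exists a function $f\in L^p(W_\kappa^\Omega;\Omega^d)$ such that $S_n^\delta(W_\kappa^\Omega;f)$ diverges in $L^p(W_\kappa^\Omega;\Omega^d)$ as $n\to\infty$.
   Context: Let $d\ge1$ be an integer, $\kappa=(\kappa_1,\dots,\kappa_{d+1})$ with all $\kappa_i\ge0$, $|\kappa|=\sum_{i=1}^{d+1}\kappa_i$, and $\sigma_\kappa=\frac{d-1}2+|\kappa|-\min_{1\le i\le d+1}\kappa_i$. Unit ball $B^d=\{x\in\mathbb R^d:\|x\|\le1\}$ (Euclidean norm) with weight $W_\kappa^B(x)=\prod_{i=1}^d|x_i|^{2\kappa_i}\,(1-\|x\|^2)^{\kappa_{d+1}-1/2}$. Simplex $T^d=\{x\in\mathbb R^d:x_1\ge0,\dots,x_d\ge0,\ 1-|x|\ge0\}$, $|x|=x_1+\dots+x_d$, with weight $W_\kappa^T(x)=\prod_{i=1}^dx_i^{\kappa_i-1/2}\,(1-|x|)^{\kappa_{d+1}-1/2}$. For $W=W_\kappa^\Omega$ on $\Omega^d$: $\|f\|_{W,p}=\left(a\int_{\Omega^d}|f|^pW\,dy\right)^{1/p}$ for $1\le p<\infty$, with $a^{-1}=\int_{\Omega^d}W\,dy$,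 and $\|\cdot\|_{W,\infty}$ is the uniform norm on $\Omega^d$; for $p=\infty$ the space $L^p(W;\Omega^d)$ is understood as $C(\Omega^d)$. $\mathcal V_n^d(W)$ is the space of polynomials of degree at most $n$ in $d$ variables that are orthogonal to all polynomials of degree at most $n-1$ in $L^2(W;\Omega^d)$. $\mathrm{proj}_n(W;f)$ is the orthogonal projection onto $\mathcal V_n^d(W)$, extended to $f\in L^1(W;\Omega^d)$ by integrating against the (polynomial) reproducing kernel of $\mathcal V_n^d(W)$. For $\delta>-1$, $S_n^\delta(W;f)=(A_n^\delta)^{-1}\sum_{j=0}^nA_{n-j}^\delta\,\mathrm{proj}_j(W;f)$, with $A_m^\delta=\binom{m+\delta}{m}$. *)

theory Defs
  imports "HOL-Analysis.Analysis"
begin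

text \<open>
  The dimension \<open>d\<close> is \<open>CARD('n)\<close>. The parameter tuple \<open>(\<kappa>\<^sub>1, \<dots>, \<kappa>\<^sub>d\<^sub>+\<^sub>1)\<close> is a function on
  \<open>'n option\<close>: \<open>\<kappa> (Some i)\<close> belongs to the coordinate \<open>i\<close> and \<open>\<kappa> None\<close> is \<open>\<kappa>\<^sub>d\<^sub>+\<^sub>1\<close>.
\<close>

definition sigma_kappa :: "('n::finite option \<Rightarrow> real) \<Rightarrow> real" where
  "sigma_kappa \<kappa> = (real CARD('n) - 1) / 2 + (\<Sum>i\<in>UNIV. \<kappa> i) - Min (range \<kappa>)"

text \<open>For \<open>p = \<infinity>\<close>, \<open>1 / p\<close> is \<open>0\<close> in \<^typ>\<open>ennreal\<close>.\<close>

definition delta_kappa :: "('n::finite option \<Rightarrow> real) \<Rightarrow> ennreal \<Rightarrow> real" where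
  "delta_kappa \<kappa> p = max ((2 * sigma_kappa \<kappa> + 1) * \<bar>enn2real (1 / p) - 1 / 2\<bar> - 1 / 2) 0"

definition ball_dom :: "(real ^ 'n::finite) set" where
  "ball_dom = {x. norm x \<le> 1}"

definition simplex_dom :: "(real ^ 'n::finite) set" where
  "simplex_dom = {x. (\<forall>i. x $ i \<ge> 0) \<and> 1 - (\<Sum>i\<in>UNIV. x $ i) \<ge> 0}"

text \<open>
  Since \<open>0 powr a = 0\<close> for every \<open>a\<close>, the two weights below are \<open>0\<close> wherever one of the bases
  vanishes. This is a null set, so it affects no integral.
\<close>

definition ball_weight :: "('n::finite option \<Rightarrow> real) \<Rightarrow> real ^ 'n \<Rightarrow> real" where
  "ball_weight \<kappa> x =
     (\<Prod>i\<in>UNIV. \<bar>x $ i\<bar> powr (2 * \<kappa> (Some i))) * (1 - (norm x)\<^sup>2) powr (\<kappa> None - 1 / 2)"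

definition simplex_weight :: "('n::finite option \<Rightarrow> real) \<Rightarrow> real ^ 'n \<Rightarrow> real" where
  "simplex_weight \<kappa> x =
     (\<Prod>i\<in>UNIV. (x $ i) powr (\<kappa> (Some i) - 1 / 2)) *
     (1 - (\<Sum>i\<in>UNIV. x $ i)) powr (\<kappa> None - 1 / 2)"

definition weighted_integral ::
    "(real ^ 'n::finite) set \<Rightarrow> (real ^ 'n \<Rightarrow> real) \<Rightarrow> (real ^ 'n \<Rightarrow> real) \<Rightarrow> real" where
  "weighted_integral \<Omega> W g =
     inverse (LINT y:\<Omega>|lborel. W y) * (LINT y:\<Omega>|lborel. g y * W y)"

text \<open>
  The elements are functions, not classes modulo null sets. For \<open>p = \<infinity>\<close> the space is \<open>C(\<Omega>)\<close>.
\<close>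

definition Lp_space ::
    "ennreal \<Rightarrow> (real ^ 'n::finite) set \<Rightarrow> (real ^ 'n \<Rightarrow> real) \<Rightarrow> (real ^ 'n \<Rightarrow> real) set" where
  "Lp_space p \<Omega> W =
     (if p = \<infinity> then {f. continuous_on \<Omega> f}
      else {f. set_borel_measurable lborel \<Omega> f \<and>
               set_integrable lborel \<Omega> (\<lambda>y. \<bar>f y\<bar> powr enn2real p * W y)})"

definition Lp_norm ::
    "ennreal \<Rightarrow> (real ^ 'n::finite) set \<Rightarrow> (real ^ 'n \<Rightarrow> real) \<Rightarrow> (real ^ 'n \<Rightarrow> real) \<Rightarrow> real" where
  "Lp_norm p \<Omega> W f =
     (if p = \<infinity> then (SUP x\<in>\<Omega>. \<bar>f x\<bar>)
      else weighted_integral \<Omega> W (\<lambda>y. \<bar>f y\<bar> powr enn2real p) powr (1 / enn2real p))"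

definition polys_deg_le :: "nat \<Rightarrow> (real ^ 'n::finite \<Rightarrow> real) set" where
  "polys_deg_le n =
     {P. \<exists>c :: ('n \<Rightarrow> nat) \<Rightarrow> real.
        P = (\<lambda>x. \<Sum>\<alpha> | (\<Sum>i\<in>UNIV. \<alpha> i) \<le> n. c \<alpha> * (\<Prod>i\<in>UNIV. (x $ i) ^ \<alpha> i))}"

text \<open>
  Orthogonality is required against all \<open>polys_deg_le m\<close> with \<open>m < n\<close>, so that there is no
  condition for \<open>n = 0\<close>.
\<close>

definition orth_polys ::
    "(real ^ 'n::finite) set \<Rightarrow> (real ^ 'n \<Rightarrow> real) \<Rightarrow> nat \<Rightarrow> (real ^ 'n \<Rightarrow> real) set" where
  "orth_polys \<Omega> W n =
     {P \<in> polys_deg_le n. \<forall>m<n. \<forall>Q\<in>polys_deg_le m. weighted_integral \<Omega> W (\<lambda>y. P y * Q y) = 0}"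

text \<open>
  \<open>repr_kernel \<Omega> W n x\<close> is \<open>K(x, \<cdot>)\<close> for the reproducing kernel \<open>K\<close> of the finite-dimensional
  inner product space \<open>orth_polys \<Omega> W n\<close>. It is the unique representer of evaluation at \<open>x\<close>.
\<close>

definition repr_kernel ::
    "(real ^ 'n::finite) set \<Rightarrow> (real ^ 'n \<Rightarrow> real) \<Rightarrow> nat \<Rightarrow> real ^ 'n \<Rightarrow> real ^ 'n \<Rightarrow> real" where
  "repr_kernel \<Omega> W n x =
     (THE K. K \<in> orth_polys \<Omega> W n \<and>
             (\<forall>P\<in>orth_polys \<Omega> W n. weighted_integral \<Omega> W (\<lambda>y. P y * K y) = P x))"

definition proj ::
    "(real ^ 'n::finite) set \<Rightarrow> (real ^ 'n \<Rightarrow> real) \<Rightarrow> nat \<Rightarrow> (real ^ 'n \<Rightarrow> real) \<Rightarrow> real ^ 'n \<Rightarrow> real"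
  where
  "proj \<Omega> W n f x = weighted_integral \<Omega> W (\<lambda>y. f y * repr_kernel \<Omega> W n x y)"

definition cesaro_coeff :: "real \<Rightarrow> nat \<Rightarrow> real" where
  "cesaro_coeff \<delta> m = (real m + \<delta>) gchoose m"

definition cesaro_mean ::
    "(real ^ 'n::finite) set \<Rightarrow> (real ^ 'n \<Rightarrow> real) \<Rightarrow> real \<Rightarrow> nat \<Rightarrow>
     (real ^ 'n \<Rightarrow> real) \<Rightarrow> real ^ 'n \<Rightarrow> real" where
  "cesaro_mean \<Omega> W \<delta> n f x =
     inverse (cesaro_coeff \<delta> n) * (\<Sum>j=0..n. cesaro_coeff \<delta> (n - j) * proj \<Omega> W j f x)"

definition converges_in_Lp ::
    "ennreal \<Rightarrow> (real ^ 'n::finite) set \<Rightarrow> (real ^ 'n \<Rightarrow> real) \<Rightarrow>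
     (nat \<Rightarrow> real ^ 'n \<Rightarrow> real) \<Rightarrow> bool" where
  "converges_in_Lp p \<Omega> W F \<longleftrightarrow>
     (\<exists>g\<in>Lp_space p \<Omega> W. (\<lambda>n. Lp_norm p \<Omega> W (\<lambda>x. F n x - g x)) \<longlonglongrightarrow> 0)"

end

theory Submission
  imports Defs "HOL-Complex_Analysis.Complex_Analysis" "HOL-Real_Asymp.Real_Asymp"
begin

text \<open>The proof has three parts: a reduction to Jacobi expansions on \<open>[0, 1]\<close>, an application of the
uniform boundedness principle, and a proof that the means on \<open>[0, 1]\<close> are not uniformly bounded.

\<^bold>\<open>Reduction.\<close> On both domains there are \<open>d + 1\<close> nonnegative functions with sum \<open>1\<close>: the barycentric
coordinates \<open>x\<^sub>1, \<dots>, x\<^sub>d, 1 - \<bar>x\<bar>\<close> on the simplex, and their analogues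
\<open>x\<^sub>1\<^sup>2, \<dots>, x\<^sub>d\<^sup>2, 1 - \<parallel>x\<parallel>\<^sup>2\<close> on the ball. In terms of them the moments of the two
weights are given by one and the same formula, the Dirichlet integral (lemmas \<open>dirichlet_simplex\<close> and
\<open>dirichlet_ball\<close>). Let \<open>i\<^sub>0\<close> be the index of a smallest \<open>\<kappa>\<^sub>i\<close>, and let \<open>s\<close> be \<open>1\<close> minus the coordinate \<open>i\<^sub>0\<close>. By
the Dirichlet integrals, \<open>s\<close> pushes the weight forward to a Jacobi weight \<open>t\<^sup>a (1 - t)\<^sup>b\<close> on
\<open>[0, 1]\<close> with \<open>a = \<sigma>\<^sub>\<kappa> - 1/2\<close> and \<open>b = \<kappa>\<^bsub>i\<^sub>0\<^esub> - 1/2\<close>, and the conditional expectation of a polynomial given \<open>s\<close> is a polynomial in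
\<open>s\<close>. Hence the means of \<open>F \<circ> s\<close> are the means of the Jacobi expansion of \<open>F\<close>, composed with \<open>s\<close>
(lemma \<open>cesaro_radial\<close>). On the ball only even degrees occur, and this is the role of the parameter \<open>e\<close>,
which is \<open>1\<close> on the simplex and \<open>2\<close> on the ball.

\<^bold>\<open>Uniform boundedness.\<close> If the means of every function in \<open>L\<^sup>p\<close> converged, the norms of these means would be
bounded for each function. By a gliding hump the bilinear forms \<open>\<langle>S\<^sub>n f, g\<rangle>\<close> would be bounded, uniformly in \<open>n\<close>,
on the product of the unit balls of \<open>L\<^sup>p\<close> and of the dual space (lemma \<open>uniform_boundedness\<close>). The form is
symmetric in \<open>f\<close> and \<open>g\<close>, so it is enough to treat \<open>p < 2\<close>.

\<^bold>\<open>Unboundedness.\<close> Suppose that the forms are bounded for some \<open>p < 2\<close>. Means of higher order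
\<open>\<delta> + i\<close> are averages of means of order \<open>\<delta>\<close>, so their forms satisfy the same bound, and so do the absolutely convergent
combinations of them. Such a combination has, in the limit and as a function of \<open>t = j / N\<close>, the multiplier
\<open>(1 - t\<^sup>2)\<^sup>\<delta> exp (t\<^sup>2)\<close>. It is applied to the bump \<open>(1 - s)\<^bsup>N\<^sup>2\<^esup>\<close>, whose Jacobi coefficients behave like
\<open>exp (- t\<^sup>2)\<close>. The result is a multiplier \<open>(1 - t\<^sup>2)\<^sup>\<delta>\<close> applied to a point mass at \<open>s = 0\<close>, and after the scaling
\<open>s = x / N\<^sup>2\<close> it converges to a multiple of the Bessel function \<open>x\<^bsup>- \<gamma> / 2\<^esup> J\<^sub>\<gamma> (2 \<surd>x)\<close> with
\<open>\<gamma> = a + \<delta> + 1\<close> (lemma \<open>bump_mean_limit\<close>). An energy estimate for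
the Bessel equation (lemma \<open>bessel_asymptotic_energy\<close>) shows that this function is just too large to lie in
\<open>L\<^sup>p (x\<^sup>a dx)\<close> when \<open>\<delta>\<close> does not exceed the critical index: at that index the integral up to
\<open>X\<close> grows like \<open>log X\<close>. Tested against a multiple of itself, cut off at \<open>X\<close>, it gives
\<open>log X \<le> C (log X)\<^bsup>1 - 1 / p\<^esup>\<close> for all \<open>X\<close>, which is false (lemma \<open>cesaro_form_unbounded\<close>).\<close>

section \<open>Jacobi polynomials on the unit interval\<close>

locale jacobi_weight =
  fixes a b :: real
  assumes a_gt: "a > -1/2" and b_ge: "b \<ge> -1/2"
begin

text \<open>The weight is not normalised; the expansions below do not depend on a constant factor.\<close>

definition nu :: "real measure" where
  "nu = density lborel (\<lambda>s. ennreal (indicator {0..1} s * (s powr a * (1 - s) powr b)))"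

abbreviation c :: real where "c \<equiv> a + b + 1"

text \<open>The coefficients of \<open>\<^sub>2F\<^sub>1 (- j, j + c; a + 1; s)\<close>. The polynomial \<open>R j\<close> below is therefore the Jacobi polynomial of
degree \<open>j\<close> for the weight \<open>s\<^sup>a (1 - s)\<^sup>b\<close>, with the value \<open>1\<close> at the end point \<open>s = 0\<close>.\<close>

definition coef :: "nat \<Rightarrow> nat \<Rightarrow> real" where
  "coef j k = pochhammer (- real j) k * pochhammer (real j + c) k / (pochhammer (a + 1) k * fact k)"

definition R :: "nat \<Rightarrow> real \<Rightarrow> real" where
  "R j s = (\<Sum>k\<le>j. coef j k * s ^ k)"

definition h :: "nat \<Rightarrow> real" where
  "h j = (LINT s|nu. R j s ^ 2)"

lemma sets_nu [measurable_cong, simp]: "sets nu = sets borel"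
  by (simp add: nu_def)

lemma space_nu [simp]: "space nu = UNIV"
  by (simp add: nu_def)

lemma c_pos: "c > 0" using a_gt b_ge by linarith

lemma integral_nu:
  assumes [measurable]: "f \<in> borel_measurable borel"
  shows "(LINT s|nu. f s) = (LINT s:{0..1}|lborel. f s * (s powr a * (1 - s) powr b))"
  unfolding nu_def set_lebesgue_integral_def
  by (subst integral_density) (auto intro!: Bochner_Integration.integral_cong simp: indicator_def)

lemma integrable_nu_iff:
  assumes [measurable]: "f \<in> borel_measurable borel"
  shows "integrable nu f \<longleftrightarrow> set_integrable lborel {0..1} (\<lambda>s. f s * (s powr a * (1 - s) powr b))"
  unfolding nu_def set_integrable_def
  by (subst integrable_density) (auto intro!: Bochner_Integration.integrable_cong simp: indicator_def)

lemma moment_aux: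
  "set_integrable lborel {0..1} (\<lambda>s. s ^ k * (1 - s) ^ m * (s powr a * (1 - s) powr b))"
  "(LINT s:{0..1}|lborel. s ^ k * (1 - s) ^ m * (s powr a * (1 - s) powr b)) = Beta (a + 1 + real k) (b + 1 + real m)"
proof -
  have pos: "a + 1 + real k > 0" "b + 1 + real m > 0" using a_gt b_ge by auto
  have I: "set_integrable lborel {0..1} (\<lambda>t. t powr (a + 1 + real k - 1) * (1 - t) powr (b + 1 + real m - 1))"
    by (rule integrable_Beta[OF pos])
  have eq: "indicat_real {0..1} t *\<^sub>R (t powr (a + 1 + real k - 1) * (1 - t) powr (b + 1 + real m - 1))
      = indicat_real {0..1} t *\<^sub>R (t ^ k * (1 - t) ^ m * (t powr a * (1 - t) powr b))" if "t \<noteq> 0" "t \<noteq> 1" for t :: real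
  proof (cases "t \<in> {0..1}")
    case True
    then have "t > 0" "1 - t > 0" using that by auto
    then show ?thesis using True
      by (simp add: powr_add powr_diff powr_realpow field_simps)
  qed auto
  have ae: "AE t in lborel. indicat_real {0..1} t *\<^sub>R (t powr (a + 1 + real k - 1) * (1 - t) powr (b + 1 + real m - 1))
      = indicat_real {0..1} t *\<^sub>R (t ^ k * (1 - t) ^ m * (t powr a * (1 - t) powr b))"
    using AE_lborel_singleton[of 0] AE_lborel_singleton[of 1] by eventually_elim (use eq in auto)
  show "set_integrable lborel {0..1} (\<lambda>s. s ^ k * (1 - s) ^ m * (s powr a * (1 - s) powr b))"
    using I unfolding set_integrable_def
    by (rule integrable_cong_AE_imp[OF _ _ ae]) measurable
  have "(LINT s:{0..1}|lborel. s ^ k * (1 - s) ^ m * (s powr a * (1 - s) powr b)) =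
     (LINT t:{0..1}|lborel. t powr (a + 1 + real k - 1) * (1 - t) powr (b + 1 + real m - 1))"
    unfolding set_lebesgue_integral_def by (rule integral_cong_AE[symmetric, OF _ _ ae]) measurable
  also have "\<dots> = Beta (a + 1 + real k) (b + 1 + real m)"
    using set_borel_integral_eq_integral(2)[OF I] has_integral_Beta_real[OF pos]
    by (simp add: has_integral_integrable_integral)
  finally show "(LINT s:{0..1}|lborel. s ^ k * (1 - s) ^ m * (s powr a * (1 - s) powr b)) = Beta (a + 1 + real k) (b + 1 + real m)" .
qed

lemma moment:
  "integrable nu (\<lambda>s. s ^ k * (1 - s) ^ m)"
  "(LINT s|nu. s ^ k * (1 - s) ^ m) = Beta (a + 1 + real k) (b + 1 + real m)"
  using moment_aux[of k m] by (simp_all add: integral_nu integrable_nu_iff)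

lemma finite_nu: "finite_measure nu"
proof -
  have "integrable nu (\<lambda>s. 1 :: real)" using moment(1)[of 0 0] by simp
  then have "emeasure nu UNIV < \<infinity>" unfolding integrable_iff_bounded by simp
  then show ?thesis by (intro finite_measureI) auto
qed

lemma AE_nu: "AE s in nu. s \<in> {0<..<1}"
proof -
  have "AE s in lborel. 0 < ennreal (indicator {0..1} s * (s powr a * (1 - s) powr b)) \<longrightarrow> s \<in> {0<..<1}"
    using AE_lborel_singleton[of 0] AE_lborel_singleton[of 1]
    by eventually_elim (auto simp: indicator_def order_less_le)
  then show ?thesis
    unfolding nu_def by (subst AE_density) auto
qed

lemma integrable_nu_bounded:
  fixes f :: "real \<Rightarrow> real"
  assumes [measurable]: "f \<in> borel_measurable borel" and "\<And>s. s \<in> {0..1} \<Longrightarrow> \<bar>f s\<bar> \<le> K"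
  shows "integrable nu f"
proof -
  interpret finite_measure nu by (rule finite_nu)
  show ?thesis
  proof (rule integrable_const_bound[of _ K])
    show "AE s in nu. norm (f s) \<le> K"
      using AE_nu by eventually_elim (use assms(2) in auto)
  qed simp
qed

lemma continuous_bounded_01:
  fixes f :: "real \<Rightarrow> real"
  assumes "continuous_on UNIV f"
  obtains K where "K > 0" "\<And>s. s \<in> {0..1} \<Longrightarrow> \<bar>f s\<bar> \<le> K"
proof -
  have "compact (f ` {0..1})"
    by (intro compact_continuous_image continuous_on_subset[OF assms]) auto
  then have "bounded (f ` {0..1})" by (rule compact_imp_bounded)
  then obtain K where "K > 0" "\<forall>x\<in>f ` {0..1}. norm x \<le> K" using bounded_pos by blast
  then show ?thesis using that by auto
qed

lemma integrable_nu_cont: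
  fixes f :: "real \<Rightarrow> real"
  assumes "continuous_on UNIV f"
  shows "integrable nu f"
proof -
  obtain K where "\<And>s. s \<in> {0..1} \<Longrightarrow> \<bar>f s\<bar> \<le> K" using continuous_bounded_01[OF assms] by metis
  then show ?thesis
    by (intro integrable_nu_bounded[of _ K] borel_measurable_continuous_onI assms)
qed

text \<open>Integration of the terms of \<open>R j\<close> gives Beta functions, and the Chu-Vandermonde identity sums them. The factor
\<open>pochhammer (m + 1 - j) j\<close> vanishes for \<open>m < j\<close>, which is the orthogonality of the \<open>R j\<close>; the case \<open>m = j\<close> gives
their norms, and the case \<open>m = N\<^sup>2\<close> the coefficients of the bump that tests the means.\<close>

lemma integral_R_pow:
  "(LINT s|nu. R j s * (1 - s) ^ m) =
     Beta (a + 1) (b + 1 + real m) * pochhammer (real m + 1 - real j) j / pochhammer (c + 1 + real m) j"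
proof -
  have pos: "a + 1 > 0" "b + 1 + real m > 0" "c + 1 + real m > 0" using a_gt b_ge by auto
  have B: "Beta (a + 1 + real k) (b + 1 + real m) =
      Beta (a + 1) (b + 1 + real m) * pochhammer (a + 1) k / pochhammer (c + 1 + real m) k" for k
  proof -
    have "pochhammer (a + 1) k = Gamma (a + 1 + real k) / Gamma (a + 1)"
      "pochhammer (c + 1 + real m) k = Gamma (c + 1 + real m + real k) / Gamma (c + 1 + real m)"
      using pos by (auto intro!: pochhammer_Gamma dest: nonpos_Ints_nonpos)
    moreover have "Gamma (a + 1) > 0" "Gamma (c + 1 + real m) > 0"  "Gamma (c + 1 + real m + real k) > 0"
      using pos by (auto intro!: Gamma_real_pos)
    ultimately show ?thesis unfolding Beta_def by (simp add: add_ac field_simps)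
  qed
  have V: "(\<Sum>k = 0..j. pochhammer (real j + c) k * pochhammer (- real j) k /
      (of_nat (fact k) * pochhammer (c + 1 + real m) k)) =
     pochhammer (c + 1 + real m - (real j + c)) j / pochhammer (c + 1 + real m) j"
    by (rule Vandermonde_pochhammer) (use pos in \<open>auto simp: add_eq_0_iff2\<close>)
  have "(LINT s|nu. R j s * (1 - s) ^ m) = (LINT s|nu. (\<Sum>k\<le>j. coef j k * (s ^ k * (1 - s) ^ m)))"
    unfolding R_def by (simp add: sum_distrib_right mult.assoc)
  also have "\<dots> = (\<Sum>k\<le>j. coef j k * Beta (a + 1 + real k) (b + 1 + real m))"
    by (subst Bochner_Integration.integral_sum) (auto intro!: integrable_mult_right moment simp: moment)
  also have "\<dots> = (\<Sum>k\<le>j. Beta (a + 1) (b + 1 + real m) * (pochhammer (real j + c) k * pochhammer (- real j) k /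
      (of_nat (fact k) * pochhammer (c + 1 + real m) k)))"
    using pochhammer_pos[OF pos(1)] unfolding B coef_def
    by (intro sum.cong refl) (simp add: less_imp_neq[symmetric] field_simps)
  also have "\<dots> = Beta (a + 1) (b + 1 + real m) * (\<Sum>k = 0..j. pochhammer (real j + c) k * pochhammer (- real j) k /
      (of_nat (fact k) * pochhammer (c + 1 + real m) k))"
    by (simp add: sum_distrib_left atLeast0AtMost)
  also have "\<dots> = Beta (a + 1) (b + 1 + real m) * (pochhammer (c + 1 + real m - (real j + c)) j / pochhammer (c + 1 + real m) j)"
    by (subst V) simp
  finally show ?thesis by (simp add: algebra_simps)
qed

definition Rp :: "nat \<Rightarrow> real poly" where "Rp j = (\<Sum>k\<le>j. monom (coef j k) k)"

lemma poly_Rp: "poly (Rp j) s = R j s"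
  unfolding Rp_def R_def by (simp add: poly_sum poly_monom)

lemma continuous_R [continuous_intros]: "continuous_on S (R j)"
  unfolding R_def by (intro continuous_intros)

lemma measurable_R [measurable]: "R j \<in> borel_measurable borel"
  by (intro borel_measurable_continuous_onI continuous_R)

lemma coeff_Rp: "coeff (Rp j) k = (if k \<le> j then coef j k else 0)"
  unfolding Rp_def by (auto simp add: coeff_sum)

lemma R_orthogonal:
  assumes "degree Q < j \<or> Q = 0"
  shows "(LINT s|nu. R j s * poly Q s) = 0"
proof (cases "Q = 0")
  case False
  define P where "P = pcompose Q [:1, -1:]"
  have degP: "degree P < j" using assms False by (simp add: P_def degree_pcompose)
  have "poly Q s = poly P (1 - s)" for s by (simp add: P_def poly_pcompose)
  then have "(LINT s|nu. R j s * poly Q s) = (LINT s|nu. (\<Sum>m\<le>degree P. coeff P m * (R j s * (1 - s) ^ m)))"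
    by (simp add: poly_altdef sum_distrib_left mult_ac)
  also have "\<dots> = (\<Sum>m\<le>degree P. coeff P m * (LINT s|nu. R j s * (1 - s) ^ m))"
    by (subst Bochner_Integration.integral_sum)
      (auto intro!: integrable_mult_right integrable_nu_cont continuous_intros)
  also have "\<dots> = 0"
  proof (intro sum.neutral ballI)
    fix m assume "m \<in> {..degree P}"
    then have "m < j" using degP by auto
    have "pochhammer (real m + 1 - real j) j = pochhammer (- real (j - Suc m)) j"
      using \<open>m < j\<close> by (simp add: of_nat_diff algebra_simps)
    also have "\<dots> = 0" using \<open>m < j\<close> by (subst pochhammer_of_nat_eq_0_iff) auto
    finally show "coeff P m * (LINT s|nu. R j s * (1 - s) ^ m) = 0"
      unfolding integral_R_pow by simp
  qed
  finally show ?thesis .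
qed auto

text \<open>In powers of \<open>1 - s\<close> only the leading term of one factor \<open>R j\<close> contributes to the integral of \<open>R j * R j\<close>.\<close>

lemma h_Beta:
  "h j = pochhammer (real j + c) j / pochhammer (a + 1) j * (Beta (a + 1) (b + 1 + real j) * fact j / pochhammer (c + 1 + real j) j)"
proof -
  define l where "l = pochhammer (real j + c) j / pochhammer (a + 1) j"
  define Q where "Q = Rp j - smult l ([:1, -1:] ^ j)"
  have degRp: "degree (Rp j) \<le> j" unfolding Rp_def
      by (intro degree_sum_le) (auto intro: order_trans[OF degree_monom_le])
  have "degree ([:1, -1:] ^ j :: real poly) = j" by (simp add: degree_power_eq)
  then have degQ: "degree Q \<le> j" using degRp unfolding Q_def
    by (intro degree_diff_le) (auto intro: order_trans[OF degree_smult_le])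
  have lead: "coeff ([:1, -1:] ^ j :: real poly) j = (-1) ^ j"
    using lead_coeff_power[of "[:1,-1::real:]" j] by (simp add: degree_power_eq)
  have "coef j j = l * (-1) ^ j"
    unfolding coef_def l_def by (simp add: pochhammer_same)
  then have "coeff Q j = 0" using lead by (simp add: Q_def coeff_Rp)
  then have dQ: "degree Q < j \<or> Q = 0"
    using degQ by (metis eq_zero_or_degree_less)
  have R_eq: "R j s = l * (1 - s) ^ j + poly Q s" for s
    by (simp add: Q_def poly_Rp)
  have "h j = (LINT s|nu. l * (R j s * (1 - s) ^ j) + R j s * poly Q s)"
    unfolding h_def power2_eq_square by (subst (2) R_eq) (simp add: algebra_simps)
  also have "\<dots> = l * (LINT s|nu. R j s * (1 - s) ^ j) + (LINT s|nu. R j s * poly Q s)"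
    by (subst Bochner_Integration.integral_add) (auto intro!: integrable_mult_right integrable_nu_cont continuous_intros)
  finally show ?thesis unfolding integral_R_pow R_orthogonal[OF dQ] l_def
    by (simp add: pochhammer_fact)
qed

lemma h_pos: "h j > 0"
proof -
  have "Beta (a + 1) (b + 1 + real j) > 0" unfolding Beta_def
    using a_gt b_ge by (intro divide_pos_pos mult_pos_pos Gamma_real_pos) auto
  then show ?thesis unfolding h_Beta using a_gt b_ge
    by (intro divide_pos_pos mult_pos_pos pochhammer_pos) auto
qed

lemma inverse_h:
  "inverse (h j) = (2 * real j + c) * Gamma (real j + c) * Gamma (real j + (a + 1)) /
     (Gamma (real j + 1) * Gamma (real j + (b + 1)) * (Gamma (a + 1))\<^sup>2)"
proof -
  note p = pochhammer_Gamma
  have pos: "x > 0 \<Longrightarrow> x \<notin> \<int>\<^sub>\<le>\<^sub>0" for x :: real by (auto dest: nonpos_Ints_nonpos)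
  have c: "c > 0" by (rule c_pos)
  have e1: "pochhammer (real j + c) j = Gamma (2 * real j + c) / Gamma (real j + c)"
    using c by (subst p) (auto intro!: pos simp: algebra_simps)
  have e2: "pochhammer (a + 1) j = Gamma (real j + (a + 1)) / Gamma (a + 1)"
    using a_gt by (subst p) (auto intro!: pos simp: algebra_simps)
  have e3: "pochhammer (c + 1 + real j) j = (2 * real j + c) * Gamma (2 * real j + c) / Gamma (real j + c + 1)"
  proof -
    have "pochhammer (c + 1 + real j) j = Gamma (2 * real j + c + 1) / Gamma (real j + c + 1)"
      using c by (subst p) (auto intro!: pos simp: algebra_simps)
    also have "Gamma (2 * real j + c + 1) = (2 * real j + c) * Gamma (2 * real j + c)"
      using c by (intro Gamma_plus1 pos) auto
    finally show ?thesis .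
  qed
  have e4: "Beta (a + 1) (b + 1 + real j) = Gamma (a + 1) * Gamma (real j + (b + 1)) / Gamma (real j + c + 1)"
    unfolding Beta_def by (simp add: algebra_simps)
  have e5: "fact j = Gamma (real j + 1)" by (simp add: Gamma_fact add.commute)
  have g: "Gamma (2 * real j + c) > 0" "Gamma (real j + c) > 0" "Gamma (real j + (a + 1)) > 0" "Gamma (real j + c + 1) > 0"
    "Gamma (real j + (b + 1)) > 0" "Gamma (a + 1) > 0" "Gamma (real j + 1) > 0" "2 * real j + c > 0"
    using c a_gt b_ge by (auto intro!: Gamma_real_pos)
  have alg: "inverse (X / Y / (Z / W) * (W * V / U * F / (D * X / U))) = D * Y * Z / (F * V * W\<^sup>2)"
    if "X > 0" "Y > 0" "Z > 0" "U > 0" "V > 0" "W > 0" "F > 0" "D > 0" for X Y Z U V W F D :: real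
    using that by (simp add: field_simps power2_eq_square)
  show ?thesis unfolding h_Beta e1 e2 e3 e4 e5 by (rule alg) (use g in auto)
qed

end

text \<open>This is Euler's limit for the Gamma function, read through \<open>pochhammer z (n + 1) = \<Gamma> (z + n + 1) / \<Gamma> z\<close>.\<close>

lemma Gamma_ratio_LIMSEQ:
  fixes z :: real
  assumes "z > 0"
  shows "(\<lambda>n. Gamma (real n + z) / (Gamma (real n + 1) * real n powr (z - 1))) \<longlonglongrightarrow> 1"
proof -
  have z: "z \<notin> \<int>\<^sub>\<le>\<^sub>0" using assms by (auto dest: nonpos_Ints_nonpos)
  have G: "Gamma z > 0" using assms by (rule Gamma_real_pos)
  have "(\<lambda>n. Gamma_series z n) \<longlonglongrightarrow> Gamma z" by (rule Gamma_series_LIMSEQ)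
  then have "(\<lambda>n. Gamma z / Gamma_series z n) \<longlonglongrightarrow> Gamma z / Gamma z"
    using G by (intro tendsto_divide tendsto_const) auto
  moreover have "(\<lambda>n. real n / (real n + z)) \<longlonglongrightarrow> 1" by real_asymp
  ultimately have "(\<lambda>n. Gamma z / Gamma_series z n * (real n / (real n + z))) \<longlonglongrightarrow> Gamma z / Gamma z * 1"
    by (rule tendsto_mult)
  moreover have "\<forall>\<^sub>F n in sequentially. Gamma z / Gamma_series z n * (real n / (real n + z)) =
     Gamma (real n + z) / (Gamma (real n + 1) * real n powr (z - 1))"
    using eventually_gt_at_top[of 0]
  proof eventually_elim
    case (elim n)
    have "pochhammer z (n + 1) = Gamma (z + real (n + 1)) / Gamma z"
      by (rule pochhammer_Gamma[OF z])
    also have "z + real (n + 1) = (real n + z) + 1" by simp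
    also have "Gamma \<dots> = (real n + z) * Gamma (real n + z)"
      using assms by (intro Gamma_plus1) (auto dest: nonpos_Ints_nonpos)
    finally have P: "pochhammer z (n + 1) = (real n + z) * Gamma (real n + z) / Gamma z" .
    have E: "exp (z * of_real (ln (of_nat n))) = real n powr z" using elim by (simp add: powr_def)
    have F: "fact n = Gamma (real n + 1)" by (simp add: Gamma_fact add.commute)
    have "Gamma (real n + 1) > 0" "real n + z > 0" "real n powr z > 0" using elim assms by (auto intro!: Gamma_real_pos)
    moreover have "G / (X * P / (D * H / G)) * (Q / D) = H / (X * (P / Q))"
      if "G > 0" "X > 0" "P > 0" "D > 0" "Q > 0" for G X P D H Q :: real
      using that by (simp add: divide_simps)
    ultimately show ?case unfolding Gamma_series_def P E F using elim G
      by (simp add: powr_diff)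
  qed
  ultimately show ?thesis using G by (simp add: tendsto_cong)
qed

section \<open>Jacobi polynomials near the end point\<close>

text \<open>With this normalisation \<open>J\<^sub>g (r) = (r / 2)\<^sup>g * bessel g (r\<^sup>2 / 4) / \<Gamma> (g + 1)\<close>.\<close>

definition bessel :: "real \<Rightarrow> real \<Rightarrow> real" where
  "bessel g x = (\<Sum>k. (- x) ^ k / (pochhammer (g + 1) k * fact k))"

lemma poch_ge_half:
  assumes "g > -1/2"
  shows "pochhammer (g + 1 :: real) k \<ge> (1/2) ^ k"
proof -
  have "(\<Prod>i\<in>{0..<k}. 1/2) \<le> (\<Prod>i\<in>{0..<k}. (g + 1 + real i))"
    by (rule prod_mono) (use assms in auto)
  then show ?thesis by (simp add: pochhammer_prod)
qed

lemma bessel_term_bound: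
  fixes g x :: real
  assumes "g > -1/2"
  shows "\<bar>x ^ k / (pochhammer (g + 1) k * fact k)\<bar> \<le> (2 * \<bar>x\<bar>) ^ k / fact k"
proof -
  have p: "pochhammer (g + 1) k \<ge> (1/2) ^ k" by (rule poch_ge_half[OF assms])
  have "(0::real) < (1/2) ^ k" by simp
  with p have p0: "pochhammer (g + 1) k > 0" by linarith
  have "\<bar>x ^ k / (pochhammer (g + 1) k * fact k)\<bar> = \<bar>x\<bar> ^ k / (pochhammer (g + 1) k * fact k)"
    using p0 by (simp add: abs_mult power_abs)
  also have "\<dots> \<le> \<bar>x\<bar> ^ k / ((1/2) ^ k * fact k)"
    using p p0 by (intro divide_left_mono mult_right_mono mult_pos_pos) auto
  also have "\<dots> = (2 * \<bar>x\<bar>) ^ k / fact k"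
    by (simp add: power_mult_distrib power_divide)
  finally show ?thesis .
qed

lemma exp_summable: "summable (\<lambda>k. (y::real) ^ k / fact k)"
  using summable_exp[of y] by (simp add: divide_inverse mult.commute)

context jacobi_weight
begin

lemma inverse_h_asymp: "(\<lambda>n. inverse (h n) / real n powr (2 * a + 1)) \<longlonglongrightarrow> 2 / (Gamma (a + 1))\<^sup>2"
proof -
  have pos: "c > 0" "a + 1 > 0" "b + 1 > 0" using a_gt b_ge by auto
  define f where "f z n = Gamma (real n + z) / (Gamma (real n + 1) * real n powr (z - 1))" for z :: real and n :: nat
  have lim: "f z \<longlonglongrightarrow> 1" if "z > 0" for z
    unfolding f_def by (rule Gamma_ratio_LIMSEQ[OF that])
  have "(\<lambda>n. (2 * real n + c) / real n) \<longlonglongrightarrow> 2" by real_asymp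
  then have "(\<lambda>n. (2 * real n + c) / real n * f c n * f (a + 1) n / (f (b + 1) n * (Gamma (a + 1))\<^sup>2)) \<longlonglongrightarrow>
     2 * 1 * 1 / (1 * (Gamma (a + 1))\<^sup>2)"
    using pos Gamma_real_pos[OF pos(2)] by (intro tendsto_intros lim) (auto simp del: Gamma_real_pos)
  moreover have "\<forall>\<^sub>F n in sequentially. (2 * real n + c) / real n * f c n * f (a + 1) n / (f (b + 1) n * (Gamma (a + 1))\<^sup>2) =
      inverse (h n) / real n powr (2 * a + 1)"
    using eventually_gt_at_top[of 0]
  proof eventually_elim
    case (elim n)
    have alg: "D / N * (X / (F * (P * Q))) * (Y / (F * P)) / (Z / (F * Q) * W\<^sup>2) =
        D * X * Y / (F * Z * W\<^sup>2) / (P * P * N)" if "N > 0" "F > 0" "P > 0" "Q > 0" "Z > 0" "W > 0"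
      for D N X F P Q Y Z W :: real
      using that by (simp add: field_simps)
    have e: "real n powr (c - 1) = real n powr a * real n powr b" "real n powr (2 * a + 1) = real n powr a * real n powr a * real n"
      "real n powr (a + 1 - 1) = real n powr a" "real n powr (b + 1 - 1) = real n powr b"
      using elim by (simp_all add: powr_add[symmetric]) (simp add: powr_add)
    show ?case unfolding f_def inverse_h e
      by (rule alg) (use elim pos in \<open>auto intro!: Gamma_real_pos\<close>)
  qed
  ultimately show ?thesis by (simp add: tendsto_cong)
qed

lemma inverse_h_bound:
  obtains K where "K > 0" "\<And>n. inverse (h n) \<le> K * (real n + 1) powr (2 * a + 1)"
proof -
  have "Bseq (\<lambda>n. inverse (h n) / real n powr (2 * a + 1))"
    by (rule convergent_imp_Bseq) (use inverse_h_asymp in \<open>auto simp: convergent_def\<close>)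
  then obtain K where K: "K > 0" "\<And>n. norm (inverse (h n) / real n powr (2 * a + 1)) \<le> K"
    unfolding Bseq_def by auto
  have "inverse (h n) \<le> max K (inverse (h 0)) * (real n + 1) powr (2 * a + 1)" for n
  proof (cases "n = 0")
    case False
    then have p: "real n powr (2 * a + 1) > 0" by simp
    have "inverse (h n) / real n powr (2 * a + 1) \<le> K" using K(2)[of n] h_pos[of n] by simp
    then have "inverse (h n) \<le> K * real n powr (2 * a + 1)" using p by (simp only: pos_divide_le_eq)
    also have "\<dots> \<le> max K (inverse (h 0)) * (real n + 1) powr (2 * a + 1)"
      using K a_gt by (intro mult_mono powr_mono2) auto
    finally show ?thesis .
  qed auto
  then show ?thesis using that[of "max K (inverse (h 0))"] K(1) by auto
qed

lemma Beta_asymp: "(\<lambda>n. Beta (a + 1) (b + 1 + real n) * real n powr (a + 1)) \<longlonglongrightarrow> Gamma (a + 1)"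
proof -
  have pos: "c > 0" "a + 1 > 0" "b + 1 > 0" using a_gt b_ge by auto
  define f where "f z n = Gamma (real n + z) / (Gamma (real n + 1) * real n powr (z - 1))" for z :: real and n :: nat
  have lim: "f z \<longlonglongrightarrow> 1" if "z > 0" for z
    unfolding f_def by (rule Gamma_ratio_LIMSEQ[OF that])
  have "(\<lambda>n. Gamma (a + 1) * f (b + 1) n / f (c + 1) n) \<longlonglongrightarrow> Gamma (a + 1) * 1 / 1"
    using pos by (intro tendsto_intros lim) auto
  moreover have "\<forall>\<^sub>F n in sequentially. Gamma (a + 1) * f (b + 1) n / f (c + 1) n = Beta (a + 1) (b + 1 + real n) * real n powr (a + 1)"
    using eventually_gt_at_top[of 0]
  proof eventually_elim
    case (elim n)
    have alg: "G * (X / (F * P)) / (Y / (F * (P * Q))) = G * X / Y * Q"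
      if "F > 0" "P > 0" "Q > 0" "Y > 0" for G X F P Y Q :: real
      using that by (simp add: field_simps)
    have e: "real n powr (c + 1 - 1) = real n powr b * real n powr (a + 1)" "real n powr (b + 1 - 1) = real n powr b"
      "Beta (a + 1) (b + 1 + real n) = Gamma (a + 1) * Gamma (real n + (b + 1)) / Gamma (real n + (c + 1))"
      using elim by (simp_all add: powr_add[symmetric] Beta_def algebra_simps)
    show ?case unfolding f_def e
      by (rule alg) (use elim pos in \<open>auto intro!: Gamma_real_pos\<close>)
  qed
  ultimately show ?thesis by (simp add: tendsto_cong)
qed

lemma coef_eq_0: "k > j \<Longrightarrow> coef j k = 0"
  unfolding coef_def by (simp add: pochhammer_of_nat_eq_0_iff)

lemma R_suminf: "R j s = (\<Sum>k. coef j k * s ^ k)"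
  unfolding R_def by (subst suminf_finite[of "{..j}"]) (auto simp: coef_eq_0)

text \<open>A bound that is uniform in the degree, as dominated convergence requires. The growth of the coefficients in \<open>j\<close>
is compensated by the scaling with \<open>n\<^sup>2\<close> as long as \<open>j \<le> n\<close>.\<close>

lemma coef_bound:
  assumes "j \<le> n" "n \<ge> 1"
  shows "\<bar>coef j k * (x / (real n)\<^sup>2) ^ k\<bar> \<le> (2 * ((2 + c) * \<bar>x\<bar>)) ^ k / fact k"
proof (cases "k \<le> j")
  case True
  have "\<bar>pochhammer (- real j) k\<bar> \<le> (\<Prod>i\<in>{0..<k}. real n)"
    unfolding pochhammer_prod abs_prod by (rule prod_mono) (use True assms in auto)
  then have 1: "\<bar>pochhammer (- real j) k\<bar> \<le> real n ^ k" by simp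
  have "\<bar>pochhammer (real j + c) k\<bar> \<le> (\<Prod>i\<in>{0..<k}. (2 + c) * real n)"
    unfolding pochhammer_prod abs_prod
  proof (rule prod_mono)
    fix i assume "i \<in> {0..<k}"
    then have "real i \<le> real n" "real j \<le> real n" "1 \<le> real n" using True assms by auto
    moreover have "c * 1 \<le> c * real n" using c_pos assms by (intro mult_left_mono) auto
    ultimately show "0 \<le> \<bar>real j + c + real i\<bar> \<and> \<bar>real j + c + real i\<bar> \<le> (2 + c) * real n"
      using c_pos by (simp add: algebra_simps)
  qed
  then have 2: "\<bar>pochhammer (real j + c) k\<bar> \<le> ((2 + c) * real n) ^ k" by simp
  have "\<bar>pochhammer (- real j) k * pochhammer (real j + c) k\<bar> \<le> real n ^ k * ((2 + c) * real n) ^ k"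
    unfolding abs_mult by (rule mult_mono[OF 1 2]) auto
  also have "\<dots> = (2 + c) ^ k * ((real n)\<^sup>2) ^ k" by (simp add: power_mult_distrib power2_eq_square)
  finally have 3: "\<bar>pochhammer (- real j) k * pochhammer (real j + c) k\<bar> \<le> (2 + c) ^ k * ((real n)\<^sup>2) ^ k" .
  have pa: "pochhammer (a + 1) k > 0" using a_gt by (intro pochhammer_pos) auto
  have "\<bar>coef j k * (x / (real n)\<^sup>2) ^ k\<bar> =
     \<bar>pochhammer (- real j) k * pochhammer (real j + c) k\<bar> / ((real n)\<^sup>2) ^ k * \<bar>x ^ k / (pochhammer (a + 1) k * fact k)\<bar>"
    unfolding coef_def using pa by (simp add: abs_mult power_divide)
  also have "\<dots> \<le> (2 + c) ^ k * ((2 * \<bar>x\<bar>) ^ k / fact k)"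
    using 3 assms by (intro mult_mono bessel_term_bound a_gt) (use c_pos in \<open>auto simp: field_simps\<close>)
  also have "\<dots> = (2 * ((2 + c) * \<bar>x\<bar>)) ^ k / fact k"
    by (simp only: power_mult_distrib times_divide_eq_right mult_ac)
  finally show ?thesis .
next
  case False
  then have "coef j k = 0" by (intro coef_eq_0) auto
  then show ?thesis using c_pos by simp
qed

lemma R_bound:
  assumes "j \<le> n" "n \<ge> 1"
  shows "\<bar>R j (x / (real n)\<^sup>2)\<bar> \<le> exp (2 * ((2 + c) * \<bar>x\<bar>))"
proof -
  have s: "summable (\<lambda>k. (2 * ((2 + c) * \<bar>x\<bar>)) ^ k / fact k)" by (rule exp_summable)
  have "norm (\<Sum>k. coef j k * (x / (real n)\<^sup>2) ^ k) \<le> (\<Sum>k. (2 * ((2 + c) * \<bar>x\<bar>)) ^ k / fact k)"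
    using coef_bound[OF assms] by (intro norm_suminf_le s) (simp only: real_norm_def)
  then have "\<bar>R j (x / (real n)\<^sup>2)\<bar> \<le> (\<Sum>k. (2 * ((2 + c) * \<bar>x\<bar>)) ^ k / fact k)"
    by (simp only: R_suminf real_norm_def)
  then show ?thesis by (simp add: exp_def divide_inverse mult.commute)
qed

text \<open>The termwise limit is justified by Tannery's theorem.\<close>

lemma Mehler_Heine:
  fixes jn :: "nat \<Rightarrow> nat"
  assumes lim: "(\<lambda>n. real (jn n) / real n) \<longlonglongrightarrow> t" and le: "\<And>n. jn n \<le> n"
  shows "(\<lambda>n. R (jn n) (x / (real n)\<^sup>2)) \<longlonglongrightarrow> bessel a (x * t\<^sup>2)"
proof -
  have inv: "(\<lambda>n. y / real n) \<longlonglongrightarrow> 0" for y :: real by real_asymp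
  have 1: "(\<lambda>n. coef (jn n) k * (x / (real n)\<^sup>2) ^ k) \<longlonglongrightarrow> (- (x * t\<^sup>2)) ^ k / (pochhammer (a + 1) k * fact k)" for k
  proof -
    have l1: "(\<lambda>n. \<Prod>i\<in>{0..<k}. (- (real (jn n) / real n) + real i / real n)) \<longlonglongrightarrow> (\<Prod>i\<in>{0..<k}. - t + 0)"
      by (intro tendsto_intros lim inv)
    have l2: "(\<lambda>n. \<Prod>i\<in>{0..<k}. (real (jn n) / real n + (c + real i) / real n)) \<longlonglongrightarrow> (\<Prod>i\<in>{0..<k}. t + 0)"
      by (intro tendsto_intros lim inv)
    have l3: "(\<lambda>n. (\<Prod>i\<in>{0..<k}. (- (real (jn n) / real n) + real i / real n)) *
         (\<Prod>i\<in>{0..<k}. (real (jn n) / real n + (c + real i) / real n)) * (x ^ k / (pochhammer (a + 1) k * fact k)))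
        \<longlonglongrightarrow> (\<Prod>i\<in>{0..<k}. - t + 0) * (\<Prod>i\<in>{0..<k}. t + 0) * (x ^ k / (pochhammer (a + 1) k * fact k))"
      by (intro tendsto_mult l1 l2 tendsto_const)
    have "\<forall>\<^sub>F n in sequentially. (\<Prod>i\<in>{0..<k}. (- (real (jn n) / real n) + real i / real n)) *
         (\<Prod>i\<in>{0..<k}. (real (jn n) / real n + (c + real i) / real n)) * (x ^ k / (pochhammer (a + 1) k * fact k))
        = coef (jn n) k * (x / (real n)\<^sup>2) ^ k"
      using eventually_gt_at_top[of 0]
    proof eventually_elim
      case (elim n)
      have "(\<Prod>i\<in>{0..<k}. (- (real (jn n) / real n) + real i / real n)) = (\<Prod>i\<in>{0..<k}. (- real (jn n) + real i) / real n)"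
        by (intro prod.cong refl) (simp add: diff_divide_distrib)
      also have "\<dots> = pochhammer (- real (jn n)) k / real n ^ k" by (simp add: prod_dividef pochhammer_prod)
      finally have e1: "(\<Prod>i\<in>{0..<k}. (- (real (jn n) / real n) + real i / real n)) = pochhammer (- real (jn n)) k / real n ^ k" .
      have "(\<Prod>i\<in>{0..<k}. (real (jn n) / real n + (c + real i) / real n)) = (\<Prod>i\<in>{0..<k}. (real (jn n) + c + real i) / real n)"
        by (intro prod.cong refl) (simp add: add_divide_distrib)
      also have "\<dots> = pochhammer (real (jn n) + c) k / real n ^ k" by (simp add: prod_dividef pochhammer_prod)
      finally have e2: "(\<Prod>i\<in>{0..<k}. (real (jn n) / real n + (c + real i) / real n)) = pochhammer (real (jn n) + c) k / real n ^ k" .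
      show ?case unfolding e1 e2 coef_def
        by (simp add: power_divide power2_eq_square power_mult_distrib)
    qed
    have e3: "(\<Prod>i\<in>{0..<k}. - t + 0) * (\<Prod>i\<in>{0..<k}. t + 0) * (x ^ k / (pochhammer (a + 1) k * fact k))
       = (- (x * t\<^sup>2)) ^ k / (pochhammer (a + 1) k * fact k)"
      by (simp add: power_mult_distrib[symmetric] power2_eq_square mult_ac)
    from Lim_transform_eventually[OF l3 \<open>eventually _ _\<close>] show ?thesis unfolding e3 .
  qed
  have "((\<lambda>n. \<Sum>k. coef (jn n) k * (x / (real n)\<^sup>2) ^ k) \<longlonglongrightarrow> (\<Sum>k. (- (x * t\<^sup>2)) ^ k / (pochhammer (a + 1) k * fact k)))"
  proof (rule tannerys_theorem[THEN conjunct2, THEN conjunct2, OF 1 _ exp_summable])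
    show "\<forall>\<^sub>F (k, n) in at_top \<times>\<^sub>F sequentially.
       norm (coef (jn n) k * (x / (real n)\<^sup>2) ^ k) \<le> (2 * ((2 + c) * \<bar>x\<bar>)) ^ k / fact k"
      unfolding eventually_prod_filter
      by (rule exI[of _ "\<lambda>_. True"], rule exI[of _ "\<lambda>n. n \<ge> 1"])
        (use coef_bound[OF le] in \<open>simp add: eventually_ge_at_top del: power_mult_distrib\<close>)
  qed auto
  then show ?thesis by (simp add: R_suminf bessel_def)
qed

text \<open>The ratio of the Jacobi coefficient of \<open>(1 - s)\<^sup>m\<close> of degree \<open>j\<close> to the one of degree \<open>0\<close>, by lemma \<open>integral_R_pow\<close>.\<close>

definition rho :: "nat \<Rightarrow> nat \<Rightarrow> real" where
  "rho m j = pochhammer (real m + 1 - real j) j / pochhammer (c + 1 + real m) j"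

lemma rho_prod:
  "rho m j = (\<Prod>i\<in>{0..<j}. (1 - (c + 1 + 2 * real i) / (c + 1 + real m + real i)))"
proof -
  have "pochhammer (real m + 1 - real j) j = (\<Prod>i\<in>{0..<j}. real m - real i)"
    unfolding pochhammer_prod
    by (rule prod.reindex_bij_witness[of _ "\<lambda>i. j - 1 - i" "\<lambda>i. j - 1 - i"]) (auto simp: of_nat_diff)
  then have "rho m j = (\<Prod>i\<in>{0..<j}. (real m - real i) / (c + 1 + real m + real i))"
    by (simp add: rho_def pochhammer_prod prod_dividef)
  also have "\<dots> = (\<Prod>i\<in>{0..<j}. (1 - (c + 1 + 2 * real i) / (c + 1 + real m + real i)))"
  proof (intro prod.cong refl)
    fix i :: nat
    have "c + 1 + real m + real i > 0" using c_pos by simp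
    then show "(real m - real i) / (c + 1 + real m + real i) = 1 - (c + 1 + 2 * real i) / (c + 1 + real m + real i)"
      by (simp add: field_simps)
  qed
  finally show ?thesis .
qed

lemma rho_bounds:
  assumes "j \<le> m" shows "0 \<le> rho m j" "rho m j \<le> 1"
proof -
  have *: "0 \<le> 1 - (c + 1 + 2 * real i) / (c + 1 + real m + real i) \<and> 1 - (c + 1 + 2 * real i) / (c + 1 + real m + real i) \<le> 1"
    if "i < j" for i
  proof -
    have "c + 1 + real m + real i > 0" "c + 1 + 2 * real i \<ge> 0" "real i \<le> real m" using c_pos that assms by auto
    then show ?thesis by (simp add: field_simps)
  qed
  show "0 \<le> rho m j" unfolding rho_prod by (rule prod_nonneg) (use * in auto)
  show "rho m j \<le> 1" unfolding rho_prod by (rule prod_le_1) (use * in auto)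
qed

text \<open>The logarithm of the product is the negative sum of the quantities \<open>(c + 1 + 2 i) / (c + 1 + n\<^sup>2 + i)\<close>, up to an error that is
bounded by the sum of their squares. The sum behaves like \<open>(j / n)\<^sup>2\<close>, and the error tends to \<open>0\<close>.\<close>

lemma rho_limit:
  fixes jn :: "nat \<Rightarrow> nat"
  assumes lim: "(\<lambda>n. real (jn n) / real n) \<longlonglongrightarrow> t" and le: "\<And>n. jn n \<le> n"
  shows "(\<lambda>n. rho (n\<^sup>2) (jn n)) \<longlonglongrightarrow> exp (- t\<^sup>2)"
proof -
  define x where "x n i = (c + 1 + 2 * real i) / (c + 1 + (real n)\<^sup>2 + real i)" for n i :: nat
  define S where "S n = (\<Sum>i\<in>{0..<jn n}. x n i)" for n
  define T where "T n = (\<Sum>i\<in>{0..<jn n}. c + 1 + 2 * real i)" for n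
  have T_eq: "T n = real (jn n) * c + real (jn n) ^ 2" for n
  proof -
    have "(\<Sum>i\<in>{0..<k}. c + 1 + 2 * real i) = real k * c + real k ^ 2" for k
      by (induction k) (auto simp: algebra_simps power2_eq_square)
    then show ?thesis by (simp add: T_def)
  qed
  have T_lim: "(\<lambda>n. T n / (real n)\<^sup>2) \<longlonglongrightarrow> t\<^sup>2"
  proof -
    have "(\<lambda>n. c / real n) \<longlonglongrightarrow> 0" by real_asymp
    then have "(\<lambda>n. (real (jn n) / real n) * (c / real n) + (real (jn n) / real n) ^ 2) \<longlonglongrightarrow> t * 0 + t ^ 2"
      by (intro tendsto_intros lim)
    then show ?thesis by (simp add: T_eq power2_eq_square add_divide_distrib[of "_ * c"])
  qed
  have x_bd: "0 \<le> x n i" "x n i \<le> (c + 1 + 2 * real n) / (real n)\<^sup>2" if "i < jn n" for n i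
  proof -
    have "i < n" using that le[of n] by auto
    then show "0 \<le> x n i" "x n i \<le> (c + 1 + 2 * real n) / (real n)\<^sup>2"
      unfolding x_def using c_pos by (auto intro!: divide_nonneg_pos frac_le add_nonneg_pos)
  qed
  have S_lim: "S \<longlonglongrightarrow> t\<^sup>2"
  proof (rule tendsto_sandwich)
    show "\<forall>\<^sub>F n in sequentially. (real n)\<^sup>2 / (c + 1 + (real n)\<^sup>2 + real n) * (T n / (real n)\<^sup>2) \<le> S n"
      using eventually_gt_at_top[of 0]
    proof eventually_elim
      case (elim n)
      have "(real n)\<^sup>2 / (c + 1 + (real n)\<^sup>2 + real n) * (T n / (real n)\<^sup>2) = (\<Sum>i\<in>{0..<jn n}. (c + 1 + 2 * real i) / (c + 1 + (real n)\<^sup>2 + real n))"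
        using elim by (simp add: T_def flip: sum_divide_distrib)
      also have "\<dots> \<le> S n" unfolding S_def x_def
      proof (rule sum_mono)
        fix i assume "i \<in> {0..<jn n}"
        then have "i \<le> n" using le[of n] by auto
        then show "(c + 1 + 2 * real i) / (c + 1 + (real n)\<^sup>2 + real n) \<le> (c + 1 + 2 * real i) / (c + 1 + (real n)\<^sup>2 + real i)"
          using c_pos by (intro divide_left_mono mult_pos_pos) (auto simp: add_pos_nonneg intro: add_pos_nonneg)
      qed
      finally show ?case .
    qed
    show "\<forall>\<^sub>F n in sequentially. S n \<le> T n / (real n)\<^sup>2"
      using eventually_gt_at_top[of 0]
    proof eventually_elim
      case (elim n)
      have p: "0 < c + 1 + (real n)\<^sup>2 + real i" "(real n)\<^sup>2 \<le> c + 1 + (real n)\<^sup>2 + real i"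
        "0 \<le> c + 1 + 2 * real i" for i
        using c_pos zero_le_power2[of "real n"] by linarith+
      show ?case unfolding S_def T_def x_def sum_divide_distrib
        using elim by (intro sum_mono divide_left_mono mult_pos_pos p) auto
    qed
    have "(\<lambda>n. (real n)\<^sup>2 / (c + 1 + (real n)\<^sup>2 + real n)) \<longlonglongrightarrow> 1" by real_asymp
    then have "(\<lambda>n. (real n)\<^sup>2 / (c + 1 + (real n)\<^sup>2 + real n) * (T n / (real n)\<^sup>2)) \<longlonglongrightarrow> 1 * t\<^sup>2"
      by (intro tendsto_mult T_lim)
    then show "(\<lambda>n. (real n)\<^sup>2 / (c + 1 + (real n)\<^sup>2 + real n) * (T n / (real n)\<^sup>2)) \<longlonglongrightarrow> t\<^sup>2" by simp
  qed (rule T_lim)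
  define L where "L n = (\<Sum>i\<in>{0..<jn n}. ln (1 - x n i))" for n
  have small: "\<forall>\<^sub>F n in sequentially. (c + 1 + 2 * real n) / (real n)\<^sup>2 \<le> 1/2"
  proof -
    have "(\<lambda>n. (c + 1 + 2 * real n) / (real n)\<^sup>2) \<longlonglongrightarrow> 0" by real_asymp
    from order_tendstoD(2)[OF this, of "1/2"] show ?thesis by (auto elim!: eventually_mono)
  qed
  have diff: "(\<lambda>n. L n + S n) \<longlonglongrightarrow> 0"
  proof (rule Lim_null_comparison)
    show "\<forall>\<^sub>F n in sequentially. norm (L n + S n) \<le> real n * (2 * ((c + 1 + 2 * real n) / (real n)\<^sup>2)\<^sup>2)"
      using small
    proof eventually_elim
      case (elim n)
      have "norm (L n + S n) = \<bar>\<Sum>i\<in>{0..<jn n}. ln (1 - x n i) + x n i\<bar>"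
        by (simp add: L_def S_def sum.distrib)
      also have "\<dots> \<le> (\<Sum>i\<in>{0..<jn n}. \<bar>ln (1 - x n i) + x n i\<bar>)" by (rule sum_abs)
      also have "\<dots> \<le> (\<Sum>i\<in>{0..<jn n}. 2 * ((c + 1 + 2 * real n) / (real n)\<^sup>2)\<^sup>2)"
      proof (rule sum_mono)
        fix i assume "i \<in> {0..<jn n}"
        then have b: "0 \<le> x n i" "x n i \<le> (c + 1 + 2 * real n) / (real n)\<^sup>2" using x_bd by auto
        then have "\<bar>- x n i\<bar> \<le> 1/2" using elim by linarith
        from abs_ln_one_plus_x_minus_x_bound[OF this]
        have "\<bar>ln (1 - x n i) + x n i\<bar> \<le> 2 * (x n i)\<^sup>2" by simp
        also have "\<dots> \<le> 2 * ((c + 1 + 2 * real n) / (real n)\<^sup>2)\<^sup>2"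
          using b by (intro mult_left_mono power_mono) auto
        finally show "\<bar>ln (1 - x n i) + x n i\<bar> \<le> 2 * ((c + 1 + 2 * real n) / (real n)\<^sup>2)\<^sup>2" .
      qed
      also have "\<dots> \<le> real n * (2 * ((c + 1 + 2 * real n) / (real n)\<^sup>2)\<^sup>2)"
        using le[of n] by (auto intro!: mult_right_mono)
      finally show ?case .
    qed
    show "(\<lambda>n. real n * (2 * ((c + 1 + 2 * real n) / (real n)\<^sup>2)\<^sup>2)) \<longlonglongrightarrow> 0" by real_asymp
  qed
  have "(\<lambda>n. (L n + S n) - S n) \<longlonglongrightarrow> 0 - t\<^sup>2" by (intro tendsto_diff diff S_lim)
  then have "(\<lambda>n. exp (L n)) \<longlonglongrightarrow> exp (- t\<^sup>2)" by (intro tendsto_exp) simp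
  moreover have "\<forall>\<^sub>F n in sequentially. exp (L n) = rho (n\<^sup>2) (jn n)"
    using small
  proof eventually_elim
    case (elim n)
    have "exp (L n) = (\<Prod>i\<in>{0..<jn n}. exp (ln (1 - x n i)))" unfolding L_def by (simp add: exp_sum)
    also have "\<dots> = (\<Prod>i\<in>{0..<jn n}. 1 - x n i)"
    proof (intro prod.cong refl)
      fix i assume "i \<in> {0..<jn n}"
      then have "x n i \<le> 1/2" using x_bd(2)[of i n] elim by (meson atLeastLessThan_iff order_trans)
      then show "exp (ln (1 - x n i)) = 1 - x n i" by simp
    qed
    also have "\<dots> = rho (n\<^sup>2) (jn n)" unfolding rho_prod x_def by simp
    finally show ?case .
  qed
  ultimately show ?thesis by (rule Lim_transform_eventually)
qed

end

section \<open>Bessel functions at infinity\<close>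

lemma bessel_summable:
  assumes "g > -1/2"
  shows "summable (\<lambda>k. (-1) ^ k / (pochhammer (g + 1) k * fact k) * (x::real) ^ k)"
proof (rule summable_comparison_test'[OF exp_summable[of "2 * \<bar>x\<bar>"]])
  fix k
  show "norm ((-1) ^ k / (pochhammer (g + 1) k * fact k) * x ^ k) \<le> (2 * \<bar>x\<bar>) ^ k / fact k"
    using bessel_term_bound[OF assms, of "x" k] by (simp add: abs_mult power_abs)
qed

lemma bessel_altdef: "bessel g x = (\<Sum>k. (-1) ^ k / (pochhammer (g + 1) k * fact k) * x ^ k)"
  unfolding bessel_def by (intro arg_cong[where f=suminf] ext) (simp add: power_minus[of x])

lemma bessel_0: "bessel g 0 = 1"
  unfolding bessel_altdef by (subst powser_zero) simp

lemma bessel_deriv: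
  assumes g: "g > -1/2"
  shows "(bessel g has_real_derivative - bessel (g + 1) x / (g + 1)) (at x)"
proof -
  define d where "d k = (-1) ^ k / (pochhammer (g + 1) k * fact k)" for k
  have "((\<lambda>x. \<Sum>k. d k * x ^ k) has_real_derivative (\<Sum>k. diffs d k * x ^ k)) (at x)"
    by (rule termdiffs_strong_converges_everywhere) (unfold d_def, rule bessel_summable[OF g])
  also have "(\<lambda>x. \<Sum>k. d k * x ^ k) = bessel g" by (simp add: bessel_altdef d_def fun_eq_iff)
  also have "(\<Sum>k. diffs d k * x ^ k) = (\<Sum>k. (- 1 / (g + 1)) * ((-1) ^ k / (pochhammer (g + 1 + 1) k * fact k) * x ^ k))"
    by (intro arg_cong[where f=suminf] ext)
      (simp add: diffs_def d_def pochhammer_rec divide_simps del: of_nat_Suc)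
  also have "\<dots> = (- 1 / (g + 1)) * (\<Sum>k. (-1) ^ k / (pochhammer (g + 1 + 1) k * fact k) * x ^ k)"
    using g by (intro suminf_mult bessel_summable) auto
  also have "\<dots> = - bessel (g + 1) x / (g + 1)" by (simp add: bessel_altdef)
  finally show ?thesis .
qed

text \<open>Together with \<open>bessel_deriv\<close> this recurrence is Bessel's differential equation
\<open>x y'' + (g + 1) y' + y = 0\<close>.\<close>

lemma bessel_recurrence:
  assumes g: "g > -1/2"
  shows "x * bessel (g + 2) x / ((g + 1) * (g + 2)) = bessel (g + 1) x - bessel g x"
proof -
  define d where "d g k = (-1) ^ k / (pochhammer (g + 1) k * fact k) * x ^ k" for g :: real and k
  have s: "summable (d g')" if "g' > -1/2" for g' unfolding d_def by (rule bessel_summable[OF that])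
  have B: "bessel g' x = suminf (d g')" for g' unfolding bessel_altdef d_def[abs_def] ..
  have "bessel (g + 1) x - bessel g x = (\<Sum>k. d (g + 1) k - d g k)"
    unfolding B using g by (intro suminf_diff s) auto
  also have "\<dots> = (\<Sum>k. d (g + 1) (Suc k) - d g (Suc k)) + (d (g + 1) 0 - d g 0)"
    using g by (subst suminf_split_head) (auto intro!: summable_diff s)
  also have "d (g + 1) 0 - d g 0 = 0" by (simp add: d_def)
  also have "(\<lambda>k. d (g + 1) (Suc k) - d g (Suc k)) = (\<lambda>k. x / ((g + 1) * (g + 2)) * d (g + 2) k)"
  proof
    fix k
    have e1: "pochhammer (g + 1 + 1) (Suc k) = (g + 2) * pochhammer (g + 3) k"
      by (simp add: pochhammer_rec add.commute)
    have e2: "pochhammer (g + 1) (Suc k) = (g + 1) * ((g + 2) * pochhammer (g + 3) k) / (g + 2 + real k)"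
    proof -
      have "(g + 2) * pochhammer (g + 3) k = pochhammer (g + 2) (Suc k)" by (simp add: pochhammer_rec add.commute)
      also have "\<dots> = pochhammer (g + 2) k * (g + 2 + real k)" by (simp add: pochhammer_Suc)
      finally show ?thesis using g by (simp add: pochhammer_rec add.commute)
    qed
    have p: "pochhammer (g + 3) k > 0" using g by (intro pochhammer_pos) auto
    have alg: "- S / ((u * P) * ((m + 1) * F)) * (x * Y) - - S / ((v * (u * P) / (u + m)) * ((m + 1) * F)) * (x * Y)
       = x / (v * u) * (S / (P * F) * Y)" if "u > 0" "v > 0" "P > 0" "F > 0" "m + 1 > 0" "u = v + 1" "u + m > 0" for u v P F m S Y :: real
      using that(1-5,7) unfolding that(6) by (simp add: divide_simps) algebra
    have eq: "fact (Suc k) = (real k + 1) * fact k" "(-1) ^ Suc k = - ((-1::real) ^ k)" "x ^ Suc k = x * x ^ k"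
      by simp_all
    have e3: "pochhammer (g + 2 + 1) k = pochhammer (g + 3) k" by (simp add: add.commute)
    show "d (g + 1) (Suc k) - d g (Suc k) = x / ((g + 1) * (g + 2)) * d (g + 2) k"
      unfolding d_def e1 e2 e3 eq by (rule alg) (use g p in auto)
  qed
  also have "(\<Sum>k. x / ((g + 1) * (g + 2)) * d (g + 2) k) = x / ((g + 1) * (g + 2)) * bessel (g + 2) x"
    unfolding B using g by (intro suminf_mult s) auto
  finally show ?thesis by simp
qed

text \<open>Let \<open>y = bessel g\<close> and \<open>z = y'\<close>. The energy \<open>E = x\<^bsup>th\<^esup> (x z\<^sup>2 + y\<^sup>2)\<close> has no sign in its derivative, but after the correction
by \<open>th * F\<close> with \<open>F = x\<^bsup>th\<^esup> y z\<close> its logarithmic derivative is \<open>O (x\<^bsup>- 3/2\<^esup>)\<close>, which is integrable at infinity. So \<open>E\<close>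
stays between two positive constants; it cannot vanish, because \<open>x\<^bsup>2 th\<^esup> (x z\<^sup>2 + y\<^sup>2)\<close> is nondecreasing and is positive
near \<open>0\<close>. The upper bound is the first conclusion. For the second one, \<open>F'\<close> is up to an integrable term
\<open>x\<^bsup>th - 1\<^esup> (x z\<^sup>2 - y\<^sup>2)\<close>. As \<open>F\<close> is bounded, both summands of \<open>E\<close> have the same share of the integral of \<open>E / x\<close>,
which grows like \<open>ln X\<close>.\<close>

lemma bessel_asymptotic_energy:
  assumes g: "g > 0"
  defines "th \<equiv> g + 1/2"
  obtains x0 e0 e1 where "x0 \<ge> 1" "0 < e0"
    "\<And>x. x \<ge> x0 \<Longrightarrow> x powr th * (bessel g x)\<^sup>2 \<le> e1"
    "\<And>X. X \<ge> x0 \<Longrightarrow> e0 * ln (X / x0) - e1 \<le> integral {x0..X} (\<lambda>x. x powr (th - 1) * (bessel g x)\<^sup>2)"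
proof -
  define y where "y = bessel g"
  define z where "z x = - bessel (g + 1) x / (g + 1)" for x
  define z' where "z' x = bessel (g + 2) x / ((g + 1) * (g + 2))" for x
  have dy: "(y has_real_derivative z x) (at x)" for x
    unfolding y_def z_def using bessel_deriv[of g x] g by simp
  have dz: "(z has_real_derivative z' x) (at x)" for x
  proof -
    have "((\<lambda>x. - bessel (g + 1) x / (g + 1)) has_real_derivative - (- bessel (g + 1 + 1) x / (g + 1 + 1)) / (g + 1)) (at x)"
      using g by (intro DERIV_cdivide DERIV_minus bessel_deriv) auto
    then show ?thesis unfolding z_def z'_def by (simp add: add.commute mult.commute)
  qed
  have ode: "x * z' x = - (g + 1) * z x - y x" for x
  proof -
    have "(g + 1) * z x = - bessel (g + 1) x" using g by (simp add: z_def)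
    then have "- (g + 1) * z x = bessel (g + 1) x" by (metis minus_mult_left minus_minus)
    then show ?thesis using bessel_recurrence[of g x] g by (simp add: z'_def y_def)
  qed
  have th: "th > 1/2" using g by (simp add: th_def)
  define G where "G x = x * (z x)\<^sup>2 + (y x)\<^sup>2" for x
  have ycont: "isCont y x" for x using dy DERIV_isCont by blast
  have G_pos: "G x > 0" if "x \<ge> 1" for x
  proof -
    have "y 0 = 1" by (simp add: y_def bessel_0)
    then have "\<forall>\<^sub>F x in at 0. y x > 0"
      using ycont[of 0] order_tendstoD(1)[of y 1 "at 0" 0] by (simp add: isCont_def)
    then obtain d where d: "d > 0" "\<And>x. x \<noteq> 0 \<Longrightarrow> dist x 0 < d \<Longrightarrow> y x > 0"
      unfolding eventually_at by auto
    define x1 where "x1 = min (d / 2) (1/2)"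
    have x1: "x1 > 0" "x1 < 1" "y x1 > 0" using d by (auto simp: x1_def)
    then have Gx1: "G x1 > 0" by (auto simp: G_def intro!: add_nonneg_pos)
    have "x1 powr (2 * th) * G x1 \<le> x powr (2 * th) * G x"
    proof (rule DERIV_nonneg_imp_nondecreasing[of x1 x])
      show "x1 \<le> x" using x1 that by auto
      fix t assume "x1 \<le> t" "t \<le> x"
      then have t: "t > 0" using x1 by auto
      have "((\<lambda>x. x powr (2 * th) * (x * (z x)\<^sup>2 + (y x)\<^sup>2)) has_real_derivative
         (2 * th * t powr (2 * th - 1)) * (t * (z t)\<^sup>2 + (y t)\<^sup>2) +
         (1 * (z t)\<^sup>2 + t * (2 * z t * z' t) + 2 * y t * z t) * t powr (2 * th)) (at t)"
        using t by (auto intro!: derivative_eq_intros dy dz has_real_derivative_powr simp: algebra_simps)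
      moreover have "(2 * th * t powr (2 * th - 1)) * (t * (z t)\<^sup>2 + (y t)\<^sup>2) +
         (1 * (z t)\<^sup>2 + t * (2 * z t * z' t) + 2 * y t * z t) * t powr (2 * th) = 2 * th * t powr (2 * th - 1) * (y t)\<^sup>2"
      proof -
        have p: "t powr (2 * th) = t * t powr (2 * th - 1)" using t by (simp add: powr_mult_base)
        have "1 * (z t)\<^sup>2 + t * (2 * z t * z' t) + 2 * y t * z t = (z t)\<^sup>2 + 2 * z t * (t * z' t) + 2 * y t * z t" by simp
        also have "\<dots> = - 2 * th * (z t)\<^sup>2" unfolding ode by (simp add: th_def power2_eq_square algebra_simps)
        finally show ?thesis unfolding p by (simp add: algebra_simps)
      qed
      ultimately show "\<exists>w. ((\<lambda>x. x powr (2 * th) * G x) has_real_derivative w) (at t) \<and> 0 \<le> w"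
        using th t unfolding G_def by (intro exI[of _ "2 * th * t powr (2 * th - 1) * (y t)\<^sup>2"]) auto
    qed
    moreover have "x1 powr (2 * th) * G x1 > 0" using x1 Gx1 by simp
    ultimately have "0 < x powr (2 * th) * G x" by linarith
    then show ?thesis using that by (simp add: zero_less_mult_iff)
  qed
  define E where "E x = x powr th * G x" for x
  define F where "F x = x powr th * (y x * z x)" for x
  define E2 where "E2 x = E x + th * F x" for x
  have yz: "\<bar>y x * z x\<bar> \<le> G x / (2 * sqrt x)" if "x \<ge> 1" for x
  proof -
    have "0 \<le> (sqrt x * \<bar>z x\<bar> - \<bar>y x\<bar>)\<^sup>2" by simp
    also have "\<dots> = x * (z x)\<^sup>2 + (y x)\<^sup>2 - 2 * sqrt x * \<bar>y x * z x\<bar>"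
      using that by (simp add: power2_diff power_mult_distrib abs_mult mult_ac)
    finally show ?thesis using that by (simp add: G_def field_simps)
  qed
  have dF: "(F has_real_derivative x powr (th - 1) * (x * (z x)\<^sup>2 - (y x)\<^sup>2 - y x * z x / 2)) (at x)" if "x > 0" for x
  proof -
    have "(F has_real_derivative (th * x powr (th - 1)) * (y x * z x) + (z x * z x + y x * z' x) * x powr th) (at x)"
      unfolding F_def using that by (auto intro!: derivative_eq_intros dy dz has_real_derivative_powr simp: algebra_simps)
    moreover have "(th * x powr (th - 1)) * (y x * z x) + (z x * z x + y x * z' x) * x powr th
       = x powr (th - 1) * (x * (z x)\<^sup>2 - (y x)\<^sup>2 - y x * z x / 2)"
    proof -
      have p: "x powr th = x * x powr (th - 1)" using that by (simp add: powr_mult_base)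
      have "(z x * z x + y x * z' x) * x = x * (z x)\<^sup>2 + y x * (x * z' x)" by (simp add: power2_eq_square algebra_simps)
      also have "\<dots> = x * (z x)\<^sup>2 - (g + 1) * (y x * z x) - (y x)\<^sup>2" unfolding ode by (simp add: power2_eq_square algebra_simps)
      finally have q: "(z x * z x + y x * z' x) * x = x * (z x)\<^sup>2 - (g + 1) * (y x * z x) - (y x)\<^sup>2" .
      have "(z x * z x + y x * z' x) * x powr th = ((z x * z x + y x * z' x) * x) * x powr (th - 1)"
        unfolding p by simp
      then show ?thesis unfolding q by (simp add: th_def algebra_simps)
    qed
    ultimately show ?thesis by simp
  qed
  have dE: "(E has_real_derivative th * x powr (th - 1) * ((y x)\<^sup>2 - x * (z x)\<^sup>2)) (at x)" if "x > 0" for x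
  proof -
    have "(E has_real_derivative (th * x powr (th - 1)) * (x * (z x)\<^sup>2 + (y x)\<^sup>2) +
         (1 * (z x)\<^sup>2 + x * (2 * z x * z' x) + 2 * y x * z x) * x powr th) (at x)"
      unfolding E_def G_def using that by (auto intro!: derivative_eq_intros dy dz has_real_derivative_powr simp: algebra_simps)
    moreover have "(th * x powr (th - 1)) * (x * (z x)\<^sup>2 + (y x)\<^sup>2) +
         (1 * (z x)\<^sup>2 + x * (2 * z x * z' x) + 2 * y x * z x) * x powr th = th * x powr (th - 1) * ((y x)\<^sup>2 - x * (z x)\<^sup>2)"
    proof -
      have p: "x powr th = x * x powr (th - 1)" using that by (simp add: powr_mult_base)
      have "1 * (z x)\<^sup>2 + x * (2 * z x * z' x) + 2 * y x * z x = (z x)\<^sup>2 + 2 * z x * (x * z' x) + 2 * y x * z x" by simp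
      also have "\<dots> = - 2 * th * (z x)\<^sup>2" unfolding ode by (simp add: th_def power2_eq_square algebra_simps)
      finally show ?thesis unfolding p by (simp add: algebra_simps)
    qed
    ultimately show ?thesis by simp
  qed
  have dE2: "(E2 has_real_derivative - (th / 2) * x powr (th - 1) * (y x * z x)) (at x)" if "x > 0" for x
    unfolding E2_def by (auto intro!: derivative_eq_intros dE dF that simp: algebra_simps)
  \<comment> \<open>From \<open>x0\<close> on the correction \<open>th * F\<close> is at most half of \<open>E\<close>.\<close>
  define x0 where "x0 = max 1 (th\<^sup>2)"
  have x0: "x0 \<ge> 1" "x0 \<ge> th\<^sup>2" by (auto simp: x0_def)
  have sq: "sqrt x \<ge> th" "sqrt x > 0" if "x \<ge> x0" for x
    using that x0 by (auto intro: real_le_rsqrt)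
  have Fb: "\<bar>F x\<bar> \<le> E x / (2 * sqrt x)" if "x \<ge> x0" for x
    using mult_left_mono[OF yz[of x], of "x powr th"] that x0 by (simp add: F_def E_def abs_mult)
  have E0: "E x > 0" if "x \<ge> x0" for x using G_pos[of x] that x0 by (auto simp: E_def)
  have E2b: "E x / 2 \<le> E2 x" "E2 x \<le> 3/2 * E x" if "x \<ge> x0" for x
  proof -
    have "th * \<bar>F x\<bar> \<le> sqrt x * (E x / (2 * sqrt x))"
      using Fb[OF that] sq[OF that] th by (intro mult_mono) auto
    also have "\<dots> = E x / 2" using sq[OF that] by simp
    finally have "\<bar>th * F x\<bar> \<le> E x / 2" using th by (simp add: abs_mult)
    then show "E x / 2 \<le> E2 x" "E2 x \<le> 3/2 * E x" unfolding E2_def by linarith+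
  qed
  have dE2b: "\<bar>- (th / 2) * x powr (th - 1) * (y x * z x)\<bar> \<le> (th / 2) * x powr (-3/2) * E2 x" if "x \<ge> x0" for x
  proof -
    have xp: "x > 0" using that x0 by auto
    have "\<bar>- (th / 2) * x powr (th - 1) * (y x * z x)\<bar> = (th / 2) * x powr (th - 1) * \<bar>y x * z x\<bar>"
      using th by (simp add: abs_mult)
    also have "\<dots> \<le> (th / 2) * x powr (th - 1) * (G x / (2 * sqrt x))"
      using yz[of x] that x0 th by (intro mult_left_mono) auto
    also have "\<dots> = (th / 2) * x powr (-3/2) * (E x / 2)"
    proof -
      have "x powr (-3/2) * x powr th = x powr (th - 1) / sqrt x"
        using xp by (simp add: powr_half_sqrt[symmetric] powr_add[symmetric] powr_diff[symmetric])
      then have "x powr (-3/2) * E x = x powr (th - 1) / sqrt x * G x" unfolding E_def by (metis mult.assoc)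
      then show ?thesis by (simp add: field_simps)
    qed
    also have "\<dots> \<le> (th / 2) * x powr (-3/2) * E2 x"
      using E2b[OF that] th by (intro mult_left_mono) auto
    finally show ?thesis .
  qed
  define m where "m x = th * x powr (-1/2)" for x
  have dm: "(m has_real_derivative - (th / 2) * x powr (-3/2)) (at x)" if "x > 0" for x
    unfolding m_def using that by (auto intro!: derivative_eq_intros has_real_derivative_powr)
  have up: "E2 x * exp (m x) \<le> E2 x0 * exp (m x0)" if "x \<ge> x0" for x
  proof (rule DERIV_nonpos_imp_nonincreasing[OF that])
    fix t assume t: "x0 \<le> t" "t \<le> x"
    then have t0: "t > 0" using x0 by auto
    have "((\<lambda>t. E2 t * exp (m t)) has_real_derivative
       (- (th / 2) * t powr (th - 1) * (y t * z t)) * exp (m t) + (exp (m t) * (- (th / 2) * t powr (-3/2))) * E2 t) (at t)"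
      by (intro DERIV_mult dE2 DERIV_fun_exp dm t0)
    moreover have "(- (th / 2) * t powr (th - 1) * (y t * z t)) * exp (m t) + (exp (m t) * (- (th / 2) * t powr (-3/2))) * E2 t \<le> 0"
    proof -
      have "(- (th / 2) * t powr (th - 1) * (y t * z t)) - (th / 2) * t powr (-3/2) * E2 t \<le> 0"
        using dE2b[OF t(1)] by linarith
      then have "exp (m t) * ((- (th / 2) * t powr (th - 1) * (y t * z t)) - (th / 2) * t powr (-3/2) * E2 t) \<le> 0"
        by (simp add: mult_le_0_iff)
      then show ?thesis by (simp add: algebra_simps)
    qed
    ultimately show "\<exists>w. ((\<lambda>t. E2 t * exp (m t)) has_real_derivative w) (at t) \<and> w \<le> 0" by blast
  qed
  have lo: "E2 x0 * exp (- m x0) \<le> E2 x * exp (- m x)" if "x \<ge> x0" for x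
  proof (rule DERIV_nonneg_imp_nondecreasing[OF that])
    fix t assume t: "x0 \<le> t" "t \<le> x"
    then have t0: "t > 0" using x0 by auto
    have "((\<lambda>t. E2 t * exp (- m t)) has_real_derivative
       (- (th / 2) * t powr (th - 1) * (y t * z t)) * exp (- m t) + (exp (- m t) * - (- (th / 2) * t powr (-3/2))) * E2 t) (at t)"
      by (intro DERIV_mult dE2 DERIV_fun_exp DERIV_minus dm t0)
    moreover have "0 \<le> (- (th / 2) * t powr (th - 1) * (y t * z t)) * exp (- m t) + (exp (- m t) * - (- (th / 2) * t powr (-3/2))) * E2 t"
    proof -
      have "0 \<le> (- (th / 2) * t powr (th - 1) * (y t * z t)) + (th / 2) * t powr (-3/2) * E2 t"
        using dE2b[OF t(1)] by linarith
      then have "0 \<le> exp (- m t) * ((- (th / 2) * t powr (th - 1) * (y t * z t)) + (th / 2) * t powr (-3/2) * E2 t)"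
        by (simp add: zero_le_mult_iff)
      then show ?thesis by (simp add: algebra_simps)
    qed
    ultimately show "\<exists>w. ((\<lambda>t. E2 t * exp (- m t)) has_real_derivative w) (at t) \<and> 0 \<le> w" by blast
  qed
  have m_nn: "m x \<ge> 0" for x using th by (simp add: m_def)
  define c0 where "c0 = E2 x0 * exp (- m x0) / 2"
  define c1 where "c1 = 2 * E2 x0 * exp (m x0)"
  have E20: "E2 x > 0" if "x \<ge> x0" for x using E2b(1)[OF that] E0[OF that] by linarith
  have c0: "c0 > 0" using E20[of x0] by (simp add: c0_def)
  have Eup: "E x \<le> c1" if "x \<ge> x0" for x
  proof -
    have "E x \<le> 2 * E2 x" using E2b(1)[OF that] by linarith
    also have "\<dots> \<le> 2 * (E2 x * exp (m x))" using E20[OF that] m_nn[of x] by simp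
    also have "\<dots> \<le> c1" using up[OF that] by (simp add: c1_def)
    finally show ?thesis .
  qed
  have Elo: "c0 \<le> E x" if "x \<ge> x0" for x
  proof -
    have "2 * c0 \<le> E2 x * exp (- m x)" using lo[OF that] by (simp add: c0_def)
    also have "\<dots> \<le> E2 x * 1" using E20[OF that] m_nn[of x] by (intro mult_left_mono) auto
    also have "\<dots> \<le> 3/2 * E x" using E2b(2)[OF that] by simp
    finally show ?thesis using c0 by simp
  qed
  have c1: "c1 > 0" using Eup[of x0] Elo[of x0] c0 by auto
  have main: "c0 / 2 * ln (X / x0) - c1 \<le> integral {x0..X} (\<lambda>x. x powr (th - 1) * (y x)\<^sup>2)" if X: "X \<ge> x0" for X
  proof -
    \<comment> \<open>The derivative \<open>p\<close> of \<open>P\<close> is a lower bound of the integrand; the last term of \<open>P\<close> absorbs \<open>y z / 2\<close>.\<close>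
    define P where "P x = (c0 * ln x - F x + c1 / 2 * x powr (-1/2)) / 2" for x
    define p where "p x = (c0 / x - x powr (th - 1) * (x * (z x)\<^sup>2 - (y x)\<^sup>2 - y x * z x / 2) - c1 / 4 * x powr (-3/2)) / 2" for x
    have dP: "(P has_real_derivative p x) (at x)" if "x \<ge> x0" for x
    proof -
      have "x > 0" using that x0 by auto
      then have "(P has_real_derivative (c0 * (1 / x) - x powr (th - 1) * (x * (z x)\<^sup>2 - (y x)\<^sup>2 - y x * z x / 2)
          + c1 / 2 * (-1/2 * x powr (-1/2 - 1))) / 2) (at x)"
        unfolding P_def
        by (intro DERIV_cdivide DERIV_add DERIV_diff DERIV_cmult DERIV_ln_divide has_real_derivative_powr dF)
      moreover have "c1 / 2 * (-1/2 * x powr (-1/2 - 1)) = - (c1 / 4 * x powr (-3/2))" by simp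
      ultimately show ?thesis unfolding p_def by simp
    qed
    have I1: "(p has_integral (P X - P x0)) {x0..X}"
    proof (rule fundamental_theorem_of_calculus[OF X, of P p])
      fix x assume "x \<in> {x0..X}"
      then have "(P has_real_derivative p x) (at x within {x0..X})"
        using has_field_derivative_at_within[OF dP[of x]] by simp
      then show "(P has_vector_derivative p x) (at x within {x0..X})"
        by (simp only: has_real_derivative_iff_has_vector_derivative)
    qed
    have cont: "continuous_on {x0..X} (\<lambda>x. x powr (th - 1) * (y x)\<^sup>2)"
    proof (intro continuous_intros)
      show "continuous_on {x0..X} y" by (intro continuous_at_imp_continuous_on ballI ycont)
    qed (use x0 in auto)
    have I2: "((\<lambda>x. x powr (th - 1) * (y x)\<^sup>2) has_integral integral {x0..X} (\<lambda>x. x powr (th - 1) * (y x)\<^sup>2)) {x0..X}"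
      using integrable_continuous_interval[OF cont] by (rule integrable_integral)
    have "P X - P x0 \<le> integral {x0..X} (\<lambda>x. x powr (th - 1) * (y x)\<^sup>2)"
    proof (rule has_integral_le[OF I1 I2])
      fix x assume "x \<in> {x0..X}"
      then have x: "x \<ge> x0" "x > 0" "x \<ge> 1" using x0 by auto
      have pe: "x powr th = x * x powr (th - 1)" using x by (simp add: powr_mult_base)
      have "c0 / x \<le> E x / x" using Elo[OF x(1)] x by (intro divide_right_mono) auto
      also have "E x / x = x powr (th - 1) * (x * (z x)\<^sup>2 + (y x)\<^sup>2)" using x by (simp add: E_def G_def pe)
      finally have 1: "c0 / x \<le> x powr (th - 1) * (x * (z x)\<^sup>2 + (y x)\<^sup>2)" .
      have "x powr (th - 1) * (y x * z x / 2) \<le> x powr (th - 1) * (G x / (2 * sqrt x) / 2)"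
        using yz[OF x(3)] by (intro mult_left_mono) auto
      also have "\<dots> = x powr (-3/2) * E x / 4"
      proof -
        have "x powr (-3/2) * x powr th = x powr (th - 1) / sqrt x"
          using x by (simp add: powr_half_sqrt[symmetric] powr_add[symmetric] powr_diff[symmetric])
        then have "x powr (-3/2) * E x = x powr (th - 1) / sqrt x * G x" unfolding E_def by (metis mult.assoc)
        then show ?thesis by (simp add: field_simps)
      qed
      also have "\<dots> \<le> x powr (-3/2) * c1 / 4" using Eup[OF x(1)] by (intro divide_right_mono mult_left_mono) auto
      finally have 2: "x powr (th - 1) * (y x * z x / 2) \<le> c1 / 4 * x powr (-3/2)" by (simp add: mult.commute)
      show "p x \<le> x powr (th - 1) * (y x)\<^sup>2" using 1 2 unfolding p_def by (simp add: algebra_simps)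
    qed
    moreover have "P X - P x0 \<ge> c0 / 2 * ln (X / x0) - c1"
    proof -
      have Fb': "\<bar>F x\<bar> \<le> c1 / 2" if "x \<ge> x0" for x
      proof -
        have "sqrt x \<ge> 1" using that x0 by auto
        then have "E x / (2 * sqrt x) \<le> E x / 2" using E0[OF that] by (intro divide_left_mono) auto
        then show ?thesis using Fb[OF that] Eup[OF that] by linarith
      qed
      have "X powr (-1/2) \<ge> 0" "x0 powr (-1/2) \<le> x0 powr 0" using x0 powr_mono[of "-1/2" 0 x0] by auto
      then have "c1 / 2 * X powr (-1/2) \<ge> 0" "c1 / 2 * x0 powr (-1/2) \<le> c1 / 2 * 1" using c1 x0 
        by (auto simp: zero_le_mult_iff)
      moreover have "c0 / 2 * ln (X / x0) = (c0 * ln X - c0 * ln x0) / 2"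
        using X x0 by (simp add: ln_div algebra_simps)
      moreover have "F X \<le> c1 / 2" "F x0 \<ge> - (c1 / 2)"
        using Fb'[OF X] Fb'[of x0] by (auto simp: abs_le_iff)
      moreover have "L - c1 \<le> (A - U + V) / 2 - (A' - U' + V') / 2"
        if "0 \<le> V" "V' \<le> c1 / 2 * 1" "L = (A - A') / 2" "U \<le> c1 / 2" "U' \<ge> - (c1 / 2)" for L A A' U U' V V'
        using that c1 by (simp add: field_simps)
      ultimately show ?thesis unfolding P_def by blast
    qed
    ultimately show ?thesis by linarith
  qed
  show ?thesis
  proof (rule that[of x0 "c0/2" c1])
    show "x powr th * (bessel g x)\<^sup>2 \<le> c1" if "x0 \<le> x" for x
    proof -
      have "x powr th * (bessel g x)\<^sup>2 \<le> E x" unfolding E_def G_def y_def using that x0 by (intro mult_left_mono) auto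
      then show ?thesis using Eup[OF that] by linarith
    qed
  qed (use x0 c0 main in \<open>auto simp: y_def\<close>)
qed

section \<open>Coefficients of the Cesaro means\<close>

lemma cesaro_pochhammer: "cesaro_coeff dl m = pochhammer (dl + 1) m / fact m"
  unfolding cesaro_coeff_def gbinomial_pochhammer' by (simp add: add.commute)

lemma cesaro_pos: "dl > -1 \<Longrightarrow> cesaro_coeff dl m > 0"
  unfolding cesaro_pochhammer by (intro divide_pos_pos pochhammer_pos) auto

lemma cesaro_mono:
  assumes "dl \<ge> 0" "m \<le> n"
  shows "cesaro_coeff dl m \<le> cesaro_coeff dl n"
proof (rule lift_Suc_mono_le[OF _ assms(2)])
  fix k
  have "cesaro_coeff dl (Suc k) = cesaro_coeff dl k * ((dl + 1 + real k) / (real k + 1))"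
    unfolding cesaro_pochhammer pochhammer_Suc fact_Suc by (simp add: add_ac)
  moreover have "(dl + 1 + real k) / (real k + 1) \<ge> 1" using assms by simp
  moreover have "cesaro_coeff dl k > 0" using assms by (intro cesaro_pos) auto
  ultimately show "cesaro_coeff dl k \<le> cesaro_coeff dl (Suc k)"
    using mult_left_mono[of 1 "(dl + 1 + real k) / (real k + 1)" "cesaro_coeff dl k"] by simp
qed

text \<open>A mean of order \<open>dl + 1\<close> is thus an average of means of order \<open>dl\<close>.\<close>

lemma cesaro_sum: "(\<Sum>k\<le>n. cesaro_coeff dl k) = cesaro_coeff (dl + 1) n"
  using gbinomial_parallel_sum[of dl n] unfolding cesaro_coeff_def by (simp add: add_ac)

lemma cesaro_ratio_bounds:
  assumes "dl \<ge> 0" "m \<le> n"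
  shows "0 \<le> cesaro_coeff dl m / cesaro_coeff dl n" "cesaro_coeff dl m / cesaro_coeff dl n \<le> 1"
  using cesaro_mono[OF assms] cesaro_pos[of dl m] cesaro_pos[of dl n] assms by (auto simp: divide_simps)

lemma cesaro_asymp:
  assumes "dl > -1"
  shows "(\<lambda>n. cesaro_coeff dl n / real n powr dl) \<longlonglongrightarrow> 1 / Gamma (dl + 1)"
proof -
  have z: "dl + 1 \<notin> \<int>\<^sub>\<le>\<^sub>0" using assms by (auto dest: nonpos_Ints_nonpos)
  have "(\<lambda>n. Gamma (real n + (dl + 1)) / (Gamma (real n + 1) * real n powr (dl + 1 - 1)) / Gamma (dl + 1)) \<longlonglongrightarrow> 1 / Gamma (dl + 1)"
    using assms by (intro tendsto_divide Gamma_ratio_LIMSEQ tendsto_const) (use z in \<open>auto simp: Gamma_eq_zero_iff\<close>)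
  moreover have "cesaro_coeff dl n = Gamma (real n + (dl + 1)) / Gamma (real n + 1) / Gamma (dl + 1)" for n
    unfolding cesaro_pochhammer using z by (simp add: pochhammer_Gamma Gamma_fact add_ac)
  ultimately show ?thesis by (simp add: field_simps)
qed

lemma cesaro_ratio_limit:
  fixes m n :: "nat \<Rightarrow> nat"
  assumes dl: "dl > -1"
    and m: "filterlim m at_top sequentially" and n: "filterlim n at_top sequentially"
    and lim: "(\<lambda>N. real (m N) / real (n N)) \<longlonglongrightarrow> r"
    and r: "r > 0"
  shows "(\<lambda>N. cesaro_coeff dl (m N) / cesaro_coeff dl (n N)) \<longlonglongrightarrow> r powr dl"
proof -
  have G: "Gamma (dl + 1) > 0" using dl by (intro Gamma_real_pos) auto
  note l = cesaro_asymp[OF dl]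
  have "(\<lambda>N. (cesaro_coeff dl (m N) / real (m N) powr dl) / (cesaro_coeff dl (n N) / real (n N) powr dl) * (real (m N) / real (n N)) powr dl)
     \<longlonglongrightarrow> (1 / Gamma (dl + 1)) / (1 / Gamma (dl + 1)) * r powr dl"
    using r G by (intro tendsto_intros filterlim_compose[OF l m] filterlim_compose[OF l n] lim) auto
  moreover have "\<forall>\<^sub>F N in sequentially. (cesaro_coeff dl (m N) / real (m N) powr dl) / (cesaro_coeff dl (n N) / real (n N) powr dl) * (real (m N) / real (n N)) powr dl
     = cesaro_coeff dl (m N) / cesaro_coeff dl (n N)"
    using eventually_compose_filterlim[OF eventually_gt_at_top[of 0] m] eventually_compose_filterlim[OF eventually_gt_at_top[of 0] n]
  proof eventually_elim
    case (elim N)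
    then have "real (m N) powr dl > 0" "real (n N) powr dl > 0" by auto
    then show ?case using elim by (simp add: powr_divide)
  qed
  ultimately show ?thesis using G by (simp add: tendsto_cong)
qed

text \<open>With \<open>x = 1 - t\<close> the function is \<open>(1 + t)\<^bsup>dl\<^esup> exp (t\<^sup>2)\<close>. The first factor turns \<open>(1 - t)\<^bsup>dl\<^esup>\<close> into
\<open>(1 - t\<^sup>2)\<^bsup>dl\<^esup>\<close>, the second one cancels the Gaussian in \<open>rho_limit\<close>. The power series at \<open>x = 0\<close> has radius of
convergence at least \<open>2\<close>, hence it converges absolutely at \<open>x = 1\<close>.\<close>

lemma compensator_series:
  obtains d :: "nat \<Rightarrow> real" where "summable (\<lambda>i. \<bar>d i\<bar>)"
    "\<And>x. x \<in> {0..1} \<Longrightarrow> (\<lambda>i. d i * x ^ i) sums ((2 - x) powr dl * exp ((1 - x)\<^sup>2))"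
proof -
  define f where "f z = exp (of_real dl * Ln (2 - z)) * exp ((1 - z)\<^sup>2)" for z :: complex
  have hol: "f holomorphic_on ball 0 2"
  proof -
    have "2 - z \<notin> \<real>\<^sub>\<le>\<^sub>0" if "z \<in> ball 0 2" for z :: complex
    proof -
      have "Re z < 2" using that complex_Re_le_cmod[of z] by auto
      then show ?thesis by (auto simp: complex_nonpos_Reals_iff)
    qed
    then show ?thesis unfolding f_def by (intro holomorphic_intros) auto
  qed
  define cc where "cc n = (deriv ^^ n) f 0 / fact n" for n
  have s: "(\<lambda>n. cc n * w ^ n) sums f w" if "w \<in> ball 0 2" for w
    using holomorphic_power_series[OF hol that] by (simp add: cc_def)
  have "summable (\<lambda>n. norm (cc n * 1 ^ n))"
    by (rule powser_insidea[of _ "3/2"]) (use sums_summable[OF s[of "3/2"]] in auto)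
  then have sn: "summable (\<lambda>n. norm (cc n))" by simp
  show ?thesis
  proof (rule that[of "\<lambda>n. Re (cc n)"])
    show "summable (\<lambda>i. \<bar>Re (cc i)\<bar>)"
      by (rule summable_comparison_test'[OF sn]) (simp add: abs_Re_le_cmod)
    fix x :: real assume x: "x \<in> {0..1}"
    then have "(\<lambda>n. Re (cc n * (of_real x) ^ n)) sums Re (f (of_real x))"
      by (intro sums_Re s) auto
    moreover have "Re (cc n * (of_real x) ^ n) = Re (cc n) * x ^ n" for n
      by (simp flip: of_real_power)
    moreover have "f (of_real x) = of_real ((2 - x) powr dl * exp ((1 - x)\<^sup>2))"
    proof -
      have "Ln (2 - of_real x) = of_real (ln (2 - x))" using x Ln_of_real[of "2 - x"] by simp
      then have "f (of_real x) = exp (of_real (dl * ln (2 - x))) * exp (of_real ((1 - x)\<^sup>2))"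
        by (simp add: f_def)
      also have "\<dots> = of_real (exp (dl * ln (2 - x)) * exp ((1 - x)\<^sup>2))"
        by (simp only: exp_of_real of_real_mult[of "exp _"])
      finally show ?thesis using x by (simp add: powr_def)
    qed
    ultimately show "(\<lambda>i. Re (cc i) * x ^ i) sums ((2 - x) powr dl * exp ((1 - x)\<^sup>2))" by simp
  qed
qed

lemma floor_index:
  assumes t: "0 < t" "t < 1"
  shows "(\<lambda>n. real (nat \<lfloor>t * real n\<rfloor>) / real n) \<longlonglongrightarrow> t"
    "filterlim (\<lambda>n. nat \<lfloor>t * real n\<rfloor>) at_top sequentially"
    "nat \<lfloor>t * real n\<rfloor> \<le> n"
proof -
  have r: "real (nat \<lfloor>t * real n\<rfloor>) = of_int \<lfloor>t * real n\<rfloor>" for n :: nat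
    using t by simp
  show 1: "(\<lambda>n. real (nat \<lfloor>t * real n\<rfloor>) / real n) \<longlonglongrightarrow> t"
  proof (rule tendsto_sandwich)
    show "\<forall>\<^sub>F n in sequentially. (t * real n - 1) / real n \<le> real (nat \<lfloor>t * real n\<rfloor>) / real n"
      unfolding r by (intro always_eventually allI divide_right_mono) linarith+
    show "\<forall>\<^sub>F n in sequentially. real (nat \<lfloor>t * real n\<rfloor>) / real n \<le> (t * real n) / real n"
      unfolding r by (intro always_eventually allI divide_right_mono) linarith+
    show "(\<lambda>n. (t * real n - 1) / real n) \<longlonglongrightarrow> t" using t by real_asymp
    show "(\<lambda>n. (t * real n) / real n) \<longlonglongrightarrow> t" using t by real_asymp
  qed
  show "filterlim (\<lambda>n. nat \<lfloor>t * real n\<rfloor>) at_top sequentially"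
  proof -
    have "filterlim (\<lambda>n. t * real n - 1) at_top sequentially" using t by real_asymp
    then have "filterlim (\<lambda>n. real (nat \<lfloor>t * real n\<rfloor>)) at_top sequentially"
      by (rule filterlim_at_top_mono) (unfold r, intro always_eventually allI, linarith)
    then show ?thesis by (simp add: filterlim_sequentially_iff_filterlim_real)
  qed
  have "t * real n \<le> 1 * real n" using t by (intro mult_right_mono) auto
  then show "nat \<lfloor>t * real n\<rfloor> \<le> n" by linarith
qed

text \<open>Sums over degrees become integrals of step functions, to which dominated convergence applies.\<close>

lemma riemann_step_integral:
  fixes u :: "nat \<Rightarrow> real"
  assumes "n \<ge> 1"
  shows "(\<Sum>j<n. u j) / real n = (LINT t:{0<..<1}|lborel. u (nat \<lfloor>t * real n\<rfloor>))"
proof -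
  have n: "real n > 0" using assms by simp
  define I where "I j = {real j / real n..<real (Suc j) / real n}" for j
  have fl: "nat \<lfloor>t * real n\<rfloor> = j \<longleftrightarrow> t \<in> I j" if "t \<ge> 0" for t j
  proof -
    have "nat \<lfloor>t * real n\<rfloor> = j \<longleftrightarrow> \<lfloor>t * real n\<rfloor> = int j" using that by auto
    also have "\<dots> \<longleftrightarrow> t \<in> I j" using n by (auto simp: floor_eq_iff I_def field_simps)
    finally show ?thesis .
  qed
  have eq: "indicator {0..<1} t * u (nat \<lfloor>t * real n\<rfloor>) = (\<Sum>j<n. u j * indicator (I j) t)" for t
  proof (cases "t \<in> {0..<1}")
    case True
    then have t: "t \<ge> 0" "t < 1" by auto
    have "t * real n < 1 * real n" using t n by (intro mult_strict_right_mono) auto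
    then have lt: "nat \<lfloor>t * real n\<rfloor> < n" using t assms by linarith
    have "(\<Sum>j<n. u j * indicator (I j) t) = (\<Sum>j<n. if j = nat \<lfloor>t * real n\<rfloor> then u j else 0)"
      by (intro sum.cong refl) (auto simp: indicator_def fl[OF t(1), symmetric])
    then show ?thesis using lt True by simp
  next
    case False
    have "t \<notin> I j" if "j < n" for j
    proof
      assume *: "t \<in> I j"
      have "0 \<le> real j / real n" "real (Suc j) / real n \<le> 1" using that n by auto
      moreover have "real j / real n \<le> t" "t < real (Suc j) / real n" using * by (auto simp: I_def)
      ultimately have "t \<in> {0..<1}" by (metis atLeastLessThan_iff order_trans order_less_le_trans)
      then show False using False by simp
    qed
    then show ?thesis using False by simp
  qed
  have "(LINT t:{0<..<1}|lborel. u (nat \<lfloor>t * real n\<rfloor>)) = (LINT t|lborel. indicator {0..<1} t * u (nat \<lfloor>t * real n\<rfloor>))"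
    unfolding set_lebesgue_integral_def
    by (rule integral_cong_AE) (use AE_lborel_singleton[of 0] in \<open>auto elim!: eventually_mono simp: indicator_def\<close>)
  also have "\<dots> = (LINT t|lborel. (\<Sum>j<n. u j * indicator (I j) t))" by (simp only: eq)
  also have "\<dots> = (\<Sum>j<n. u j * (LINT t|lborel. indicator (I j) t))"
  proof (subst Bochner_Integration.integral_sum)
    fix j assume "j \<in> {..<n}"
    have "bounded (I j)" unfolding I_def by (rule bounded_subset[OF bounded_closed_interval[of "real j / real n" "real (Suc j) / real n"]]) auto
    then show "integrable lborel (\<lambda>x. u j * indicat_real (I j) x)"
      by (intro integrable_mult_right integrable_real_indicator emeasure_bounded_finite) (simp_all add: I_def)
  qed simp
  also have "\<dots> = (\<Sum>j<n. u j * (1 / real n))"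
    using n by (intro sum.cong refl) (simp add: I_def measure_def field_simps divide_right_mono)
  finally show ?thesis by (simp add: sum_divide_distrib)
qed

section \<open>The bilinear form of the means\<close>

lemma bessel_continuous:
  assumes "g > -1/2" shows "continuous_on UNIV (bessel g)"
  by (intro continuous_at_imp_continuous_on ballI DERIV_isCont[OF bessel_deriv[OF assms]])

text \<open>Sonine's first integral: the series of \<open>bessel a\<close> is integrated term by term, and each term is a Beta integral.\<close>

lemma bessel_fractional_integral:
  assumes a: "a > -1/2" and dl: "dl > 0"
  shows "set_integrable lborel {0..1} (\<lambda>s. bessel a (x * s) * (s powr a * (1 - s) powr dl))"
    "(LINT s:{0..1}|lborel. bessel a (x * s) * (s powr a * (1 - s) powr dl)) =
       Gamma (a + 1) * Gamma (dl + 1) / Gamma (a + dl + 2) * bessel (a + dl + 1) x"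
proof -
  interpret J: jacobi_weight a dl by unfold_locales (use a dl in auto)
  interpret finite_measure J.nu by (rule J.finite_nu)
  define co where "co k = (- x) ^ k / (pochhammer (a + 1) k * fact k)" for k
  have cont: "continuous_on UNIV (\<lambda>s. bessel a (x * s))"
    by (rule continuous_on_compose2[OF bessel_continuous[OF a]]) (auto intro!: continuous_intros)
  then have [measurable]: "(\<lambda>s. bessel a (x * s)) \<in> borel_measurable borel" by (rule borel_measurable_continuous_onI)
  have int: "integrable J.nu (\<lambda>s. bessel a (x * s))" by (rule J.integrable_nu_cont[OF cont])
  then show "set_integrable lborel {0..1} (\<lambda>s. bessel a (x * s) * (s powr a * (1 - s) powr dl))"
    by (simp add: J.integrable_nu_iff)
  have B: "bessel a (x * s) = (\<Sum>k. co k * s ^ k)" for s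
    unfolding bessel_def co_def by (intro arg_cong[where f=suminf] ext) (simp add: power_mult_distrib[symmetric])
  have co: "\<bar>co k\<bar> \<le> (2 * \<bar>x\<bar>) ^ k / fact k" for k
    unfolding co_def using bessel_term_bound[OF a, of "-x" k] by simp
  have sco: "summable (\<lambda>k. \<bar>co k\<bar>)"
    by (rule summable_comparison_test'[OF exp_summable[of "2 * \<bar>x\<bar>"]]) (use co in auto)
  have "(LINT s:{0..1}|lborel. bessel a (x * s) * (s powr a * (1 - s) powr dl)) = (LINT s|J.nu. bessel a (x * s))"
    by (simp add: J.integral_nu)
  also have "\<dots> = (LINT s|J.nu. (\<Sum>k. co k * s ^ k))" by (simp only: B)
  also have "\<dots> = (\<Sum>k. LINT s|J.nu. co k * s ^ k)"
  proof (rule integral_suminf)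
    show "integrable J.nu (\<lambda>s. co k * s ^ k)" for k by (intro J.integrable_nu_cont continuous_intros)
    have le: "norm (co k * s ^ k) \<le> \<bar>co k\<bar>" if "s \<in> {0<..<1}" for s k
      using that by (auto simp: abs_mult power_abs intro!: mult_left_le power_le_one)
    show "AE s in J.nu. summable (\<lambda>i. norm (co i * s ^ i))"
      using J.AE_nu
    proof eventually_elim
      case (elim s)
      show ?case by (rule summable_comparison_test'[OF sco]) (use le[OF elim] in auto)
    qed
    show "summable (\<lambda>i. LINT s|J.nu. norm (co i * s ^ i))"
    proof (rule summable_comparison_test'[OF summable_mult[OF sco, of "measure J.nu UNIV"]])
      fix k
      have "(LINT s|J.nu. norm (co k * s ^ k)) \<le> (LINT s|J.nu. \<bar>co k\<bar>)"
        by (rule integral_mono_AE) (auto intro!: J.integrable_nu_cont continuous_intros eventually_mono[OF J.AE_nu] le[simplified])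
      moreover have "0 \<le> (LINT s|J.nu. norm (co k * s ^ k))" by (rule integral_nonneg_AE) auto
      ultimately show "norm (LINT s|J.nu. norm (co k * s ^ k)) \<le> measure J.nu UNIV * \<bar>co k\<bar>" by simp
    qed
  qed
  also have "(\<lambda>k. LINT s|J.nu. co k * s ^ k) = (\<lambda>k. Gamma (a + 1) * Gamma (dl + 1) / Gamma (a + dl + 2) *
      ((- x) ^ k / (pochhammer (a + dl + 1 + 1) k * fact k)))"
  proof
    fix k
    have "pochhammer (a + 1) k = Gamma (a + 1 + real k) / Gamma (a + 1)"
      "pochhammer (a + dl + 1 + 1) k = Gamma (a + dl + 1 + 1 + real k) / Gamma (a + dl + 1 + 1)"
      using a dl by (auto intro!: pochhammer_Gamma dest: nonpos_Ints_nonpos)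
    moreover have "Gamma (a + 1) > 0" "Gamma (a + 1 + real k) > 0" "Gamma (a + dl + 1 + 1) > 0" "Gamma (a + dl + 1 + 1 + real k) > 0"
      using a dl by (auto intro!: Gamma_real_pos)
    moreover have "Gamma (a + 1 + real k + (dl + 1)) = Gamma (a + dl + 1 + 1 + real k)" "Gamma (a + dl + 2) = Gamma (a + dl + 1 + 1)"
      by (simp_all add: add_ac)
    ultimately show "(LINT s|J.nu. co k * s ^ k) = Gamma (a + 1) * Gamma (dl + 1) / Gamma (a + dl + 2) *
      ((- x) ^ k / (pochhammer (a + dl + 1 + 1) k * fact k))"
      using J.moment(2)[of k 0] by (simp add: co_def Beta_def)
  qed
  also have "(\<Sum>k. Gamma (a + 1) * Gamma (dl + 1) / Gamma (a + dl + 2) *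
      ((- x) ^ k / (pochhammer (a + dl + 1 + 1) k * fact k))) = Gamma (a + 1) * Gamma (dl + 1) / Gamma (a + dl + 2) * bessel (a + dl + 1) x"
    unfolding bessel_def
  proof (rule suminf_mult)
    show "summable (\<lambda>k. (- x) ^ k / (pochhammer (a + dl + 1 + 1) k * fact k))"
      by (rule summable_comparison_test'[OF exp_summable[of "2 * \<bar>x\<bar>"]])
        (use bessel_term_bound[of "a + dl + 1" "-x"] a dl in simp)
  qed
  finally show "(LINT s:{0..1}|lborel. bessel a (x * s) * (s powr a * (1 - s) powr dl)) =
       Gamma (a + 1) * Gamma (dl + 1) / Gamma (a + dl + 2) * bessel (a + dl + 1) x" .
qed

lemma bessel_fractional_integral_sq:
  assumes a: "a > -1/2" and dl: "dl > 0"
  shows "(LINT t:{0<..<1}|lborel. (1 - t) powr dl * (1 + t) powr dl * t powr (2 * a + 1) * bessel a (x * t\<^sup>2)) =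
       Gamma (a + 1) * Gamma (dl + 1) / (2 * Gamma (a + dl + 2)) * bessel (a + dl + 1) x"
proof -
  define f where "f s = bessel a (x * s) * (s powr a * (1 - s) powr dl)" for s
  have fi: "set_integrable lborel {0..1} f" unfolding f_def by (rule bessel_fractional_integral[OF a dl])
  have "(LBINT x. f x * indicat_real {0^2..1^2} x) = (LBINT t. f (t^2) * (2 * t) * indicat_real {0..1} t)"
    by (rule integral_substitution) (use fi in \<open>auto intro!: derivative_eq_intros continuous_intros\<close>)
  moreover have "(LBINT x. f x * indicat_real {0^2..1^2} x) = (LINT s:{0..1}|lborel. f s)"
    unfolding set_lebesgue_integral_def by (simp add: mult.commute)
  moreover have "(LBINT t. f (t^2) * (2 * t) * indicat_real {0..1} t) =
     2 * (LINT t:{0<..<1}|lborel. (1 - t) powr dl * (1 + t) powr dl * t powr (2 * a + 1) * bessel a (x * t\<^sup>2))"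
  proof -
    have *: "f (t^2) * (2 * t) = 2 * ((1 - t) powr dl * (1 + t) powr dl * t powr (2 * a + 1) * bessel a (x * t\<^sup>2))"
      if "0 < t" "t < 1" for t
    proof -
      have "(1 - t\<^sup>2) powr dl = (1 - t) powr dl * (1 + t) powr dl"
      proof -
        have "1 - t\<^sup>2 = (1 - t) * (1 + t)" by (simp add: power2_eq_square algebra_simps)
        then show ?thesis using that by (simp add: powr_mult)
      qed
      moreover have "(t\<^sup>2) powr a * t = t powr (2 * a + 1)"
      proof -
        have "t\<^sup>2 = t powr 2" using that by simp
        then show ?thesis using that by (simp only: powr_powr powr_add powr_one)
      qed
      moreover have "B * (P * (Q * S)) * (2 * t) = 2 * (Q * S * (P * t) * B)" for B P Q S by simp
      ultimately show ?thesis unfolding f_def by simp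
    qed
    have [measurable]: "bessel a \<in> borel_measurable borel" by (intro borel_measurable_continuous_onI bessel_continuous a)
    have "(LBINT t. f (t^2) * (2 * t) * indicat_real {0..1} t) =
      (LBINT t. 2 * (indicat_real {0<..<1} t *\<^sub>R ((1 - t) powr dl * (1 + t) powr dl * t powr (2 * a + 1) * bessel a (x * t\<^sup>2))))"
    proof (rule integral_cong_AE)
      show "AE t in lborel. f (t^2) * (2 * t) * indicat_real {0..1} t =
        2 * (indicat_real {0<..<1} t *\<^sub>R ((1 - t) powr dl * (1 + t) powr dl * t powr (2 * a + 1) * bessel a (x * t\<^sup>2)))"
        using AE_lborel_singleton[of 0] AE_lborel_singleton[of 1]
        by eventually_elim (use * in \<open>auto simp: indicator_def\<close>)
    qed (auto simp: f_def)
    then show ?thesis by (simp add: set_lebesgue_integral_def)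
  qed
  moreover have "(LINT s:{0..1}|lborel. f s) = Gamma (a + 1) * Gamma (dl + 1) / Gamma (a + dl + 2) * bessel (a + dl + 1) x"
    unfolding f_def by (rule bessel_fractional_integral[OF a dl])
  ultimately show ?thesis by simp
qed

context jacobi_weight
begin

definition hat :: "(real \<Rightarrow> real) \<Rightarrow> nat \<Rightarrow> real" where
  "hat f j = (LINT s|nu. f s * R j s)"

text \<open>The pairing of \<open>g\<close> with the mean of order \<open>dl\<close> and index \<open>n\<close> of the expansion of \<open>f\<close>, where the Jacobi polynomial of degree \<open>j\<close> is
counted with the degree \<open>e * j\<close> (see \<open>pairing_mean\<close>).\<close>

definition form :: "real \<Rightarrow> nat \<Rightarrow> nat \<Rightarrow> (real \<Rightarrow> real) \<Rightarrow> (real \<Rightarrow> real) \<Rightarrow> real" where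
  "form dl e n f g = (\<Sum>j\<le>n div e. cesaro_coeff dl (n - e * j) / cesaro_coeff dl n * (hat f j * hat g j / h j))"

lemma form_Suc:
  assumes dl: "dl > 0" and e: "e \<ge> 1"
  shows "form (dl + 1) e n f g = (\<Sum>m\<le>n. cesaro_coeff dl m * form dl e m f g) / cesaro_coeff (dl + 1) n"
proof -
  define X where "X j = hat f j * hat g j / h j" for j
  have "(\<Sum>m\<le>n. cesaro_coeff dl m * form dl e m f g) = (\<Sum>m\<le>n. \<Sum>j\<le>n div e. if e * j \<le> m then cesaro_coeff dl (m - e * j) * X j else 0)"
  proof (intro sum.cong refl)
    fix m assume m: "m \<in> {..n}"
    have "cesaro_coeff dl m * form dl e m f g = (\<Sum>j\<le>m div e. cesaro_coeff dl (m - e * j) * X j)"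
      unfolding form_def X_def sum_distrib_left using cesaro_pos[of dl m] dl by (intro sum.cong refl) (simp add: field_simps)
    also have "\<dots> = (\<Sum>j\<le>n div e. if e * j \<le> m then cesaro_coeff dl (m - e * j) * X j else 0)"
    proof (rule sum.mono_neutral_cong_left)
      have "e * j \<le> m \<longleftrightarrow> j \<le> m div e" for j
        using e by (simp add: less_eq_div_iff_mult_less_eq mult.commute)
      then show "\<forall>j\<in>{..n div e} - {..m div e}. (if e * j \<le> m then cesaro_coeff dl (m - e * j) * X j else 0) = 0"
        "\<And>j. j \<in> {..m div e} \<Longrightarrow> cesaro_coeff dl (m - e * j) * X j = (if e * j \<le> m then cesaro_coeff dl (m - e * j) * X j else 0)"
        by auto
    qed (use m in \<open>auto intro: div_le_mono order_trans\<close>)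
    finally show "cesaro_coeff dl m * form dl e m f g = (\<Sum>j\<le>n div e. if e * j \<le> m then cesaro_coeff dl (m - e * j) * X j else 0)" .
  qed
  also have "\<dots> = (\<Sum>j\<le>n div e. \<Sum>m\<le>n. if e * j \<le> m then cesaro_coeff dl (m - e * j) * X j else 0)"
    by (rule sum.swap)
  also have "\<dots> = (\<Sum>j\<le>n div e. cesaro_coeff (dl + 1) (n - e * j) * X j)"
  proof (intro sum.cong refl)
    fix j assume "j \<in> {..n div e}"
    then have j: "e * j \<le> n" using e by (simp add: less_eq_div_iff_mult_less_eq mult.commute)
    have "(\<Sum>m\<le>n. if e * j \<le> m then cesaro_coeff dl (m - e * j) * X j else 0) = (\<Sum>m\<in>{e * j..n}. cesaro_coeff dl (m - e * j) * X j)"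
      by (rule sum.mono_neutral_cong_right) auto
    also have "\<dots> = (\<Sum>k\<le>n - e * j. cesaro_coeff dl k * X j)"
      by (rule sum.reindex_bij_witness[of _ "\<lambda>k. k + e * j" "\<lambda>m. m - e * j"]) (use j in auto)
    also have "\<dots> = cesaro_coeff (dl + 1) (n - e * j) * X j"
      by (simp add: cesaro_sum[symmetric] sum_distrib_right)
    finally show "(\<Sum>m\<le>n. if e * j \<le> m then cesaro_coeff dl (m - e * j) * X j else 0) = cesaro_coeff (dl + 1) (n - e * j) * X j" .
  qed
  finally show ?thesis
    unfolding form_def X_def by (simp add: sum_divide_distrib mult.commute[of "h _"])
qed

text \<open>Averages with positive weights obey the bound of what they average.\<close>

lemma form_higher:
  assumes dl: "dl > 0" and e: "e \<ge> 1" and bd: "\<And>n. \<bar>form dl e n f g\<bar> \<le> C"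
  shows "\<bar>form (dl + real i) e n f g\<bar> \<le> C"
proof (induction i arbitrary: n)
  case 0 then show ?case using bd by simp
next
  case (Suc i)
  define d where "d = dl + real i"
  have d: "d > 0" using dl by (simp add: d_def)
  have p: "cesaro_coeff d m > 0" "cesaro_coeff (d + 1) m > 0" for m using d by (auto intro: cesaro_pos)
  have "\<bar>\<Sum>m\<le>n. cesaro_coeff d m * form d e m f g\<bar> \<le> (\<Sum>m\<le>n. cesaro_coeff d m * C)"
  proof (rule order_trans[OF sum_abs sum_mono])
    fix m
    show "\<bar>cesaro_coeff d m * form d e m f g\<bar> \<le> cesaro_coeff d m * C"
      using Suc[of m] p(1)[of m] by (simp add: abs_mult d_def)
  qed
  also have "\<dots> = cesaro_coeff (d + 1) n * C" by (simp add: sum_distrib_right[symmetric] cesaro_sum)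
  finally have "\<bar>form (d + 1) e n f g\<bar> \<le> C"
    unfolding form_Suc[OF d e] using p(2)[of n] by (simp add: field_simps)
  then show ?case by (simp add: d_def add_ac)
qed

end

section \<open>The limit of the means of a concentrated bump\<close>

context jacobi_weight
begin

text \<open>The multiplier of the combination \<open>\<Sum>\<^bsub>i \<le> N\<^esub> d\<^sub>i S\<^bsup>dl + i\<^esup>\<close> of means of index \<open>e * N\<close>; the coefficients will be those of lemma
\<open>compensator_series\<close>.\<close>

definition compensated :: "(nat \<Rightarrow> real) \<Rightarrow> real \<Rightarrow> nat \<Rightarrow> nat \<Rightarrow> nat \<Rightarrow> real" where
  "compensated d dl e N j = (\<Sum>i\<le>N. d i * (cesaro_coeff (dl + real i) (e * N - e * j) / cesaro_coeff (dl + real i) (e * N)))"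

lemma compensated_bound:
  assumes dl: "dl > 0" and d: "summable (\<lambda>i. \<bar>d i\<bar>)"
  shows "\<bar>compensated d dl e N j\<bar> \<le> (\<Sum>i. \<bar>d i\<bar>)"
proof -
  have "\<bar>compensated d dl e N j\<bar> \<le> (\<Sum>i\<le>N. \<bar>d i\<bar>)"
    unfolding compensated_def
  proof (rule order_trans[OF sum_abs sum_mono])
    fix i
    have "\<bar>cesaro_coeff (dl + real i) (e * N - e * j) / cesaro_coeff (dl + real i) (e * N)\<bar> \<le> 1"
      using cesaro_ratio_bounds[of "dl + real i" "e * N - e * j" "e * N"] dl by simp
    then show "\<bar>d i * (cesaro_coeff (dl + real i) (e * N - e * j) / cesaro_coeff (dl + real i) (e * N))\<bar> \<le> \<bar>d i\<bar>"
      unfolding abs_mult[of "d i"] by (rule mult_left_le) simp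
  qed
  also have "\<dots> \<le> (\<Sum>i. \<bar>d i\<bar>)" by (intro sum_le_suminf d) auto
  finally show ?thesis .
qed

lemma compensated_limit:
  assumes dl: "dl > 0" and e: "e \<ge> 1" and t: "0 < t" "t < 1"
    and d: "summable (\<lambda>i. \<bar>d i\<bar>)"
    and ds: "\<And>x. x \<in> {0..1} \<Longrightarrow> (\<lambda>i. d i * x ^ i) sums ((2 - x) powr dl * exp ((1 - x)\<^sup>2))"
  shows "(\<lambda>N. compensated d dl e N (nat \<lfloor>t * real N\<rfloor>)) \<longlonglongrightarrow> (1 - t) powr dl * ((1 + t) powr dl * exp (t\<^sup>2))"
proof -
  define jn where "jn N = nat \<lfloor>t * real N\<rfloor>" for N
  note fl = floor_index[OF t, folded jn_def]
  have lim1: "(\<lambda>N. real (e * N - e * jn N) / real (e * N)) \<longlonglongrightarrow> 1 - t"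
  proof -
    have "(\<lambda>N. 1 - real (jn N) / real N) \<longlonglongrightarrow> 1 - t" by (intro tendsto_intros fl)
    moreover have "\<forall>\<^sub>F N in sequentially. 1 - real (jn N) / real N = real (e * N - e * jn N) / real (e * N)"
      using eventually_gt_at_top[of 0]
    proof eventually_elim
      case (elim N)
      have "e * jn N \<le> e * N" using fl(3)[of N] by simp
      then show ?case using elim e by (simp add: of_nat_diff diff_divide_distrib)
    qed
    ultimately show ?thesis by (rule Lim_transform_eventually)
  qed
  have topn: "filterlim (\<lambda>N. e * N) at_top sequentially"
    using e by (intro filterlim_subseq strict_monoI) auto
  have topm: "filterlim (\<lambda>N. e * N - e * jn N) at_top sequentially"
  proof -
    have "filterlim (\<lambda>N. real (e * N - e * jn N) / real (e * N) * real (e * N)) at_top sequentially"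
      by (rule filterlim_tendsto_pos_mult_at_top[OF lim1])
        (use t topn in \<open>auto simp: filterlim_sequentially_iff_filterlim_real simp del: of_nat_mult\<close>)
    then have "filterlim (\<lambda>N. real (e * N - e * jn N)) at_top sequentially"
      by (rule filterlim_mono_eventually)
         (use e in \<open>auto intro!: eventually_mono[OF eventually_gt_at_top[of 0]] simp del: of_nat_mult of_nat_diff\<close>)
    then show ?thesis by (simp only: filterlim_sequentially_iff_filterlim_real)
  qed
  define A where "A i N = (if i \<le> N then d i * (cesaro_coeff (dl + real i) (e * N - e * jn N) / cesaro_coeff (dl + real i) (e * N)) else 0)" for i N
  have A: "compensated d dl e N (jn N) = (\<Sum>i. A i N)" for N
    unfolding compensated_def A_def by (subst suminf_finite[of "{..N}"]) auto
  have l: "(\<lambda>N. A i N) \<longlonglongrightarrow> d i * (1 - t) powr (dl + real i)" for i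
  proof (rule Lim_transform_eventually)
    show "(\<lambda>N. d i * (cesaro_coeff (dl + real i) (e * N - e * jn N) / cesaro_coeff (dl + real i) (e * N))) \<longlonglongrightarrow> d i * (1 - t) powr (dl + real i)"
      using dl t by (intro tendsto_mult tendsto_const cesaro_ratio_limit topn topm lim1) auto
    show "\<forall>\<^sub>F N in sequentially. d i * (cesaro_coeff (dl + real i) (e * N - e * jn N) / cesaro_coeff (dl + real i) (e * N)) = A i N"
      using eventually_ge_at_top[of i] by eventually_elim (simp add: A_def)
  qed
  have bd: "norm (A i N) \<le> \<bar>d i\<bar>" for i N
  proof -
    have "\<bar>cesaro_coeff (dl + real i) (e * N - e * jn N) / cesaro_coeff (dl + real i) (e * N)\<bar> \<le> 1"
      using cesaro_ratio_bounds[of "dl + real i" "e * N - e * jn N" "e * N"] dl by simp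
    then have "\<bar>d i\<bar> * \<bar>cesaro_coeff (dl + real i) (e * N - e * jn N) / cesaro_coeff (dl + real i) (e * N)\<bar> \<le> \<bar>d i\<bar>"
      by (rule mult_left_le) simp
    then show ?thesis unfolding A_def real_norm_def by (simp only: abs_mult[of "d i", symmetric]) simp
  qed
  have "(\<lambda>N. \<Sum>i. A i N) \<longlonglongrightarrow> (\<Sum>i. d i * (1 - t) powr (dl + real i))"
  proof (rule tannerys_theorem[THEN conjunct2, THEN conjunct2, OF l _ d])
    show "\<forall>\<^sub>F (i, N) in sequentially \<times>\<^sub>F sequentially. norm (A i N) \<le> \<bar>d i\<bar>"
      by (rule always_eventually) (use bd in auto)
  qed auto
  moreover have "(\<Sum>i. d i * (1 - t) powr (dl + real i)) = (1 - t) powr dl * ((1 + t) powr dl * exp (t\<^sup>2))"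
  proof -
    have "(\<lambda>i. (1 - t) powr dl * (d i * (1 - t) ^ i)) sums ((1 - t) powr dl * ((2 - (1 - t)) powr dl * exp ((1 - (1 - t))\<^sup>2)))"
      using t by (intro sums_mult ds) auto
    moreover have "(1 - t) powr dl * (d i * (1 - t) ^ i) = d i * (1 - t) powr (dl + real i)" for i
      using t by (simp add: powr_add powr_realpow)
    ultimately have "(\<lambda>i. d i * (1 - t) powr (dl + real i)) sums ((1 - t) powr dl * ((1 + t) powr dl * exp (t\<^sup>2)))"
      by (simp add: add.commute)
    then show ?thesis by (rule sums_unique[symmetric])
  qed
  ultimately show ?thesis unfolding A[symmetric] jn_def by simp
qed

text \<open>The combination of means, with multiplier \<open>compensated\<close>, of the bump \<open>(1 - s)\<^bsup>N\<^sup>2\<^esup>\<close>.\<close>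

definition bump_mean :: "(nat \<Rightarrow> real) \<Rightarrow> real \<Rightarrow> nat \<Rightarrow> nat \<Rightarrow> real \<Rightarrow> real" where
  "bump_mean d dl e N s = (\<Sum>j\<le>N. compensated d dl e N j * (hat (\<lambda>s. (1 - s) ^ (N\<^sup>2)) j / h j) * R j s)"

lemma hat_bump: "hat (\<lambda>s. (1 - s) ^ m) j = Beta (a + 1) (b + 1 + real m) * rho m j"
  unfolding hat_def rho_def using integral_R_pow[of j m] by (simp add: mult.commute)

text \<open>The sum over \<open>j\<close> is a Riemann sum. Its terms converge by \<open>compensated_limit\<close>, \<open>rho_limit\<close>, \<open>inverse_h_asymp\<close> and
\<open>Mehler_Heine\<close>, and the exponential factors of the first two cancel. What remains is the integral in
\<open>bessel_fractional_integral_sq\<close>.\<close>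

lemma bump_mean_limit:
  assumes dl: "dl > 0" and e: "e \<ge> 1"
    and d: "summable (\<lambda>i. \<bar>d i\<bar>)"
    and ds: "\<And>x. x \<in> {0..1} \<Longrightarrow> (\<lambda>i. d i * x ^ i) sums ((2 - x) powr dl * exp ((1 - x)\<^sup>2))"
  shows "(\<lambda>N. bump_mean d dl e N (x / (real N)\<^sup>2)) \<longlonglongrightarrow> Gamma (dl + 1) / Gamma (a + dl + 2) * bessel (a + dl + 1) x"
    and "\<exists>K. \<forall>N\<ge>1. \<forall>x\<in>{0..X}. \<bar>bump_mean d dl e N (x / (real N)\<^sup>2)\<bar> \<le> K"
proof -
  define u where "u N x j = compensated d dl e N j * rho (N\<^sup>2) j * (inverse (h j) / real N powr (2 * a + 1)) * R j (x / (real N)\<^sup>2)" for N x j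
  define BN where "BN N = Beta (a + 1) (b + 1 + real (N\<^sup>2)) * real (N\<^sup>2) powr (a + 1)" for N
  have D_eq: "bump_mean d dl e N (x / (real N)\<^sup>2) = BN N * ((\<Sum>j<N. u N x j) / real N + u N x N / real N)" if "N \<ge> 1" for N x
  proof -
    have p: "real (N\<^sup>2) powr (a + 1) = real N powr (2 * a + 1) * real N"
    proof -
      have "real (N\<^sup>2) = real N powr 2" using that by simp
      then have "real (N\<^sup>2) powr (a + 1) = real N powr (2 * a + 1 + 1)" by (simp only: powr_powr) (simp add: algebra_simps)
      then show ?thesis using that by (simp only: powr_add powr_one)
    qed
    have pp: "real N powr (2 * a + 1) > 0" "real N > 0" using that by auto
    have "bump_mean d dl e N (x / (real N)\<^sup>2) = (\<Sum>j\<le>N. BN N * (u N x j / real N))"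
      unfolding bump_mean_def
    proof (intro sum.cong refl)
      fix j
      have alg: "m * (Bt * r / H) * Rj = Bt * (P * n) * (m * r * (inverse H / P) * Rj / n)"
        if "P > 0" "n > 0" for m Bt r H Rj P n :: real using that by (simp add: field_simps)
      show "compensated d dl e N j * (hat (\<lambda>s. (1 - s) ^ N\<^sup>2) j / h j) * R j (x / (real N)\<^sup>2) = BN N * (u N x j / real N)"
        unfolding hat_bump u_def BN_def p by (rule alg[OF pp])
    qed
    also have "\<dots> = BN N * ((\<Sum>j\<le>N. u N x j) / real N)" by (simp add: sum_distrib_left sum_divide_distrib)
    also have "(\<Sum>j\<le>N. u N x j) = (\<Sum>j<N. u N x j) + u N x N" by (simp add: lessThan_Suc_atMost[symmetric])
    finally show ?thesis by (simp add: add_divide_distrib)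
  qed
  have BN_lim: "BN \<longlonglongrightarrow> Gamma (a + 1)"
  proof -
    have "filterlim (\<lambda>N::nat. N\<^sup>2) at_top sequentially" by (intro filterlim_subseq strict_monoI) (auto simp: power_strict_mono)
    from filterlim_compose[OF Beta_asymp this] show ?thesis by (simp add: BN_def[abs_def])
  qed
  obtain K where K: "K > 0" "\<And>n. inverse (h n) \<le> K * (real n + 1) powr (2 * a + 1)" using inverse_h_bound by blast
  define S where "S = (\<Sum>i. \<bar>d i\<bar>)"
  have S0: "S \<ge> 0" unfolding S_def by (rule suminf_nonneg[OF d]) auto
  define U where "U x = S * (K * 2 powr (2 * a + 1)) * exp (2 * ((2 + c) * \<bar>x\<bar>))" for x
  have ubd: "\<bar>u N x j\<bar> \<le> U x" if "N \<ge> 1" "j \<le> N" for N x j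
  proof -
    have jN: "j \<le> N\<^sup>2" using that by (metis le_square order_trans power2_eq_square)
    have r: "\<bar>rho (N\<^sup>2) j\<bar> \<le> 1" using rho_bounds[OF jN] by simp
    have Np: "real N powr (2 * a + 1) > 0" using that by simp
    have "inverse (h j) \<le> K * (real j + 1) powr (2 * a + 1)" by (rule K)
    also have "\<dots> \<le> K * (2 * real N) powr (2 * a + 1)" using that K a_gt by (intro mult_left_mono powr_mono2) auto
    also have "\<dots> = K * 2 powr (2 * a + 1) * real N powr (2 * a + 1)" by (simp add: powr_mult)
    finally have "inverse (h j) / real N powr (2 * a + 1) \<le> K * 2 powr (2 * a + 1)" using Np by (simp only: pos_divide_le_eq)
    then have ih: "\<bar>inverse (h j) / real N powr (2 * a + 1)\<bar> \<le> K * 2 powr (2 * a + 1)" using h_pos[of j] Np by simp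
    have "\<bar>u N x j\<bar> \<le> (S * 1) * (K * 2 powr (2 * a + 1)) * exp (2 * ((2 + c) * \<bar>x\<bar>))"
      unfolding u_def abs_mult
      using compensated_bound[OF dl d, of e N j, folded S_def] r ih R_bound[OF that(2,1)] S0 K(1)
      by (intro mult_mono mult_nonneg_nonneg) auto
    then show ?thesis by (simp add: U_def)
  qed
  show "\<exists>K. \<forall>N\<ge>1. \<forall>x\<in>{0..X}. \<bar>bump_mean d dl e N (x / (real N)\<^sup>2)\<bar> \<le> K"
  proof -
    have "Bseq BN" using BN_lim by (intro convergent_imp_Bseq) (auto simp: convergent_def)
    then obtain M where M: "M > 0" "\<And>N. \<bar>BN N\<bar> \<le> M" unfolding Bseq_def by auto
    have "\<bar>bump_mean d dl e N (x / (real N)\<^sup>2)\<bar> \<le> M * (U X + U X)" if N: "N \<ge> 1" and x: "x \<in> {0..X}" for N x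
    proof -
      have UX: "U x \<le> U X" unfolding U_def
        using x S0 K(1) c_pos by (intro mult_left_mono) (auto intro!: mult_left_mono)
      have U0: "U x \<ge> 0" unfolding U_def using S0 K(1) by auto
      have "\<bar>\<Sum>j<N. u N x j\<bar> \<le> (\<Sum>j<N. U x)" by (rule order_trans[OF sum_abs sum_mono]) (use ubd N in auto)
      then have "\<bar>\<Sum>j<N. u N x j\<bar> \<le> U x * real N" by (simp add: mult.commute)
      then have 1: "\<bar>(\<Sum>j<N. u N x j) / real N\<bar> \<le> U x" using N by (simp add: field_simps)
      have "\<bar>u N x N\<bar> \<le> U x * 1" using ubd[of N N x] N by simp
      also have "\<dots> \<le> U x * real N" using U0 N by (intro mult_left_mono) auto
      finally have 2: "\<bar>u N x N / real N\<bar> \<le> U x" using N by (simp add: field_simps)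
      have "\<bar>(\<Sum>j<N. u N x j) / real N + u N x N / real N\<bar> \<le> U X + U X" using 1 2 UX by linarith
      then show ?thesis unfolding D_eq[OF N] abs_mult using M by (intro mult_mono) auto
    qed
    then show ?thesis by blast
  qed
  define v where "v t = 2 / (Gamma (a + 1))\<^sup>2 * ((1 - t) powr dl * (1 + t) powr dl * t powr (2 * a + 1) * bessel a (x * t\<^sup>2))" for t
  have ptw: "(\<lambda>N. u N x (nat \<lfloor>t * real N\<rfloor>)) \<longlonglongrightarrow> v t" if t: "0 < t" "t < 1" for t
  proof -
    define jn where "jn N = nat \<lfloor>t * real N\<rfloor>" for N
    note fl = floor_index[OF t, folded jn_def]
    have l1: "(\<lambda>N. compensated d dl e N (jn N)) \<longlonglongrightarrow> (1 - t) powr dl * ((1 + t) powr dl * exp (t\<^sup>2))"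
      unfolding jn_def by (rule compensated_limit[OF dl e t d ds])
    have l2: "(\<lambda>N. rho (N\<^sup>2) (jn N)) \<longlonglongrightarrow> exp (- t\<^sup>2)" by (rule rho_limit[OF fl(1) fl(3)])
    have l3: "(\<lambda>N. inverse (h (jn N)) / real N powr (2 * a + 1)) \<longlonglongrightarrow> 2 / (Gamma (a + 1))\<^sup>2 * t powr (2 * a + 1)"
    proof (rule Lim_transform_eventually)
      show "(\<lambda>N. inverse (h (jn N)) / real (jn N) powr (2 * a + 1) * (real (jn N) / real N) powr (2 * a + 1))
         \<longlonglongrightarrow> 2 / (Gamma (a + 1))\<^sup>2 * t powr (2 * a + 1)"
        using t by (intro tendsto_mult filterlim_compose[OF inverse_h_asymp fl(2)] tendsto_powr fl(1) tendsto_const) auto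
      show "\<forall>\<^sub>F N in sequentially. inverse (h (jn N)) / real (jn N) powr (2 * a + 1) * (real (jn N) / real N) powr (2 * a + 1)
        = inverse (h (jn N)) / real N powr (2 * a + 1)"
        using eventually_compose_filterlim[OF eventually_gt_at_top[of 0] fl(2)]
        by eventually_elim (simp add: powr_divide)
    qed
    have l4: "(\<lambda>N. R (jn N) (x / (real N)\<^sup>2)) \<longlonglongrightarrow> bessel a (x * t\<^sup>2)" by (rule Mehler_Heine[OF fl(1) fl(3)])
    have "(\<lambda>N. u N x (jn N)) \<longlonglongrightarrow> (1 - t) powr dl * ((1 + t) powr dl * exp (t\<^sup>2)) * exp (- t\<^sup>2) *
       (2 / (Gamma (a + 1))\<^sup>2 * t powr (2 * a + 1)) * bessel a (x * t\<^sup>2)"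
      unfolding u_def by (intro tendsto_mult l1 l2 l3 l4)
    also have "(1 - t) powr dl * ((1 + t) powr dl * exp (t\<^sup>2)) * exp (- t\<^sup>2) *
       (2 / (Gamma (a + 1))\<^sup>2 * t powr (2 * a + 1)) * bessel a (x * t\<^sup>2) = (exp (t\<^sup>2) * exp (- t\<^sup>2)) * v t"
      unfolding v_def by (simp add: mult_ac)
    also have "exp (t\<^sup>2) * exp (- t\<^sup>2) = 1" by (simp add: exp_minus_inverse)
    finally show ?thesis by (simp add: jn_def)
  qed
  have [measurable]: "bessel a \<in> borel_measurable borel" using a_gt by (intro borel_measurable_continuous_onI bessel_continuous)
  have I: "(\<lambda>N. LINT t:{0<..<1}|lborel. u N x (nat \<lfloor>t * real N\<rfloor>)) \<longlonglongrightarrow> (LINT t:{0<..<1}|lborel. v t)"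
    unfolding set_lebesgue_integral_def
  proof (rule LIMSEQ_imp_Suc, rule integral_dominated_convergence)
    show "integrable lborel (\<lambda>t::real. indicat_real {0<..<1} t * U x)"
      by (intro integrable_mult_left integrable_real_indicator) auto
    show "(\<lambda>t. indicat_real {0<..<1} t *\<^sub>R u (Suc N) x (nat \<lfloor>t * real (Suc N)\<rfloor>)) \<in> borel_measurable lborel" for N
    proof -
      have "(\<lambda>t::real. nat \<lfloor>t * real (Suc N)\<rfloor>) \<in> measurable borel (count_space UNIV)" by measurable
      then have [measurable]: "(\<lambda>t::real. u (Suc N) x (nat \<lfloor>t * real (Suc N)\<rfloor>)) \<in> borel_measurable borel"
        by (rule measurable_compose) simp
      show ?thesis by measurable
    qed
    show "AE t in lborel. (\<lambda>N. indicat_real {0<..<1} t *\<^sub>R u (Suc N) x (nat \<lfloor>t * real (Suc N)\<rfloor>)) \<longlonglongrightarrow> indicat_real {0<..<1} t *\<^sub>R v t"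
    proof (rule AE_I2)
      fix t :: real
      show "(\<lambda>N. indicat_real {0<..<1} t *\<^sub>R u (Suc N) x (nat \<lfloor>t * real (Suc N)\<rfloor>)) \<longlonglongrightarrow> indicat_real {0<..<1} t *\<^sub>R v t"
        using LIMSEQ_Suc[OF ptw[of t]] by (cases "t \<in> {0<..<1}") auto
    qed
    show "AE t in lborel. norm (indicat_real {0<..<1} t *\<^sub>R u (Suc N) x (nat \<lfloor>t * real (Suc N)\<rfloor>)) \<le> indicat_real {0<..<1} t * U x" for N
      using ubd[of "Suc N" _ x] floor_index(3)[of _ "Suc N"]
      by (intro AE_I2) (auto simp: indicator_def)
    show "(\<lambda>t. indicat_real {0<..<1} t *\<^sub>R v t) \<in> borel_measurable lborel" unfolding v_def by measurable
  qed
  have Vint: "Gamma (a + 1) * (LINT t:{0<..<1}|lborel. v t) = Gamma (dl + 1) / Gamma (a + dl + 2) * bessel (a + dl + 1) x"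
  proof -
    have "(LINT t:{0<..<1}|lborel. v t) = 2 / (Gamma (a + 1))\<^sup>2 * (Gamma (a + 1) * Gamma (dl + 1) / (2 * Gamma (a + dl + 2)) * bessel (a + dl + 1) x)"
      unfolding v_def by (simp only: set_integral_mult_right bessel_fractional_integral_sq[OF a_gt dl])
    moreover have "Gamma (a + 1) > 0" using a_gt by (intro Gamma_real_pos) auto
    ultimately show ?thesis by (simp add: power2_eq_square)
  qed
  have last: "(\<lambda>N. u N x N / real N) \<longlonglongrightarrow> 0"
  proof (rule Lim_null_comparison)
    show "\<forall>\<^sub>F N in sequentially. norm (u N x N / real N) \<le> U x / real N"
      using eventually_ge_at_top[of 1] by eventually_elim (use ubd in \<open>auto intro!: divide_right_mono\<close>)
    show "(\<lambda>N. U x / real N) \<longlonglongrightarrow> 0" by real_asymp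
  qed
  have "(\<lambda>N. BN N * ((LINT t:{0<..<1}|lborel. u N x (nat \<lfloor>t * real N\<rfloor>)) + u N x N / real N)) \<longlonglongrightarrow>
     Gamma (a + 1) * ((LINT t:{0<..<1}|lborel. v t) + 0)"
    by (intro tendsto_mult BN_lim tendsto_add I last)
  moreover have "\<forall>\<^sub>F N in sequentially. BN N * ((LINT t:{0<..<1}|lborel. u N x (nat \<lfloor>t * real N\<rfloor>)) + u N x N / real N) = bump_mean d dl e N (x / (real N)\<^sup>2)"
    using eventually_ge_at_top[of 1] by eventually_elim (simp add: D_eq riemann_step_integral)
  ultimately show "(\<lambda>N. bump_mean d dl e N (x / (real N)\<^sup>2)) \<longlonglongrightarrow> Gamma (dl + 1) / Gamma (a + dl + 2) * bessel (a + dl + 1) x"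
    unfolding Vint[symmetric] by (simp add: tendsto_cong)
qed

end

section \<open>Unboundedness of the means on the interval\<close>

context jacobi_weight
begin

text \<open>The continuous functions in the unit ball of \<open>L\<^sup>p\<close> with \<open>\<theta> = 1 / p\<close>, so that the conjugate exponent belongs to
\<open>1 - \<theta>\<close> and \<open>\<theta> = 0\<close> stands for the uniform norm.\<close>

definition unit_ball :: "real \<Rightarrow> (real \<Rightarrow> real) \<Rightarrow> bool" where
  "unit_ball \<theta> g \<longleftrightarrow> continuous_on UNIV g \<and>
     (if \<theta> = 0 then \<forall>s. \<bar>g s\<bar> \<le> 1 else (LINT s|nu. \<bar>g s\<bar> powr (1 / \<theta>)) \<le> 1)"

lemma hat_scale: "hat (\<lambda>s. m * f s) j = m * hat f j"
  unfolding hat_def by (simp add: mult.assoc)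

lemma compensated_form_bound:
  assumes dl: "dl > 0" and e: "e \<ge> 1" and d: "summable (\<lambda>i. \<bar>d i\<bar>)"
    and bd: "\<And>n. \<bar>form dl e n f g\<bar> \<le> C"
  shows "\<bar>\<Sum>j\<le>N. compensated d dl e N j * (hat f j * hat g j / h j)\<bar> \<le> C * (\<Sum>i. \<bar>d i\<bar>)"
proof -
  have C: "C \<ge> 0" using bd[of 0] by linarith
  have "(\<Sum>j\<le>N. compensated d dl e N j * (hat f j * hat g j / h j)) = (\<Sum>j\<le>N. \<Sum>i\<le>N. d i * (cesaro_coeff (dl + real i) (e * N - e * j) / cesaro_coeff (dl + real i) (e * N) * (hat f j * hat g j / h j)))"
    unfolding compensated_def sum_distrib_right by (simp only: mult.assoc)
  also have "\<dots> = (\<Sum>i\<le>N. d i * form (dl + real i) e (e * N) f g)"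
    using e by (subst sum.swap) (simp add: form_def sum_distrib_left)
  also have "\<bar>\<dots>\<bar> \<le> (\<Sum>i\<le>N. \<bar>d i\<bar> * C)"
  proof (rule order_trans[OF sum_abs sum_mono])
    fix i
    show "\<bar>d i * form (dl + real i) e (e * N) f g\<bar> \<le> \<bar>d i\<bar> * C"
      unfolding abs_mult by (intro mult_left_mono form_higher dl e bd) auto
  qed
  also have "\<dots> = (\<Sum>i\<le>N. \<bar>d i\<bar>) * C" by (simp add: sum_distrib_right)
  also have "\<dots> \<le> (\<Sum>i. \<bar>d i\<bar>) * C" by (intro mult_right_mono sum_le_suminf d C) auto
  finally show ?thesis by (simp add: mult.commute)
qed

lemma pairing_bump_mean:
  assumes "continuous_on UNIV g"
  shows "(\<Sum>j\<le>N. compensated d dl e N j * (hat (\<lambda>s. (1 - s) ^ (N\<^sup>2)) j * hat g j / h j)) = (LINT s|nu. g s * bump_mean d dl e N s)"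
proof -
  have "(LINT s|nu. g s * bump_mean d dl e N s) = (LINT s|nu. (\<Sum>j\<le>N. compensated d dl e N j * (hat (\<lambda>s. (1 - s) ^ (N\<^sup>2)) j / h j) * (g s * R j s)))"
    unfolding bump_mean_def by (simp add: sum_distrib_left mult_ac)
  also have "\<dots> = (\<Sum>j\<le>N. compensated d dl e N j * (hat (\<lambda>s. (1 - s) ^ (N\<^sup>2)) j / h j) * hat g j)"
    unfolding hat_def[of g]
  proof (subst Bochner_Integration.integral_sum)
    fix j
    show "integrable nu (\<lambda>s. compensated d dl e N j * (hat (\<lambda>s. (1 - s) ^ (N\<^sup>2)) j / h j) * (g s * R j s))"
      by (intro integrable_nu_cont continuous_intros assms)
  qed simp
  finally show ?thesis by (simp add: mult_ac)
qed

text \<open>As \<open>0 \<le> 1 - s \<le> 1\<close>, raising the bump to the power \<open>1 / \<theta> \<ge> 1\<close> only makes it smaller, and the integral of the bump itself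
is a Beta function.\<close>

lemma bump_norm_bound:
  obtains Cf where "Cf > 0" "\<And>N \<theta>. N \<ge> 1 \<Longrightarrow> 0 < \<theta> \<Longrightarrow> \<theta> \<le> 1 \<Longrightarrow>
     (LINT s|nu. \<bar>(1 - s) ^ (N\<^sup>2)\<bar> powr (1 / \<theta>)) \<le> Cf * real N powr (- 2 * (a + 1))"
proof -
  have "Bseq (\<lambda>n. Beta (a + 1) (b + 1 + real n) * real n powr (a + 1))"
    using Beta_asymp by (intro convergent_imp_Bseq) (auto simp: convergent_def)
  then obtain Cf where Cf: "Cf > 0" "\<And>n. \<bar>Beta (a + 1) (b + 1 + real n) * real n powr (a + 1)\<bar> \<le> Cf"
    unfolding Bseq_def by auto
  show ?thesis
  proof (rule that[OF Cf(1)])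
    fix N \<theta> assume N: "(N::nat) \<ge> 1" and \<theta>: "0 < (\<theta>::real)" "\<theta> \<le> 1"
    have "(LINT s|nu. \<bar>(1 - s) ^ (N\<^sup>2)\<bar> powr (1 / \<theta>)) \<le> (LINT s|nu. s ^ 0 * (1 - s) ^ (N\<^sup>2))"
    proof (rule integral_mono_AE)
      have le: "\<bar>(1 - s) ^ (N\<^sup>2)\<bar> powr (1 / \<theta>) \<le> (1 - s) ^ (N\<^sup>2)" "\<bar>(1 - s) ^ (N\<^sup>2)\<bar> \<le> 1" if "s \<in> {0..1}" for s
      proof -
        have y: "0 \<le> (1 - s) ^ (N\<^sup>2)" "(1 - s) ^ (N\<^sup>2) \<le> 1" using that by (auto intro: power_le_one)
        then show "\<bar>(1 - s) ^ (N\<^sup>2)\<bar> \<le> 1" by simp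
        have "((1 - s) ^ (N\<^sup>2)) powr (1 / \<theta>) \<le> ((1 - s) ^ (N\<^sup>2)) powr 1"
          using y \<theta> by (intro powr_mono') auto
        then show "\<bar>(1 - s) ^ (N\<^sup>2)\<bar> powr (1 / \<theta>) \<le> (1 - s) ^ (N\<^sup>2)" using y by simp
      qed
      show "integrable nu (\<lambda>s. \<bar>(1 - s) ^ (N\<^sup>2)\<bar> powr (1 / \<theta>))"
        by (rule integrable_nu_bounded[of _ 1]) (use le \<theta> in \<open>auto intro!: powr_le1\<close>)
      show "integrable nu (\<lambda>s. s ^ 0 * (1 - s) ^ (N\<^sup>2))" by (rule moment)
      show "AE s in nu. \<bar>(1 - s) ^ (N\<^sup>2)\<bar> powr (1 / \<theta>) \<le> s ^ 0 * (1 - s) ^ (N\<^sup>2)"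
        using AE_nu by eventually_elim (use le in auto)
    qed
    also have "\<dots> = Beta (a + 1) (b + 1 + real (N\<^sup>2))" unfolding moment by simp
    also have "\<dots> \<le> Cf * real N powr (- 2 * (a + 1))"
    proof -
      have e: "real (N\<^sup>2) powr (a + 1) = real N powr (2 * (a + 1))"
      proof -
        have "real (N\<^sup>2) = real N powr 2" using N by simp
        then show ?thesis by (simp only: powr_powr)
      qed
      have p: "real N powr (2 * (a + 1)) > 0" using N by simp
      have "Beta (a + 1) (b + 1 + real (N\<^sup>2)) * real N powr (2 * (a + 1)) \<le> Cf"
        using Cf(2)[of "N\<^sup>2"] unfolding e by linarith
      then have "Beta (a + 1) (b + 1 + real (N\<^sup>2)) \<le> Cf / real N powr (2 * (a + 1))" using p by (simp add: pos_le_divide_eq)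
      also have "\<dots> = Cf * real N powr (- (2 * (a + 1)))" by (simp only: powr_minus_divide) simp
      also have "- (2 * (a + 1)) = - 2 * (a + 1)" by simp
      finally show ?thesis .
    qed
    finally show "(LINT s|nu. \<bar>(1 - s) ^ (N\<^sup>2)\<bar> powr (1 / \<theta>)) \<le> Cf * real N powr (- 2 * (a + 1))" .
  qed
qed

lemma one_minus_powr_le_2:
  assumes "0 \<le> s" "s \<le> 1/2" shows "(1 - s) powr b \<le> 2"
proof (cases "b \<ge> 0")
  case True
  then have "(1 - s) powr b \<le> 1" using assms by (intro powr_le1) auto
  then show ?thesis by simp
next
  case False
  have "(1 - s) powr b \<le> (1/2) powr b" using assms False by (intro powr_mono2') auto
  also have "\<dots> \<le> (1/2) powr (-1)" using b_ge by (intro powr_mono') auto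
  also have "\<dots> = 2" by (simp add: powr_minus)
  finally show ?thesis .
qed

text \<open>The substitution \<open>s = x / N\<^sup>2\<close>. The support of \<open>F\<close> keeps the integral away from the other end point \<open>s = 1\<close>.\<close>

lemma scaled_integral:
  assumes [measurable]: "F \<in> borel_measurable borel" and N: "N \<ge> 1" and Y: "real (N\<^sup>2) \<ge> 2 * Y" "Y > 0"
    and F0: "\<And>s. s \<notin> {0..Y / (real N)\<^sup>2} \<Longrightarrow> F s = 0"
  shows "real N powr (2 * (a + 1)) * (LINT s|nu. F s) =
     (LINT x:{0..Y}|lborel. F (x / (real N)\<^sup>2) * (x powr a * (1 - x / (real N)\<^sup>2) powr b))"
proof -
  define n where "n = (real N)\<^sup>2"
  have n: "n > 0" using N by (simp add: n_def)
  have Yn: "Y / n \<le> 1" using Y n by (simp add: n_def)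
  have np: "real N powr (2 * (a + 1)) = n powr a * n"
  proof -
    have "n = real N powr 2" using N by (simp add: n_def)
    then have "real N powr (2 * (a + 1)) = n powr (a + 1)" by (simp only: powr_powr)
    then show ?thesis using n by (simp add: powr_add)
  qed
  have "(LINT s|nu. F s) = (LINT s|lborel. indicator {0..1} s *\<^sub>R (F s * (s powr a * (1 - s) powr b)))"
    by (simp add: integral_nu set_lebesgue_integral_def)
  also have "\<dots> = \<bar>1 / n\<bar> *\<^sub>R (LINT x|lborel. indicator {0..1} (0 + 1 / n * x) *\<^sub>R (F (0 + 1 / n * x) * ((0 + 1 / n * x) powr a * (1 - (0 + 1 / n * x)) powr b)))"
    by (rule lborel_integral_real_affine) (use n in simp)
  also have "(\<lambda>x. indicator {0..1} (0 + 1 / n * x) *\<^sub>R (F (0 + 1 / n * x) * ((0 + 1 / n * x) powr a * (1 - (0 + 1 / n * x)) powr b)))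
     = (\<lambda>x. (1 / n powr a) * (indicator {0..Y} x *\<^sub>R (F (x / n) * (x powr a * (1 - x / n) powr b))))"
  proof
    fix x
    show "indicator {0..1} (0 + 1 / n * x) *\<^sub>R (F (0 + 1 / n * x) * ((0 + 1 / n * x) powr a * (1 - (0 + 1 / n * x)) powr b))
      = (1 / n powr a) * (indicator {0..Y} x *\<^sub>R (F (x / n) * (x powr a * (1 - x / n) powr b)))"
    proof (cases "x \<in> {0..Y}")
      case True
      then have "x / n \<le> Y / n" "0 \<le> x / n" using n by (auto intro: divide_right_mono)
      then have "x / n \<in> {0..1}" using Yn by auto
      moreover have "(x / n) powr a = x powr a / n powr a" using True n by (simp add: powr_divide)
      ultimately show ?thesis using True by simp
    next
      case False
      then have "x / n \<notin> {0..Y / n}" using n by (auto simp: divide_simps)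
      then have "F (x / n) = 0" by (intro F0) (simp add: n_def)
      then show ?thesis by simp
    qed
  qed
  finally show ?thesis unfolding np set_lebesgue_integral_def n_def[symmetric] using n by simp
qed

end

text \<open>The power with exponent \<open>\<theta>'\<close> is at most the square root, and the square root of \<open>ln X\<close> is of smaller order than \<open>ln X\<close>.\<close>

lemma log_growth_contradiction:
  fixes eps A K r :: real
  assumes "eps > 0" "r \<ge> 1" and K: "K \<ge> 0" and th: "0 \<le> \<theta>'" "\<theta>' < 1/2"
    and le: "\<And>X. X \<ge> r + 1 \<Longrightarrow> eps * ln (X / r) - A \<le> K * (2 * ln (X + 1)) powr \<theta>'"
  shows False
proof -
  have "\<forall>\<^sub>F X in at_top. K * (2 * ln (X + 1)) powr (1/2) < eps * (ln X - ln r) - A"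
    using assms(1,2) by real_asymp
  moreover have "\<forall>\<^sub>F X :: real in at_top. 2 * ln (X + 1) \<ge> 1" by real_asymp
  ultimately have "\<forall>\<^sub>F X in at_top. K * (2 * ln (X + 1)) powr (1/2) < eps * (ln X - ln r) - A \<and> 2 * ln (X + 1) \<ge> 1 \<and> X \<ge> r + 1"
    using eventually_ge_at_top[of "r + 1"] by eventually_elim auto
  then obtain X where X: "K * (2 * ln (X + 1)) powr (1/2) < eps * (ln X - ln r) - A" "2 * ln (X + 1) \<ge> 1" "X \<ge> r + 1"
    using eventually_happens'[OF trivial_limit_at_top_linorder] by blast
  have "eps * ln (X / r) - A \<le> K * (2 * ln (X + 1)) powr \<theta>'" by (rule le) fact
  also have "\<dots> \<le> K * (2 * ln (X + 1)) powr (1/2)" using X K th by (intro mult_left_mono powr_mono) auto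
  also have "\<dots> < eps * (ln X - ln r) - A" by fact
  also have "ln X - ln r = ln (X / r)" using X assms by (simp add: ln_div)
  finally show False by simp
qed

context jacobi_weight
begin

text \<open>The forms are tested with the bump and with a cut-off \<open>H\<close> of \<open>x\<^bsup>\<eta>\<^esup> bessel G x\<close> at scale \<open>N\<^sup>-\<^sup>2\<close>, both divided by their
norms. The exponent \<open>\<eta>\<close> is chosen such that the power \<open>1 / (1 - \<theta>)\<close> of \<open>\<bar>H\<bar>\<close>, times \<open>x\<^sup>a\<close>, is at most a multiple of \<open>1 / x\<close>. Then the norm of \<open>H\<close> is at
most a multiple of \<open>(ln X)\<^bsup>1 - \<theta>\<^esup>\<close>. For \<open>N \<rightarrow> \<infinity>\<close> the pairing tends to a multiple of the integral of
\<open>H * bessel G * x\<^sup>a\<close>, whose integrand is at least \<open>x\<^bsup>th - 1\<^esup> (bessel G x)\<^sup>2\<close> by the assumption on \<open>dl\<close>; so it grows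
like \<open>ln X\<close>. The powers of \<open>N\<close> in the two norms and in the substitution cancel.\<close>

lemma cesaro_form_unbounded:
  assumes dl: "dl > 0" and e: "e \<ge> 1" and \<theta>: "1/2 < \<theta>" "\<theta> \<le> 1"
    and crit: "dl \<le> (2 * a + 2) * (\<theta> - 1/2) - 1/2"
    and bd: "\<And>n f g. unit_ball \<theta> f \<Longrightarrow> unit_ball (1 - \<theta>) g \<Longrightarrow> \<bar>form dl e n f g\<bar> \<le> C"
  shows False
proof -
  define G where "G = a + dl + 1"
  define th where "th = G + 1/2"
  have G: "G > 0" using a_gt dl by (simp add: G_def)
  obtain x0 e0 e1 where x0: "x0 \<ge> 1" and e0: "0 < e0"
    and up: "\<And>x. x \<ge> x0 \<Longrightarrow> x powr th * (bessel G x)\<^sup>2 \<le> e1"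
    and lo: "\<And>X. X \<ge> x0 \<Longrightarrow> e0 * ln (X / x0) - e1 \<le> integral {x0..X} (\<lambda>x. x powr (th - 1) * (bessel G x)\<^sup>2)"
    by (rule bessel_asymptotic_energy[OF G, folded th_def]) (rule that; assumption)
  have e1: "e1 \<ge> 0" using up[of x0] by (meson order_refl order_trans mult_nonneg_nonneg powr_ge_zero zero_le_power2)
  \<comment> \<open>The summand \<open>1\<close> makes the bound positive, so that test functions can be divided by it.\<close>
  define E where "E = sqrt e1 + 1"
  have E: "E > 0" using real_sqrt_ge_zero[OF e1] unfolding E_def by linarith
  have Bup: "x powr (th / 2) * \<bar>bessel G x\<bar> \<le> E" if "x \<ge> x0" for x
  proof -
    have "(x powr (th / 2) * \<bar>bessel G x\<bar>)\<^sup>2 = x powr th * (bessel G x)\<^sup>2"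
      using that x0 by (simp add: power_mult_distrib powr_power)
    also have "\<dots> \<le> e1" by (rule up[OF that])
    finally have "x powr (th / 2) * \<bar>bessel G x\<bar> \<le> sqrt e1" by (rule real_le_rsqrt)
    then show ?thesis by (simp add: E_def)
  qed
  have Bc: "continuous_on S (bessel G)" for S
    using bessel_continuous[of G] G by (auto intro: continuous_on_subset)
  obtain d where d: "summable (\<lambda>i. \<bar>d i\<bar>)"
    and ds: "\<And>x. x \<in> {0..1} \<Longrightarrow> (\<lambda>i. d i * x ^ i) sums ((2 - x) powr dl * exp ((1 - x)\<^sup>2))"
    by (rule compensator_series[of dl]) (rule that; assumption)
  obtain Cf where Cf: "Cf > 0" and Cfb: "\<And>N \<theta>. N \<ge> 1 \<Longrightarrow> 0 < \<theta> \<Longrightarrow> \<theta> \<le> 1 \<Longrightarrow>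
     (LINT s|nu. \<bar>(1 - s) ^ (N\<^sup>2)\<bar> powr (1 / \<theta>)) \<le> Cf * real N powr (- 2 * (a + 1))"
    by (rule bump_norm_bound) (rule that; assumption)
  define S where "S = (\<Sum>i. \<bar>d i\<bar>)"
  define \<kappa> where "\<kappa> = Gamma (dl + 1) / Gamma (a + dl + 2)"
  have \<kappa>: "\<kappa> > 0" unfolding \<kappa>_def using a_gt dl by (intro divide_pos_pos Gamma_real_pos) auto
  define \<eta> where "\<eta> = th / 2 - (a + 1) * (1 - \<theta>)"
  have \<eta>: "th - 1 \<le> \<eta> + a" using crit by (simp add: \<eta>_def th_def G_def field_simps)
  have main: "\<kappa> * (e0 * ln (X / x0) - 2 * e1) \<le> (C * S) * (E * (2 * ln (X + 1)) powr (1 - \<theta>) * Cf powr \<theta>)"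
    if X: "X \<ge> x0 + 1" for X
  proof -
    define Y where "Y = X + 1"
    define \<psi> where "\<psi> x = max 0 (min 1 (min (x - x0) (Y - x)))" for x
    define H where "H x = \<psi> x * (bessel G x * (max x x0) powr \<eta>)" for x
    have Y: "Y > 0" "x0 \<le> Y" using X x0 by (auto simp: Y_def)
    have \<psi>: "0 \<le> \<psi> x" "\<psi> x \<le> 1" "x \<notin> {x0..Y} \<Longrightarrow> \<psi> x = 0" "x \<in> {x0+1..X} \<Longrightarrow> \<psi> x = 1" for x
      by (auto simp: \<psi>_def Y_def)
    have Hc: "continuous_on UNIV H"
      unfolding H_def \<psi>_def using x0 by (intro continuous_intros Bc) auto
    have Hm [measurable]: "H \<in> borel_measurable borel" by (rule borel_measurable_continuous_onI[OF Hc])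
    have H0: "H x = 0" if "x \<notin> {x0..Y}" for x using \<psi>(3)[OF that] by (simp add: H_def)
    have Hb: "\<bar>H x\<bar> \<le> E * x powr (- (a + 1) * (1 - \<theta>))" if x: "x \<in> {x0..Y}" for x
    proof -
      have "\<bar>H x\<bar> = \<psi> x * (\<bar>bessel G x\<bar> * x powr \<eta>)" using x \<psi>(1)[of x] by (simp add: H_def abs_mult)
      also have "\<dots> \<le> 1 * (\<bar>bessel G x\<bar> * x powr \<eta>)" using \<psi> by (intro mult_right_mono) auto
      also have "x powr \<eta> = x powr (th / 2) * x powr (- (a + 1) * (1 - \<theta>))"
        unfolding \<eta>_def powr_add[symmetric] by (simp add: algebra_simps)
      also have "1 * (\<bar>bessel G x\<bar> * (x powr (th / 2) * x powr (- (a + 1) * (1 - \<theta>)))) =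
         (x powr (th / 2) * \<bar>bessel G x\<bar>) * x powr (- (a + 1) * (1 - \<theta>))" by simp
      also have "\<dots> \<le> E * x powr (- (a + 1) * (1 - \<theta>))" using x by (intro mult_right_mono Bup) auto
      finally show ?thesis .
    qed
    have HE: "\<bar>H x\<bar> \<le> E" for x
    proof (cases "x \<in> {x0..Y}")
      case True
      have "x powr (- (a + 1) * (1 - \<theta>)) \<le> x powr 0"
        using True x0 a_gt \<theta> by (intro powr_mono mult_nonpos_nonneg) auto
      then have "x powr (- (a + 1) * (1 - \<theta>)) \<le> 1" using True x0 by simp
      then have "E * x powr (- (a + 1) * (1 - \<theta>)) \<le> E * 1" using E by (intro mult_left_mono) auto
      then show ?thesis using Hb[OF True] by simp
    qed (use H0 E in auto)
    define W where "W = E * (2 * ln Y) powr (1 - \<theta>)"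
    have lnY: "ln Y > 0" using X x0 by (auto simp: Y_def)
    have W: "W > 0" using E lnY by (simp add: W_def)
    have NB: "\<bar>real N powr (2 * (a + 1)) * (LINT s|nu. H ((real N)\<^sup>2 * s) * bump_mean d dl e N s)\<bar> \<le> (C * S) * (W * Cf powr \<theta>)"
      if N: "N \<ge> 1" "real (N\<^sup>2) \<ge> 2 * Y" for N
    proof -
      define P where "P = real N powr (2 * (a + 1))"
      have P: "P > 0" using N by (simp add: P_def)
      define f where "f s = (P / Cf) powr \<theta> * (1 - s) ^ (N\<^sup>2)" for s
      define g where "g s = (P powr (1 - \<theta>) / W) * H ((real N)\<^sup>2 * s)" for s
      have Hsc: "continuous_on UNIV (\<lambda>s. H ((real N)\<^sup>2 * s))"
        by (rule continuous_on_compose2[OF Hc]) (auto intro!: continuous_intros)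
      have ub1: "unit_ball \<theta> f"
      proof -
        have "(LINT s|nu. \<bar>f s\<bar> powr (1 / \<theta>)) = (LINT s|nu. P / Cf * \<bar>(1 - s) ^ (N\<^sup>2)\<bar> powr (1 / \<theta>))"
          unfolding f_def using P Cf \<theta> by (simp add: abs_mult powr_mult powr_powr)
        also have "\<dots> = P / Cf * (LINT s|nu. \<bar>(1 - s) ^ (N\<^sup>2)\<bar> powr (1 / \<theta>))" by simp
        also have "\<dots> \<le> P / Cf * (Cf * real N powr (- 2 * (a + 1)))"
          using P Cf \<theta> N by (intro mult_left_mono Cfb) auto
        also have "\<dots> = P * real N powr (- 2 * (a + 1))" using Cf by simp
        also have "\<dots> = 1" unfolding P_def powr_add[symmetric] using N by simp
        finally show ?thesis unfolding unit_ball_def f_def using \<theta> by (auto intro!: continuous_intros)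
      qed
      have gc: "continuous_on UNIV g" unfolding g_def using W by (intro continuous_intros Hsc) auto
      have ub2: "unit_ball (1 - \<theta>) g"
      proof (cases "\<theta> = 1")
        case True
        have "\<bar>g s\<bar> \<le> 1" for s
        proof -
          have "W = E" using True lnY by (simp add: W_def)
          then show ?thesis using HE[of "(real N)\<^sup>2 * s"] E P True by (simp add: g_def abs_mult)
        qed
        then show ?thesis unfolding unit_ball_def using True gc by simp
      next
        case False
        define q where "q = 1 / (1 - \<theta>)"
        have q: "q > 0" "(1 - \<theta>) * q = 1" using False \<theta> by (auto simp: q_def)
        define F where "F s = \<bar>H ((real N)\<^sup>2 * s)\<bar> powr q" for s
        have Fm: "F \<in> borel_measurable borel" unfolding F_def by measurable
        have Fsc: "P * (LINT s|nu. F s) = (LINT x:{0..Y}|lborel. F (x / (real N)\<^sup>2) * (x powr a * (1 - x / (real N)\<^sup>2) powr b))"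
          unfolding P_def
        proof (rule scaled_integral[OF Fm N Y(1)])
          fix s assume s: "s \<notin> {0..Y / (real N)\<^sup>2}"
          have "(real N)\<^sup>2 * s \<notin> {x0..Y}"
          proof
            assume "(real N)\<^sup>2 * s \<in> {x0..Y}"
            then have "0 \<le> (real N)\<^sup>2 * s" "(real N)\<^sup>2 * s \<le> Y" using x0 by auto
            then show False using s N by (auto simp: field_simps zero_le_mult_iff)
          qed
          then show "F s = 0" by (simp add: F_def H0)
        qed
        have "(LINT x:{0..Y}|lborel. F (x / (real N)\<^sup>2) * (x powr a * (1 - x / (real N)\<^sup>2) powr b)) =
            (LINT x:{x0..Y}|lborel. \<bar>H x\<bar> powr q * (x powr a * (1 - x / (real N)\<^sup>2) powr b))"
          unfolding set_lebesgue_integral_def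
          by (intro Bochner_Integration.integral_cong refl) (use N H0 x0 q in \<open>auto simp: F_def indicator_def\<close>)
        also have "\<dots> \<le> (LINT x:{x0..Y}|lborel. 2 * E powr q * (1 / x))"
        proof (rule set_integral_mono)
          have le: "\<bar>H x\<bar> powr q * (x powr a * (1 - x / (real N)\<^sup>2) powr b) \<le> 2 * E powr q * (1 / x)" if x: "x \<in> {x0..Y}" for x
          proof -
            have xp: "x > 0" using x x0 by auto
            have "\<bar>H x\<bar> powr q \<le> (E * x powr (- (a + 1) * (1 - \<theta>))) powr q"
              using Hb[OF x] q by (intro powr_mono2) auto
            also have "\<dots> = E powr q * x powr (- (a + 1))"
            proof -
              have "- (a + 1) * (1 - \<theta>) * q = - (a + 1)" using q(2) by (simp only: mult.assoc) simp
              then show ?thesis using E by (simp only: powr_mult powr_powr) 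
            qed
            finally have 1: "\<bar>H x\<bar> powr q \<le> E powr q * x powr (- (a + 1))" .
            have "x / (real N)\<^sup>2 \<le> Y / (real N)\<^sup>2" using x by (intro divide_right_mono) auto
            also have "\<dots> \<le> 1 / 2" using N by (simp add: field_simps)
            finally have 2: "(1 - x / (real N)\<^sup>2) powr b \<le> 2" using xp by (intro one_minus_powr_le_2) auto
            have "\<bar>H x\<bar> powr q * (x powr a * (1 - x / (real N)\<^sup>2) powr b) \<le> (E powr q * x powr (- (a + 1))) * (x powr a * 2)"
              using 1 2 by (intro mult_mono) auto
            also have "\<dots> = 2 * E powr q * (x powr (- (a + 1)) * x powr a)" by simp
            also have "x powr (- (a + 1)) * x powr a = 1 / x" using xp by (simp add: powr_add[symmetric] powr_minus_divide)
            finally show ?thesis .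
          qed
          show i2: "set_integrable lborel {x0..Y} (\<lambda>x. 2 * E powr q * (1 / x))"
            by (intro borel_integrable_atLeastAtMost') (use x0 in \<open>auto intro!: continuous_intros\<close>)
          show "set_integrable lborel {x0..Y} (\<lambda>x. \<bar>H x\<bar> powr q * (x powr a * (1 - x / (real N)\<^sup>2) powr b))"
          proof (rule set_integrable_bound[OF i2])
            show "set_borel_measurable lborel {x0..Y} (\<lambda>x. \<bar>H x\<bar> powr q * (x powr a * (1 - x / (real N)\<^sup>2) powr b))"
              unfolding set_borel_measurable_def by measurable
            show "AE x\<in>{x0..Y} in lborel. norm (\<bar>H x\<bar> powr q * (x powr a * (1 - x / (real N)\<^sup>2) powr b)) \<le> norm (2 * E powr q * (1 / x))"
              by (intro AE_I2 impI) (use le x0 in \<open>auto simp: abs_mult\<close>)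
          qed
          show "\<And>x. x \<in> {x0..Y} \<Longrightarrow> \<bar>H x\<bar> powr q * (x powr a * (1 - x / (real N)\<^sup>2) powr b) \<le> 2 * E powr q * (1 / x)" by (rule le)
        qed
        also have "\<dots> = 2 * E powr q * (LINT x:{x0..Y}|lborel. 1 / x)" by (rule set_integral_mult_right)
        also have "(LINT x:{x0..Y}|lborel. 1 / x) = ln Y - ln x0"
        proof -
          have "(LBINT x. (1 / x) * indicator {x0..Y} x) = ln Y - ln x0"
            by (rule integral_FTC_Icc_real) (use Y x0 in \<open>auto intro!: derivative_eq_intros continuous_intros\<close>)
          then show ?thesis by (simp add: set_lebesgue_integral_def mult.commute)
        qed
        finally have "P * (LINT s|nu. F s) \<le> 2 * E powr q * (ln Y - ln x0)" unfolding Fsc .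
        also have "\<dots> \<le> 2 * E powr q * ln Y" using x0 by (intro mult_left_mono) auto
        also have "\<dots> = W powr q"
        proof -
          have "((2 * ln Y) powr (1 - \<theta>)) powr q = 2 * ln Y" using q(2) lnY by (simp add: powr_powr)
          then show ?thesis unfolding W_def using E lnY by (simp add: powr_mult)
        qed
        finally have PF: "P * (LINT s|nu. F s) \<le> W powr q" .
        have "(LINT s|nu. \<bar>g s\<bar> powr q) = (LINT s|nu. P / W powr q * F s)"
        proof -
          have "(P powr (1 - \<theta>)) powr q = P" using q(2) P by (simp add: powr_powr)
          then show ?thesis unfolding g_def F_def using P W by (simp add: abs_mult powr_mult powr_divide)
        qed
        also have "\<dots> = P * (LINT s|nu. F s) / W powr q" by simp
        also have "\<dots> \<le> 1" using PF W by simp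
        finally show ?thesis unfolding unit_ball_def q_def using False gc by simp
      qed
      have "\<bar>\<Sum>j\<le>N. compensated d dl e N j * (hat f j * hat g j / h j)\<bar> \<le> C * S"
        unfolding S_def by (intro compensated_form_bound dl e d bd ub1 ub2)
      also have "(\<Sum>j\<le>N. compensated d dl e N j * (hat f j * hat g j / h j)) =
         (P / Cf) powr \<theta> * (P powr (1 - \<theta>) / W) * (\<Sum>j\<le>N. compensated d dl e N j * (hat (\<lambda>s. (1 - s) ^ (N\<^sup>2)) j * hat (\<lambda>s. H ((real N)\<^sup>2 * s)) j / h j))"
        unfolding f_def g_def hat_scale sum_distrib_left by (intro sum.cong refl) (simp add: mult_ac)
      also have "\<dots> = (P / Cf) powr \<theta> * (P powr (1 - \<theta>) / W) * (LINT s|nu. H ((real N)\<^sup>2 * s) * bump_mean d dl e N s)"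
        by (subst pairing_bump_mean[OF Hsc]) simp
      also have "(P / Cf) powr \<theta> * (P powr (1 - \<theta>) / W) = P / (W * Cf powr \<theta>)"
      proof -
        have "P powr \<theta> * P powr (1 - \<theta>) = P" using P by (simp add: powr_add[symmetric])
        then show ?thesis using P Cf by (simp add: powr_divide)
      qed
      finally have "\<bar>P * (LINT s|nu. H ((real N)\<^sup>2 * s) * bump_mean d dl e N s)\<bar> / (W * Cf powr \<theta>) \<le> C * S"
        using W Cf by (simp add: abs_mult)
      then show ?thesis unfolding P_def using W Cf by (simp add: pos_divide_le_eq)
    qed
    define Ig where "Ig N x = H x * bump_mean d dl e N (x / (real N)\<^sup>2) * (x powr a * (1 - x / (real N)\<^sup>2) powr b)" for N x
    have Ieq: "real N powr (2 * (a + 1)) * (LINT s|nu. H ((real N)\<^sup>2 * s) * bump_mean d dl e N s) = (LINT x:{x0..Y}|lborel. Ig N x)"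
      if N: "N \<ge> 1" "real (N\<^sup>2) \<ge> 2 * Y" for N
    proof -
      have Dm [measurable]: "bump_mean d dl e N \<in> borel_measurable borel" unfolding bump_mean_def by measurable
      have "real N powr (2 * (a + 1)) * (LINT s|nu. H ((real N)\<^sup>2 * s) * bump_mean d dl e N s) =
        (LINT x:{0..Y}|lborel. (H ((real N)\<^sup>2 * (x / (real N)\<^sup>2)) * bump_mean d dl e N (x / (real N)\<^sup>2)) * (x powr a * (1 - x / (real N)\<^sup>2) powr b))"
      proof (rule scaled_integral[OF _ N Y(1)])
        fix s assume s: "s \<notin> {0..Y / (real N)\<^sup>2}"
        have "(real N)\<^sup>2 * s \<notin> {x0..Y}"
        proof
          assume "(real N)\<^sup>2 * s \<in> {x0..Y}"
          then have "0 \<le> (real N)\<^sup>2 * s" "(real N)\<^sup>2 * s \<le> Y" using x0 by auto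
          then show False using s N by (auto simp: field_simps zero_le_mult_iff)
        qed
        then show "H ((real N)\<^sup>2 * s) * bump_mean d dl e N s = 0" by (simp add: H0)
      qed measurable
      also have "\<dots> = (LINT x:{x0..Y}|lborel. Ig N x)"
        unfolding set_lebesgue_integral_def Ig_def
        by (intro Bochner_Integration.integral_cong refl) (use N H0 x0 in \<open>auto simp: indicator_def\<close>)
      finally show ?thesis .
    qed
    obtain K where K: "\<And>N x. N \<ge> 1 \<Longrightarrow> x \<in> {0..Y} \<Longrightarrow> \<bar>bump_mean d dl e N (x / (real N)\<^sup>2)\<bar> \<le> K"
      using bump_mean_limit(2)[OF dl e d ds, of Y] by blast
    have K0: "K \<ge> 0" using K[of 1 0] Y by (meson abs_ge_zero atLeastAtMost_iff less_imp_le order_refl order_trans)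
    have evN: "\<forall>\<^sub>F N in sequentially. N \<ge> 1 \<and> real (N\<^sup>2) \<ge> 2 * Y"
    proof -
      have "\<forall>\<^sub>F N in sequentially. real N ^ 2 \<ge> 2 * Y" by real_asymp
      then show ?thesis using eventually_ge_at_top[of 1] by eventually_elim auto
    qed
    then obtain N0 where N0: "\<And>N. N \<ge> N0 \<Longrightarrow> N \<ge> 1 \<and> real (N\<^sup>2) \<ge> 2 * Y" unfolding eventually_sequentially by blast
    have [measurable]: "bessel G \<in> borel_measurable borel" by (intro borel_measurable_continuous_onI Bc)
    have lim: "(\<lambda>N. LINT x:{x0..Y}|lborel. Ig N x) \<longlonglongrightarrow> (LINT x:{x0..Y}|lborel. H x * (\<kappa> * bessel G x) * (x powr a * 1))"
      unfolding set_lebesgue_integral_def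
    proof (rule LIMSEQ_offset[of _ N0], rule integral_dominated_convergence)
      have "set_integrable lborel {x0..Y} (\<lambda>x. E * K * (x powr a * 2))"
        by (intro borel_integrable_atLeastAtMost') (use x0 in \<open>auto intro!: continuous_intros\<close>)
      then show "integrable lborel (\<lambda>x. indicat_real {x0..Y} x *\<^sub>R (E * K * (x powr a * 2)))" by (simp add: set_integrable_def)
      show "(\<lambda>x. indicat_real {x0..Y} x *\<^sub>R (H x * (\<kappa> * bessel G x) * (x powr a * 1))) \<in> borel_measurable lborel" by measurable
      show "(\<lambda>x. indicat_real {x0..Y} x *\<^sub>R Ig (N + N0) x) \<in> borel_measurable lborel" for N
        unfolding Ig_def bump_mean_def by measurable
      show "AE x in lborel. (\<lambda>N. indicat_real {x0..Y} x *\<^sub>R Ig (N + N0) x) \<longlonglongrightarrow> indicat_real {x0..Y} x *\<^sub>R (H x * (\<kappa> * bessel G x) * (x powr a * 1))"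
      proof (rule AE_I2)
        fix x :: real
        have l1: "(\<lambda>N. bump_mean d dl e N (x / (real N)\<^sup>2)) \<longlonglongrightarrow> \<kappa> * bessel G x"
          unfolding \<kappa>_def G_def by (rule bump_mean_limit(1)[OF dl e d ds])
        have l2: "(\<lambda>N. (1 - x / (real N)\<^sup>2) powr b) \<longlonglongrightarrow> 1"
        proof -
          have "(\<lambda>N. x / (real N)\<^sup>2) \<longlonglongrightarrow> 0" by real_asymp
          then have "(\<lambda>N. (1 - x / (real N)\<^sup>2) powr b) \<longlonglongrightarrow> (1 - 0) powr b" by (intro tendsto_intros) auto
          then show ?thesis by simp
        qed
        have "(\<lambda>N. indicat_real {x0..Y} x *\<^sub>R Ig N x) \<longlonglongrightarrow> indicat_real {x0..Y} x *\<^sub>R (H x * (\<kappa> * bessel G x) * (x powr a * 1))"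
          unfolding Ig_def by (intro tendsto_intros l1 l2)
        then show "(\<lambda>N. indicat_real {x0..Y} x *\<^sub>R Ig (N + N0) x) \<longlonglongrightarrow> indicat_real {x0..Y} x *\<^sub>R (H x * (\<kappa> * bessel G x) * (x powr a * 1))"
          by (rule LIMSEQ_ignore_initial_segment)
      qed
      show "AE x in lborel. norm (indicat_real {x0..Y} x *\<^sub>R Ig (N + N0) x) \<le> indicat_real {x0..Y} x *\<^sub>R (E * K * (x powr a * 2))" for N
      proof (rule AE_I2)
        fix x :: real
        define M where "M = N + N0"
        have M: "M \<ge> 1" "real (M\<^sup>2) \<ge> 2 * Y" using N0[of M] by (auto simp: M_def)
        have "\<bar>Ig M x\<bar> \<le> E * K * (x powr a * 2)" if x: "x \<in> {x0..Y}"
        proof -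
          have xp: "x > 0" using x x0 by auto
          have "x / (real M)\<^sup>2 \<le> Y / (real M)\<^sup>2" using x by (intro divide_right_mono) auto
          also have "\<dots> \<le> 1 / 2" using M by (simp add: field_simps)
          finally have 2: "(1 - x / (real M)\<^sup>2) powr b \<le> 2" using xp by (intro one_minus_powr_le_2) auto
          show ?thesis unfolding Ig_def abs_mult
            using HE[of x] K[of M x] 2 x xp M E K0 by (intro mult_mono) auto
        qed
        then show "norm (indicat_real {x0..Y} x *\<^sub>R Ig (N + N0) x) \<le> indicat_real {x0..Y} x *\<^sub>R (E * K * (x powr a * 2))"
          unfolding M_def by (auto simp: indicator_def)
      qed
    qed
    have up_bd: "(LINT x:{x0..Y}|lborel. H x * (\<kappa> * bessel G x) * (x powr a * 1)) \<le> (C * S) * (W * Cf powr \<theta>)"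
    proof (rule LIMSEQ_le_const2[OF lim])
      show "\<exists>N. \<forall>n\<ge>N. (LINT x:{x0..Y}|lborel. Ig n x) \<le> (C * S) * (W * Cf powr \<theta>)"
      proof (intro exI allI impI)
        fix n assume "n \<ge> N0"
        then have n: "n \<ge> 1" "real (n\<^sup>2) \<ge> 2 * Y" using N0 by auto
        show "(LINT x:{x0..Y}|lborel. Ig n x) \<le> (C * S) * (W * Cf powr \<theta>)"
          using NB[OF n] unfolding Ieq[OF n] by linarith
      qed
    qed
    define k where "k x = x powr (th - 1) * (bessel G x)\<^sup>2" for x
    have kc: "continuous_on {u..v} k" if "u \<ge> x0" for u v
      unfolding k_def using that x0 by (intro continuous_intros Bc) auto
    have kub: "0 \<le> k x" "k x \<le> e1" if "x \<ge> x0" for x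
    proof -
      have "x powr th = x * x powr (th - 1)" using that x0 by (simp add: powr_mult_base)
      moreover have "1 * k x \<le> x * k x" using that x0 by (intro mult_right_mono) (auto simp: k_def)
      ultimately show "0 \<le> k x" "k x \<le> e1" using up[OF that] by (auto simp: k_def mult_ac)
    qed
    have low: "\<kappa> * integral {x0+1..X} k \<le> (LINT x:{x0..Y}|lborel. H x * (\<kappa> * bessel G x) * (x powr a * 1))"
    proof -
      have si: "set_integrable lborel {x0+1..X} k" by (intro borel_integrable_atLeastAtMost' kc) simp
      have "\<kappa> * integral {x0+1..X} k = (LINT x:{x0+1..X}|lborel. \<kappa> * k x)"
        using set_borel_integral_eq_integral(2)[OF si] by simp
      also have "\<dots> \<le> (LINT x:{x0..Y}|lborel. H x * (\<kappa> * bessel G x) * (x powr a * 1))"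
        unfolding set_lebesgue_integral_def
      proof (rule integral_mono)
        show "integrable lborel (\<lambda>x. indicat_real {x0+1..X} x *\<^sub>R (\<kappa> * k x))"
        proof -
          have "set_integrable lborel {x0+1..X} (\<lambda>x. \<kappa> * k x)" by (intro set_integrable_mult_right si)
          then show ?thesis by (simp add: set_integrable_def)
        qed
        have "set_integrable lborel {x0..Y} (\<lambda>x. H x * (\<kappa> * bessel G x) * (x powr a * 1))"
          by (intro borel_integrable_atLeastAtMost' continuous_intros Bc continuous_on_subset[OF Hc]) (use x0 in auto)
        then show "integrable lborel (\<lambda>x. indicat_real {x0..Y} x *\<^sub>R (H x * (\<kappa> * bessel G x) * (x powr a * 1)))" by (simp add: set_integrable_def)
        fix x :: real
        have eq: "H x * (\<kappa> * bessel G x) * (x powr a * 1) = \<psi> x * (\<kappa> * ((bessel G x)\<^sup>2 * x powr (\<eta> + a)))" if "x \<ge> x0"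
          using that by (simp add: H_def power2_eq_square powr_add)
        show "indicat_real {x0+1..X} x *\<^sub>R (\<kappa> * k x) \<le> indicat_real {x0..Y} x *\<^sub>R (H x * (\<kappa> * bessel G x) * (x powr a * 1))"
        proof (cases "x \<in> {x0+1..X}")
          case True
          then have x: "x \<ge> x0" "x \<in> {x0..Y}" "x \<ge> 1" using x0 by (auto simp: Y_def)
          have "\<kappa> * k x \<le> \<kappa> * ((bessel G x)\<^sup>2 * x powr (\<eta> + a))"
            unfolding k_def using \<kappa> x \<eta> by (subst mult.commute[of "x powr _"]) (intro mult_left_mono powr_mono, auto)
          then show ?thesis using True x(2) unfolding eq[OF x(1)] \<psi>(4)[OF True] by simp
        next
          case False
          have "0 \<le> H x * (\<kappa> * bessel G x) * (x powr a * 1)" if "x \<ge> x0" unfolding eq[OF that] using \<kappa> \<psi>(1)[of x] by auto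
          then show ?thesis using False by (auto simp: indicator_def)
        qed
      qed
      finally show ?thesis .
    qed
    have "e0 * ln (X / x0) - e1 \<le> integral {x0..X} k" unfolding k_def using X by (intro lo) auto
    also have "\<dots> = integral {x0..x0+1} k + integral {x0+1..X} k"
      using X by (intro Henstock_Kurzweil_Integration.integral_combine[symmetric] integrable_continuous_interval kc) auto
    also have "integral {x0..x0+1} k \<le> integral {x0..x0+1} (\<lambda>x. e1)"
      by (intro integral_le integrable_continuous_interval kc kub continuous_intros) auto
    finally have "e0 * ln (X / x0) - 2 * e1 \<le> integral {x0+1..X} k" by simp
    then have "\<kappa> * (e0 * ln (X / x0) - 2 * e1) \<le> \<kappa> * integral {x0+1..X} k" using \<kappa> by (intro mult_left_mono) auto
    then show ?thesis using low up_bd unfolding W_def Y_def by linarith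
  qed
  have "unit_ball \<theta> (\<lambda>_. 0)" "unit_ball (1 - \<theta>) (\<lambda>_. 0)" by (auto simp: unit_ball_def)
  then have C: "C \<ge> 0" using bd[of "\<lambda>_. 0" "\<lambda>_. 0" 0] by (meson abs_ge_zero order_trans)
  have S: "S \<ge> 0" unfolding S_def by (rule suminf_nonneg[OF d]) auto
  show False
  proof (rule log_growth_contradiction[where \<theta>' = "1 - \<theta>" and eps = "\<kappa> * e0" and r = x0 and A = "\<kappa> * (2 * e1)" and K = "C * S * (E * Cf powr \<theta>)"])
    show "\<kappa> * e0 * ln (X / x0) - \<kappa> * (2 * e1) \<le> C * S * (E * Cf powr \<theta>) * (2 * ln (X + 1)) powr (1 - \<theta>)"
      if "X \<ge> x0 + 1" for X using main[OF that] by (simp add: algebra_simps)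
  qed (use \<kappa> e0 x0 C S E \<theta> in auto)
qed

end

section \<open>Uniform boundedness\<close>

text \<open>The elementary proof of the uniform boundedness principle. Functionals \<open>\<Lambda> (i m)\<close> with norms \<open>L (i m)\<close> that grow faster
than \<open>3\<^sup>m\<close> are fixed in advance, together with elements \<open>u m\<close> at which they nearly attain their norms. In the series
\<open>\<Sum> \<plusminus> 3\<^sup>-\<^sup>m u m\<close> the signs are chosen one after the other. The first \<open>m + 1\<close> terms contribute at
least \<open>2/3 * 3\<^sup>-\<^sup>m L (i m)\<close> to the value of \<open>\<Lambda> (i m)\<close>, while the tail contributes at most
\<open>1/2 * 3\<^sup>-\<^sup>m L (i m)\<close>. Completeness enters only through the assumption on these series.\<close>

lemma gliding_hump:
  fixes \<Lambda> :: "'i \<Rightarrow> 'f \<Rightarrow> real"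
  assumes ne: "U \<noteq> {}"
    and bdd: "\<And>i. i \<in> I \<Longrightarrow> \<exists>L. \<forall>u\<in>U. \<bar>\<Lambda> i u\<bar> \<le> L"
    and sym: "\<And>u. u \<in> U \<Longrightarrow> \<exists>u'\<in>U. \<forall>i\<in>I. \<Lambda> i u' = - \<Lambda> i u"
    and ptw: "\<And>g. (\<And>m. g m \<in> U) \<Longrightarrow> \<exists>K. \<forall>i\<in>I. \<bar>\<Sum>m. (1/3) ^ m * \<Lambda> i (g m)\<bar> \<le> K"
  shows "\<exists>C. \<forall>i\<in>I. \<forall>u\<in>U. \<bar>\<Lambda> i u\<bar> \<le> C"
proof (rule ccontr)
  assume "\<not> ?thesis"
  then have unb: "\<exists>i\<in>I. \<exists>u\<in>U. \<bar>\<Lambda> i u\<bar> > C" for C by (meson not_le)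
  define L where "L i = (SUP u\<in>U. \<bar>\<Lambda> i u\<bar>)" for i
  have bda: "bdd_above ((\<lambda>u. \<bar>\<Lambda> i u\<bar>) ` U)" if "i \<in> I" for i using bdd[OF that] by (auto simp: bdd_above_def)
  have Lup: "\<bar>\<Lambda> i u\<bar> \<le> L i" if "i \<in> I" "u \<in> U" for i u
    unfolding L_def by (rule cSUP_upper[OF that(2) bda[OF that(1)]])
  have "\<exists>i\<in>I. L i > 6 * 3 ^ m * (real m + 1)" for m
    using unb[of "6 * 3 ^ m * (real m + 1)"] Lup by (meson less_le_trans)
  then obtain i where i: "\<And>m. i m \<in> I" "\<And>m. L (i m) > 6 * 3 ^ m * (real m + 1)" by metis
  have Lpos: "L (i m) > 0" for m
  proof -
    have "0 < (6::real) * 3 ^ m * (real m + 1)" by (intro mult_pos_pos) auto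
    then show ?thesis using i(2)[of m] by linarith
  qed
  have "\<exists>u\<in>U. \<bar>\<Lambda> (i m) u\<bar> > 2/3 * L (i m)" for m
  proof -
    have "2/3 * L (i m) < L (i m)" using Lpos[of m] by simp
    then show ?thesis using less_cSUP_iff[OF ne bda[OF i(1)], of "2/3 * L (i m)" m] by (simp add: L_def)
  qed
  then obtain u where u: "\<And>m. u m \<in> U" "\<And>m. \<bar>\<Lambda> (i m) (u m)\<bar> > 2/3 * L (i m)" by metis
  \<comment> \<open>A state consists of the values of the partial sum under all functionals, and of the next element of the series.\<close>
  define P where "P m x = (snd x \<in> U \<and> (m = 0 \<longrightarrow> fst x = (\<lambda>_. 0)) \<and>
      \<bar>fst x (i m) + (1/3) ^ m * \<Lambda> (i m) (snd x)\<bar> \<ge> (1/3) ^ m * (2/3 * L (i m)))" for m and x :: "('i \<Rightarrow> real) \<times> 'f"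
  define Q where "Q m x y = (fst y = (\<lambda>j. fst x j + (1/3) ^ m * \<Lambda> j (snd x)))" for m :: nat and x y :: "('i \<Rightarrow> real) \<times> 'f"
  \<comment> \<open>One of the two signs does not decrease the absolute value of the partial sum.\<close>
  have choose: "\<exists>v\<in>U. \<bar>A + (1/3) ^ m * \<Lambda> (i m) v\<bar> \<ge> (1/3) ^ m * (2/3 * L (i m))" for A m
  proof -
    obtain u' where u': "u' \<in> U" "\<Lambda> (i m) u' = - \<Lambda> (i m) (u m)" using sym[OF u(1)] i(1) by blast
    have "(1/3) ^ m * (2/3 * L (i m)) \<le> (1/3) ^ m * \<bar>\<Lambda> (i m) (u m)\<bar>" using u(2)[of m] by (intro mult_left_mono) auto
    also have "\<dots> = \<bar>(1/3) ^ m * \<Lambda> (i m) (u m)\<bar>" by (simp add: abs_mult)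
    finally have "(1/3) ^ m * (2/3 * L (i m)) \<le> \<bar>A + (1/3) ^ m * \<Lambda> (i m) (u m)\<bar> \<or>
      (1/3) ^ m * (2/3 * L (i m)) \<le> \<bar>A - (1/3) ^ m * \<Lambda> (i m) (u m)\<bar>" by linarith
    then show ?thesis using u(1)[of m] u' by (auto intro: bexI[of _ "u m"] bexI[of _ u'])
  qed
  have "\<exists>x. \<forall>m. P m (x m) \<and> Q m (x m) (x (Suc m))"
  proof (rule dependent_nat_choice)
    obtain v where "v \<in> U" "\<bar>0 + (1/3) ^ 0 * \<Lambda> (i 0) v\<bar> \<ge> (1/3) ^ 0 * (2/3 * L (i 0))" using choose[of 0 0] by blast
    then show "\<exists>x. P 0 x" unfolding P_def by (intro exI[of _ "(\<lambda>_. 0, v)"]) simp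
  next
    fix x m
    define A where "A = (\<lambda>j. fst x j + (1/3) ^ m * \<Lambda> j (snd x))"
    obtain v where "v \<in> U" "\<bar>A (i (Suc m)) + (1/3) ^ Suc m * \<Lambda> (i (Suc m)) v\<bar> \<ge> (1/3) ^ Suc m * (2/3 * L (i (Suc m)))"
      using choose by blast
    then show "\<exists>y. P (Suc m) y \<and> Q m x y" unfolding P_def Q_def A_def[symmetric] by (intro exI[of _ "(A, v)"]) simp
  qed
  then obtain x where x: "\<And>m. P m (x m)" "\<And>m. Q m (x m) (x (Suc m))" by blast
  define g where "g m = snd (x m)" for m
  have gU: "g m \<in> U" for m using x(1)[of m] by (simp add: P_def g_def)
  have A: "fst (x m) j = (\<Sum>k<m. (1/3) ^ k * \<Lambda> j (g k))" for m j
  proof (induction m)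
    case 0 then show ?case using x(1)[of 0] by (simp add: P_def)
  next
    case (Suc m) then show ?case using x(2)[of m] by (simp add: Q_def g_def)
  qed
  obtain K where K: "\<And>j. j \<in> I \<Longrightarrow> \<bar>\<Sum>m. (1/3) ^ m * \<Lambda> j (g m)\<bar> \<le> K" using ptw[of g, OF gU] by blast
  have "real m + 1 \<le> K" for m
  proof -
    let ?t = "\<lambda>k. (1/3) ^ k * \<Lambda> (i m) (g k)"
    have tb: "\<bar>?t k\<bar> \<le> L (i m) * (1/3) ^ k" for k
      using Lup[OF i(1) gU, of m k] by (simp add: abs_mult mult.commute)
    have gs: "summable (\<lambda>k. L (i m) * (1/3::real) ^ k)" by (intro summable_mult summable_geometric) auto
    have st: "summable ?t" by (rule summable_comparison_test'[OF gs]) (use tb in auto)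
    have "\<bar>\<Sum>k. ?t (k + Suc m)\<bar> \<le> (\<Sum>k. (L (i m) * (1/3) ^ Suc m) * (1/3) ^ k)"
    proof -
      have "norm (\<Sum>k. ?t (k + Suc m)) \<le> (\<Sum>k. (L (i m) * (1/3) ^ Suc m) * (1/3) ^ k)"
      proof (rule norm_suminf_le)
        show "norm (?t (k + Suc m)) \<le> (L (i m) * (1/3) ^ Suc m) * (1/3) ^ k" for k
          using tb[of "k + Suc m"] by (simp add: power_add mult_ac)
      qed (intro summable_mult summable_geometric, auto)
      then show ?thesis by simp
    qed
    also have "\<dots> = (L (i m) * (1/3) ^ Suc m) * (3/2)"
      by (subst suminf_mult) (auto simp: suminf_geometric)
    finally have tail: "\<bar>\<Sum>k. ?t (k + Suc m)\<bar> \<le> (1/3) ^ m * (1/2 * L (i m))" by (simp add: mult_ac)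
    have split: "(\<Sum>k. ?t k) = (\<Sum>k. ?t (k + Suc m)) + (\<Sum>k<Suc m. ?t k)"
      by (rule suminf_split_initial_segment[OF st])
    have head: "\<bar>\<Sum>k<Suc m. ?t k\<bar> \<ge> (1/3) ^ m * (2/3 * L (i m))"
      using x(1)[of m] A[of m "i m"] by (simp add: P_def g_def)
    have "real m + 1 = (1/3) ^ m * (1/6 * (6 * 3 ^ m * (real m + 1)))" by (simp add: power_divide)
    also have "\<dots> \<le> (1/3) ^ m * (1/6 * L (i m))" using i(2)[of m] by (intro mult_left_mono) auto
    also have "\<dots> = (1/3) ^ m * (2/3 * L (i m)) - (1/3) ^ m * (1/2 * L (i m))" by (simp add: algebra_simps)
    also have "\<dots> \<le> \<bar>\<Sum>k. ?t k\<bar>" using tail head unfolding split by linarith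
    also have "\<dots> \<le> K" by (rule K[OF i(1)])
    finally show ?thesis .
  qed
  moreover obtain m :: nat where "K < real m" using reals_Archimedean2 by blast
  ultimately show False using \<open>\<And>m. real m + 1 \<le> K\<close>[of m] by linarith
qed

text \<open>The sum is at most twice the supremum of \<open>(2/3)\<^sup>m * y m\<close>. This replaces Minkowski's inequality.\<close>

lemma powr_sum_le:
  fixes y :: "nat \<Rightarrow> real"
  assumes q: "q \<ge> 1" and y: "\<And>m. y m \<ge> 0" and T: "T \<ge> 0" and le: "\<And>m. (2/3) ^ m * y m powr q \<le> T"
  shows "summable (\<lambda>m. (1/3) ^ m * y m)" "(\<Sum>m. (1/3) ^ m * y m) powr q \<le> 2 powr q * T"
proof -
  have b: "(1/3) ^ m * y m \<le> T powr (1 / q) * (1/2) ^ m" for m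
  proof -
    have "((2/3) ^ m * y m) powr q = ((2/3) ^ m) powr q * y m powr q" by (rule powr_mult)
    also have "((2/3::real) ^ m) powr q \<le> ((2/3) ^ m) powr 1"
      using q by (intro powr_mono') (auto intro: power_le_one)
    then have "((2/3) ^ m) powr q * y m powr q \<le> (2/3) ^ m * y m powr q" by (intro mult_right_mono) auto
    also have "\<dots> \<le> T" by (rule le)
    finally have "(((2/3) ^ m * y m) powr q) powr (1 / q) \<le> T powr (1 / q)" using q by (intro powr_mono2) auto
    then have "(2/3) ^ m * y m \<le> T powr (1 / q)" using q y[of m] by (simp add: powr_powr)
    then have "(1/2) ^ m * ((2/3) ^ m * y m) \<le> (1/2) ^ m * T powr (1 / q)" by (intro mult_left_mono) auto
    moreover have "(1/2) ^ m * ((2/3) ^ m * y m) = (1/3) ^ m * y m"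
    proof -
      have "(1/2::real) ^ m * (2/3) ^ m = (1/3) ^ m" by (simp add: power_mult_distrib[symmetric])
      then show ?thesis by (metis mult.assoc)
    qed
    ultimately show ?thesis by (simp only: mult.commute)
  qed
  have gs: "summable (\<lambda>m. T powr (1 / q) * (1/2::real) ^ m)" by (intro summable_mult summable_geometric) auto
  show s: "summable (\<lambda>m. (1/3) ^ m * y m)"
    by (rule summable_comparison_test'[OF gs]) (use b y in auto)
  have "(\<Sum>m. (1/3) ^ m * y m) \<le> (\<Sum>m. T powr (1 / q) * (1/2) ^ m)" by (rule suminf_le[OF b s gs])
  also have "\<dots> = T powr (1 / q) * 2" by (subst suminf_mult) (auto simp: suminf_geometric)
  finally have "(\<Sum>m. (1/3) ^ m * y m) powr q \<le> (T powr (1 / q) * 2) powr q"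
    using q y by (intro powr_mono2 suminf_nonneg s) auto
  also have "\<dots> = 2 powr q * T" using q T by (simp add: powr_mult powr_powr)
  finally show "(\<Sum>m. (1/3) ^ m * y m) powr q \<le> 2 powr q * T" .
qed

lemma continuous_on_abs_powr:
  fixes f :: "real \<Rightarrow> real"
  assumes "continuous_on S f" "q > 0"
  shows "continuous_on S (\<lambda>s. \<bar>f s\<bar> powr q)"
  by (rule continuous_on_powr') (use assms in \<open>auto intro!: continuous_intros\<close>)

context jacobi_weight
begin

definition in_Lp :: "real \<Rightarrow> (real \<Rightarrow> real) \<Rightarrow> bool" where
  "in_Lp \<theta> f \<longleftrightarrow> (if \<theta> = 0 then continuous_on UNIV f
     else f \<in> borel_measurable borel \<and> integrable nu (\<lambda>s. \<bar>f s\<bar> powr (1 / \<theta>)))"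

definition mean :: "real \<Rightarrow> nat \<Rightarrow> nat \<Rightarrow> (real \<Rightarrow> real) \<Rightarrow> real \<Rightarrow> real" where
  "mean dl e n f s = (\<Sum>j\<le>n div e. cesaro_coeff dl (n - e * j) / cesaro_coeff dl n * (hat f j / h j) * R j s)"

lemma mean_continuous: "continuous_on S (mean dl e n f)"
  unfolding mean_def by (intro continuous_intros)

lemma pairing_mean:
  assumes "continuous_on UNIV g"
  shows "(LINT s|nu. mean dl e n f s * g s) = form dl e n f g"
proof -
  have "(LINT s|nu. mean dl e n f s * g s) = (LINT s|nu. (\<Sum>j\<le>n div e. cesaro_coeff dl (n - e * j) / cesaro_coeff dl n * (hat f j / h j) * (g s * R j s)))"
    unfolding mean_def sum_distrib_right by (simp only: mult_ac)
  also have "\<dots> = (\<Sum>j\<le>n div e. cesaro_coeff dl (n - e * j) / cesaro_coeff dl n * (hat f j / h j) * hat g j)"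
    unfolding hat_def[of g]
  proof (subst Bochner_Integration.integral_sum)
    fix j
    show "integrable nu (\<lambda>s. cesaro_coeff dl (n - e * j) / cesaro_coeff dl n * (hat f j / h j) * (g s * R j s))"
      by (intro integrable_nu_cont continuous_intros assms)
  qed simp
  finally show ?thesis by (simp add: form_def mult_ac)
qed

lemma unit_ball_L1:
  assumes f: "unit_ball \<theta> f" and \<theta>: "0 \<le> \<theta>" "\<theta> \<le> 1"
  shows "(LINT s|nu. \<bar>f s\<bar>) \<le> measure nu UNIV + 1"
proof -
  interpret finite_measure nu by (rule finite_nu)
  have c: "continuous_on UNIV f" using f by (simp add: unit_ball_def)
  show ?thesis
  proof (cases "\<theta> = 0")
    case True
    then have "(LINT s|nu. \<bar>f s\<bar>) \<le> (LINT s|nu. 1)" using f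
      by (intro integral_mono integrable_nu_cont continuous_intros c) (auto simp: unit_ball_def)
    then show ?thesis by simp
  next
    case False
    have cp: "continuous_on UNIV (\<lambda>s. \<bar>f s\<bar> powr (1 / \<theta>))" using False \<theta> by (intro continuous_on_abs_powr c) auto
    have "(LINT s|nu. \<bar>f s\<bar>) \<le> (LINT s|nu. 1 + \<bar>f s\<bar> powr (1 / \<theta>))"
    proof (intro integral_mono integrable_nu_cont continuous_on_rabs[OF c] continuous_on_add[OF continuous_on_const cp])
      fix s
      show "\<bar>f s\<bar> \<le> 1 + \<bar>f s\<bar> powr (1 / \<theta>)"
      proof (cases "\<bar>f s\<bar> \<le> 1")
        case False
        then have "\<bar>f s\<bar> powr 1 \<le> \<bar>f s\<bar> powr (1 / \<theta>)" using \<theta> \<open>\<theta> \<noteq> 0\<close> by (intro powr_mono) auto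
        then show ?thesis using False by simp
      qed (auto intro: add_increasing2)
    qed
    also have "\<dots> = measure nu UNIV + (LINT s|nu. \<bar>f s\<bar> powr (1 / \<theta>))"
      by (subst Bochner_Integration.integral_add) (auto intro!: integrable_nu_cont cp)
    finally show ?thesis using f False by (simp add: unit_ball_def)
  qed
qed

lemma hat_bound:
  assumes c: "continuous_on UNIV f" and K: "\<And>s. s \<in> {0..1} \<Longrightarrow> \<bar>R j s\<bar> \<le> K"
  shows "(LINT s|nu. \<bar>f s * R j s\<bar>) \<le> K * (LINT s|nu. \<bar>f s\<bar>)"
proof -
  have "(LINT s|nu. \<bar>f s * R j s\<bar>) \<le> (LINT s|nu. K * \<bar>f s\<bar>)"
  proof (rule integral_mono_AE)
    show "AE s in nu. \<bar>f s * R j s\<bar> \<le> K * \<bar>f s\<bar>"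
      using AE_nu
    proof eventually_elim
      case (elim s)
      then have "\<bar>f s\<bar> * \<bar>R j s\<bar> \<le> \<bar>f s\<bar> * K" by (intro mult_left_mono K) auto
      then show ?case by (simp add: abs_mult mult.commute)
    qed
  qed (intro integrable_nu_cont continuous_intros c)+
  then show ?thesis by simp
qed

text \<open>Young's inequality suffices in place of Hoelder's, since only finiteness for each function is needed for the uniform
boundedness principle.\<close>

lemma Young_pairing:
  assumes phi: "continuous_on UNIV \<phi>" and g: "unit_ball (1 - \<theta>) g" and \<theta>: "0 \<le> \<theta>" "\<theta> \<le> 1"
    and K: "if \<theta> = 0 then AE s in nu. \<bar>\<phi> s\<bar> \<le> K else (LINT s|nu. \<bar>\<phi> s\<bar> powr (1 / \<theta>)) \<le> K"
  shows "\<bar>LINT s|nu. \<phi> s * g s\<bar> \<le> \<bar>K\<bar> + 1"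
proof -
  have c: "continuous_on UNIV g" using g by (simp add: unit_ball_def)
  have "\<bar>LINT s|nu. \<phi> s * g s\<bar> \<le> (LINT s|nu. \<bar>\<phi> s * g s\<bar>)" by (rule integral_abs_bound)
  also have "\<dots> \<le> \<bar>K\<bar> + 1"
  proof -
    consider "\<theta> = 0" | "\<theta> = 1" | "0 < \<theta>" "\<theta> < 1" using \<theta> by force
    then show ?thesis
    proof cases
      case 1
      have "(LINT s|nu. \<bar>\<phi> s * g s\<bar>) \<le> (LINT s|nu. \<bar>K\<bar> * \<bar>g s\<bar>)"
      proof (rule integral_mono_AE)
        show "AE s in nu. \<bar>\<phi> s * g s\<bar> \<le> \<bar>K\<bar> * \<bar>g s\<bar>"
          using K[unfolded 1, simplified]
        proof eventually_elim
          case (elim s)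
          then have "\<bar>\<phi> s\<bar> \<le> \<bar>K\<bar>" by linarith
          then show ?case by (simp add: abs_mult mult_right_mono)
        qed
      qed (intro integrable_nu_cont continuous_intros c phi)+
      also have "\<dots> \<le> \<bar>K\<bar> * 1" using g 1 by (simp add: unit_ball_def mult_left_le)
      finally show ?thesis by simp
    next
      case 2
      have "(LINT s|nu. \<bar>\<phi> s * g s\<bar>) \<le> (LINT s|nu. \<bar>\<phi> s\<bar>)"
        using g 2 by (intro integral_mono integrable_nu_cont continuous_intros c phi)
          (auto simp: unit_ball_def abs_mult mult_left_le)
      then show ?thesis using K 2 by simp
    next
      case 3
      have le: "\<bar>\<phi> s * g s\<bar> \<le> \<bar>\<phi> s\<bar> powr (1 / \<theta>) + \<bar>g s\<bar> powr (1 / (1 - \<theta>))" for s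
      proof -
        have "\<bar>\<phi> s\<bar> * \<bar>g s\<bar> \<le> \<bar>\<phi> s\<bar> powr (1 / \<theta>) / (1 / \<theta>) + \<bar>g s\<bar> powr (1 / (1 - \<theta>)) / (1 / (1 - \<theta>))"
          using 3 by (intro Youngs_inequality) auto
        also have "\<dots> \<le> \<bar>\<phi> s\<bar> powr (1 / \<theta>) + \<bar>g s\<bar> powr (1 / (1 - \<theta>))"
          using 3 by (intro add_mono) (auto simp: mult_left_le)
        finally show ?thesis by (simp add: abs_mult)
      qed
      have i: "integrable nu (\<lambda>s. \<bar>\<phi> s\<bar> powr (1 / \<theta>))" "integrable nu (\<lambda>s. \<bar>g s\<bar> powr (1 / (1 - \<theta>)))"
        using 3 by (intro integrable_nu_cont continuous_on_abs_powr c phi; simp)+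
      have "(LINT s|nu. \<bar>\<phi> s * g s\<bar>) \<le> (LINT s|nu. \<bar>\<phi> s\<bar> powr (1 / \<theta>) + \<bar>g s\<bar> powr (1 / (1 - \<theta>)))"
        by (intro integral_mono le Bochner_Integration.integrable_add i integrable_nu_cont continuous_intros c phi)
      also have "\<dots> \<le> K + 1" using K g 3 i by (simp add: unit_ball_def)
      finally show ?thesis by simp
    qed
  qed
  finally show ?thesis .
qed

text \<open>This is the completeness of \<open>L\<^sup>p\<close>, in the form in which \<open>gliding_hump\<close> uses it. For \<open>\<theta> > 0\<close> the sum of the functions
\<open>(2/3)\<^sup>m \<bar>g m\<bar>\<^bsup>1 / \<theta>\<^esup>\<close> is integrable and controls the series through \<open>powr_sum_le\<close>.\<close>

lemma superposition:
  assumes g: "\<And>m. unit_ball \<theta> (g m)" and \<theta>: "0 \<le> \<theta>" "\<theta> \<le> 1"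
  shows "\<exists>f. in_Lp \<theta> f \<and> (\<forall>j. (\<lambda>m. (1/3) ^ m * hat (g m) j) sums hat f j)"
proof -
  have gc: "continuous_on UNIV (g m)" for m using g by (simp add: unit_ball_def)
  have [measurable]: "g m \<in> borel_measurable borel" for m by (intro borel_measurable_continuous_onI gc)
  define f where "f s = (\<Sum>m. (1/3) ^ m * g m s)" for s
  have fm [measurable]: "f \<in> borel_measurable borel" unfolding f_def[abs_def] by measurable
  have sg: "summable (\<lambda>m. (1/3::real) ^ m)" by (rule summable_geometric) auto
  have key: "in_Lp \<theta> f \<and> (AE s in nu. summable (\<lambda>m. (1/3) ^ m * \<bar>g m s\<bar>))"
  proof (cases "\<theta> = 0")
    case True
    have le: "\<bar>g m s\<bar> \<le> 1" for m s using g[of m] True by (simp add: unit_ball_def)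
    have s: "summable (\<lambda>m. (1/3) ^ m * \<bar>g m s\<bar>)" for s
      by (rule summable_comparison_test'[OF sg]) (use le in \<open>auto simp: mult_left_le abs_mult\<close>)
    have "uniform_limit UNIV (\<lambda>n s. \<Sum>m<n. (1/3) ^ m * g m s) f sequentially"
      unfolding f_def by (rule Weierstrass_m_test[OF _ sg]) (use le in \<open>auto simp: mult_left_le abs_mult\<close>)
    then have "continuous_on UNIV f"
      by (rule uniform_limit_theorem[rotated]) (auto intro!: always_eventually continuous_intros gc)
    then show ?thesis using s True by (simp add: in_Lp_def)
  next
    case False
    define q where "q = 1 / \<theta>"
    have q: "q \<ge> 1" "q > 0" using False \<theta> by (auto simp: q_def)
    define T where "T s = (\<Sum>m. ennreal ((2/3) ^ m * \<bar>g m s\<bar> powr q))" for s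
    have [measurable]: "T \<in> borel_measurable borel" unfolding T_def by measurable
    have gq: "(\<integral>\<^sup>+ s. ennreal ((2/3) ^ m * \<bar>g m s\<bar> powr q) \<partial>nu) \<le> ennreal ((2/3) ^ m)" for m
    proof -
      have i: "integrable nu (\<lambda>s. \<bar>g m s\<bar> powr q)" by (intro integrable_nu_cont continuous_on_abs_powr gc q)
      have "(\<integral>\<^sup>+ s. ennreal ((2/3) ^ m * \<bar>g m s\<bar> powr q) \<partial>nu) = ennreal (LINT s|nu. (2/3) ^ m * \<bar>g m s\<bar> powr q)"
        by (rule nn_integral_eq_integral) (use i in auto)
      also have "\<dots> \<le> ennreal ((2/3) ^ m)"
        using g[of m] False by (intro ennreal_leI) (simp add: unit_ball_def q_def mult_left_le)
      finally show ?thesis .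
    qed
    have "(\<integral>\<^sup>+ s. T s \<partial>nu) = (\<Sum>m. \<integral>\<^sup>+ s. ennreal ((2/3) ^ m * \<bar>g m s\<bar> powr q) \<partial>nu)"
      unfolding T_def by (rule nn_integral_suminf) measurable
    also have "\<dots> \<le> (\<Sum>m. ennreal ((2/3) ^ m))" by (intro suminf_le gq) auto
    also have "\<dots> = ennreal (\<Sum>m. (2/3) ^ m)" by (rule suminf_ennreal2) (auto intro!: summable_geometric)
    finally have Tint: "(\<integral>\<^sup>+ s. T s \<partial>nu) < \<infinity>" by (metis ennreal_less_top infinity_ennreal_def le_less_trans)
    then have AE_T: "AE s in nu. T s \<noteq> \<infinity>" by (intro nn_integral_PInf_AE) auto
    have pt: "summable (\<lambda>m. (1/3) ^ m * \<bar>g m s\<bar>)" "ennreal (\<bar>f s\<bar> powr q) \<le> ennreal (2 powr q) * T s" if "T s \<noteq> \<infinity>" for s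
    proof -
      obtain t where t: "t \<ge> 0" "T s = ennreal t" using \<open>T s \<noteq> \<infinity>\<close> by (cases "T s") auto
      have le: "(2/3) ^ m * \<bar>g m s\<bar> powr q \<le> t" for m
      proof -
        have "ennreal ((2/3) ^ m * \<bar>g m s\<bar> powr q) \<le> (\<Sum>k\<in>{m}. ennreal ((2/3) ^ k * \<bar>g k s\<bar> powr q))" by simp
        also have "\<dots> \<le> T s" unfolding T_def by (intro sum_le_suminf) auto
        finally show ?thesis using t by (simp add: ennreal_le_iff)
      qed
      show s: "summable (\<lambda>m. (1/3) ^ m * \<bar>g m s\<bar>)" by (rule powr_sum_le(1)[OF q(1) _ t(1) le]) simp
      have "\<bar>f s\<bar> \<le> (\<Sum>m. \<bar>(1/3) ^ m * g m s\<bar>)" unfolding f_def by (rule summable_rabs) (use s in \<open>simp add: abs_mult\<close>)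
      also have "\<dots> = (\<Sum>m. (1/3) ^ m * \<bar>g m s\<bar>)" by (simp add: abs_mult)
      finally have "\<bar>f s\<bar> powr q \<le> (\<Sum>m. (1/3) ^ m * \<bar>g m s\<bar>) powr q" using q by (intro powr_mono2) auto
      also have "\<dots> \<le> 2 powr q * t" by (rule powr_sum_le(2)[OF q(1) _ t(1) le]) simp
      finally show "ennreal (\<bar>f s\<bar> powr q) \<le> ennreal (2 powr q) * T s"
        unfolding t by (simp add: ennreal_mult'[symmetric] ennreal_leI)
    qed
    have "(\<integral>\<^sup>+ s. ennreal (\<bar>f s\<bar> powr q) \<partial>nu) \<le> (\<integral>\<^sup>+ s. ennreal (2 powr q) * T s \<partial>nu)"
      by (rule nn_integral_mono_AE) (use AE_T pt in \<open>auto elim!: eventually_mono\<close>)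
    also have "\<dots> = ennreal (2 powr q) * (\<integral>\<^sup>+ s. T s \<partial>nu)" by (rule nn_integral_cmult) measurable
    also have "\<dots> < \<infinity>" using Tint by (simp add: ennreal_mult_less_top)
    finally have "integrable nu (\<lambda>s. \<bar>f s\<bar> powr q)"
      by (intro integrableI_bounded) auto
    then show ?thesis using False AE_T pt(1) by (auto simp: in_Lp_def q_def elim!: eventually_mono)
  qed
  have "(\<lambda>m. (1/3) ^ m * hat (g m) j) sums hat f j" for j
  proof -
    obtain K where K: "K > 0" "\<And>s. s \<in> {0..1} \<Longrightarrow> \<bar>R j s\<bar> \<le> K" using continuous_bounded_01[OF continuous_R] by metis
    define M where "M = measure nu UNIV + 1"
    have M: "M \<ge> 0" by (simp add: M_def)
    have i: "integrable nu (\<lambda>s. (1/3) ^ m * (g m s * R j s))" for m by (intro integrable_nu_cont continuous_intros gc)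
    have b: "(LINT s|nu. norm ((1/3) ^ m * (g m s * R j s))) \<le> (1/3) ^ m * (K * M)" for m
    proof -
      have "(LINT s|nu. norm ((1/3) ^ m * (g m s * R j s))) = (1/3) ^ m * (LINT s|nu. \<bar>g m s * R j s\<bar>)"
        by (simp add: abs_mult)
      also have "\<dots> \<le> (1/3) ^ m * (K * (LINT s|nu. \<bar>g m s\<bar>))" by (intro mult_left_mono hat_bound gc K) auto
      also have "\<dots> \<le> (1/3) ^ m * (K * M)" unfolding M_def using K(1) by (intro mult_left_mono unit_ball_L1[OF g] \<theta>) auto
      finally show ?thesis .
    qed
    have s1: "summable (\<lambda>m. LINT s|nu. norm ((1/3) ^ m * (g m s * R j s)))"
    proof (rule summable_comparison_test'[OF summable_mult2[OF sg, of "K * M"]])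
      fix m
      have "0 \<le> (LINT s|nu. norm ((1/3) ^ m * (g m s * R j s)))" by (rule integral_nonneg_AE) auto
      then show "norm (LINT s|nu. norm ((1/3) ^ m * (g m s * R j s))) \<le> (1/3) ^ m * (K * M)" using b[of m] by simp
    qed
    have s2: "AE s in nu. summable (\<lambda>m. norm ((1/3) ^ m * (g m s * R j s)))"
      using key[THEN conjunct2]
    proof eventually_elim
      case (elim s)
      have "summable (\<lambda>m. (1/3) ^ m * \<bar>g m s\<bar> * \<bar>R j s\<bar>)" by (rule summable_mult2[OF elim])
      then show ?case by (simp add: abs_mult mult_ac)
    qed
    have "(\<lambda>m. LINT s|nu. (1/3) ^ m * (g m s * R j s)) sums (LINT s|nu. (\<Sum>m. (1/3) ^ m * (g m s * R j s)))"
      by (rule sums_integral[OF i s2 s1])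
    moreover have "(LINT s|nu. (\<Sum>m. (1/3) ^ m * (g m s * R j s))) = hat f j"
      unfolding hat_def
    proof (rule integral_cong_AE)
      show "AE s in nu. (\<Sum>m. (1/3) ^ m * (g m s * R j s)) = f s * R j s"
        using key[THEN conjunct2]
      proof eventually_elim
        case (elim s)
        have "summable (\<lambda>m. (1/3) ^ m * g m s)"
          by (rule summable_rabs_cancel) (use elim in \<open>simp add: abs_mult\<close>)
        then show ?case unfolding f_def by (subst suminf_mult2) (auto simp: mult.assoc)
      qed
    qed measurable
    ultimately show ?thesis by (simp add: hat_def)
  qed
  then show ?thesis using key by blast
qed

lemma uniform_boundedness:
  assumes \<theta>: "0 \<le> \<theta>" "\<theta> \<le> 1"
    and bd: "\<And>f. in_Lp \<theta> f \<Longrightarrow> \<exists>K. \<forall>n. (if \<theta> = 0 then AE s in nu. \<bar>mean dl e n f s\<bar> \<le> K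
       else (LINT s|nu. \<bar>mean dl e n f s\<bar> powr (1 / \<theta>)) \<le> K)"
  shows "\<exists>C. \<forall>n f g. unit_ball \<theta> f \<longrightarrow> unit_ball (1 - \<theta>) g \<longrightarrow> \<bar>form dl e n f g\<bar> \<le> C"
proof -
  define I where "I = {(n::nat, g). unit_ball (1 - \<theta>) g}"
  define \<Lambda> where "\<Lambda> i f = form dl e (fst i) f (snd i)" for i f
  define w where "w i j = cesaro_coeff dl (fst i - e * j) / cesaro_coeff dl (fst i) * hat (snd i) j / h j" for i :: "nat \<times> (real \<Rightarrow> real)" and j
  have \<Lambda>w: "\<Lambda> i f = (\<Sum>j\<le>fst i div e. w i j * hat f j)" for i f
    unfolding \<Lambda>_def form_def w_def by (intro sum.cong refl) simp
  have "\<exists>C. \<forall>i\<in>I. \<forall>f\<in>{f. unit_ball \<theta> f}. \<bar>\<Lambda> i f\<bar> \<le> C"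
  proof (rule gliding_hump)
    have "unit_ball \<theta> (\<lambda>_. 0)" by (auto simp: unit_ball_def)
    then show "{f. unit_ball \<theta> f} \<noteq> {}" by auto
  next
    fix i assume "i \<in> I"
    have "\<exists>L. \<forall>f. unit_ball \<theta> f \<longrightarrow> \<bar>hat f j\<bar> \<le> L" for j
    proof -
      obtain K where K: "K > 0" "\<And>s. s \<in> {0..1} \<Longrightarrow> \<bar>R j s\<bar> \<le> K" using continuous_bounded_01[OF continuous_R] by metis
      have "\<bar>hat f j\<bar> \<le> K * (measure nu UNIV + 1)" if f: "unit_ball \<theta> f" for f
      proof -
        have "\<bar>hat f j\<bar> \<le> (LINT s|nu. \<bar>f s * R j s\<bar>)" unfolding hat_def by (rule integral_abs_bound)
        also have "\<dots> \<le> K * (LINT s|nu. \<bar>f s\<bar>)" using f by (intro hat_bound K) (auto simp: unit_ball_def)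
        also have "\<dots> \<le> K * (measure nu UNIV + 1)" using K(1) by (intro mult_left_mono unit_ball_L1[OF f] \<theta>) auto
        finally show ?thesis .
      qed
      then show ?thesis by blast
    qed
    then obtain L where L: "\<And>j f. unit_ball \<theta> f \<Longrightarrow> \<bar>hat f j\<bar> \<le> L j" by metis
    have "\<bar>\<Lambda> i f\<bar> \<le> (\<Sum>j\<le>fst i div e. \<bar>w i j\<bar> * L j)" if "unit_ball \<theta> f" for f
      unfolding \<Lambda>w by (rule order_trans[OF sum_abs sum_mono]) (use L[OF that] in \<open>auto simp: abs_mult intro!: mult_left_mono\<close>)
    then show "\<exists>L. \<forall>u\<in>{f. unit_ball \<theta> f}. \<bar>\<Lambda> i u\<bar> \<le> L" by blast
  next
    fix u assume "u \<in> {f. unit_ball \<theta> f}"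
    then have "unit_ball \<theta> (\<lambda>s. -1 * u s)" by (auto simp: unit_ball_def intro!: continuous_intros)
    moreover have "\<Lambda> i (\<lambda>s. -1 * u s) = - \<Lambda> i u" for i unfolding \<Lambda>w hat_scale by (simp add: sum_negf)
    ultimately show "\<exists>u'\<in>{f. unit_ball \<theta> f}. \<forall>i\<in>I. \<Lambda> i u' = - \<Lambda> i u" by blast
  next
    fix g :: "nat \<Rightarrow> real \<Rightarrow> real" assume "\<And>m. g m \<in> {f. unit_ball \<theta> f}"
    then obtain f where f: "in_Lp \<theta> f" "\<And>j. (\<lambda>m. (1/3) ^ m * hat (g m) j) sums hat f j"
      using superposition[of \<theta> g] \<theta> by auto
    obtain K where K: "\<And>n. if \<theta> = 0 then AE s in nu. \<bar>mean dl e n f s\<bar> \<le> K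
       else (LINT s|nu. \<bar>mean dl e n f s\<bar> powr (1 / \<theta>)) \<le> K" using bd[OF f(1)] by blast
    have "\<bar>\<Sum>m. (1/3) ^ m * \<Lambda> i (g m)\<bar> \<le> \<bar>K\<bar> + 1" if "i \<in> I" for i
    proof -
      have ub: "unit_ball (1 - \<theta>) (snd i)" using that by (auto simp: I_def)
      have "(\<lambda>m. \<Sum>j\<le>fst i div e. w i j * ((1/3) ^ m * hat (g m) j)) sums (\<Sum>j\<le>fst i div e. w i j * hat f j)"
        by (intro sums_sum sums_mult f)
      then have "(\<lambda>m. (1/3) ^ m * \<Lambda> i (g m)) sums \<Lambda> i f"
        unfolding \<Lambda>w by (simp add: sum_distrib_left mult_ac)
      then have "(\<Sum>m. (1/3) ^ m * \<Lambda> i (g m)) = \<Lambda> i f" by (rule sums_unique[symmetric])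
      also have "\<dots> = (LINT s|nu. mean dl e (fst i) f s * snd i s)"
        unfolding \<Lambda>_def using ub by (intro pairing_mean[symmetric]) (simp add: unit_ball_def)
      finally show ?thesis using Young_pairing[OF mean_continuous ub \<theta> K] by simp
    qed
    then show "\<exists>K. \<forall>i\<in>I. \<bar>\<Sum>m. (1/3) ^ m * \<Lambda> i (g m)\<bar> \<le> K" by blast
  qed
  then show ?thesis unfolding \<Lambda>_def I_def by auto
qed

lemma form_commute: "form dl e n f g = form dl e n g f"
  unfolding form_def by (simp add: mult_ac)

text \<open>By the symmetry of the form, exponents above \<open>2\<close> are reduced to the conjugate exponents.\<close>

lemma unbounded_means_exist:
  assumes dl: "dl > 0" and e: "e \<ge> 1" and \<theta>: "0 \<le> \<theta>" "\<theta> \<le> 1"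
    and crit: "dl \<le> (2 * a + 2) * \<bar>\<theta> - 1/2\<bar> - 1/2"
  shows "\<exists>f. in_Lp \<theta> f \<and> \<not> (\<exists>K. \<forall>n. (if \<theta> = 0 then AE s in nu. \<bar>mean dl e n f s\<bar> \<le> K
       else (LINT s|nu. \<bar>mean dl e n f s\<bar> powr (1 / \<theta>)) \<le> K))"
proof (rule ccontr)
  assume "\<not> ?thesis"
  then obtain C where C: "\<And>n f g. unit_ball \<theta> f \<Longrightarrow> unit_ball (1 - \<theta>) g \<Longrightarrow> \<bar>form dl e n f g\<bar> \<le> C"
    using uniform_boundedness[OF \<theta>, of dl e] by blast
  consider "\<theta> > 1/2" | "\<theta> < 1/2" | "\<theta> = 1/2" by linarith
  then show False
  proof cases
    case 1
    then show False using cesaro_form_unbounded[OF dl e 1 \<theta>(2) _ C] crit by simp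
  next
    case 2
    have "\<bar>form dl e n f g\<bar> \<le> C" if "unit_ball (1 - \<theta>) f" "unit_ball (1 - (1 - \<theta>)) g" for n f g
      using C[of g f n] that by (simp add: form_commute)
    then show False using cesaro_form_unbounded[OF dl e, of "1 - \<theta>" C] crit 2 \<theta> by simp
  next
    case 3
    show False using crit dl unfolding 3 by simp
  qed
qed

end

section \<open>Dirichlet integrals\<close>

lemma nn_integral_prod_vec:
  fixes \<phi> :: "'n::finite \<Rightarrow> real \<Rightarrow> ennreal"
  assumes [measurable]: "\<And>i. \<phi> i \<in> borel_measurable borel"
  shows "(\<integral>\<^sup>+ x. (\<Prod>i\<in>UNIV. \<phi> i (x $ i)) \<partial>(lborel :: (real ^ 'n) measure)) = (\<Prod>i\<in>UNIV. \<integral>\<^sup>+ t. \<phi> i t \<partial>lborel)"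
proof -
  interpret P: product_sigma_finite "\<lambda>b :: real ^ 'n. lborel :: real measure" ..
  define idx where "idx b = (THE i. b = axis i (1::real))" for b :: "real ^ 'n"
  have idx: "idx (axis i 1) = i" for i unfolding idx_def by (rule the_equality) (auto simp: axis_eq_axis)
  have bij: "bij_betw (\<lambda>i. axis i (1::real)) UNIV (Basis :: (real ^ 'n) set)"
    by (auto simp: bij_betw_def inj_on_def axis_eq_axis Basis_vec_def)
  have comp: "(\<Sum>b\<in>Basis. f b *\<^sub>R b) $ i = f (axis i 1)" for f :: "real ^ 'n \<Rightarrow> real" and i
  proof -
    have "(\<Sum>b\<in>Basis. f b *\<^sub>R b) $ i = (\<Sum>b\<in>Basis. f b *\<^sub>R b) \<bullet> axis i 1" by (simp add: inner_axis)
    also have "\<dots> = f (axis i 1)"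
      by (rule inner_sum_left_Basis) (auto simp: Basis_vec_def)
    finally show ?thesis .
  qed
  have [measurable]: "(\<lambda>x::real ^ 'n. x $ i) \<in> borel_measurable borel" for i
    by (intro borel_measurable_continuous_onI continuous_intros)
  have "(\<integral>\<^sup>+ x. (\<Prod>i\<in>UNIV. \<phi> i (x $ i)) \<partial>(lborel :: (real ^ 'n) measure)) =
     (\<integral>\<^sup>+ f. (\<Prod>i\<in>UNIV. \<phi> i ((\<Sum>b\<in>Basis. f b *\<^sub>R b) $ i)) \<partial>(\<Pi>\<^sub>M b\<in>Basis. lborel))"
    by (subst lborel_eq, subst nn_integral_distr) measurable
  also have "\<dots> = (\<integral>\<^sup>+ f. (\<Prod>b\<in>Basis. \<phi> (idx b) (f b)) \<partial>(\<Pi>\<^sub>M b\<in>Basis. lborel))"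
    by (simp only: comp prod.reindex_bij_betw[OF bij, symmetric] idx)
  also have "\<dots> = (\<Prod>b\<in>Basis. \<integral>\<^sup>+ t. \<phi> (idx b) t \<partial>lborel)"
    by (rule P.product_nn_integral_prod) auto
  also have "\<dots> = (\<Prod>i\<in>UNIV. \<integral>\<^sup>+ t. \<phi> i t \<partial>lborel)"
    by (simp only: prod.reindex_bij_betw[OF bij, symmetric] idx)
  finally show ?thesis .
qed

lemma nn_integral_Gamma:
  assumes "s > 0"
  shows "(\<integral>\<^sup>+ t. ennreal (indicator {0..} t * t powr (s - 1) * exp (- t)) \<partial>lborel) = ennreal (Gamma s)"
  unfolding Gamma_conv_nn_integral_real[OF assms] by (simp add: exp_minus divide_inverse)

text \<open>The substitution \<open>t \<mapsto> t\<^sup>2\<close> on the half line, and symmetry.\<close>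

lemma nn_integral_Gamma_sq:
  assumes s: "s > 0"
  shows "(\<integral>\<^sup>+ t. ennreal (\<bar>t\<bar> powr (2 * s - 1) * exp (- t\<^sup>2)) \<partial>lborel) = ennreal (Gamma s)"
proof -
  define f where "f t = t powr (s - 1) * exp (- t)" for t :: real
  have half: "(\<integral>\<^sup>+ t. ennreal (f (t\<^sup>2) * (2 * t) * indicator {0..} t) \<partial>lborel) = ennreal (Gamma s)"
  proof -
    have 1: "(\<integral>\<^sup>+ t. ennreal (f t * indicator {0..(real n)\<^sup>2} t) \<partial>lborel) = (\<integral>\<^sup>+ t. ennreal (f (t\<^sup>2) * (2 * t) * indicator {0..real n} t) \<partial>lborel)" for n
    proof -
      have "(\<integral>\<^sup>+ t. ennreal (f t * indicator {0\<^sup>2..(real n)\<^sup>2} t) \<partial>lborel) = (\<integral>\<^sup>+ t. ennreal (f (t\<^sup>2) * (2 * t) * indicator {0..real n} t) \<partial>lborel)"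
        by (rule nn_integral_substitution)
          (auto intro!: derivative_eq_intros continuous_intros simp: f_def set_borel_measurable_def)
      then show ?thesis by simp
    qed
    have sq_mono: "x \<le> (real n)\<^sup>2" if "x \<le> (real m)\<^sup>2" "m \<le> n" for x and m n :: nat
      using that power_mono[of "real m" "real n" 2] by linarith
    have mono: "incseq (\<lambda>n t. ennreal (f (t\<^sup>2) * (2 * t) * indicator {0..real n} t))"
      "incseq (\<lambda>n t. ennreal (f t * indicator {0..(real n)\<^sup>2} t))"
    proof -
      have f0: "f t \<ge> 0" for t by (simp add: f_def)
      have "f (t\<^sup>2) * (2 * t) * indicator {0..real m} t \<le> f (t\<^sup>2) * (2 * t) * indicator {0..real n} t" if "m \<le> n" for m n t
        using that f0[of "t\<^sup>2"] by (simp add: indicator_def)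
      then show "incseq (\<lambda>n t. ennreal (f (t\<^sup>2) * (2 * t) * indicator {0..real n} t))"
        unfolding incseq_def le_fun_def by (intro allI impI ennreal_leI)
      have "f t * indicator {0..(real m)\<^sup>2} t \<le> f t * indicator {0..(real n)\<^sup>2} t" if "m \<le> n" for m n t
        using sq_mono[of t m n] that f0[of t] by (simp add: indicator_def)
      then show "incseq (\<lambda>n t. ennreal (f t * indicator {0..(real n)\<^sup>2} t))"
        unfolding incseq_def le_fun_def by (intro allI impI ennreal_leI)
    qed
    have sup1: "(SUP n. ennreal (f (t\<^sup>2) * (2 * t) * indicator {0..real n} t)) = ennreal (f (t\<^sup>2) * (2 * t) * indicator {0..} t)" for t
    proof (rule LIMSEQ_unique[OF LIMSEQ_SUP])
      show "incseq (\<lambda>n. ennreal (f (t\<^sup>2) * (2 * t) * indicator {0..real n} t))" using mono(1) by (auto simp: incseq_def le_fun_def)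
      obtain n0 where "t \<le> real n0" using real_arch_simple by blast
      then show "(\<lambda>n. ennreal (f (t\<^sup>2) * (2 * t) * indicator {0..real n} t)) \<longlonglongrightarrow> ennreal (f (t\<^sup>2) * (2 * t) * indicator {0..} t)"
        by (intro tendsto_eventually eventually_sequentiallyI[of n0]) (auto simp: indicator_def)
    qed
    have sup2: "(SUP n. ennreal (f t * indicator {0..(real n)\<^sup>2} t)) = ennreal (f t * indicator {0..} t)" for t
    proof (rule LIMSEQ_unique[OF LIMSEQ_SUP])
      show "incseq (\<lambda>n. ennreal (f t * indicator {0..(real n)\<^sup>2} t))" using mono(2) by (auto simp: incseq_def le_fun_def)
      obtain n0 where n0: "t \<le> real n0" using real_arch_simple by blast
      have "t \<le> (real n)\<^sup>2" if "n0 \<le> n" for n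
      proof -
        have "real n \<le> (real n)\<^sup>2" by (cases "n = 0") (auto simp: power2_eq_square)
        then show ?thesis using n0 that by linarith
      qed
      then show "(\<lambda>n. ennreal (f t * indicator {0..(real n)\<^sup>2} t)) \<longlonglongrightarrow> ennreal (f t * indicator {0..} t)"
        by (intro tendsto_eventually eventually_sequentiallyI[of n0]) (auto simp: indicator_def)
    qed
    have [measurable]: "f \<in> borel_measurable borel" unfolding f_def by measurable
    have "(\<integral>\<^sup>+ t. ennreal (f (t\<^sup>2) * (2 * t) * indicator {0..} t) \<partial>lborel) = (SUP n. \<integral>\<^sup>+ t. ennreal (f (t\<^sup>2) * (2 * t) * indicator {0..real n} t) \<partial>lborel)"
      unfolding sup1[symmetric] by (rule nn_integral_monotone_convergence_SUP[OF mono(1)]) measurable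
    also have "\<dots> = (SUP n. \<integral>\<^sup>+ t. ennreal (f t * indicator {0..(real n)\<^sup>2} t) \<partial>lborel)" by (simp only: 1)
    also have "\<dots> = (\<integral>\<^sup>+ t. ennreal (f t * indicator {0..} t) \<partial>lborel)"
      unfolding sup2[symmetric] by (rule nn_integral_monotone_convergence_SUP[OF mono(2), symmetric]) measurable
    also have "\<dots> = ennreal (Gamma s)"
      using nn_integral_Gamma[OF s] by (simp add: f_def mult_ac)
    finally show ?thesis .
  qed
  have eq: "f (t\<^sup>2) * (2 * t) = 2 * (\<bar>t\<bar> powr (2 * s - 1) * exp (- t\<^sup>2))" if "t \<ge> 0" for t
  proof (cases "t = 0")
    case False
    then have t: "t > 0" using that by simp
    have "t\<^sup>2 = t powr 2" using t by simp
    then have "(t\<^sup>2) powr (s - 1) = t powr (2 * (s - 1))" by (simp only: powr_powr)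
    also have "2 * (s - 1) = (2 * s - 1) - 1" by simp
    also have "t powr ((2 * s - 1) - 1) = t powr (2 * s - 1) / t" using t by (simp only: powr_diff powr_one)
    finally show ?thesis using t by (simp add: f_def)
  qed (simp add: f_def)
  define k where "k t = \<bar>t\<bar> powr (2 * s - 1) * exp (- t\<^sup>2)" for t :: real
  have [measurable]: "k \<in> borel_measurable borel" unfolding k_def by measurable
  have k0: "k t \<ge> 0" for t by (simp add: k_def)
  have h2: "2 * (\<integral>\<^sup>+ t. ennreal (k t * indicator {0..} t) \<partial>lborel) = ennreal (Gamma s)"
  proof -
    have "2 * (\<integral>\<^sup>+ t. ennreal (k t * indicator {0..} t) \<partial>lborel) = (\<integral>\<^sup>+ t. 2 * ennreal (k t * indicator {0..} t) \<partial>lborel)"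
      by (rule nn_integral_cmult[symmetric]) measurable
    also have "\<dots> = (\<integral>\<^sup>+ t. ennreal (f (t\<^sup>2) * (2 * t) * indicator {0..} t) \<partial>lborel)"
    proof (intro nn_integral_cong)
      fix t :: real
      have "2 * ennreal (k t * indicator {0..} t) = ennreal (2 * (k t * indicator {0..} t))"
        using k0[of t] by (simp add: ennreal_mult')
      also have "2 * (k t * indicator {0..} t) = f (t\<^sup>2) * (2 * t) * indicator {0..} t"
        using eq[of t] by (auto simp: k_def indicator_def)
      finally show "2 * ennreal (k t * indicator {0..} t) = ennreal (f (t\<^sup>2) * (2 * t) * indicator {0..} t)" .
    qed
    finally show ?thesis using half by simp
  qed
  have "(\<integral>\<^sup>+ t. ennreal (k t) \<partial>lborel) = (\<integral>\<^sup>+ t. ennreal (k t * indicator {0..} t) + ennreal (k t * indicator {..<0} t) \<partial>lborel)"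
    by (intro nn_integral_cong) (auto simp: indicator_def)
  also have "\<dots> = (\<integral>\<^sup>+ t. ennreal (k t * indicator {0..} t) \<partial>lborel) + (\<integral>\<^sup>+ t. ennreal (k t * indicator {..<0} t) \<partial>lborel)"
    by (rule nn_integral_add) measurable
  also have "(\<integral>\<^sup>+ t. ennreal (k t * indicator {..<0} t) \<partial>lborel) = (\<integral>\<^sup>+ t. ennreal (k t * indicator {..0} t) \<partial>lborel)"
    by (intro nn_integral_cong_AE) (use AE_lborel_singleton[of 0] in \<open>auto elim!: eventually_mono simp: indicator_def\<close>)
  also have "\<dots> = ennreal \<bar>-1\<bar> * (\<integral>\<^sup>+ t. ennreal (k (0 + -1 * t) * indicator {..0} (0 + -1 * t)) \<partial>lborel)"
    by (rule nn_integral_real_affine) auto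
  also have "\<dots> = (\<integral>\<^sup>+ t. ennreal (k t * indicator {0..} t) \<partial>lborel)"
    by (simp add: k_def indicator_def)
  finally have "(\<integral>\<^sup>+ t. ennreal (k t) \<partial>lborel) = 2 * (\<integral>\<^sup>+ t. ennreal (k t * indicator {0..} t) \<partial>lborel)"
    by (simp only: mult_2)
  then show ?thesis unfolding h2 by (simp only: k_def)
qed

text \<open>The integral of \<open>w x * t powr (B - 1) * exp (- (\<rho> x + t))\<close> over all \<open>x\<close> and \<open>t \<ge> 0\<close> is computed in two ways. It is the
product of \<open>P\<close> and \<open>\<Gamma> B\<close>. On the other hand, with \<open>\<tau> = \<rho> x + t\<close> as a new variable, the inner integral over \<open>x\<close> is by
homogeneity \<open>\<tau> powr (D + B - 1)\<close> times the wanted integral, so that the result is \<open>\<Gamma> (D + B)\<close> times the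
wanted integral.\<close>

lemma homogeneous_beta_integral:
  fixes w :: "real ^ 'n::finite \<Rightarrow> ennreal" and \<rho> :: "real ^ 'n \<Rightarrow> real" and cc :: "real \<Rightarrow> real"
  assumes [measurable]: "w \<in> borel_measurable borel" "\<rho> \<in> borel_measurable borel"
    and \<rho>: "\<And>x. \<rho> x \<ge> 0"
    and cc: "\<And>\<tau>. \<tau> > 0 \<Longrightarrow> cc \<tau> > 0"
    and hom_\<rho>: "\<And>\<tau> x. \<tau> > 0 \<Longrightarrow> \<rho> (cc \<tau> *\<^sub>R x) = \<tau> * \<rho> x"
    and hom_w: "\<And>\<tau> x. \<tau> > 0 \<Longrightarrow> ennreal (cc \<tau> ^ CARD('n)) * w (cc \<tau> *\<^sub>R x) = ennreal (\<tau> powr D) * w x"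
    and Pint: "(\<integral>\<^sup>+ x. w x * ennreal (exp (- \<rho> x)) \<partial>lborel) = ennreal P"
    and P: "P \<ge> 0" and D: "D > 0" and B: "B > 0"
  shows "(\<integral>\<^sup>+ x. w x * ennreal (indicator {0..} (1 - \<rho> x) * (1 - \<rho> x) powr (B - 1)) \<partial>lborel) = ennreal (P * Gamma B / Gamma (D + B))"
proof -
  define k where "k t = indicator {0..} t * t powr (B - 1)" for t :: real
  have [measurable]: "k \<in> borel_measurable borel" unfolding k_def by measurable
  have k0: "k t \<ge> 0" for t by (simp add: k_def)
  define J where "J \<tau> = (\<integral>\<^sup>+ x. w x * ennreal (k (\<tau> - \<rho> x)) \<partial>lborel)" for \<tau>
  have J_hom: "J \<tau> = ennreal (\<tau> powr (D + B - 1)) * J 1" if \<tau>: "\<tau> > 0" for \<tau>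
  proof -
    have c: "cc \<tau> > 0" by (rule cc[OF \<tau>])
    have "J \<tau> = (\<integral>\<^sup>+ x. w x * ennreal (k (\<tau> - \<rho> x)) \<partial>density (distr lborel borel (\<lambda>x. 0 + cc \<tau> *\<^sub>R x)) (\<lambda>_. ennreal (\<bar>cc \<tau>\<bar> ^ DIM(real ^ 'n))))"
      unfolding J_def using c by (subst lborel_affine[of "cc \<tau>" 0]) auto
    also have "\<dots> = (\<integral>\<^sup>+ x. ennreal (\<bar>cc \<tau>\<bar> ^ DIM(real ^ 'n)) * (w (0 + cc \<tau> *\<^sub>R x) * ennreal (k (\<tau> - \<rho> (0 + cc \<tau> *\<^sub>R x)))) \<partial>lborel)"
      by (subst nn_integral_density, measurable, subst nn_integral_distr, measurable)
    also have "\<dots> = (\<integral>\<^sup>+ x. ennreal (\<tau> powr (D + B - 1)) * (w x * ennreal (k (1 - \<rho> x))) \<partial>lborel)"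
    proof (intro nn_integral_cong)
      fix x
      have "k (\<tau> - \<tau> * \<rho> x) = \<tau> powr (B - 1) * k (1 - \<rho> x)"
      proof -
        have "\<tau> - \<tau> * \<rho> x = \<tau> * (1 - \<rho> x)" by (simp add: algebra_simps)
        then show ?thesis using \<tau> by (auto simp: k_def indicator_def powr_mult zero_le_mult_iff)
      qed
      then have kk: "ennreal (k (\<tau> - \<rho> (0 + cc \<tau> *\<^sub>R x))) = ennreal (\<tau> powr (B - 1)) * ennreal (k (1 - \<rho> x))"
        using k0 by (simp add: hom_\<rho>[OF \<tau>] ennreal_mult)
      have "ennreal (\<bar>cc \<tau>\<bar> ^ DIM(real ^ 'n)) * (w (0 + cc \<tau> *\<^sub>R x) * ennreal (k (\<tau> - \<rho> (0 + cc \<tau> *\<^sub>R x)))) =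
        (ennreal (cc \<tau> ^ CARD('n)) * w (cc \<tau> *\<^sub>R x)) * (ennreal (\<tau> powr (B - 1)) * ennreal (k (1 - \<rho> x)))"
        unfolding kk using c by (simp add: mult.assoc)
      also have "\<dots> = (ennreal (\<tau> powr D) * ennreal (\<tau> powr (B - 1))) * (w x * ennreal (k (1 - \<rho> x)))"
        unfolding hom_w[OF \<tau>] by (simp add: mult_ac)
      also have "ennreal (\<tau> powr D) * ennreal (\<tau> powr (B - 1)) = ennreal (\<tau> powr (D + B - 1))"
        by (simp add: ennreal_mult[symmetric] powr_add[symmetric] add_diff_eq)
      finally show "ennreal (\<bar>cc \<tau>\<bar> ^ DIM(real ^ 'n)) * (w (0 + cc \<tau> *\<^sub>R x) * ennreal (k (\<tau> - \<rho> (0 + cc \<tau> *\<^sub>R x)))) =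
        ennreal (\<tau> powr (D + B - 1)) * (w x * ennreal (k (1 - \<rho> x)))" .
    qed
    also have "\<dots> = ennreal (\<tau> powr (D + B - 1)) * J 1" unfolding J_def by (rule nn_integral_cmult) measurable
    finally show ?thesis .
  qed
  \<comment> \<open>Both sides of the next identity are the integral of \<open>w x * t powr (B - 1) * exp (- (\<rho> x + t))\<close> over \<open>t \<ge> 0\<close>.\<close>
  have L: "(\<integral>\<^sup>+ x. \<integral>\<^sup>+ \<tau>. w x * ennreal (k (\<tau> - \<rho> x) * exp (- \<tau>)) \<partial>lborel \<partial>lborel) = ennreal P * ennreal (Gamma B)"
  proof -
    have "(\<integral>\<^sup>+ \<tau>. w x * ennreal (k (\<tau> - \<rho> x) * exp (- \<tau>)) \<partial>lborel) = w x * ennreal (exp (- \<rho> x)) * ennreal (Gamma B)" for x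
    proof -
      have "(\<integral>\<^sup>+ \<tau>. w x * ennreal (k (\<tau> - \<rho> x) * exp (- \<tau>)) \<partial>lborel) = w x * (\<integral>\<^sup>+ \<tau>. ennreal (k (\<tau> - \<rho> x) * exp (- \<tau>)) \<partial>lborel)"
        by (rule nn_integral_cmult) measurable
      also have "(\<integral>\<^sup>+ \<tau>. ennreal (k (\<tau> - \<rho> x) * exp (- \<tau>)) \<partial>lborel) = ennreal \<bar>1\<bar> * (\<integral>\<^sup>+ t. ennreal (k ((\<rho> x + 1 * t) - \<rho> x) * exp (- (\<rho> x + 1 * t))) \<partial>lborel)"
        by (rule nn_integral_real_affine) auto
      also have "\<dots> = (\<integral>\<^sup>+ t. ennreal (exp (- \<rho> x)) * ennreal (k t * exp (- t)) \<partial>lborel)"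
        using k0 by (simp add: ennreal_mult[symmetric] exp_diff exp_minus field_simps)
      also have "\<dots> = ennreal (exp (- \<rho> x)) * (\<integral>\<^sup>+ t. ennreal (k t * exp (- t)) \<partial>lborel)" by (rule nn_integral_cmult) measurable
      also have "(\<integral>\<^sup>+ t. ennreal (k t * exp (- t)) \<partial>lborel) = ennreal (Gamma B)"
        using nn_integral_Gamma[OF B] by (simp add: k_def)
      finally show ?thesis by (simp add: mult.assoc)
    qed
    then have "(\<integral>\<^sup>+ x. \<integral>\<^sup>+ \<tau>. w x * ennreal (k (\<tau> - \<rho> x) * exp (- \<tau>)) \<partial>lborel \<partial>lborel) = (\<integral>\<^sup>+ x. w x * ennreal (exp (- \<rho> x)) * ennreal (Gamma B) \<partial>lborel)"
      by simp
    also have "\<dots> = (\<integral>\<^sup>+ x. w x * ennreal (exp (- \<rho> x)) \<partial>lborel) * ennreal (Gamma B)" by (rule nn_integral_multc) measurable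
    finally show ?thesis by (simp add: Pint)
  qed
  have "(\<integral>\<^sup>+ x. \<integral>\<^sup>+ \<tau>. w x * ennreal (k (\<tau> - \<rho> x) * exp (- \<tau>)) \<partial>lborel \<partial>lborel) = (\<integral>\<^sup>+ \<tau>. \<integral>\<^sup>+ x. w x * ennreal (k (\<tau> - \<rho> x) * exp (- \<tau>)) \<partial>lborel \<partial>lborel)"
    by (rule lborel_pair.Fubini') measurable
  also have "\<dots> = (\<integral>\<^sup>+ \<tau>. ennreal (indicator {0..} \<tau> * \<tau> powr (D + B - 1) * exp (- \<tau>)) * J 1 \<partial>lborel)"
  proof (intro nn_integral_cong_AE)
    show "AE \<tau> in lborel. (\<integral>\<^sup>+ x. w x * ennreal (k (\<tau> - \<rho> x) * exp (- \<tau>)) \<partial>lborel) = ennreal (indicator {0..} \<tau> * \<tau> powr (D + B - 1) * exp (- \<tau>)) * J 1"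
      using AE_lborel_singleton[of 0]
    proof eventually_elim
      case (elim \<tau>)
      show ?case
      proof (cases "\<tau> > 0")
        case True
        have "(\<integral>\<^sup>+ x. w x * ennreal (k (\<tau> - \<rho> x) * exp (- \<tau>)) \<partial>lborel) = (\<integral>\<^sup>+ x. (w x * ennreal (k (\<tau> - \<rho> x))) * ennreal (exp (- \<tau>)) \<partial>lborel)"
          using k0 by (simp add: ennreal_mult mult.assoc)
        also have "\<dots> = J \<tau> * ennreal (exp (- \<tau>))" unfolding J_def by (rule nn_integral_multc) measurable
        finally show ?thesis unfolding J_hom[OF True] using True by (simp add: ennreal_mult mult_ac)
      next
        case False
        have "k (\<tau> - \<rho> x) = 0" for x using False elim \<rho>[of x] by (simp add: k_def indicator_def)
        then show ?thesis using False elim by simp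
      qed
    qed
  qed
  also have "\<dots> = (\<integral>\<^sup>+ \<tau>. ennreal (indicator {0..} \<tau> * \<tau> powr (D + B - 1) * exp (- \<tau>)) \<partial>lborel) * J 1"
    by (rule nn_integral_multc) measurable
  also have "\<dots> = ennreal (Gamma (D + B)) * J 1" using nn_integral_Gamma[of "D + B"] D B by simp
  finally have eq: "ennreal P * ennreal (Gamma B) = ennreal (Gamma (D + B)) * J 1" unfolding L .
  have G: "Gamma (D + B) > 0" "Gamma B > 0" using D B by (auto intro: Gamma_real_pos)
  have "J 1 = ennreal (P * Gamma B / Gamma (D + B))"
  proof (cases "J 1")
    case (real r)
    then have "ennreal (P * Gamma B) = ennreal (Gamma (D + B) * r)" using eq P G by (simp add: ennreal_mult)
    then have "P * Gamma B = Gamma (D + B) * r" using real G P by simp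
    then show ?thesis using real G by (simp add: field_simps)
  next
    case top
    then have "ennreal (Gamma (D + B)) * J 1 = \<infinity>" using G by (simp add: ennreal_mult_top)
    then show ?thesis using eq P G by (simp add: ennreal_mult[symmetric])
  qed
  then show ?thesis unfolding J_def k_def by simp
qed

definition simplex_coord :: "'n::finite option \<Rightarrow> real ^ 'n \<Rightarrow> real" where
  "simplex_coord i x = (case i of Some j \<Rightarrow> x $ j | None \<Rightarrow> 1 - (\<Sum>j\<in>UNIV. x $ j))"

definition ball_coord :: "'n::finite option \<Rightarrow> real ^ 'n \<Rightarrow> real" where
  "ball_coord i x = (case i of Some j \<Rightarrow> (x $ j)\<^sup>2 | None \<Rightarrow> 1 - (norm x)\<^sup>2)"

text \<open>Dirichlet's integral, the common value of the moments of both weights in terms of the coordinates above.\<close>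

definition dirichlet_value :: "('n::finite option \<Rightarrow> real) \<Rightarrow> ('n option \<Rightarrow> nat) \<Rightarrow> real" where
  "dirichlet_value \<kappa> m = (\<Prod>i\<in>UNIV. Gamma (real (m i) + \<kappa> i + 1/2)) / Gamma (\<Sum>i\<in>UNIV. real (m i) + \<kappa> i + 1/2)"

lemma prod_UNIV_option: "(\<Prod>i\<in>UNIV. f i) = f None * (\<Prod>j\<in>UNIV. f (Some j))"
  for f :: "'n::finite option \<Rightarrow> 'a :: comm_monoid_mult"
  by (simp add: UNIV_option_conv prod.reindex)

lemma sum_UNIV_option: "(\<Sum>i\<in>UNIV. f i) = f None + (\<Sum>j\<in>UNIV. f (Some j))"
  for f :: "'n::finite option \<Rightarrow> 'a :: comm_monoid_add"
  by (simp add: UNIV_option_conv sum.reindex)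

lemma measurable_vec_nth [measurable]: "(\<lambda>x::real ^ 'n::finite. x $ i) \<in> borel_measurable borel"
  by (intro borel_measurable_continuous_onI continuous_intros)

lemma norm_sq_vec: "(norm (x :: real ^ 'n::finite))\<^sup>2 = (\<Sum>i\<in>UNIV. (x $ i)\<^sup>2)"
  unfolding power2_norm_eq_inner inner_vec_def by (simp add: power2_eq_square)

lemma prod_ennreal_fun: "(\<And>i. f i \<ge> 0) \<Longrightarrow> (\<Prod>i\<in>S. ennreal (f i)) = ennreal (\<Prod>i\<in>S. f i)"
  by (rule prod_ennreal) auto

lemma power_CARD_eq_prod: "c ^ CARD('n::finite) = (\<Prod>i\<in>(UNIV::'n set). c)"
  by simp

lemma prod_indicator_ge: "(\<Prod>i\<in>UNIV. indicator {0..} (x $ i) * f i) = (if \<forall>i. x $ i \<ge> 0 then (\<Prod>i\<in>UNIV. f i) else 0)"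
  for x :: "real ^ 'n::finite" and f :: "'n \<Rightarrow> real"
proof (cases "\<forall>i. x $ i \<ge> 0")
  case False
  then obtain i where "x $ i < 0" by (auto simp: not_le)
  then have "(\<Prod>i\<in>UNIV. indicator {0..} (x $ i) * f i) = 0" by (intro prod_zero bexI[of _ i]) auto
  then show ?thesis using False by auto
qed simp

lemma dirichlet_simplex:
  fixes \<kappa> :: "'n::finite option \<Rightarrow> real"
  assumes \<kappa>: "\<And>i. \<kappa> i \<ge> 0"
  shows "has_bochner_integral lborel
    (\<lambda>x. indicator simplex_dom x * ((\<Prod>i\<in>UNIV. simplex_coord i x ^ m i) * simplex_weight \<kappa> x)) (dirichlet_value \<kappa> m)"
proof -
  define A where "A i = real (m i) + \<kappa> i + 1/2" for i
  have A: "A i > 0" for i using \<kappa>[of i] by (simp add: A_def add_nonneg_pos)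
  define w where "w x = (\<Prod>i\<in>UNIV. ennreal (indicator {0..} (x $ i) * (x $ i) powr (A (Some i) - 1)))" for x :: "real ^ 'n"
  define \<rho> where "\<rho> x = (\<Sum>i\<in>UNIV. \<bar>x $ i\<bar>)" for x :: "real ^ 'n"
  define D where "D = (\<Sum>i\<in>UNIV. A (Some i))"
  have "(\<integral>\<^sup>+ x. w x * ennreal (indicator {0..} (1 - \<rho> x) * (1 - \<rho> x) powr (A None - 1)) \<partial>lborel) =
      ennreal ((\<Prod>i\<in>UNIV. Gamma (A (Some i))) * Gamma (A None) / Gamma (D + A None))"
  proof (rule homogeneous_beta_integral[where cc = "\<lambda>\<tau>. \<tau>"])
    show "w \<in> borel_measurable borel" "\<rho> \<in> borel_measurable borel" unfolding w_def \<rho>_def by measurable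
    show "\<rho> x \<ge> 0" for x by (simp add: \<rho>_def sum_nonneg)
    show "\<rho> (\<tau> *\<^sub>R x) = \<tau> * \<rho> x" if "\<tau> > 0" for \<tau> x using that by (simp add: \<rho>_def abs_mult sum_distrib_left)
    show "ennreal (\<tau> ^ CARD('n)) * w (\<tau> *\<^sub>R x) = ennreal (\<tau> powr D) * w x" if \<tau>: "\<tau> > 0" for \<tau> x
    proof -
      have 1: "\<tau> * (indicator {0..} (\<tau> * (x $ i)) * (\<tau> * (x $ i)) powr (A (Some i) - 1)) = \<tau> powr A (Some i) * (indicator {0..} (x $ i) * (x $ i) powr (A (Some i) - 1))" for i
      proof -
        have "\<tau> * \<tau> powr (A (Some i) - 1) = \<tau> powr A (Some i)" using \<tau> by (simp add: powr_mult_base)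
        then show ?thesis using \<tau> by (auto simp: indicator_def powr_mult zero_le_mult_iff)
      qed
      have "\<tau> ^ CARD('n) * (\<Prod>i\<in>UNIV. indicator {0..} (\<tau> * (x $ i)) * (\<tau> * (x $ i)) powr (A (Some i) - 1))
        = \<tau> powr D * (\<Prod>i\<in>UNIV. indicator {0..} (x $ i) * (x $ i) powr (A (Some i) - 1))"
        unfolding D_def using \<tau> by (simp only: power_CARD_eq_prod prod.distrib[symmetric] 1 powr_sum finite UNIV_I less_imp_neq[symmetric] not_False_eq_True)
      then show ?thesis unfolding w_def using \<tau>
        by (subst (1 2) prod_ennreal_fun) (simp_all add: ennreal_mult'[symmetric] del: prod_constant)
    qed
    have "(\<integral>\<^sup>+ x. w x * ennreal (exp (- \<rho> x)) \<partial>lborel) = (\<integral>\<^sup>+ x. (\<Prod>i\<in>UNIV. ennreal (indicator {0..} (x $ i) * (x $ i) powr (A (Some i) - 1) * exp (- (x $ i)))) \<partial>lborel)"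
    proof (intro nn_integral_cong)
      fix x :: "real ^ 'n"
      have "ennreal (exp (- \<rho> x)) = (\<Prod>i\<in>UNIV. ennreal (exp (- \<bar>x $ i\<bar>)))"
        by (subst prod_ennreal_fun) (simp_all add: \<rho>_def exp_sum sum_negf[symmetric])
      then show "w x * ennreal (exp (- \<rho> x)) = (\<Prod>i\<in>UNIV. ennreal (indicator {0..} (x $ i) * (x $ i) powr (A (Some i) - 1) * exp (- (x $ i))))"
        unfolding w_def by (simp only: prod.distrib[symmetric])
          (intro prod.cong refl, auto simp: ennreal_mult[symmetric] indicator_def)
    qed
    also have "\<dots> = (\<Prod>i\<in>UNIV. \<integral>\<^sup>+ t. ennreal (indicator {0..} t * t powr (A (Some i) - 1) * exp (- t)) \<partial>lborel)"
      by (rule nn_integral_prod_vec) measurable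
    also have "\<dots> = (\<Prod>i\<in>UNIV. ennreal (Gamma (A (Some i))))" using A by (intro prod.cong refl nn_integral_Gamma) auto
    also have "\<dots> = ennreal (\<Prod>i\<in>UNIV. Gamma (A (Some i)))" using A by (intro prod_ennreal_fun less_imp_le Gamma_real_pos) auto
    finally show "(\<integral>\<^sup>+ x. w x * ennreal (exp (- \<rho> x)) \<partial>lborel) = ennreal (\<Prod>i\<in>UNIV. Gamma (A (Some i)))" .
    show "0 \<le> (\<Prod>i\<in>UNIV. Gamma (A (Some i)))" using A by (intro prod_nonneg less_imp_le Gamma_real_pos) auto
    show "D > 0" unfolding D_def using A by (intro sum_pos) auto
  qed (use A in auto)
  also have "(\<Prod>i\<in>UNIV. Gamma (A (Some i))) * Gamma (A None) / Gamma (D + A None) = dirichlet_value \<kappa> m"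
    unfolding dirichlet_value_def A_def[symmetric] prod_UNIV_option sum_UNIV_option D_def by (simp add: mult_ac add_ac)
  also have "(\<integral>\<^sup>+ x. w x * ennreal (indicator {0..} (1 - \<rho> x) * (1 - \<rho> x) powr (A None - 1)) \<partial>lborel) =
     (\<integral>\<^sup>+ x. ennreal (indicator simplex_dom x * ((\<Prod>i\<in>UNIV. simplex_coord i x ^ m i) * simplex_weight \<kappa> x)) \<partial>lborel)"
  proof (intro nn_integral_cong)
    fix x :: "real ^ 'n"
    have pw: "t ^ m i * t powr (\<kappa> i - 1/2) = t powr (A i - 1)" if "t \<ge> 0" for t i
    proof (cases "t = 0")
      case False
      then have "t > 0" using that by simp
      then have "t ^ m i * t powr (\<kappa> i - 1/2) = t powr (real (m i) + (\<kappa> i - 1/2))" by (simp only: powr_add powr_realpow)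
      then show ?thesis by (simp add: A_def add_diff_eq)
    qed auto
    have w: "w x = ennreal (if \<forall>i. x $ i \<ge> 0 then \<Prod>i\<in>UNIV. (x $ i) powr (A (Some i) - 1) else 0)"
      unfolding w_def by (subst prod_ennreal_fun) (simp, simp only: prod_indicator_ge)
    show "w x * ennreal (indicator {0..} (1 - \<rho> x) * (1 - \<rho> x) powr (A None - 1)) =
       ennreal (indicator simplex_dom x * ((\<Prod>i\<in>UNIV. simplex_coord i x ^ m i) * simplex_weight \<kappa> x))"
    proof (cases "\<forall>i. x $ i \<ge> 0")
      case True
      then have \<rho>: "\<rho> x = (\<Sum>i\<in>UNIV. x $ i)" by (simp add: \<rho>_def)
      have dom: "x \<in> simplex_dom \<longleftrightarrow> 0 \<le> 1 - \<rho> x" using True by (simp add: simplex_dom_def \<rho>)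
      show ?thesis
      proof (cases "0 \<le> 1 - \<rho> x")
        case t: True
        have "(\<Prod>i\<in>UNIV. simplex_coord i x ^ m i) * simplex_weight \<kappa> x =
          ((1 - \<rho> x) ^ m None * (1 - \<rho> x) powr (\<kappa> None - 1/2)) * (\<Prod>i\<in>UNIV. (x $ i) ^ m (Some i) * (x $ i) powr (\<kappa> (Some i) - 1/2))"
          unfolding prod_UNIV_option simplex_weight_def by (simp add: simplex_coord_def \<rho> prod.distrib)
        also have "\<dots> = (1 - \<rho> x) powr (A None - 1) * (\<Prod>i\<in>UNIV. (x $ i) powr (A (Some i) - 1))"
          using True t by (simp add: pw)
        finally show ?thesis using True t dom unfolding w by (simp add: ennreal_mult'[symmetric] prod_nonneg mult.commute)
      next
        case False
        then show ?thesis using dom by simp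
      qed
    next
      case False
      then have "x \<notin> simplex_dom" by (auto simp: simplex_dom_def)
      moreover have "w x = 0" using False unfolding w by (simp only: if_False ennreal_0)
      ultimately show ?thesis by simp
    qed
  qed
  finally have N: "(\<integral>\<^sup>+ x. ennreal (indicator simplex_dom x * ((\<Prod>i\<in>UNIV. simplex_coord i x ^ m i) * simplex_weight \<kappa> x)) \<partial>lborel) = ennreal (dirichlet_value \<kappa> m)" .
  have [measurable]: "simplex_dom \<in> sets (borel :: (real ^ 'n) measure)"
    unfolding simplex_dom_def by measurable
  have [measurable]: "simplex_coord i \<in> borel_measurable borel" for i :: "'n option"
    unfolding simplex_coord_def by (cases i) auto
  show ?thesis
  proof (rule has_bochner_integral_nn_integral[OF _ _ _ N])
    show "(\<lambda>x. indicator simplex_dom x * ((\<Prod>i\<in>UNIV. simplex_coord i x ^ m i) * simplex_weight \<kappa> x)) \<in> borel_measurable lborel"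
      unfolding simplex_weight_def by measurable
    show "AE x in lborel. 0 \<le> indicator simplex_dom x * ((\<Prod>i\<in>UNIV. simplex_coord i x ^ m i) * simplex_weight \<kappa> x)"
      by (intro AE_I2) (auto simp: indicator_def simplex_dom_def simplex_weight_def simplex_coord_def intro!: mult_nonneg_nonneg prod_nonneg zero_le_power split: option.split)
    show "0 \<le> dirichlet_value \<kappa> m" unfolding dirichlet_value_def A_def[symmetric]
      using A by (intro divide_nonneg_pos prod_nonneg Gamma_real_pos sum_pos less_imp_le[OF Gamma_real_pos]) auto
  qed
qed

lemma dirichlet_ball:
  fixes \<kappa> :: "'n::finite option \<Rightarrow> real"
  assumes \<kappa>: "\<And>i. \<kappa> i \<ge> 0"
  shows "has_bochner_integral lborel
    (\<lambda>x. indicator ball_dom x * ((\<Prod>i\<in>UNIV. ball_coord i x ^ m i) * ball_weight \<kappa> x)) (dirichlet_value \<kappa> m)"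
proof -
  define A where "A i = real (m i) + \<kappa> i + 1/2" for i
  have A: "A i > 0" for i using \<kappa>[of i] by (simp add: A_def add_nonneg_pos)
  define w where "w x = (\<Prod>i\<in>UNIV. ennreal (\<bar>x $ i\<bar> powr (2 * A (Some i) - 1)))" for x :: "real ^ 'n"
  define \<rho> where "\<rho> x = (\<Sum>i\<in>UNIV. (x $ i)\<^sup>2)" for x :: "real ^ 'n"
  define D where "D = (\<Sum>i\<in>UNIV. A (Some i))"
  have "(\<integral>\<^sup>+ x. w x * ennreal (indicator {0..} (1 - \<rho> x) * (1 - \<rho> x) powr (A None - 1)) \<partial>lborel) =
      ennreal ((\<Prod>i\<in>UNIV. Gamma (A (Some i))) * Gamma (A None) / Gamma (D + A None))"
  proof (rule homogeneous_beta_integral[where cc = sqrt])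
    show "w \<in> borel_measurable borel" "\<rho> \<in> borel_measurable borel" unfolding w_def \<rho>_def by measurable
    show "\<rho> x \<ge> 0" for x by (simp add: \<rho>_def sum_nonneg)
    show "\<rho> (sqrt \<tau> *\<^sub>R x) = \<tau> * \<rho> x" if "\<tau> > 0" for \<tau> x using that by (simp add: \<rho>_def power_mult_distrib sum_distrib_left)
    show "ennreal (sqrt \<tau> ^ CARD('n)) * w (sqrt \<tau> *\<^sub>R x) = ennreal (\<tau> powr D) * w x" if \<tau>: "\<tau> > 0" for \<tau> x
    proof -
      have 1: "sqrt \<tau> * (\<bar>sqrt \<tau> * (x $ i)\<bar> powr (2 * A (Some i) - 1)) = \<tau> powr A (Some i) * (\<bar>x $ i\<bar> powr (2 * A (Some i) - 1))" for i
      proof -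
        have "sqrt \<tau> * sqrt \<tau> powr (2 * A (Some i) - 1) = sqrt \<tau> powr (2 * A (Some i))" using \<tau> by (simp add: powr_mult_base)
        also have "\<dots> = \<tau> powr A (Some i)" using \<tau> by (simp add: powr_half_sqrt[symmetric] powr_powr)
        finally show ?thesis using \<tau> by (simp add: abs_mult powr_mult)
      qed
      have "sqrt \<tau> ^ CARD('n) * (\<Prod>i\<in>UNIV. \<bar>sqrt \<tau> * (x $ i)\<bar> powr (2 * A (Some i) - 1))
        = \<tau> powr D * (\<Prod>i\<in>UNIV. \<bar>x $ i\<bar> powr (2 * A (Some i) - 1))"
        unfolding D_def using \<tau> by (simp only: power_CARD_eq_prod prod.distrib[symmetric] 1 powr_sum finite UNIV_I less_imp_neq[symmetric] not_False_eq_True)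
      then show ?thesis unfolding w_def using \<tau>
        by (subst (1 2) prod_ennreal_fun) (simp_all add: ennreal_mult'[symmetric] del: prod_constant)
    qed
    have "(\<integral>\<^sup>+ x. w x * ennreal (exp (- \<rho> x)) \<partial>lborel) = (\<integral>\<^sup>+ x. (\<Prod>i\<in>UNIV. ennreal (\<bar>x $ i\<bar> powr (2 * A (Some i) - 1) * exp (- (x $ i)\<^sup>2))) \<partial>lborel)"
    proof (intro nn_integral_cong)
      fix x :: "real ^ 'n"
      have "ennreal (exp (- \<rho> x)) = (\<Prod>i\<in>UNIV. ennreal (exp (- (x $ i)\<^sup>2)))"
        by (subst prod_ennreal_fun) (simp_all add: \<rho>_def exp_sum sum_negf[symmetric])
      then show "w x * ennreal (exp (- \<rho> x)) = (\<Prod>i\<in>UNIV. ennreal (\<bar>x $ i\<bar> powr (2 * A (Some i) - 1) * exp (- (x $ i)\<^sup>2)))"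
        unfolding w_def by (simp only: prod.distrib[symmetric])
          (intro prod.cong refl, auto simp: ennreal_mult[symmetric])
    qed
    also have "\<dots> = (\<Prod>i\<in>UNIV. \<integral>\<^sup>+ t. ennreal (\<bar>t\<bar> powr (2 * A (Some i) - 1) * exp (- t\<^sup>2)) \<partial>lborel)"
      by (rule nn_integral_prod_vec) measurable
    also have "\<dots> = (\<Prod>i\<in>UNIV. ennreal (Gamma (A (Some i))))" using A by (intro prod.cong refl nn_integral_Gamma_sq) auto
    also have "\<dots> = ennreal (\<Prod>i\<in>UNIV. Gamma (A (Some i)))" using A by (intro prod_ennreal_fun less_imp_le Gamma_real_pos) auto
    finally show "(\<integral>\<^sup>+ x. w x * ennreal (exp (- \<rho> x)) \<partial>lborel) = ennreal (\<Prod>i\<in>UNIV. Gamma (A (Some i)))" .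
    show "0 \<le> (\<Prod>i\<in>UNIV. Gamma (A (Some i)))" using A by (intro prod_nonneg less_imp_le Gamma_real_pos) auto
    show "D > 0" unfolding D_def using A by (intro sum_pos) auto
  qed (use A in auto)
  also have "(\<Prod>i\<in>UNIV. Gamma (A (Some i))) * Gamma (A None) / Gamma (D + A None) = dirichlet_value \<kappa> m"
    unfolding dirichlet_value_def A_def[symmetric] prod_UNIV_option sum_UNIV_option D_def by (simp add: mult_ac add_ac)
  also have "(\<integral>\<^sup>+ x. w x * ennreal (indicator {0..} (1 - \<rho> x) * (1 - \<rho> x) powr (A None - 1)) \<partial>lborel) =
     (\<integral>\<^sup>+ x. ennreal (indicator ball_dom x * ((\<Prod>i\<in>UNIV. ball_coord i x ^ m i) * ball_weight \<kappa> x)) \<partial>lborel)"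
  proof (intro nn_integral_cong)
    fix x :: "real ^ 'n"
    have pw: "t ^ m i * t powr (\<kappa> i - 1/2) = t powr (A i - 1)" if "t \<ge> 0" for t i
    proof (cases "t = 0")
      case False
      then have "t > 0" using that by simp
      then have "t ^ m i * t powr (\<kappa> i - 1/2) = t powr (real (m i) + (\<kappa> i - 1/2))" by (simp only: powr_add powr_realpow)
      then show ?thesis by (simp add: A_def add_diff_eq)
    qed auto
    have pw2: "(t\<^sup>2) ^ m i * \<bar>t\<bar> powr (2 * \<kappa> i) = \<bar>t\<bar> powr (2 * A i - 1)" for t i
    proof (cases "t = 0")
      case False
      then have "\<bar>t\<bar> > 0" by simp
      have "(t\<^sup>2) ^ m i = \<bar>t\<bar> ^ (2 * m i)" by (simp add: power_mult)
      also have "\<dots> = \<bar>t\<bar> powr (real (2 * m i))" using \<open>\<bar>t\<bar> > 0\<close> by (simp only: powr_realpow)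
      finally have "(t\<^sup>2) ^ m i * \<bar>t\<bar> powr (2 * \<kappa> i) = \<bar>t\<bar> powr (real (2 * m i) + 2 * \<kappa> i)" by (simp only: powr_add)
      also have "real (2 * m i) + 2 * \<kappa> i = 2 * A i - 1" by (simp add: A_def)
      finally show ?thesis .
    qed auto
    have w: "w x = ennreal (\<Prod>i\<in>UNIV. \<bar>x $ i\<bar> powr (2 * A (Some i) - 1))"
      unfolding w_def by (subst prod_ennreal_fun) auto
    have \<rho>: "\<rho> x = (norm x)\<^sup>2" by (simp add: \<rho>_def norm_sq_vec)
    have dom: "x \<in> ball_dom \<longleftrightarrow> 0 \<le> 1 - \<rho> x" by (simp add: ball_dom_def \<rho> power_le_one_iff)
    show "w x * ennreal (indicator {0..} (1 - \<rho> x) * (1 - \<rho> x) powr (A None - 1)) =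
       ennreal (indicator ball_dom x * ((\<Prod>i\<in>UNIV. ball_coord i x ^ m i) * ball_weight \<kappa> x))"
    proof (cases "0 \<le> 1 - \<rho> x")
      case t: True
      have "(\<Prod>i\<in>UNIV. ball_coord i x ^ m i) * ball_weight \<kappa> x =
        ((1 - \<rho> x) ^ m None * (1 - \<rho> x) powr (\<kappa> None - 1/2)) * (\<Prod>i\<in>UNIV. ((x $ i)\<^sup>2) ^ m (Some i) * \<bar>x $ i\<bar> powr (2 * \<kappa> (Some i)))"
        unfolding prod_UNIV_option ball_weight_def by (simp add: ball_coord_def \<rho> prod.distrib)
      also have "\<dots> = (1 - \<rho> x) powr (A None - 1) * (\<Prod>i\<in>UNIV. \<bar>x $ i\<bar> powr (2 * A (Some i) - 1))"
        by (simp only: pw[OF t] pw2)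
      finally show ?thesis using t dom unfolding w by (simp add: ennreal_mult'[symmetric] prod_nonneg mult.commute)
    next
      case False
      then show ?thesis using dom by simp
    qed
  qed
  finally have N: "(\<integral>\<^sup>+ x. ennreal (indicator ball_dom x * ((\<Prod>i\<in>UNIV. ball_coord i x ^ m i) * ball_weight \<kappa> x)) \<partial>lborel) = ennreal (dirichlet_value \<kappa> m)" .
  have [measurable]: "ball_dom \<in> sets (borel :: (real ^ 'n) measure)"
    unfolding ball_dom_def by measurable
  have [measurable]: "ball_coord i \<in> borel_measurable borel" for i :: "'n option"
    unfolding ball_coord_def by (cases i) auto
  show ?thesis
  proof (rule has_bochner_integral_nn_integral[OF _ _ _ N])
    show "(\<lambda>x. indicator ball_dom x * ((\<Prod>i\<in>UNIV. ball_coord i x ^ m i) * ball_weight \<kappa> x)) \<in> borel_measurable lborel"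
      unfolding ball_weight_def by measurable
    show "AE x in lborel. 0 \<le> indicator ball_dom x * ((\<Prod>i\<in>UNIV. ball_coord i x ^ m i) * ball_weight \<kappa> x)"
      by (intro AE_I2) (auto simp: indicator_def ball_dom_def ball_weight_def ball_coord_def power_le_one intro!: mult_nonneg_nonneg prod_nonneg zero_le_power split: option.split)
    show "0 \<le> dirichlet_value \<kappa> m" unfolding dirichlet_value_def A_def[symmetric]
      using A by (intro divide_nonneg_pos prod_nonneg Gamma_real_pos sum_pos less_imp_le[OF Gamma_real_pos]) auto
  qed
qed

text \<open>The reflection of the coordinate \<open>i\<close> changes the sign of the integrand.\<close>

lemma odd_monomial_ball:
  fixes \<kappa> :: "'n::finite option \<Rightarrow> real" and \<alpha> :: "'n \<Rightarrow> nat" and F :: "real \<Rightarrow> real"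
  assumes [measurable]: "F \<in> borel_measurable borel" and odd: "odd (\<alpha> i)"
  shows "(LINT x:ball_dom|lborel. F (ball_coord i0 x) * (\<Prod>j\<in>UNIV. (x $ j) ^ \<alpha> j) * ball_weight \<kappa> x) = 0"
proof -
  define T where "T x = (\<chi> j. if j = i then - (x $ j) else x $ j)" for x :: "real ^ 'n"
  define cf where "cf b = (if b = axis i (1::real) then -1 else 1::real)" for b :: "real ^ 'n"
  have T_eq: "T x = 0 + (\<Sum>b\<in>Basis. (cf b * (x \<bullet> b)) *\<^sub>R b)" for x
  proof (rule euclidean_eqI)
    fix b :: "real ^ 'n" assume b: "b \<in> Basis"
    then obtain j where j: "b = axis j 1" by (auto simp: Basis_vec_def)
    have "T x \<bullet> b = cf b * (x \<bullet> b)" by (auto simp: j T_def inner_axis cf_def axis_eq_axis)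
    then show "T x \<bullet> b = (0 + (\<Sum>b\<in>Basis. (cf b * (x \<bullet> b)) *\<^sub>R b)) \<bullet> b" using b by simp
  qed
  have lb: "(lborel :: (real ^ 'n) measure) = distr lborel borel T"
  proof -
    have "(lborel :: (real ^ 'n) measure) = density (distr lborel borel (\<lambda>x. 0 + (\<Sum>b\<in>Basis. (cf b * (x \<bullet> b)) *\<^sub>R b))) (\<lambda>x. ennreal (\<Prod>b\<in>Basis. \<bar>cf b\<bar>))"
      by (rule lborel_affine_euclidean) (auto simp: cf_def)
    also have "(\<Prod>b\<in>Basis. \<bar>cf b\<bar>) = 1" by (intro prod.neutral) (auto simp: cf_def)
    also have "(\<lambda>x. 0 + (\<Sum>b\<in>Basis. (cf b * (x \<bullet> b)) *\<^sub>R b)) = T" by (rule ext) (rule T_eq[symmetric])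
    finally show ?thesis by (simp add: density_1)
  qed
  have Tm [measurable]: "T \<in> borel_measurable borel"
    unfolding T_def
  proof (intro borel_measurable_continuous_onI continuous_on_vec_lambda)
    show "continuous_on UNIV (\<lambda>x :: real ^ 'n. if j = i then - (x $ j) else x $ j)" for j
      by (cases "j = i") (auto intro!: continuous_intros)
  qed
  have nT: "(norm (T x))\<^sup>2 = (norm x)\<^sup>2" for x
    unfolding norm_sq_vec by (intro sum.cong refl) (auto simp: T_def)
  have dT: "T x \<in> ball_dom \<longleftrightarrow> x \<in> ball_dom" for x
  proof -
    have "norm (T x) = norm x" using nT[of x] by (metis norm_ge_zero power2_eq_imp_eq)
    then show ?thesis by (simp add: ball_dom_def)
  qed
  have cT: "ball_coord i0 (T x) = ball_coord i0 x" for x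
  proof (cases i0)
    case None
    then show ?thesis by (simp add: ball_coord_def nT)
  next
    case (Some j)
    then show ?thesis by (simp add: ball_coord_def T_def)
  qed
  have wT: "ball_weight \<kappa> (T x) = ball_weight \<kappa> x" for x
    unfolding ball_weight_def nT by (auto simp: T_def intro!: arg_cong2[where f = "(*)"] prod.cong)
  have mT: "(\<Prod>j\<in>UNIV. (T x $ j) ^ \<alpha> j) = - (\<Prod>j\<in>UNIV. (x $ j) ^ \<alpha> j)" for x
  proof -
    have "(\<Prod>j\<in>UNIV. (T x $ j) ^ \<alpha> j) = (\<Prod>j\<in>UNIV. (if j = i then -1 else 1) * (x $ j) ^ \<alpha> j)"
      using odd by (intro prod.cong refl) (auto simp: T_def)
    then show ?thesis by (simp add: prod.distrib)
  qed
  have [measurable]: "ball_dom \<in> sets (borel :: (real ^ 'n) measure)"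
    unfolding ball_dom_def by measurable
  have [measurable]: "ball_coord i \<in> borel_measurable borel" for i :: "'n option"
    unfolding ball_coord_def by (cases i) auto
  have [measurable]: "ball_weight \<kappa> \<in> borel_measurable borel" unfolding ball_weight_def by measurable
  define g where "g x = indicator ball_dom x *\<^sub>R (F (ball_coord i0 x) * (\<Prod>j\<in>UNIV. (x $ j) ^ \<alpha> j) * ball_weight \<kappa> x)" for x
  have [measurable]: "g \<in> borel_measurable borel" unfolding g_def by measurable
  have "(LINT x|lborel. g x) = (LINT x|distr lborel borel T. g x)" using lb by simp
  also have "\<dots> = (LINT x|lborel. g (T x))" by (rule integral_distr) auto
  also have "\<dots> = (LINT x|lborel. - g x)"
    unfolding g_def mT cT wT by (intro Bochner_Integration.integral_cong refl) (simp add: indicator_def dT)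
  finally show ?thesis by (simp add: g_def set_lebesgue_integral_def)
qed

section \<open>The push-forward to the interval\<close>

text \<open>By the Weierstrass theorem the integrals of continuous functions agree, and the indicator functions of half lines
are limits of continuous functions.\<close>

lemma finite_measure_eqI_moments:
  fixes M N :: "real measure"
  assumes fin: "finite_measure M" "finite_measure N" and sets: "sets M = sets borel" "sets N = sets borel"
    and conc: "AE x in M. x \<in> {0..1}" "AE x in N. x \<in> {0..1}"
    and mom: "\<And>m. (LINT x|M. (1 - x) ^ m) = (LINT x|N. (1 - x) ^ m)"
  shows "M = N"
proof -
  note [measurable_cong] = sets
  have int: "integrable L f" if "finite_measure L" "sets L = sets borel" "AE x in L. x \<in> {0..1}" "continuous_on UNIV f"
    for L :: "real measure" and f :: "real \<Rightarrow> real"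
  proof -
    have "compact (f ` {0..1})" by (intro compact_continuous_image continuous_on_subset[OF that(4)]) auto
    then obtain B where B: "\<forall>x\<in>f ` {0..1}. norm x \<le> B" using compact_imp_bounded bounded_iff by metis
    have "f \<in> borel_measurable L" using borel_measurable_continuous_onI[OF that(4)] that(2) by (simp cong: measurable_cong_sets)
    moreover have "AE x in L. norm (f x) \<le> B" using that(3) by eventually_elim (use B in auto)
    ultimately show ?thesis by (intro finite_measure.integrable_const_bound[OF that(1)])
  qed
  note intM = int[OF fin(1) sets(1) conc(1)] and intN = int[OF fin(2) sets(2) conc(2)]
  have poly: "(LINT x|M. p x) = (LINT x|N. p x)" if "real_polynomial_function p" for p
  proof -
    have "polynomial_function (\<lambda>y::real. 1 - y)"
      by (intro polynomial_function_diff polynomial_function_const polynomial_function_id)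
    then have "real_polynomial_function (p \<circ> (\<lambda>y. 1 - y))"
      by (rule real_polynomial_function_compose) (use that in \<open>simp_all only: real_polynomial_function_eq\<close>)
    then obtain c n where cn: "p \<circ> (\<lambda>y. 1 - y) = (\<lambda>x. \<Sum>i\<le>n. c i * x ^ i)"
      using real_polynomial_function_iff_sum[THEN iffD1] by blast
    have p: "p x = (\<Sum>i\<le>n. c i * (1 - x) ^ i)" for x
    proof -
      have "p x = (p \<circ> (\<lambda>y. 1 - y)) (1 - x)" by simp
      then show ?thesis unfolding cn .
    qed
    show ?thesis unfolding p
      by (subst (1 2) Bochner_Integration.integral_sum) (auto intro!: intM intN continuous_intros simp: mom)
  qed
  have cont: "(LINT x|M. f x) = (LINT x|N. f x)" if f: "continuous_on UNIV f" for f :: "real \<Rightarrow> real"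
  proof (rule ccontr)
    assume ne: "(LINT x|M. f x) \<noteq> (LINT x|N. f x)"
    define d where "d = \<bar>(LINT x|M. f x) - (LINT x|N. f x)\<bar>"
    define K where "K = measure M (space M) + measure N (space N) + 1"
    have K: "K > 0" by (simp add: K_def add_nonneg_pos)
    have d: "d > 0" using ne by (simp add: d_def)
    define e where "e = d / (2 * K)"
    have e: "e > 0" using d K by (simp add: e_def)
    obtain p where p: "real_polynomial_function p" "\<And>x. x \<in> {0..1} \<Longrightarrow> \<bar>f x - p x\<bar> < e"
      using Stone_Weierstrass_real_polynomial_function[OF compact_Icc continuous_on_subset[OF f subset_UNIV] e] by blast
    have pc: "continuous_on UNIV p" using p(1) by (intro continuous_on_polymonial_function) (simp only: real_polynomial_function_eq)
    have bd: "\<bar>(LINT x|L. f x) - (LINT x|L. p x)\<bar> \<le> e * measure L (space L)"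
      if L: "finite_measure L" "sets L = sets borel" "AE x in L. x \<in> {0..1}" for L :: "real measure"
    proof -
      interpret finite_measure L by fact
      note i = int[OF L]
      have "\<bar>(LINT x|L. f x) - (LINT x|L. p x)\<bar> = \<bar>LINT x|L. f x - p x\<bar>"
        by (subst Bochner_Integration.integral_diff) (auto intro!: i f pc)
      also have "\<dots> \<le> (LINT x|L. \<bar>f x - p x\<bar>)" by (rule integral_abs_bound)
      also have "\<dots> \<le> (LINT x|L. e)"
      proof (intro integral_mono_AE i continuous_intros f pc)
        show "AE x in L. \<bar>f x - p x\<bar> \<le> e" using L(3) by eventually_elim (use p(2) less_imp_le in blast)
      qed
      finally show ?thesis by (simp add: mult.commute)
    qed
    have "d \<le> e * measure M (space M) + e * measure N (space N)"
      using bd[OF fin(1) sets(1) conc(1)] bd[OF fin(2) sets(2) conc(2)] poly[OF p(1)] unfolding d_def by linarith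
    also have "\<dots> \<le> e * K" using e by (simp add: K_def algebra_simps)
    also have "\<dots> = d / 2" using K by (simp add: e_def)
    finally show False using d by simp
  qed
  have tail: "measure L {x<..} = lim (\<lambda>k. LINT y|L. max 0 (min 1 (real k * (y - x))))"
    "(\<lambda>k. LINT y|L. max 0 (min 1 (real k * (y - x)))) \<longlonglongrightarrow> measure L {x<..}"
    if L: "finite_measure L" "sets L = sets borel" for L :: "real measure" and x
  proof -
    interpret finite_measure L by fact
    note [measurable_cong] = L(2)
    have "(\<lambda>k. LINT y|L. max 0 (min 1 (real k * (y - x)))) \<longlonglongrightarrow> (LINT y|L. indicator {x<..} y)"
    proof (rule integral_dominated_convergence[where w = "\<lambda>_. 1"])
      show "AE y in L. (\<lambda>k. max 0 (min 1 (real k * (y - x)))) \<longlonglongrightarrow> indicator {x<..} y"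
      proof (rule AE_I2)
        fix y
        show "(\<lambda>k. max 0 (min 1 (real k * (y - x)))) \<longlonglongrightarrow> indicator {x<..} y"
        proof (cases "y > x")
          case True
          obtain k0 where "real k0 > 1 / (y - x)" using reals_Archimedean2 by blast
          then have k0: "real k0 * (y - x) > 1" using True by (simp add: field_simps)
          have "max 0 (min 1 (real k * (y - x))) = 1" if "k \<ge> k0" for k
          proof -
            have "real k0 * (y - x) \<le> real k * (y - x)" using that True by (intro mult_right_mono) auto
            then show ?thesis using k0 by linarith
          qed
          then show ?thesis using True by (intro tendsto_eventually eventually_sequentiallyI[of k0]) auto
        next
          case False
          then have "real k * (y - x) \<le> 0" for k by (intro mult_nonneg_nonpos) auto
          then have "max 0 (min 1 (real k * (y - x))) = 0" for k by (intro max_absorb1 min.coboundedI2)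
          then show ?thesis using False by simp
        qed
      qed
    qed auto
    also have "(LINT y|L. indicator {x<..} y) = measure L {x<..}" using L(2) by (simp add: sets_eq_imp_space_eq[OF L(2)])
    finally show "(\<lambda>k. LINT y|L. max 0 (min 1 (real k * (y - x)))) \<longlonglongrightarrow> measure L {x<..}" .
    then show "measure L {x<..} = lim (\<lambda>k. LINT y|L. max 0 (min 1 (real k * (y - x))))" by (simp add: limI)
  qed
  show ?thesis
  proof (rule measure_eqI_lessThan[OF sets])
    fix x :: real
    show "emeasure M {x<..} < \<infinity>" using finite_measure.emeasure_finite[OF fin(1)] by (simp add: less_top)
    have "measure M {x<..} = measure N {x<..}"
      unfolding tail(1)[OF fin(1) sets(1)] tail(1)[OF fin(2) sets(2)]
      by (subst cont) (auto intro!: continuous_intros)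
    then show "emeasure M {x<..} = emeasure N {x<..}"
      using finite_measure.emeasure_eq_measure[OF fin(1)] finite_measure.emeasure_eq_measure[OF fin(2)] by simp
  qed
qed

text \<open>What the simplex (\<open>e = 1\<close>) and the ball (\<open>e = 2\<close>) have in common. A monomial of degree \<open>k\<close> is either a product of
at most \<open>k / e\<close> coordinates \<open>U i\<close>, or its integral against every function of \<open>U i0\<close> vanishes.\<close>

locale barycentric_weight =
  fixes \<kappa> :: "'n::finite option \<Rightarrow> real" and \<Omega> :: "(real ^ 'n) set" and W :: "real ^ 'n \<Rightarrow> real"
    and U :: "'n option \<Rightarrow> real ^ 'n \<Rightarrow> real" and e :: nat and i0 :: "'n option"
  assumes \<kappa>_nonneg: "\<And>i. \<kappa> i \<ge> 0"
    and dim_gt: "(\<Sum>i\<in>UNIV - {i0}. \<kappa> i + 1/2) > 1/2"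
    and e_pos: "e \<ge> 1"
    and compact_dom: "compact \<Omega>"
    and U_range: "\<And>i x. x \<in> \<Omega> \<Longrightarrow> 0 \<le> U i x" "\<And>i x. x \<in> \<Omega> \<Longrightarrow> U i x \<le> 1"
    and U_poly: "\<And>i. U i \<in> polys_deg_le e"
    and U_cont: "\<And>i. continuous_on UNIV (U i)"
    and W_meas [measurable]: "W \<in> borel_measurable borel" and W_nonneg: "\<And>x. x \<in> \<Omega> \<Longrightarrow> W x \<ge> 0"
    and dirichlet: "\<And>m. has_bochner_integral lborel (\<lambda>x. indicator \<Omega> x * ((\<Prod>i\<in>UNIV. U i x ^ m i) * W x)) (dirichlet_value \<kappa> m)"
    and monomial: "\<And>\<alpha> :: 'n \<Rightarrow> nat. (\<exists>m. e * (\<Sum>i\<in>UNIV. m i) \<le> (\<Sum>i\<in>UNIV. \<alpha> i) \<and> (\<forall>x. (\<Prod>j\<in>UNIV. (x $ j) ^ \<alpha> j) = (\<Prod>i\<in>UNIV. U i x ^ m i)))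
        \<or> (\<forall>F\<in>borel_measurable borel. (LINT x:\<Omega>|lborel. F (U i0 x) * (\<Prod>j\<in>UNIV. (x $ j) ^ \<alpha> j) * W x) = 0)"
    and interior: "\<exists>y r. 0 < r \<and> ball y r \<subseteq> \<Omega> \<and> (\<forall>x\<in>ball y r. W x > 0)"
begin

sublocale J: jacobi_weight "(\<Sum>i\<in>UNIV - {i0}. \<kappa> i + 1/2) - 1" "\<kappa> i0 - 1/2"
  by unfold_locales (use dim_gt \<kappa>_nonneg[of i0] in auto)

text \<open>The end point \<open>s = 0\<close>, at which the means are tested, corresponds to the set where the coordinate \<open>i0\<close> is \<open>1\<close>.\<close>

definition s :: "real ^ 'n \<Rightarrow> real" where "s x = 1 - U i0 x"

lemma s_cont: "continuous_on S s"
  unfolding s_def by (intro continuous_intros continuous_on_subset[OF U_cont]) auto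

lemma s_meas [measurable]: "s \<in> borel_measurable borel"
  by (intro borel_measurable_continuous_onI s_cont)

lemma U_meas [measurable]: "U i \<in> borel_measurable borel"
  by (intro borel_measurable_continuous_onI U_cont)

lemma dom_meas [measurable]: "\<Omega> \<in> sets borel"
  using compact_dom by (intro borel_compact)

lemma s_range: "x \<in> \<Omega> \<Longrightarrow> s x \<in> {0..1}"
  using U_range[of x i0] by (simp add: s_def)

definition rest_degree :: "('n option \<Rightarrow> nat) \<Rightarrow> nat" where "rest_degree m = (\<Sum>i\<in>UNIV - {i0}. m i)"

definition fibre_const :: "('n option \<Rightarrow> nat) \<Rightarrow> real" where
  "fibre_const m = (\<Prod>i\<in>UNIV - {i0}. Gamma (real (m i) + \<kappa> i + 1/2)) / Gamma (\<Sum>i\<in>UNIV - {i0}. real (m i) + \<kappa> i + 1/2)"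

lemma fibre_const_pos: "fibre_const m > 0"
proof -
  have "real (m i) + \<kappa> i + 1/2 > 0" for i using \<kappa>_nonneg[of i] by (simp add: add_nonneg_pos)
  moreover have "UNIV - {i0} \<noteq> {}" using dim_gt by (metis less_numeral_extra(3) sum.empty zero_less_divide_1_iff zero_less_numeral less_asym)
  ultimately show ?thesis unfolding fibre_const_def by (intro divide_pos_pos prod_pos Gamma_real_pos sum_pos) auto
qed

definition weighted_measure :: "('n option \<Rightarrow> nat) \<Rightarrow> (real ^ 'n) measure" where
  "weighted_measure m = density lborel (\<lambda>x. ennreal (indicator \<Omega> x * ((\<Prod>i\<in>UNIV. U i x ^ m i) * W x)))"

lemma integral_weighted_measure:
  assumes [measurable]: "G \<in> borel_measurable borel"
  shows "integrable (weighted_measure m) G \<longleftrightarrow> set_integrable lborel \<Omega> (\<lambda>x. G x * (\<Prod>i\<in>UNIV. U i x ^ m i) * W x)"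
    "(LINT x|weighted_measure m. G x) = (LINT x:\<Omega>|lborel. G x * (\<Prod>i\<in>UNIV. U i x ^ m i) * W x)"
proof -
  have nn: "0 \<le> indicator \<Omega> x * ((\<Prod>i\<in>UNIV. U i x ^ m i) * W x)" for x
    using U_range[of x] W_nonneg[of x] by (auto simp: indicator_def intro!: mult_nonneg_nonneg prod_nonneg)
  show "integrable (weighted_measure m) G \<longleftrightarrow> set_integrable lborel \<Omega> (\<lambda>x. G x * (\<Prod>i\<in>UNIV. U i x ^ m i) * W x)"
    unfolding weighted_measure_def set_integrable_def by (subst integrable_density[OF _ _ AE_I2[OF nn]]) (auto simp: mult_ac)
  show "(LINT x|weighted_measure m. G x) = (LINT x:\<Omega>|lborel. G x * (\<Prod>i\<in>UNIV. U i x ^ m i) * W x)"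
    unfolding weighted_measure_def set_lebesgue_integral_def by (subst integral_density[OF _ _ AE_I2[OF nn]]) (auto simp: mult_ac)
qed

lemma sets_weighted_measure [measurable_cong, simp]: "sets (weighted_measure m) = sets borel" by (simp add: weighted_measure_def)

lemma finite_weighted_measure: "finite_measure (weighted_measure m)"
proof -
  have "set_integrable lborel \<Omega> (\<lambda>x. 1 * (\<Prod>i\<in>UNIV. U i x ^ m i) * W x)"
    using has_bochner_integral_iff[THEN iffD1, OF dirichlet[of m]] by (simp add: set_integrable_def)
  then have "integrable (weighted_measure m) (\<lambda>x. 1 :: real)" by (subst integral_weighted_measure(1)) auto
  then have "emeasure (weighted_measure m) (space (weighted_measure m)) < \<infinity>" unfolding integrable_iff_bounded by simp
  then show ?thesis by (intro finite_measureI) auto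
qed

lemma AE_weighted_measure: "AE x in weighted_measure m. x \<in> \<Omega>"
  unfolding weighted_measure_def by (subst AE_density) (auto simp: indicator_def)

definition pushed :: "('n option \<Rightarrow> nat) \<Rightarrow> real measure" where
  "pushed m = density J.nu (\<lambda>t. ennreal (indicator {0..1} t * (fibre_const m * (t ^ rest_degree m * (1 - t) ^ m i0))))"

lemma integral_pushed:
  assumes [measurable]: "F \<in> borel_measurable borel"
  shows "integrable (pushed m) F \<longleftrightarrow> integrable J.nu (\<lambda>t. F t * (t ^ rest_degree m * (1 - t) ^ m i0))"
    "(LINT t|pushed m. F t) = fibre_const m * (LINT t|J.nu. F t * (t ^ rest_degree m * (1 - t) ^ m i0))"
proof -
  have nn: "0 \<le> indicator {0..1} t * (fibre_const m * (t ^ rest_degree m * (1 - t) ^ m i0))" for t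
    using fibre_const_pos[of m] by (auto simp: indicator_def intro!: mult_nonneg_nonneg zero_le_power)
  have ae: "AE t in J.nu. indicator {0..1} t * (fibre_const m * (t ^ rest_degree m * (1 - t) ^ m i0)) * F t = fibre_const m * (F t * (t ^ rest_degree m * (1 - t) ^ m i0))"
    using J.AE_nu by eventually_elim simp
  have "integrable (pushed m) F \<longleftrightarrow> integrable J.nu (\<lambda>t. fibre_const m * (F t * (t ^ rest_degree m * (1 - t) ^ m i0)))"
    unfolding pushed_def
    by (subst integrable_density[OF _ _ AE_I2[OF nn]], simp, simp, unfold real_scaleR_def, rule integrable_cong_AE[OF _ _ ae]) auto
  then show "integrable (pushed m) F \<longleftrightarrow> integrable J.nu (\<lambda>t. F t * (t ^ rest_degree m * (1 - t) ^ m i0))"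
    using fibre_const_pos[of m] by simp
  have "(LINT t|pushed m. F t) = (LINT t|J.nu. fibre_const m * (F t * (t ^ rest_degree m * (1 - t) ^ m i0)))"
    unfolding pushed_def
    by (subst integral_density[OF _ _ AE_I2[OF nn]], simp, simp, unfold real_scaleR_def, rule integral_cong_AE[OF _ _ ae]) auto
  then show "(LINT t|pushed m. F t) = fibre_const m * (LINT t|J.nu. F t * (t ^ rest_degree m * (1 - t) ^ m i0))" by simp
qed

text \<open>By the Dirichlet integrals the two measures have the same moments, which are again Beta functions.\<close>

lemma pushforward: "distr (weighted_measure m) borel s = pushed m"
proof (rule finite_measure_eqI_moments)
  interpret finite_measure "weighted_measure m" by (rule finite_weighted_measure)
  show "finite_measure (distr (weighted_measure m) borel s)" by (rule finite_measure_distr) measurable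
  have "integrable J.nu (\<lambda>t. 1 * (t ^ rest_degree m * (1 - t) ^ m i0))" by (intro J.integrable_nu_cont continuous_intros)
  then have "integrable (pushed m) (\<lambda>_. 1 :: real)" by (subst integral_pushed(1)) auto
  then have "emeasure (pushed m) (space (pushed m)) < \<infinity>" unfolding integrable_iff_bounded by simp
  then show "finite_measure (pushed m)" by (intro finite_measureI) auto
  show "AE x in distr (weighted_measure m) borel s. x \<in> {0..1}"
  proof (subst AE_distr_iff)
    show "AE x in weighted_measure m. s x \<in> {0..1}" using AE_weighted_measure by eventually_elim (rule s_range)
  qed auto
  show "AE x in pushed m. x \<in> {0..1}" unfolding pushed_def by (subst AE_density) (auto simp: indicator_def)
  show "(LINT x|distr (weighted_measure m) borel s. (1 - x) ^ k) = (LINT x|pushed m. (1 - x) ^ k)" for k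
  proof -
    define mk where "mk = m(i0 := m i0 + k)"
    define A where "A i = real (m i) + \<kappa> i + 1/2" for i
    have A: "A i > 0" for i using \<kappa>_nonneg[of i] by (simp add: A_def add_nonneg_pos)
    have "(LINT x|distr (weighted_measure m) borel s. (1 - x) ^ k) = (LINT x|weighted_measure m. (1 - s x) ^ k)" by (rule integral_distr) auto
    also have "\<dots> = (LINT x:\<Omega>|lborel. (1 - s x) ^ k * (\<Prod>i\<in>UNIV. U i x ^ m i) * W x)" by (rule integral_weighted_measure(2)) measurable
    also have "\<dots> = (LINT x|lborel. indicator \<Omega> x * ((\<Prod>i\<in>UNIV. U i x ^ mk i) * W x))"
    proof -
      have "(\<Prod>i\<in>UNIV. U i x ^ mk i) = (1 - s x) ^ k * (\<Prod>i\<in>UNIV. U i x ^ m i)" for x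
        by (simp add: mk_def s_def prod.remove[of UNIV i0] power_add mult_ac)
      then show ?thesis by (simp add: set_lebesgue_integral_def)
    qed
    also have "\<dots> = dirichlet_value \<kappa> mk" by (rule has_bochner_integral_integral_eq[OF dirichlet])
    also have "\<dots> = (\<Prod>i\<in>UNIV - {i0}. Gamma (A i)) * Gamma (A i0 + real k) / Gamma ((\<Sum>i\<in>UNIV - {i0}. A i) + (A i0 + real k))"
    proof -
      have p: "(\<Prod>i\<in>UNIV. Gamma (real (mk i) + \<kappa> i + 1/2)) = Gamma (A i0 + real k) * (\<Prod>i\<in>UNIV - {i0}. Gamma (A i))"
        by (simp add: mk_def A_def prod.remove[of UNIV i0] add_ac)
      have q: "(\<Sum>i\<in>UNIV. real (mk i) + \<kappa> i + 1/2) = (A i0 + real k) + (\<Sum>i\<in>UNIV - {i0}. A i)"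
        by (simp add: mk_def A_def sum.remove[of UNIV i0] add_ac)
      show ?thesis unfolding dirichlet_value_def p q by (simp add: mult.commute add.commute)
    qed
    also have "\<dots> = fibre_const m * Beta (\<Sum>i\<in>UNIV - {i0}. A i) (A i0 + real k)"
    proof -
      have "UNIV - {i0} \<noteq> {}" using dim_gt by (metis less_numeral_extra(3) sum.empty zero_less_divide_1_iff zero_less_numeral less_asym)
      then have "Gamma (\<Sum>i\<in>UNIV - {i0}. A i) > 0" using A by (intro Gamma_real_pos sum_pos) auto
      then show ?thesis unfolding fibre_const_def Beta_def A_def[symmetric] by simp
    qed
    also have "Beta (\<Sum>i\<in>UNIV - {i0}. A i) (A i0 + real k) = (LINT t|J.nu. t ^ rest_degree m * (1 - t) ^ (m i0 + k))"
    proof -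
      have 1: "(\<Sum>i\<in>UNIV - {i0}. A i) = (\<Sum>i\<in>UNIV - {i0}. \<kappa> i + 1/2) - 1 + 1 + real (rest_degree m)"
        unfolding A_def rest_degree_def of_nat_sum by (simp only: sum.distrib[symmetric] diff_add_cancel) (intro sum.cong refl, simp)
      have 2: "A i0 + real k = \<kappa> i0 - 1/2 + 1 + real (m i0 + k)" by (simp add: A_def)
      show ?thesis unfolding 1 2 by (rule J.moment(2)[symmetric])
    qed
    also have "fibre_const m * (LINT t|J.nu. t ^ rest_degree m * (1 - t) ^ (m i0 + k)) = (LINT x|pushed m. (1 - x) ^ k)"
      by (subst integral_pushed(2)) (auto simp: power_add mult_ac)
    finally show ?thesis .
  qed
qed (auto simp: pushed_def)

lemma reduction:
  assumes [measurable]: "F \<in> borel_measurable borel"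
  shows "set_integrable lborel \<Omega> (\<lambda>x. F (s x) * (\<Prod>i\<in>UNIV. U i x ^ m i) * W x) \<longleftrightarrow> integrable J.nu (\<lambda>t. F t * (t ^ rest_degree m * (1 - t) ^ m i0))"
    "(LINT x:\<Omega>|lborel. F (s x) * (\<Prod>i\<in>UNIV. U i x ^ m i) * W x) = fibre_const m * (LINT t|J.nu. F t * (t ^ rest_degree m * (1 - t) ^ m i0))"
proof -
  have G: "(\<lambda>x. F (s x)) \<in> borel_measurable borel" by measurable
  show "set_integrable lborel \<Omega> (\<lambda>x. F (s x) * (\<Prod>i\<in>UNIV. U i x ^ m i) * W x) \<longleftrightarrow> integrable J.nu (\<lambda>t. F t * (t ^ rest_degree m * (1 - t) ^ m i0))"
    unfolding integral_weighted_measure(1)[OF G, symmetric] integral_pushed(1)[OF assms, symmetric] pushforward[symmetric]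
    by (rule integrable_distr_eq[symmetric]) measurable
  show "(LINT x:\<Omega>|lborel. F (s x) * (\<Prod>i\<in>UNIV. U i x ^ m i) * W x) = fibre_const m * (LINT t|J.nu. F t * (t ^ rest_degree m * (1 - t) ^ m i0))"
    unfolding integral_weighted_measure(2)[OF G, symmetric] integral_pushed(2)[OF assms, symmetric] pushforward[symmetric]
    by (rule integral_distr[symmetric]) measurable
qed

end

section \<open>Polynomials in several variables\<close>

definition monomial_fun :: "('n::finite \<Rightarrow> nat) \<Rightarrow> real ^ 'n \<Rightarrow> real" where
  "monomial_fun \<alpha> x = (\<Prod>i\<in>UNIV. (x $ i) ^ \<alpha> i)"

lemma finite_exponents: "finite {\<alpha> :: 'n::finite \<Rightarrow> nat. (\<Sum>i\<in>UNIV. \<alpha> i) \<le> n}"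
proof (rule finite_subset)
  have "\<alpha> i \<le> n" if "(\<Sum>i\<in>UNIV. \<alpha> i) \<le> n" for \<alpha> :: "'n \<Rightarrow> nat" and i
    using member_le_sum[of i UNIV \<alpha>] that by simp
  then show "{\<alpha> :: 'n \<Rightarrow> nat. (\<Sum>i\<in>UNIV. \<alpha> i) \<le> n} \<subseteq> PiE UNIV (\<lambda>_. {..n})" by auto
qed (intro finite_PiE, auto)

lemma polys_iff: "P \<in> polys_deg_le n \<longleftrightarrow> (\<exists>c. P = (\<lambda>x. \<Sum>\<alpha> | (\<Sum>i\<in>UNIV. \<alpha> i) \<le> n. c \<alpha> * monomial_fun \<alpha> x))"
  unfolding polys_deg_le_def monomial_fun_def by simp

lemma polys_add: "P \<in> polys_deg_le n \<Longrightarrow> Q \<in> polys_deg_le n \<Longrightarrow> (\<lambda>x. P x + Q x) \<in> polys_deg_le n"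
  unfolding polys_iff
proof (elim exE)
  fix c d assume "P = (\<lambda>x. \<Sum>\<alpha> | (\<Sum>i\<in>UNIV. \<alpha> i) \<le> n. c \<alpha> * monomial_fun \<alpha> x)" "Q = (\<lambda>x. \<Sum>\<alpha> | (\<Sum>i\<in>UNIV. \<alpha> i) \<le> n. d \<alpha> * monomial_fun \<alpha> x)"
  then show "\<exists>c. (\<lambda>x. P x + Q x) = (\<lambda>x. \<Sum>\<alpha> | (\<Sum>i\<in>UNIV. \<alpha> i) \<le> n. c \<alpha> * monomial_fun \<alpha> x)"
    by (intro exI[of _ "\<lambda>\<alpha>. c \<alpha> + d \<alpha>"]) (simp add: sum.distrib distrib_right)
qed

lemma polys_scale: "P \<in> polys_deg_le n \<Longrightarrow> (\<lambda>x. r * P x) \<in> polys_deg_le n"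
  unfolding polys_iff
proof (elim exE)
  fix c assume "P = (\<lambda>x. \<Sum>\<alpha> | (\<Sum>i\<in>UNIV. \<alpha> i) \<le> n. c \<alpha> * monomial_fun \<alpha> x)"
  then show "\<exists>c. (\<lambda>x. r * P x) = (\<lambda>x. \<Sum>\<alpha> | (\<Sum>i\<in>UNIV. \<alpha> i) \<le> n. c \<alpha> * monomial_fun \<alpha> x)"
    by (intro exI[of _ "\<lambda>\<alpha>. r * c \<alpha>"]) (simp add: sum_distrib_left mult.assoc)
qed

lemma polys_monomial: "(\<Sum>i\<in>UNIV. \<alpha> i) \<le> n \<Longrightarrow> monomial_fun \<alpha> \<in> polys_deg_le n"
proof -
  assume le: "(\<Sum>i\<in>UNIV. \<alpha> i) \<le> n"
  have "(\<Sum>\<beta> | (\<Sum>i\<in>UNIV. \<beta> i) \<le> n. (if \<beta> = \<alpha> then 1 else 0) * monomial_fun \<beta> x) = monomial_fun \<alpha> x" for x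
  proof -
    have "(\<Sum>\<beta> | (\<Sum>i\<in>UNIV. \<beta> i) \<le> n. (if \<beta> = \<alpha> then 1 else 0) * monomial_fun \<beta> x) = (\<Sum>\<beta> | (\<Sum>i\<in>UNIV. \<beta> i) \<le> n. if \<beta> = \<alpha> then monomial_fun \<beta> x else 0)"
      by (intro sum.cong refl) auto
    then show ?thesis using sum.delta[OF finite_exponents, of \<alpha> "\<lambda>\<beta>. monomial_fun \<beta> x" n] le by simp
  qed
  then show ?thesis unfolding polys_iff by (intro exI[of _ "\<lambda>\<beta>. if \<beta> = \<alpha> then 1 else 0"]) (simp add: fun_eq_iff)
qed

lemma polys_zero: "(\<lambda>x. 0) \<in> polys_deg_le n"
  unfolding polys_iff by (intro exI[of _ "\<lambda>_. 0"]) simp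

lemma polys_const: "(\<lambda>x. r) \<in> polys_deg_le n"
proof -
  have "(\<lambda>x. r * monomial_fun (\<lambda>_. 0) x) \<in> polys_deg_le n" by (intro polys_scale polys_monomial) simp
  then show ?thesis by (simp add: monomial_fun_def)
qed

lemma polys_sum: "(\<And>a. a \<in> A \<Longrightarrow> f a \<in> polys_deg_le n) \<Longrightarrow> (\<lambda>x. \<Sum>a\<in>A. f a x) \<in> polys_deg_le n"
  by (induction A rule: infinite_finite_induct) (auto intro: polys_add polys_zero)

lemma polys_subset: "P \<in> polys_deg_le m \<Longrightarrow> m \<le> n \<Longrightarrow> P \<in> polys_deg_le n"
proof -
  assume P: "P \<in> polys_deg_le m" and mn: "m \<le> n"
  obtain c where "P = (\<lambda>x. \<Sum>\<alpha> | (\<Sum>i\<in>UNIV. \<alpha> i) \<le> m. c \<alpha> * monomial_fun \<alpha> x)" using P unfolding polys_iff by blast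
  moreover have "(\<lambda>x. \<Sum>\<alpha> | (\<Sum>i\<in>UNIV. \<alpha> i) \<le> m. c \<alpha> * monomial_fun \<alpha> x) \<in> polys_deg_le n"
    by (intro polys_sum polys_scale polys_monomial) (use mn in auto)
  ultimately show ?thesis by simp
qed

lemma polys_mult:
  assumes "P \<in> polys_deg_le m" "Q \<in> polys_deg_le n"
  shows "(\<lambda>x. P x * Q x) \<in> polys_deg_le (m + n)"
proof -
  obtain c where P: "P = (\<lambda>x. \<Sum>\<alpha> | (\<Sum>i\<in>UNIV. \<alpha> i) \<le> m. c \<alpha> * monomial_fun \<alpha> x)" using assms(1) unfolding polys_iff by blast
  obtain d where Q: "Q = (\<lambda>x. \<Sum>\<alpha> | (\<Sum>i\<in>UNIV. \<alpha> i) \<le> n. d \<alpha> * monomial_fun \<alpha> x)" using assms(2) unfolding polys_iff by blast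
  have mm: "monomial_fun \<alpha> x * monomial_fun \<beta> x = monomial_fun (\<lambda>i. \<alpha> i + \<beta> i) x" for \<alpha> \<beta> and x :: "real ^ 'a"
    by (simp add: monomial_fun_def power_add prod.distrib)
  have "(\<lambda>x. P x * Q x) = (\<lambda>x. \<Sum>\<alpha> | (\<Sum>i\<in>UNIV. \<alpha> i) \<le> m. \<Sum>\<beta> | (\<Sum>i\<in>UNIV. \<beta> i) \<le> n. (c \<alpha> * d \<beta>) * monomial_fun (\<lambda>i. \<alpha> i + \<beta> i) x)"
    unfolding P Q sum_product mm[symmetric] by (simp add: mult_ac)
  also have "\<dots> \<in> polys_deg_le (m + n)"
    by (intro polys_sum polys_scale polys_monomial) (auto simp: sum.distrib intro: add_mono)
  finally show ?thesis .
qed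

lemma polys_power: "P \<in> polys_deg_le m \<Longrightarrow> (\<lambda>x. P x ^ k) \<in> polys_deg_le (m * k)"
proof (induction k)
  case 0 then show ?case by (simp add: polys_const)
next
  case (Suc k)
  then have "(\<lambda>x. P x * P x ^ k) \<in> polys_deg_le (m + m * k)" by (intro polys_mult) auto
  then show ?case by simp
qed

lemma polys_coord: "(\<lambda>x::real ^ 'n::finite. x $ j) \<in> polys_deg_le 1"
proof -
  have "monomial_fun (\<lambda>i. if i = j then 1 else 0) = (\<lambda>x::real ^ 'n. x $ j)"
  proof
    fix x :: "real ^ 'n"
    have "monomial_fun (\<lambda>i. if i = j then 1 else 0) x = (\<Prod>i\<in>UNIV. if i = j then x $ i else 1)"
      unfolding monomial_fun_def by (intro prod.cong refl) auto
    then show "monomial_fun (\<lambda>i. if i = j then 1 else 0) x = x $ j" by (simp add: prod.delta)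
  qed
  moreover have "monomial_fun (\<lambda>i. if i = j then 1 else 0) \<in> polys_deg_le 1" by (rule polys_monomial) simp
  ultimately show ?thesis by simp
qed

lemma polys_continuous: "P \<in> polys_deg_le n \<Longrightarrow> continuous_on S P"
  unfolding polys_iff monomial_fun_def by (auto intro!: continuous_intros)

text \<open>On each line through the centre of the ball the polynomial has infinitely many zeros.\<close>

lemma polys_zero_on_ball:
  fixes P :: "real ^ 'n::finite \<Rightarrow> real"
  assumes P: "P \<in> polys_deg_le n" and r: "r > 0" and zero: "\<And>x. x \<in> ball y r \<Longrightarrow> P x = 0"
  shows "P x = 0"
proof -
  obtain c where c: "P = (\<lambda>x. \<Sum>\<alpha> | (\<Sum>i\<in>UNIV. \<alpha> i) \<le> n. c \<alpha> * monomial_fun \<alpha> x)" using P unfolding polys_iff by blast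
  define v where "v = x - y"
  define p where "p = (\<Sum>\<alpha> | (\<Sum>i\<in>UNIV. \<alpha> i) \<le> n. smult (c \<alpha>) (\<Prod>i\<in>UNIV. [: y $ i, v $ i :] ^ \<alpha> i))"
  have p: "poly p t = P (y + t *\<^sub>R v)" for t
    unfolding p_def c monomial_fun_def by (simp add: poly_sum poly_prod)
  define d where "d = r / (norm v + 1)"
  have d: "d > 0" using r by (simp add: d_def add_nonneg_pos)
  have "poly p t = 0" if "t \<in> {0<..<d}" for t
  proof -
    have "t * norm v \<le> t * (norm v + 1)" using that by (intro mult_left_mono) auto
    also have "\<dots> < d * (norm v + 1)" using that by (intro mult_strict_right_mono) (auto simp: add_nonneg_pos)
    also have "\<dots> = r" using norm_ge_zero[of v] by (simp add: d_def add_nonneg_eq_0_iff)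
    finally have "y + t *\<^sub>R v \<in> ball y r" using that by (simp add: dist_norm)
    then show ?thesis unfolding p by (rule zero)
  qed
  then have "{0<..<d} \<subseteq> {t. poly p t = 0}" by auto
  moreover have "infinite {0<..<d}" using d by simp
  ultimately have "infinite {t. poly p t = 0}" using infinite_super by blast
  then have "p = 0" using poly_roots_finite by blast
  then have "P (y + 1 *\<^sub>R v) = 0" using p[of 1] by simp
  then show ?thesis by (simp add: v_def)
qed

text \<open>Riesz representation in the span of finitely many functions, by induction on their number: the part of a new function that is
orthogonal to the span of the others either vanishes or adds a multiple of itself to the representer.\<close>

lemma finite_span_representer:
  fixes \<phi> :: "'a \<Rightarrow> 'x \<Rightarrow> real" and ip :: "('x \<Rightarrow> real) \<Rightarrow> ('x \<Rightarrow> real) \<Rightarrow> real" and L :: "('x \<Rightarrow> real) \<Rightarrow> real"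
  assumes V: "\<And>f g r. f \<in> V \<Longrightarrow> g \<in> V \<Longrightarrow> (\<lambda>x. f x + r * g x) \<in> V" "(\<lambda>x. 0) \<in> V"
    and ip_lin: "\<And>f g k r. f \<in> V \<Longrightarrow> g \<in> V \<Longrightarrow> k \<in> V \<Longrightarrow> ip (\<lambda>x. f x + r * g x) k = ip f k + r * ip g k"
    and ip_sym: "\<And>f g. f \<in> V \<Longrightarrow> g \<in> V \<Longrightarrow> ip f g = ip g f"
    and ip_def: "\<And>f. f \<in> V \<Longrightarrow> ip f f = 0 \<Longrightarrow> f = (\<lambda>x. 0)"
    and L: "\<And>f g r. f \<in> V \<Longrightarrow> g \<in> V \<Longrightarrow> L (\<lambda>x. f x + r * g x) = L f + r * L g"
    and A: "finite A" and \<phi>: "\<And>a. a \<in> A \<Longrightarrow> \<phi> a \<in> V"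
  shows "\<exists>k. (\<exists>c. k = (\<lambda>x. \<Sum>a\<in>A. c a * \<phi> a x)) \<and> (\<forall>c. ip (\<lambda>x. \<Sum>a\<in>A. c a * \<phi> a x) k = L (\<lambda>x. \<Sum>a\<in>A. c a * \<phi> a x))"
  using A \<phi> L
proof (induction A arbitrary: L rule: finite_induct)
  case empty
  have "ip (\<lambda>x. 0) (\<lambda>x. 0) = 0" using ip_lin[OF V(2) V(2) V(2), of 1] by simp
  moreover have "L (\<lambda>x. 0) = 0" using empty(2)[OF V(2) V(2), of 1] by simp
  ultimately show ?case by simp
next
  case (insert a A)
  define sp where "sp c = (\<lambda>x. \<Sum>a\<in>A. c a * \<phi> a x)" for c
  have spV: "sp c \<in> V" for c
  proof -
    have "(\<lambda>x. \<Sum>b\<in>B. c b * \<phi> b x) \<in> V" if "B \<subseteq> A" "finite B" for B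
      using that(2,1)
    proof (induction B rule: finite_induct)
      case empty then show ?case using V(2) by simp
    next
      case (insert b B)
      then have "(\<lambda>x. (\<Sum>b\<in>B. c b * \<phi> b x) + c b * \<phi> b x) \<in> V" using \<open>\<And>a'. a' \<in> Set.insert a A \<Longrightarrow> \<phi> a' \<in> V\<close> by (intro V) auto
      then show ?case using insert by (simp add: add.commute)
    qed
    then show ?thesis using insert(1) by (simp add: sp_def)
  qed
  have fV: "\<phi> a \<in> V" using insert by auto
  have "\<exists>f0. (\<exists>c. f0 = sp c) \<and> (\<forall>c. ip (sp c) f0 = ip (sp c) (\<phi> a))"
    unfolding sp_def by (rule insert.IH) (use insert.prems in \<open>auto intro!: ip_lin fV\<close>)
  then obtain c0 where c0: "\<And>c. ip (sp c) (sp c0) = ip (sp c) (\<phi> a)" by blast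
  define f1 where "f1 = (\<lambda>x. \<phi> a x + (-1) * sp c0 x)"
  have f1V: "f1 \<in> V" unfolding f1_def by (intro V fV spV)
  have orth: "ip f1 (sp c) = 0" for c
    unfolding f1_def using ip_lin[OF fV spV[of c0] spV[of c], of "-1"] c0[of c] ip_sym[OF spV[of c] spV[of c0]] ip_sym[OF spV[of c] fV] by simp
  have "\<exists>k. (\<exists>c. k = sp c) \<and> (\<forall>c. ip (sp c) k = L (sp c))"
    unfolding sp_def by (rule insert.IH) (use insert.prems in auto)
  then obtain c1 where c1: "\<And>c. ip (sp c) (sp c1) = L (sp c)" by blast
  define q where "q = (if ip f1 f1 = 0 then 0 else (L f1) / ip f1 f1)"
  define k where "k = (\<lambda>x. sp c1 x + q * f1 x)"
  have kV: "k \<in> V" unfolding k_def by (intro V spV f1V)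
  have ipk: "ip g k = ip g (sp c1) + q * ip g f1" if "g \<in> V" for g
    using ip_lin[OF spV[of c1] f1V that, of q] ip_sym[OF that kV] ip_sym[OF that spV[of c1]] ip_sym[OF that f1V] by (simp add: k_def)
  have f1k: "ip f1 k = L f1"
  proof (cases "ip f1 f1 = 0")
    case True
    then have "f1 = (\<lambda>x. 0)" by (rule ip_def[OF f1V])
    moreover have "L (\<lambda>x. 0) = 0" using insert.prems(2)[OF V(2) V(2), of 1] by simp
    ultimately show ?thesis using ipk[OF f1V] True orth[of c1] by (simp add: q_def)
  next
    case False
    then show ?thesis using ipk[OF f1V] orth[of c1] by (simp add: q_def)
  qed
  have spk: "ip (sp c) k = L (sp c)" for c
    using ipk[OF spV[of c]] c1[of c] orth[of c] ip_sym[OF spV[of c] f1V] by simp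
  have ins: "(\<lambda>x. \<Sum>b\<in>Set.insert a A. c b * \<phi> b x) = (\<lambda>x. sp (\<lambda>b. c b + c a * c0 b) x + c a * f1 x)" for c
    unfolding f1_def sp_def using insert(1,2) by (auto simp: fun_eq_iff algebra_simps sum.distrib sum_distrib_left sum_negf)
  have "ip (\<lambda>x. \<Sum>b\<in>Set.insert a A. c b * \<phi> b x) k = L (\<lambda>x. \<Sum>b\<in>Set.insert a A. c b * \<phi> b x)" for c
    unfolding ins using ip_lin[OF spV f1V kV] insert.prems(2)[OF spV f1V] spk f1k by simp
  moreover have "\<exists>c. k = (\<lambda>x. \<Sum>b\<in>Set.insert a A. c b * \<phi> b x)"
  proof (rule exI[of _ "\<lambda>b. if b = a then q else c1 b - q * c0 b"], rule ext)
    fix x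
    have "(\<Sum>b\<in>A. (if b = a then q else c1 b - q * c0 b) * \<phi> b x) = (\<Sum>b\<in>A. (c1 b - q * c0 b) * \<phi> b x)"
      using insert(2) by (intro sum.cong refl) auto
    then show "k x = (\<Sum>b\<in>Set.insert a A. (if b = a then q else c1 b - q * c0 b) * \<phi> b x)"
      unfolding k_def f1_def sp_def using insert(1,2) by (simp add: algebra_simps sum.distrib sum_subtractf sum_distrib_left sum_negf)
  qed
  ultimately show ?case by blast
qed

section \<open>Reproducing kernels and radial functions\<close>

context barycentric_weight
begin

abbreviation wint :: "(real ^ 'n \<Rightarrow> real) \<Rightarrow> real" where "wint \<equiv> weighted_integral \<Omega> W"

definition mass :: real where "mass = (LINT y:\<Omega>|lborel. W y)"

lemma W_int: "set_integrable lborel \<Omega> W" and mass_pos: "mass > 0"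
proof -
  have b: "has_bochner_integral lborel (\<lambda>x. indicator \<Omega> x * W x) (dirichlet_value \<kappa> (\<lambda>_. 0))"
    using dirichlet[of "\<lambda>_. 0"] by simp
  then show "set_integrable lborel \<Omega> W" by (simp add: set_integrable_def has_bochner_integral_iff)
  have A: "0 + \<kappa> i + 1/2 > 0" for i using \<kappa>_nonneg[of i] by simp
  have "mass = dirichlet_value \<kappa> (\<lambda>_. 0)" using b by (simp add: mass_def set_lebesgue_integral_def has_bochner_integral_iff)
  also have "\<dots> > 0" unfolding dirichlet_value_def
    by (intro divide_pos_pos prod_pos Gamma_real_pos sum_pos) (use A in auto)
  finally show "mass > 0" .
qed

lemma wint_eq: "wint G = (LINT y:\<Omega>|lborel. G y * W y) / mass"
  unfolding weighted_integral_def mass_def by (simp add: divide_inverse mult.commute)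

lemma comp_integrable:
  assumes [measurable]: "F \<in> borel_measurable borel" and F: "integrable J.nu F" and P: "continuous_on UNIV P"
  shows "set_integrable lborel \<Omega> (\<lambda>x. F (s x) * P x * W x)"
proof -
  have [measurable]: "P \<in> borel_measurable borel" by (rule borel_measurable_continuous_onI[OF P])
  have "compact (P ` \<Omega>)" by (intro compact_continuous_image continuous_on_subset[OF P] compact_dom) auto
  then obtain B where B: "\<forall>x\<in>P ` \<Omega>. norm x \<le> B" using compact_imp_bounded bounded_iff by metis
  have i: "set_integrable lborel \<Omega> (\<lambda>x. F (s x) * W x)"
    using reduction(1)[OF assms(1), of "\<lambda>_. 0"] F by (simp add: rest_degree_def)
  have i2: "set_integrable lborel \<Omega> (\<lambda>x. B * (F (s x) * W x))"
    by (intro set_integrable_mult_right i)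
  show ?thesis
  proof (rule set_integrable_bound[OF i2])
    show "set_borel_measurable lborel \<Omega> (\<lambda>x. F (s x) * P x * W x)" unfolding set_borel_measurable_def by measurable
    show "AE x\<in>\<Omega> in lborel. norm (F (s x) * P x * W x) \<le> norm (B * (F (s x) * W x))"
    proof (intro AE_I2 impI)
      fix x assume "x \<in> \<Omega>"
      then have "\<bar>P x\<bar> \<le> \<bar>B\<bar>" using B by (auto intro: order_trans[OF _ abs_ge_self])
      then have "\<bar>F (s x)\<bar> * \<bar>P x\<bar> * \<bar>W x\<bar> \<le> \<bar>F (s x)\<bar> * \<bar>B\<bar> * \<bar>W x\<bar>" by (intro mult_right_mono mult_left_mono) auto
      then show "norm (F (s x) * P x * W x) \<le> norm (B * (F (s x) * W x))" by (simp add: abs_mult mult_ac)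
    qed
  qed
qed

lemma cont_integrable: "continuous_on UNIV P \<Longrightarrow> set_integrable lborel \<Omega> (\<lambda>x. P x * W x)"
  using comp_integrable[of "\<lambda>_. 1" P] J.integrable_nu_cont[of "\<lambda>_. 1"] by simp

lemma monomial_cont: "continuous_on S (monomial_fun \<alpha>)"
  unfolding monomial_fun_def by (intro continuous_intros)

lemma monomial_reduction:
  "\<exists>q. degree q \<le> (\<Sum>i\<in>UNIV. \<alpha> i) div e \<and>
     (\<forall>F\<in>borel_measurable borel. integrable J.nu F \<longrightarrow> (LINT x:\<Omega>|lborel. F (s x) * monomial_fun \<alpha> x * W x) = (LINT t|J.nu. F t * poly q t))"
  using monomial[of \<alpha>]
proof
  assume "\<exists>m. e * (\<Sum>i\<in>UNIV. m i) \<le> (\<Sum>i\<in>UNIV. \<alpha> i) \<and> (\<forall>x. (\<Prod>j\<in>UNIV. (x $ j) ^ \<alpha> j) = (\<Prod>i\<in>UNIV. U i x ^ m i))"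
  then obtain m where m: "e * (\<Sum>i\<in>UNIV. m i) \<le> (\<Sum>i\<in>UNIV. \<alpha> i)" "\<And>x. monomial_fun \<alpha> x = (\<Prod>i\<in>UNIV. U i x ^ m i)" unfolding monomial_fun_def by blast
  define q where "q = smult (fibre_const m) (monom 1 (rest_degree m) * [:1, -1:] ^ m i0)"
  have "degree q \<le> degree (monom 1 (rest_degree m) :: real poly) + degree ([:1, -1:] ^ m i0 :: real poly)"
    unfolding q_def by (rule order_trans[OF degree_smult_le degree_mult_le])
  also have "\<dots> \<le> rest_degree m + m i0"
    by (intro add_mono degree_monom_le) (simp add: degree_power_eq)
  also have "\<dots> = (\<Sum>i\<in>UNIV. m i)" unfolding rest_degree_def by (simp add: sum.remove[of UNIV i0])
  also have "\<dots> \<le> (\<Sum>i\<in>UNIV. \<alpha> i) div e" using m(1) e_pos by (simp add: less_eq_div_iff_mult_less_eq mult.commute)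
  finally have deg: "degree q \<le> (\<Sum>i\<in>UNIV. \<alpha> i) div e" .
  have "(LINT x:\<Omega>|lborel. F (s x) * monomial_fun \<alpha> x * W x) = (LINT t|J.nu. F t * poly q t)" if F: "F \<in> borel_measurable borel" for F
  proof -
    have "(LINT x:\<Omega>|lborel. F (s x) * monomial_fun \<alpha> x * W x) = (LINT t|J.nu. fibre_const m * (F t * (t ^ rest_degree m * (1 - t) ^ m i0)))"
      unfolding m(2) reduction(2)[OF F] by simp
    also have "\<dots> = (LINT t|J.nu. F t * poly q t)"
      by (intro Bochner_Integration.integral_cong refl) (simp add: q_def poly_monom)
    finally show ?thesis .
  qed
  then show ?thesis using deg by blast
next
  assume z: "\<forall>F\<in>borel_measurable borel. (LINT x:\<Omega>|lborel. F (U i0 x) * (\<Prod>j\<in>UNIV. (x $ j) ^ \<alpha> j) * W x) = 0"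
  have "(LINT x:\<Omega>|lborel. F (s x) * monomial_fun \<alpha> x * W x) = 0" if [measurable]: "F \<in> borel_measurable borel" for F
  proof -
    have "(\<lambda>t. F (1 - t)) \<in> borel_measurable borel" by measurable
    from z[rule_format, OF this] show ?thesis by (simp add: s_def monomial_fun_def)
  qed
  then show ?thesis by (intro exI[of _ 0]) simp
qed

lemma integrable_F_poly:
  assumes [measurable]: "F \<in> borel_measurable borel" and F: "integrable J.nu F"
  shows "integrable J.nu (\<lambda>t. F t * poly q t)"
proof -
  have pm: "continuous_on UNIV (poly q)" by (intro continuous_intros)
  then have [measurable]: "poly q \<in> borel_measurable borel" by (rule borel_measurable_continuous_onI)
  obtain K where K: "K > 0" "\<And>t. t \<in> {0..1} \<Longrightarrow> \<bar>poly q t\<bar> \<le> K" using J.continuous_bounded_01[OF pm] by metis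
  show ?thesis
  proof (rule Bochner_Integration.integrable_bound[OF integrable_mult_right[OF F, of K]])
    show "AE t in J.nu. norm (F t * poly q t) \<le> norm (K * F t)"
      using J.AE_nu
    proof eventually_elim
      case (elim t)
      then have "\<bar>F t\<bar> * \<bar>poly q t\<bar> \<le> \<bar>F t\<bar> * K" by (intro mult_left_mono K) auto
      then show ?case using K(1) by (simp add: abs_mult mult.commute)
    qed
  qed measurable
qed

text \<open>The polynomial \<open>q\<close> is, up to a constant factor, the conditional expectation of \<open>P\<close> given \<open>s\<close>.\<close>

lemma poly_reduction:
  assumes "P \<in> polys_deg_le n"
  obtains q where "degree q \<le> n div e"
    "\<And>F. F \<in> borel_measurable borel \<Longrightarrow> integrable J.nu F \<Longrightarrow> (LINT x:\<Omega>|lborel. F (s x) * P x * W x) = (LINT t|J.nu. F t * poly q t)"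
proof -
  obtain c where c: "P = (\<lambda>x. \<Sum>\<alpha> | (\<Sum>i\<in>UNIV. \<alpha> i) \<le> n. c \<alpha> * monomial_fun \<alpha> x)" using assms unfolding polys_iff by blast
  have "\<exists>qq. \<forall>\<alpha>. degree (qq \<alpha>) \<le> (\<Sum>i\<in>UNIV. \<alpha> i) div e \<and>
     (\<forall>F\<in>borel_measurable borel. integrable J.nu F \<longrightarrow> (LINT x:\<Omega>|lborel. F (s x) * monomial_fun \<alpha> x * W x) = (LINT t|J.nu. F t * poly (qq \<alpha>) t))"
    by (rule choice) (rule allI, rule monomial_reduction)
  then obtain qq where qqq: "\<forall>\<alpha>. degree (qq \<alpha>) \<le> (\<Sum>i\<in>UNIV. \<alpha> i) div e \<and>
     (\<forall>F\<in>borel_measurable borel. integrable J.nu F \<longrightarrow> (LINT x:\<Omega>|lborel. F (s x) * monomial_fun \<alpha> x * W x) = (LINT t|J.nu. F t * poly (qq \<alpha>) t))"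
    by (rule exE)
  have qq: "\<And>\<alpha>. degree (qq \<alpha>) \<le> (\<Sum>i\<in>UNIV. \<alpha> i) div e"
     "\<And>\<alpha> F. F \<in> borel_measurable borel \<Longrightarrow> integrable J.nu F \<Longrightarrow> (LINT x:\<Omega>|lborel. F (s x) * monomial_fun \<alpha> x * W x) = (LINT t|J.nu. F t * poly (qq \<alpha>) t)"
    using qqq by simp_all
  define q where "q = (\<Sum>\<alpha> | (\<Sum>i\<in>UNIV. \<alpha> i) \<le> n. smult (c \<alpha>) (qq \<alpha>))"
  show ?thesis
  proof (rule that[of q])
    show "degree q \<le> n div e" unfolding q_def
      by (intro degree_sum_le finite_exponents) (auto intro!: order_trans[OF degree_smult_le] order_trans[OF qq(1)] div_le_mono)
    fix F :: "real \<Rightarrow> real" assume Fm [measurable]: "F \<in> borel_measurable borel" and F: "integrable J.nu F"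
    have ii: "set_integrable lborel \<Omega> (\<lambda>x. c \<alpha> * (F (s x) * monomial_fun \<alpha> x * W x))" for \<alpha>
      by (intro set_integrable_mult_right comp_integrable F monomial_cont) measurable
    have ij: "integrable J.nu (\<lambda>t. c \<alpha> * (F t * poly (qq \<alpha>) t))" for \<alpha>
      by (intro integrable_mult_right integrable_F_poly Fm F)
    have "(LINT x:\<Omega>|lborel. F (s x) * P x * W x) = (LINT x:\<Omega>|lborel. (\<Sum>\<alpha> | (\<Sum>i\<in>UNIV. \<alpha> i) \<le> n. c \<alpha> * (F (s x) * monomial_fun \<alpha> x * W x)))"
      unfolding c sum_distrib_left sum_distrib_right by (simp only: mult_ac)
    also have "\<dots> = (\<Sum>\<alpha> | (\<Sum>i\<in>UNIV. \<alpha> i) \<le> n. (LINT x:\<Omega>|lborel. c \<alpha> * (F (s x) * monomial_fun \<alpha> x * W x)))"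
      using ii unfolding set_lebesgue_integral_def set_integrable_def scaleR_sum_right
      by (intro Bochner_Integration.integral_sum) auto
    also have "\<dots> = (\<Sum>\<alpha> | (\<Sum>i\<in>UNIV. \<alpha> i) \<le> n. (LINT t|J.nu. c \<alpha> * (F t * poly (qq \<alpha>) t)))"
      using qq(2)[OF Fm F] by simp
    also have "\<dots> = (LINT t|J.nu. (\<Sum>\<alpha> | (\<Sum>i\<in>UNIV. \<alpha> i) \<le> n. c \<alpha> * (F t * poly (qq \<alpha>) t)))"
      using ij by (intro Bochner_Integration.integral_sum[symmetric]) auto
    also have "\<dots> = (LINT t|J.nu. F t * poly q t)"
      unfolding q_def by (simp add: poly_sum sum_distrib_left mult_ac)
    finally show "(LINT x:\<Omega>|lborel. F (s x) * P x * W x) = (LINT t|J.nu. F t * poly q t)" .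
  qed
qed

lemma s_poly: "s \<in> polys_deg_le e"
proof -
  have "(\<lambda>x. 1 + (-1) * U i0 x) \<in> polys_deg_le e" by (intro polys_add polys_const polys_scale U_poly)
  then show ?thesis by (simp add: s_def[abs_def])
qed

lemma comp_poly: "degree Q \<le> j \<Longrightarrow> (\<lambda>x. poly Q (s x)) \<in> polys_deg_le (e * j)"
  unfolding poly_altdef
  by (intro polys_sum polys_scale polys_subset[OF polys_power[OF s_poly]]) auto

lemma polys_int: "P \<in> polys_deg_le n \<Longrightarrow> Q \<in> polys_deg_le k \<Longrightarrow> set_integrable lborel \<Omega> (\<lambda>x. P x * Q x * W x)"
  by (intro cont_integrable continuous_intros polys_continuous)

text \<open>The polynomial vanishes almost everywhere on a ball where the weight is positive, so everywhere on this ball by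
continuity.\<close>

lemma poly_definite:
  assumes P: "P \<in> polys_deg_le n" and z: "wint (\<lambda>y. P y * P y) = 0"
  shows "P = (\<lambda>x. 0)"
proof -
  have Pc: "continuous_on UNIV P" by (rule polys_continuous[OF P])
  have [measurable]: "P \<in> borel_measurable borel" by (rule borel_measurable_continuous_onI[OF Pc])
  have "(LINT x|lborel. indicator \<Omega> x *\<^sub>R (P x * P x * W x)) = 0"
    using z mass_pos by (simp add: wint_eq set_lebesgue_integral_def)
  moreover have "integrable lborel (\<lambda>x. indicator \<Omega> x *\<^sub>R (P x * P x * W x))"
    using polys_int[OF P P] by (simp add: set_integrable_def)
  moreover have "AE x in lborel. 0 \<le> indicator \<Omega> x *\<^sub>R (P x * P x * W x)"
    using W_nonneg by (intro AE_I2) (auto simp: indicator_def)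
  ultimately have ae: "AE x in lborel. indicator \<Omega> x *\<^sub>R (P x * P x * W x) = 0"
    using integral_nonneg_eq_0_iff_AE by blast
  obtain y r where yr: "0 < r" "ball y r \<subseteq> \<Omega>" "\<And>x. x \<in> ball y r \<Longrightarrow> W x > 0" using interior by blast
  define N where "N = {x \<in> ball y r. P x \<noteq> 0}"
  have "open N"
  proof -
    have "N = ball y r \<inter> P -` (- {0})" by (auto simp: N_def)
    then show ?thesis using Pc by (auto intro!: continuous_open_preimage continuous_on_subset[OF Pc])
  qed
  have "AE x in lborel. x \<notin> N" using ae
    by eventually_elim (use yr in \<open>force simp: N_def\<close>)
  then have "N \<in> null_sets lborel" using \<open>open N\<close> by (subst AE_iff_null_sets) auto
  then have "negligible N" by (simp add: negligible_iff_null_sets null_sets_completionI)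
  then have "N = {}" using open_not_negligible[OF \<open>open N\<close>] by blast
  then have "P x = 0" if "x \<in> ball y r" for x using that by (auto simp: N_def)
  then show ?thesis using polys_zero_on_ball[OF P yr(1)] by blast
qed

lemma wint_add:
  assumes "set_integrable lborel \<Omega> (\<lambda>x. f x * W x)" "set_integrable lborel \<Omega> (\<lambda>x. g x * W x)"
  shows "wint (\<lambda>x. f x + r * g x) = wint f + r * wint g"
proof -
  have "(LINT x:\<Omega>|lborel. (f x + r * g x) * W x) = (LINT x:\<Omega>|lborel. f x * W x + r * (g x * W x))"
    by (simp add: distrib_right mult.assoc)
  also have "\<dots> = (LINT x:\<Omega>|lborel. f x * W x) + (LINT x:\<Omega>|lborel. r * (g x * W x))"
    using assms by (intro set_integral_add set_integrable_mult_right) auto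
  finally show ?thesis unfolding wint_eq by (simp add: add_divide_distrib)
qed

lemma wint_lin:
  assumes "f \<in> polys_deg_le n" "g \<in> polys_deg_le n" "k \<in> polys_deg_le n"
  shows "wint (\<lambda>y. (f y + r * g y) * k y) = wint (\<lambda>y. f y * k y) + r * wint (\<lambda>y. g y * k y)"
  using wint_add[OF polys_int[OF assms(1,3)] polys_int[OF assms(2,3)], of r] by (simp add: distrib_right mult.assoc)

lemma evaluation_representer:
  "\<exists>k\<in>polys_deg_le n. \<forall>P\<in>polys_deg_le n. wint (\<lambda>y. P y * k y) = P x"
proof -
  have "\<exists>k. (\<exists>c. k = (\<lambda>x. \<Sum>\<alpha> | (\<Sum>i\<in>UNIV. \<alpha> i) \<le> n. c \<alpha> * monomial_fun \<alpha> x)) \<and>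
     (\<forall>c. wint (\<lambda>y. (\<Sum>\<alpha> | (\<Sum>i\<in>UNIV. \<alpha> i) \<le> n. c \<alpha> * monomial_fun \<alpha> y) * k y) = (\<Sum>\<alpha> | (\<Sum>i\<in>UNIV. \<alpha> i) \<le> n. c \<alpha> * monomial_fun \<alpha> x))"
  proof (rule finite_span_representer[where V = "polys_deg_le n" and ip = "\<lambda>f g. wint (\<lambda>y. f y * g y)" and L = "\<lambda>f. f x"])
    show "wint (\<lambda>y. f y * g y) = wint (\<lambda>y. g y * f y)" for f g :: "real ^ 'n \<Rightarrow> real" by (simp add: mult.commute)
  qed (simp_all add: polys_add polys_scale polys_zero wint_lin poly_definite finite_exponents polys_monomial)
  then obtain k c0 where k: "k = (\<lambda>x. \<Sum>\<alpha> | (\<Sum>i\<in>UNIV. \<alpha> i) \<le> n. c0 \<alpha> * monomial_fun \<alpha> x)"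
     "\<And>c. wint (\<lambda>y. (\<Sum>\<alpha> | (\<Sum>i\<in>UNIV. \<alpha> i) \<le> n. c \<alpha> * monomial_fun \<alpha> y) * k y) = (\<Sum>\<alpha> | (\<Sum>i\<in>UNIV. \<alpha> i) \<le> n. c \<alpha> * monomial_fun \<alpha> x)"
    by (elim exE conjE) (rule that, assumption, erule allE)
  show ?thesis
  proof (intro bexI ballI)
    show "k \<in> polys_deg_le n" unfolding polys_iff k(1) by (rule exI) (rule refl)
    fix P :: "real ^ 'n \<Rightarrow> real" assume "P \<in> polys_deg_le n"
    then obtain c where c: "P = (\<lambda>x. \<Sum>\<alpha> | (\<Sum>i\<in>UNIV. \<alpha> i) \<le> n. c \<alpha> * monomial_fun \<alpha> x)" unfolding polys_iff by (rule exE)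
    show "wint (\<lambda>y. P y * k y) = P x" unfolding c by (rule k(2))
  qed
qed

text \<open>The kernel for degree exactly \<open>n\<close> is the difference of the representers of the evaluation at \<open>x\<close> on the polynomials of degree at
most \<open>n\<close> and at most \<open>n - 1\<close>. Definiteness makes it unique, so the description in \<open>repr_kernel_def\<close> applies.\<close>

lemma kernel:
  defines "K \<equiv> \<lambda>n x. repr_kernel \<Omega> W n x"
  shows "K n x \<in> orth_polys \<Omega> W n" "\<And>P. P \<in> orth_polys \<Omega> W n \<Longrightarrow> wint (\<lambda>y. P y * K n x y) = P x"
proof -
  have ex: "\<exists>k. k \<in> orth_polys \<Omega> W n \<and> (\<forall>P\<in>orth_polys \<Omega> W n. wint (\<lambda>y. P y * k y) = P x)"
  proof (cases n)
    case 0
    obtain k where "k \<in> polys_deg_le n" "\<forall>P\<in>polys_deg_le n. wint (\<lambda>y. P y * k y) = P x" using evaluation_representer by blast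
    then show ?thesis unfolding orth_polys_def 0 by auto
  next
    case (Suc l)
    obtain k1 where k1: "k1 \<in> polys_deg_le n" "\<And>P. P \<in> polys_deg_le n \<Longrightarrow> wint (\<lambda>y. P y * k1 y) = P x" using evaluation_representer by blast
    obtain k0 where k0: "k0 \<in> polys_deg_le l" "\<And>P. P \<in> polys_deg_le l \<Longrightarrow> wint (\<lambda>y. P y * k0 y) = P x" using evaluation_representer by blast
    have k0n: "k0 \<in> polys_deg_le n" using polys_subset[OF k0(1)] Suc by simp
    define k where "k = (\<lambda>y. k1 y + (-1) * k0 y)"
    have kn: "k \<in> polys_deg_le n" unfolding k_def by (intro polys_add polys_scale k1 k0n)
    have k: "wint (\<lambda>y. Q y * k y) = Q x - wint (\<lambda>y. Q y * k0 y)" if Q: "Q \<in> polys_deg_le n" for Q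
      using wint_lin[OF k1(1) k0n Q, of "-1"] k1(2)[OF Q] by (simp add: k_def mult.commute)
    have "wint (\<lambda>y. k y * Q y) = 0" if "m < n" "Q \<in> polys_deg_le m" for m Q
    proof -
      have "Q \<in> polys_deg_le l" "Q \<in> polys_deg_le n" using that Suc polys_subset[OF that(2)] by simp_all
      then show ?thesis using k[of Q] k0(2)[of Q] by (simp add: mult.commute)
    qed
    then have "k \<in> orth_polys \<Omega> W n" unfolding orth_polys_def using kn by blast
    moreover have "wint (\<lambda>y. P y * k y) = P x" if P: "P \<in> orth_polys \<Omega> W n" for P
    proof -
      have "P \<in> polys_deg_le n" "wint (\<lambda>y. P y * k0 y) = 0" using P k0(1) Suc unfolding orth_polys_def by auto
      then show ?thesis using k by simp
    qed
    ultimately show ?thesis by blast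
  qed
  have uniq: "k = k'" if k: "k \<in> orth_polys \<Omega> W n" "\<forall>P\<in>orth_polys \<Omega> W n. wint (\<lambda>y. P y * k y) = P x"
    and k': "k' \<in> orth_polys \<Omega> W n" "\<forall>P\<in>orth_polys \<Omega> W n. wint (\<lambda>y. P y * k' y) = P x" for k k'
  proof -
    have pn: "k \<in> polys_deg_le n" "k' \<in> polys_deg_le n" using k k' by (auto simp: orth_polys_def)
    define d where "d = (\<lambda>y. k y + (-1) * k' y)"
    have dn: "d \<in> polys_deg_le n" unfolding d_def by (intro polys_add polys_scale pn)
    have s: "wint (\<lambda>y. f y * g y) = wint (\<lambda>y. g y * f y)" for f g by (simp add: mult.commute)
    have "wint (\<lambda>y. d y * d y) = wint (\<lambda>y. k y * d y) + (-1) * wint (\<lambda>y. k' y * d y)"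
      using wint_lin[OF pn dn, of "-1"] by (simp add: d_def)
    also have "wint (\<lambda>y. k y * d y) = k x - k x"
      using wint_lin[OF pn(1) pn(2) pn(1), of "-1"] k k' s[of k d] s[of k' k] by (simp add: d_def)
    also have "wint (\<lambda>y. k' y * d y) = k' x - k' x"
      using wint_lin[OF pn(1) pn(2) pn(2), of "-1"] k k' s[of k' d] s[of k k'] by (simp add: d_def)
    finally have "d = (\<lambda>x. 0)" using poly_definite[OF dn] by simp
    then show ?thesis by (auto simp: d_def fun_eq_iff)
  qed
  have ex1: "\<exists>!k. k \<in> orth_polys \<Omega> W n \<and> (\<forall>P\<in>orth_polys \<Omega> W n. wint (\<lambda>y. P y * k y) = P x)"
    using ex uniq by blast
  have "K n x \<in> orth_polys \<Omega> W n \<and> (\<forall>P\<in>orth_polys \<Omega> W n. wint (\<lambda>y. P y * K n x y) = P x)"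
    using theI'[OF ex1] unfolding K_def repr_kernel_def .
  then show "K n x \<in> orth_polys \<Omega> W n" "\<And>P. P \<in> orth_polys \<Omega> W n \<Longrightarrow> wint (\<lambda>y. P y * K n x y) = P x" by auto
qed

lemma poly_int: "integrable J.nu (poly q)"
  by (intro J.integrable_nu_cont continuous_intros)

lemma poly_sq_zero:
  assumes "(LINT t|J.nu. poly q t * poly q t) = 0"
  shows "AE t in J.nu. poly q t = 0"
proof -
  have "integrable J.nu (\<lambda>t. poly q t * poly q t)" by (intro J.integrable_nu_cont continuous_intros)
  then have "AE t in J.nu. poly q t * poly q t = 0"
    using integral_nonneg_eq_0_iff_AE[of J.nu "\<lambda>t. poly q t * poly q t"] assms by simp
  then show ?thesis by eventually_elim simp
qed

lemma R_comp_orth: "(\<lambda>x. J.R j (s x)) \<in> orth_polys \<Omega> W (e * j)"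
proof -
  have "degree (J.Rp j) \<le> j" unfolding J.Rp_def
    by (intro degree_sum_le) (auto intro: order_trans[OF degree_monom_le])
  then have "(\<lambda>x. poly (J.Rp j) (s x)) \<in> polys_deg_le (e * j)" by (rule comp_poly)
  moreover have "wint (\<lambda>y. J.R j (s y) * Q y) = 0" if m: "m < e * j" and Q: "Q \<in> polys_deg_le m" for m Q
  proof -
    obtain q where q: "degree q \<le> m div e"
      "\<And>F. F \<in> borel_measurable borel \<Longrightarrow> integrable J.nu F \<Longrightarrow> (LINT x:\<Omega>|lborel. F (s x) * Q x * W x) = (LINT t|J.nu. F t * poly q t)"
      using poly_reduction[OF Q] by blast
    have "m div e < j" using m e_pos by (simp add: div_less_iff_less_mult mult.commute)
    then have "degree q < j" using q(1) by simp
    then have "(LINT t|J.nu. J.R j t * poly q t) = 0" by (intro J.R_orthogonal) simp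
    moreover have "(LINT x:\<Omega>|lborel. J.R j (s x) * Q x * W x) = (LINT t|J.nu. J.R j t * poly q t)"
      by (intro q(2) J.measurable_R J.integrable_nu_cont J.continuous_R)
    ultimately show ?thesis by (simp add: wint_eq)
  qed
  ultimately show ?thesis unfolding orth_polys_def by (simp add: J.poly_Rp)
qed

text \<open>Let \<open>q\<close> be the conditional expectation of the kernel. It is a polynomial in \<open>s\<close> of degree at most \<open>n div e\<close>, and it is orthogonal to all
polynomials \<open>Q\<close> with \<open>e * degree Q < n\<close>. If \<open>e\<close> does not divide \<open>n\<close>, then \<open>q\<close> is orthogonal to itself. Otherwise it is a multiple of
\<open>R (n div e)\<close>, and the reproducing property determines the factor.\<close>

lemma proj_radial:
  assumes Fm [measurable]: "F \<in> borel_measurable borel" and F: "integrable J.nu F"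
  shows "proj \<Omega> W n (\<lambda>y. F (s y)) x =
    (if e dvd n then J.hat F (n div e) / J.h (n div e) * J.R (n div e) (s x) else 0)"
proof -
  define K where "K = repr_kernel \<Omega> W n x"
  have K: "K \<in> orth_polys \<Omega> W n" "\<And>P. P \<in> orth_polys \<Omega> W n \<Longrightarrow> wint (\<lambda>y. P y * K y) = P x"
    unfolding K_def using kernel(1)[of n x] kernel(2)[of _ n x] by simp_all
  have Kn: "K \<in> polys_deg_le n" using K(1) by (simp add: orth_polys_def)
  obtain q where q: "degree q \<le> n div e"
      "\<And>F. F \<in> borel_measurable borel \<Longrightarrow> integrable J.nu F \<Longrightarrow> (LINT x:\<Omega>|lborel. F (s x) * K x * W x) = (LINT t|J.nu. F t * poly q t)"
    by (rule poly_reduction[OF Kn]) (rule that; assumption)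
  have proj: "proj \<Omega> W n (\<lambda>y. F (s y)) x = (LINT t|J.nu. F t * poly q t) / mass"
    unfolding proj_def K_def[symmetric] wint_eq by (subst q(2)[OF Fm F]) simp
  have orth: "(LINT t|J.nu. poly Q t * poly q t) = 0" if d: "e * degree Q < n" for Q
  proof -
    have "\<forall>m<n. \<forall>Q\<in>polys_deg_le m. wint (\<lambda>y. K y * Q y) = 0" using K(1) by (simp add: orth_polys_def)
    from this[rule_format, OF d comp_poly[OF order_refl]] have "wint (\<lambda>y. K y * poly Q (s y)) = 0" .
    then have "(LINT x:\<Omega>|lborel. poly Q (s x) * K x * W x) = 0" using mass_pos by (simp add: wint_eq mult.commute)
    moreover have "poly Q \<in> borel_measurable borel" by (intro borel_measurable_continuous_onI continuous_intros)
    ultimately show ?thesis using q(2)[of "poly Q"] poly_int by simp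
  qed
  have AE0: "(LINT t|J.nu. F t * poly p t) = 0" if "AE t in J.nu. poly p t = 0" for p
  proof -
    have "poly p \<in> borel_measurable borel" by (intro borel_measurable_continuous_onI continuous_intros)
    then have "(LINT t|J.nu. F t * poly p t) = (LINT t|J.nu. 0)"
      using that by (intro integral_cong_AE) (auto elim!: eventually_mono)
    then show ?thesis by simp
  qed
  show ?thesis
  proof (cases "e dvd n")
    case False
    have "e * (n div e) \<noteq> n" using False by (metis dvd_triv_left)
    then have "e * (n div e) < n" using times_div_less_eq_dividend[of e n] by linarith
    moreover have "e * degree q \<le> e * (n div e)" using q(1) by simp
    ultimately have "(LINT t|J.nu. poly q t * poly q t) = 0" by (intro orth) linarith
    then show ?thesis using False proj AE0[OF poly_sq_zero] by simp
  next
    case True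
    define j where "j = n div e"
    have n: "n = e * j" using True by (simp add: j_def)
    have degRp: "degree (J.Rp j) \<le> j" unfolding J.Rp_def
      by (intro degree_sum_le) (auto intro: order_trans[OF degree_monom_le])
    have cn: "coeff (J.Rp j) j \<noteq> 0"
    proof -
      have "pochhammer (- real j) j \<noteq> 0" by (simp add: pochhammer_same)
      moreover have "pochhammer (real j + J.c) j > 0" "pochhammer ((\<Sum>i\<in>UNIV - {i0}. \<kappa> i + 1/2) - 1 + 1) j > 0"
        using J.c_pos J.a_gt by (auto intro!: pochhammer_pos)
      ultimately show ?thesis unfolding J.coeff_Rp J.coef_def by simp
    qed
    define l where "l = coeff q j / coeff (J.Rp j) j"
    define p where "p = q - smult l (J.Rp j)"
    have "degree p \<le> j" unfolding p_def using q(1) degRp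
      by (intro degree_diff_le) (auto simp: j_def intro: order_trans[OF degree_smult_le])
    moreover have "coeff p j = 0" using cn by (simp add: p_def l_def)
    ultimately have dp: "degree p < j \<or> p = 0" by (metis eq_zero_or_degree_less)
    have qp: "poly q t = l * J.R j t + poly p t" for t by (simp add: p_def J.poly_Rp)
    have pq: "(LINT t|J.nu. poly p t * poly q t) = 0"
    proof (cases "p = 0")
      case False
      then have "degree p < j" using dp by simp
      then show ?thesis using e_pos by (intro orth) (simp add: n)
    qed simp
    have pR: "(LINT t|J.nu. J.R j t * poly p t) = 0" by (rule J.R_orthogonal[OF dp])
    have ip: "integrable J.nu (\<lambda>t. poly p t * poly p t)" "integrable J.nu (\<lambda>t. J.R j t * poly p t)" "integrable J.nu (\<lambda>t. J.R j t * J.R j t)"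
      by (intro J.integrable_nu_cont continuous_intros)+
    have "(LINT t|J.nu. poly p t * poly q t) = (LINT t|J.nu. l * (J.R j t * poly p t) + poly p t * poly p t)"
      unfolding qp by (simp add: algebra_simps)
    also have "\<dots> = l * (LINT t|J.nu. J.R j t * poly p t) + (LINT t|J.nu. poly p t * poly p t)"
      using ip by (subst Bochner_Integration.integral_add) auto
    finally have "(LINT t|J.nu. poly p t * poly p t) = 0" using pq pR by simp
    then have Fp: "(LINT t|J.nu. F t * poly p t) = 0" by (intro AE0 poly_sq_zero)
    have "(LINT t|J.nu. J.R j t * poly q t) = l * J.h j"
    proof -
      have "(LINT t|J.nu. J.R j t * poly q t) = (LINT t|J.nu. l * (J.R j t * J.R j t) + J.R j t * poly p t)"
        unfolding qp by (simp add: algebra_simps)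
      also have "\<dots> = l * (LINT t|J.nu. J.R j t * J.R j t) + (LINT t|J.nu. J.R j t * poly p t)"
        using ip by (subst Bochner_Integration.integral_add) auto
      finally show ?thesis by (simp add: pR J.h_def power2_eq_square)
    qed
    moreover have "(LINT t|J.nu. J.R j t * poly q t) = mass * J.R j (s x)"
    proof -
      have "wint (\<lambda>y. J.R j (s y) * K y) = J.R j (s x)" using K(2)[of "\<lambda>y. J.R j (s y)"] R_comp_orth[of j] by (simp add: n)
      then have "(LINT x:\<Omega>|lborel. J.R j (s x) * K x * W x) = mass * J.R j (s x)" using mass_pos by (simp add: wint_eq field_simps)
      moreover have "(LINT x:\<Omega>|lborel. J.R j (s x) * K x * W x) = (LINT t|J.nu. J.R j t * poly q t)"
        by (intro q(2) J.measurable_R J.integrable_nu_cont J.continuous_R)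
      ultimately show ?thesis by simp
    qed
    ultimately have l: "l = mass * J.R j (s x) / J.h j" using J.h_pos[of j] by (simp add: field_simps)
    have "(LINT t|J.nu. F t * poly q t) = (LINT t|J.nu. l * (F t * poly (J.Rp j) t) + F t * poly p t)"
      unfolding qp J.poly_Rp by (simp add: algebra_simps)
    also have "\<dots> = l * (LINT t|J.nu. F t * poly (J.Rp j) t) + (LINT t|J.nu. F t * poly p t)"
      using integrable_F_poly[OF Fm F] by (subst Bochner_Integration.integral_add) auto
    finally have "(LINT t|J.nu. F t * poly q t) = l * J.hat F j" by (simp add: Fp J.hat_def J.poly_Rp)
    then show ?thesis unfolding proj l using True mass_pos by (simp add: j_def)
  qed
qed

lemma cesaro_radial:
  assumes Fm: "F \<in> borel_measurable borel" and F: "integrable J.nu F"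
  shows "cesaro_mean \<Omega> W dl n (\<lambda>y. F (s y)) x = J.mean dl e n F (s x)"
proof -
  have "(\<Sum>j=0..n. cesaro_coeff dl (n - j) * proj \<Omega> W j (\<lambda>y. F (s y)) x) =
     (\<Sum>j\<in>(\<lambda>i. e * i) ` {..n div e}. cesaro_coeff dl (n - j) * proj \<Omega> W j (\<lambda>y. F (s y)) x)"
  proof (rule sum.mono_neutral_right)
    show "(\<lambda>i. e * i) ` {..n div e} \<subseteq> {0..n}"
      using e_pos by (auto simp: less_eq_div_iff_mult_less_eq mult.commute)
    show "\<forall>i\<in>{0..n} - (\<lambda>i. e * i) ` {..n div e}. cesaro_coeff dl (n - i) * proj \<Omega> W i (\<lambda>y. F (s y)) x = 0"
    proof
      fix i assume i: "i \<in> {0..n} - (\<lambda>i. e * i) ` {..n div e}"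
      have "\<not> e dvd i"
      proof
        assume "e dvd i"
        then have "i = e * (i div e)" by simp
        moreover have "i div e \<le> n div e" using i by (intro div_le_mono) auto
        ultimately show False using i by (metis DiffE atMost_iff imageI)
      qed
      then show "cesaro_coeff dl (n - i) * proj \<Omega> W i (\<lambda>y. F (s y)) x = 0" by (simp add: proj_radial[OF Fm F])
    qed
  qed auto
  also have "\<dots> = (\<Sum>i\<le>n div e. cesaro_coeff dl (n - e * i) * (J.hat F i / J.h i * J.R i (s x)))"
    using e_pos by (subst sum.reindex) (auto simp: inj_on_def proj_radial[OF Fm F])
  finally have S: "(\<Sum>j=0..n. cesaro_coeff dl (n - j) * proj \<Omega> W j (\<lambda>y. F (s y)) x) =
     (\<Sum>i\<le>n div e. cesaro_coeff dl (n - e * i) * (J.hat F i / J.h i * J.R i (s x)))" .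
  show ?thesis unfolding cesaro_mean_def J.mean_def S sum_distrib_left
    by (intro sum.cong refl) (simp only: divide_inverse mult_ac)
qed

end

section \<open>Divergence on the ball and on the simplex\<close>

lemma eventually_uniform_bound:
  fixes P :: "nat \<Rightarrow> real \<Rightarrow> bool"
  assumes mono: "\<And>n K K'. P n K \<Longrightarrow> K \<le> K' \<Longrightarrow> P n K'" and each: "\<And>n. \<exists>K. P n K"
    and tail: "\<And>n. n \<ge> N \<Longrightarrow> P n K0"
  shows "\<exists>K. \<forall>n. P n K"
proof -
  have "\<exists>K. \<forall>n<N. P n K"
  proof (induction N)
    case (Suc N)
    then obtain K where K: "\<And>n. n < N \<Longrightarrow> P n K" by blast
    obtain K' where "P N K'" using each by blast
    then have "\<forall>n<Suc N. P n (max K K')" using K mono by (metis less_Suc_eq max.cobounded1 max.cobounded2)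
    then show ?case by blast
  qed simp
  then obtain K where K: "\<And>n. n < N \<Longrightarrow> P n K" by blast
  have "P n (max K K0)" for n
    by (cases "n < N") (use K tail mono in \<open>metis max.cobounded1\<close>, use tail mono in \<open>metis max.cobounded2 not_le\<close>)
  then show ?thesis by blast
qed

lemma powr_abs_le_two:
  fixes x y q :: real
  assumes "q \<ge> 1"
  shows "\<bar>x\<bar> powr q \<le> 2 powr q * (\<bar>x - y\<bar> powr q + \<bar>y\<bar> powr q)"
proof -
  have "\<bar>x\<bar> \<le> 2 * max \<bar>x - y\<bar> \<bar>y\<bar>"
  proof -
    have "\<bar>x\<bar> \<le> \<bar>x - y\<bar> + \<bar>y\<bar>" by linarith
    also have "\<dots> \<le> max \<bar>x - y\<bar> \<bar>y\<bar> + max \<bar>x - y\<bar> \<bar>y\<bar>" by (intro add_mono) auto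
    finally show ?thesis by simp
  qed
  then have "\<bar>x\<bar> powr q \<le> (2 * max \<bar>x - y\<bar> \<bar>y\<bar>) powr q" using assms by (intro powr_mono2) auto
  also have "\<dots> = 2 powr q * max \<bar>x - y\<bar> \<bar>y\<bar> powr q" by (simp add: powr_mult)
  also have "\<dots> \<le> 2 powr q * (\<bar>x - y\<bar> powr q + \<bar>y\<bar> powr q)"
    by (intro mult_left_mono) (auto simp: max_def)
  finally show ?thesis .
qed

context barycentric_weight
begin

text \<open>Null sets are transported by the push-forward.\<close>

lemma AE_interval_of_AE_domain:
  assumes "\<And>x. x \<in> \<Omega> \<Longrightarrow> Q (s x)" and [measurable]: "{t. Q t} \<in> sets borel"
  shows "AE t in J.nu. Q t"
proof -
  have "AE x in weighted_measure (\<lambda>_. 0). Q (s x)" using AE_weighted_measure by eventually_elim (rule assms)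
  then have "AE t in distr (weighted_measure (\<lambda>_. 0)) borel s. Q t" by (subst AE_distr_iff) auto
  then have "AE t in pushed (\<lambda>_. 0). Q t" unfolding pushforward .
  then have "AE t in J.nu. 0 < ennreal (indicator {0..1} t * (fibre_const (\<lambda>_. 0) * (t ^ rest_degree (\<lambda>_. 0) * (1 - t) ^ 0))) \<longrightarrow> Q t"
    unfolding pushed_def by (subst (asm) AE_density) auto
  then show ?thesis using J.AE_nu
  proof eventually_elim
    case (elim t)
    then show ?case using fibre_const_pos[of "\<lambda>_. 0"] by (simp add: rest_degree_def)
  qed
qed

lemma reduction_plain:
  assumes [measurable]: "F \<in> borel_measurable borel"
  shows "set_integrable lborel \<Omega> (\<lambda>x. F (s x) * W x) \<longleftrightarrow> integrable J.nu F"
    "(LINT x:\<Omega>|lborel. F (s x) * W x) = fibre_const (\<lambda>_. 0) * (LINT t|J.nu. F t)"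
  using reduction[OF assms, of "\<lambda>_. 0"] by (simp_all add: rest_degree_def)

text \<open>The means of a function that is composed with \<open>s\<close> have, up to a constant, the norms of the one-dimensional means. If they
converged to \<open>g\<close> in \<open>L\<^sup>p\<close>, these norms would be bounded in \<open>n\<close>.\<close>

lemma divergent_cesaro_means:
  assumes p: "1 \<le> p" and dl: "0 < dl"
    and crit: "dl \<le> 2 * (\<Sum>i\<in>UNIV - {i0}. \<kappa> i + 1/2) * \<bar>enn2real (1 / p) - 1/2\<bar> - 1/2"
  shows "\<exists>f\<in>Lp_space p \<Omega> W. \<not> converges_in_Lp p \<Omega> W (\<lambda>n. cesaro_mean \<Omega> W dl n f)"
proof -
  define \<theta> where "\<theta> = enn2real (1 / p)"
  define q where "q = enn2real p"
  have pq: "p = \<infinity> \<and> \<theta> = 0 \<or> p \<noteq> \<infinity> \<and> 1 \<le> q \<and> \<theta> = 1 / q \<and> p = ennreal q"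
  proof (cases p)
    case (real r)
    then have "1 \<le> r" using p by (metis ennreal_1 ennreal_le_iff)
    moreover have "1 / p = ennreal (1 / r)" using real \<open>1 \<le> r\<close> by (simp flip: ennreal_1 add: divide_ennreal)
    ultimately show ?thesis using real by (simp add: \<theta>_def q_def)
  qed (simp add: \<theta>_def)
  have \<theta>: "0 \<le> \<theta>" "\<theta> \<le> 1" using pq by auto
  obtain F where FL: "J.in_Lp \<theta> F" and unb: "\<not> (\<exists>K. \<forall>n. (if \<theta> = 0 then AE t in J.nu. \<bar>J.mean dl e n F t\<bar> \<le> K
       else (LINT t|J.nu. \<bar>J.mean dl e n F t\<bar> powr (1 / \<theta>)) \<le> K))"
    using J.unbounded_means_exist[OF dl e_pos \<theta>] crit unfolding \<theta>_def[symmetric] by auto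
  have Fm [measurable]: "F \<in> borel_measurable borel"
    using FL unfolding J.in_Lp_def by (auto split: if_splits intro: borel_measurable_continuous_onI)
  have F1: "integrable J.nu F"
  proof (cases "\<theta> = 0")
    case True then show ?thesis using FL by (intro J.integrable_nu_cont) (simp add: J.in_Lp_def)
  next
    case False
    then have i: "integrable J.nu (\<lambda>t. \<bar>F t\<bar> powr q)" and q: "q \<ge> 1" using FL pq by (auto simp: J.in_Lp_def)
    interpret finite_measure J.nu by (rule J.finite_nu)
    show ?thesis
    proof (rule Bochner_Integration.integrable_bound[OF Bochner_Integration.integrable_add[OF integrable_const[of 1] i]])
      show "AE t in J.nu. norm (F t) \<le> norm (1 + \<bar>F t\<bar> powr q)"
      proof (rule AE_I2)
        fix t
        show "norm (F t) \<le> norm (1 + \<bar>F t\<bar> powr q)"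
        proof (cases "\<bar>F t\<bar> \<le> 1")
          case False
          then have "\<bar>F t\<bar> powr 1 \<le> \<bar>F t\<bar> powr q" using q by (intro powr_mono) auto
          then show ?thesis using False by simp
        qed (auto intro: add_increasing2)
      qed
    qed measurable
  qed
  define f where "f x = F (s x)" for x
  have mean: "cesaro_mean \<Omega> W dl n f x = J.mean dl e n F (s x)" for n x
    unfolding f_def[abs_def] by (rule cesaro_radial[OF Fm F1])
  have meanc: "continuous_on S (J.mean dl e n F)" for S n by (rule J.mean_continuous)
  then have [measurable]: "J.mean dl e n F \<in> borel_measurable borel" for n by (intro borel_measurable_continuous_onI)
  have msc: "continuous_on S (\<lambda>x. J.mean dl e n F (s x))" for S n
    by (rule continuous_on_compose2[OF meanc[of UNIV] s_cont]) auto
  have fL: "f \<in> Lp_space p \<Omega> W"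
  proof (cases "p = \<infinity>")
    case True
    then have "continuous_on UNIV F" using FL pq by (auto simp: J.in_Lp_def)
    then have "continuous_on \<Omega> f" unfolding f_def by (rule continuous_on_compose2[OF _ s_cont]) auto
    then show ?thesis using True by (simp add: Lp_space_def)
  next
    case False
    then have "integrable J.nu (\<lambda>t. \<bar>F t\<bar> powr q)" using FL pq by (auto simp: J.in_Lp_def)
    then have "set_integrable lborel \<Omega> (\<lambda>x. \<bar>f x\<bar> powr q * W x)"
      unfolding f_def using reduction_plain(1)[of "\<lambda>t. \<bar>F t\<bar> powr q"] by simp
    moreover have "set_borel_measurable lborel \<Omega> f" unfolding set_borel_measurable_def f_def by measurable
    ultimately show ?thesis using False by (simp add: Lp_space_def q_def)
  qed
  have "\<not> converges_in_Lp p \<Omega> W (\<lambda>n. cesaro_mean \<Omega> W dl n f)"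
  proof
    assume "converges_in_Lp p \<Omega> W (\<lambda>n. cesaro_mean \<Omega> W dl n f)"
    then obtain g where gL: "g \<in> Lp_space p \<Omega> W"
      and lim: "(\<lambda>n. Lp_norm p \<Omega> W (\<lambda>x. J.mean dl e n F (s x) - g x)) \<longlonglongrightarrow> 0"
      unfolding converges_in_Lp_def mean by blast
    obtain N where N: "\<And>n. n \<ge> N \<Longrightarrow> Lp_norm p \<Omega> W (\<lambda>x. J.mean dl e n F (s x) - g x) < 1"
      using order_tendstoD(2)[OF lim, of 1] unfolding eventually_sequentially by auto
    have "\<exists>K. \<forall>n. (if \<theta> = 0 then AE t in J.nu. \<bar>J.mean dl e n F t\<bar> \<le> K
       else (LINT t|J.nu. \<bar>J.mean dl e n F t\<bar> powr (1 / \<theta>)) \<le> K)"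
    proof (cases "p = \<infinity>")
      case True
      then have \<theta>0: "\<theta> = 0" using pq by auto
      have gc: "continuous_on \<Omega> g" using gL True by (simp add: Lp_space_def)
      have bnd: "\<exists>B. \<forall>x\<in>\<Omega>. \<bar>k x\<bar> \<le> B" if "continuous_on \<Omega> k" for k :: "real ^ 'n \<Rightarrow> real"
      proof -
        have "bounded (k ` \<Omega>)" by (intro compact_imp_bounded compact_continuous_image that compact_dom)
        then show ?thesis unfolding bounded_iff by auto
      qed
      obtain B where B: "\<And>x. x \<in> \<Omega> \<Longrightarrow> \<bar>g x\<bar> \<le> B" using bnd[OF gc] by blast
      have "\<exists>K. \<forall>n. AE t in J.nu. \<bar>J.mean dl e n F t\<bar> \<le> K"
      proof (rule eventually_uniform_bound)
        show "AE t in J.nu. \<bar>J.mean dl e n F t\<bar> \<le> K'" if "AE t in J.nu. \<bar>J.mean dl e n F t\<bar> \<le> K" "K \<le> K'" for n K K'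
          using that(1) by eventually_elim (use that(2) in linarith)
        show "\<exists>K. AE t in J.nu. \<bar>J.mean dl e n F t\<bar> \<le> K" for n
        proof -
          obtain K where "\<And>t. t \<in> {0..1} \<Longrightarrow> \<bar>J.mean dl e n F t\<bar> \<le> K" using J.continuous_bounded_01[OF meanc] by metis
          then have "AE t in J.nu. \<bar>J.mean dl e n F t\<bar> \<le> K"
            using J.AE_nu by (intro eventually_mono[OF J.AE_nu]) simp
          then show ?thesis by blast
        qed
        fix n assume n: "n \<ge> N"
        show "AE t in J.nu. \<bar>J.mean dl e n F t\<bar> \<le> 1 + B"
        proof (rule AE_interval_of_AE_domain)
          fix x assume x: "x \<in> \<Omega>"
          obtain B' where B': "\<forall>x\<in>\<Omega>. \<bar>J.mean dl e n F (s x) - g x\<bar> \<le> B'"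
            using bnd[OF continuous_on_diff[OF msc gc]] by blast
          have "\<bar>J.mean dl e n F (s x) - g x\<bar> \<le> (SUP x\<in>\<Omega>. \<bar>J.mean dl e n F (s x) - g x\<bar>)"
            using B' by (intro cSUP_upper x) (auto simp: bdd_above_def)
          also have "\<dots> < 1" using N[OF n] True by (simp add: Lp_norm_def)
          finally show "\<bar>J.mean dl e n F (s x)\<bar> \<le> 1 + B" using B[OF x] by linarith
        qed measurable
      qed
      then show ?thesis using \<theta>0 by simp
    next
      case False
      then have q: "q \<ge> 1" "\<theta> = 1 / q" "p = ennreal q" "\<theta> \<noteq> 0" using pq by auto
      have gm: "(\<lambda>x. indicator \<Omega> x *\<^sub>R g x) \<in> borel_measurable lborel"
        and gi: "set_integrable lborel \<Omega> (\<lambda>x. \<bar>g x\<bar> powr q * W x)"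
        using gL False by (auto simp: Lp_space_def q_def set_borel_measurable_def)
      define Ig where "Ig = (LINT x:\<Omega>|lborel. \<bar>g x\<bar> powr q * W x)"
      have mi: "integrable J.nu (\<lambda>t. \<bar>J.mean dl e n F t\<bar> powr q)" for n
        using q by (intro J.integrable_nu_cont continuous_on_abs_powr meanc) auto
      have mi': "set_integrable lborel \<Omega> (\<lambda>x. \<bar>J.mean dl e n F (s x)\<bar> powr q * W x)" for n
        using reduction_plain(1)[of "\<lambda>t. \<bar>J.mean dl e n F t\<bar> powr q"] mi by simp
      have di: "set_integrable lborel \<Omega> (\<lambda>x. \<bar>J.mean dl e n F (s x) - g x\<bar> powr q * W x)" for n
      proof (rule set_integrable_bound[OF set_integrable_mult_right[OF set_integral_add(1)[OF mi'[of n] gi], of "2 powr q"]])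
        have "(\<lambda>x. indicator \<Omega> x *\<^sub>R (\<bar>J.mean dl e n F (s x) - g x\<bar> powr q * W x)) =
          (\<lambda>x. indicator \<Omega> x *\<^sub>R (\<bar>J.mean dl e n F (s x) - indicator \<Omega> x *\<^sub>R g x\<bar> powr q * W x))"
          by (auto simp: indicator_def)
        then show "set_borel_measurable lborel \<Omega> (\<lambda>x. \<bar>J.mean dl e n F (s x) - g x\<bar> powr q * W x)"
          unfolding set_borel_measurable_def using gm by simp
        show "AE x\<in>\<Omega> in lborel. norm (\<bar>J.mean dl e n F (s x) - g x\<bar> powr q * W x)
           \<le> norm (2 powr q * (\<bar>J.mean dl e n F (s x)\<bar> powr q * W x + \<bar>g x\<bar> powr q * W x))"
        proof (intro AE_I2 impI)
          fix x assume x: "x \<in> \<Omega>"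
          have "\<bar>J.mean dl e n F (s x) - g x\<bar> powr q \<le> 2 powr q * (\<bar>J.mean dl e n F (s x)\<bar> powr q + \<bar>g x\<bar> powr q)"
            using powr_abs_le_two[OF q(1), of "J.mean dl e n F (s x) - g x" "- g x"] by simp
          then have "\<bar>J.mean dl e n F (s x) - g x\<bar> powr q * W x \<le> 2 powr q * (\<bar>J.mean dl e n F (s x)\<bar> powr q + \<bar>g x\<bar> powr q) * W x"
            using W_nonneg[OF x] by (intro mult_right_mono) auto
          then show "norm (\<bar>J.mean dl e n F (s x) - g x\<bar> powr q * W x)
             \<le> norm (2 powr q * (\<bar>J.mean dl e n F (s x)\<bar> powr q * W x + \<bar>g x\<bar> powr q * W x))"
            using W_nonneg[OF x] by (simp add: abs_mult distrib_right mult.assoc)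
        qed
      qed
      have c0: "fibre_const (\<lambda>_. 0) > 0" by (rule fibre_const_pos)
      have "\<exists>K. \<forall>n. (LINT t|J.nu. \<bar>J.mean dl e n F t\<bar> powr q) \<le> K"
      proof (rule eventually_uniform_bound)
        fix n assume n: "n \<ge> N"
        define D where "D = (LINT x:\<Omega>|lborel. \<bar>J.mean dl e n F (s x) - g x\<bar> powr q * W x)"
        have D0: "D \<ge> 0" unfolding D_def set_lebesgue_integral_def
          using W_nonneg by (intro integral_nonneg_AE AE_I2) (auto simp: indicator_def)
        have "(D / mass) powr (1 / q) < 1"
          using N[OF n] False unfolding Lp_norm_def wint_eq D_def q_def by simp
        have "D / mass < 1"
        proof (rule ccontr)
          assume "\<not> D / mass < 1"
          then have "1 \<le> (D / mass) powr (1 / q)" using q by (intro ge_one_powr_ge_zero) auto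
          then show False using \<open>(D / mass) powr (1 / q) < 1\<close> by simp
        qed
        then have D: "D \<le> mass" using mass_pos by (simp add: field_simps)
        have "fibre_const (\<lambda>_. 0) * (LINT t|J.nu. \<bar>J.mean dl e n F t\<bar> powr q) = (LINT x:\<Omega>|lborel. \<bar>J.mean dl e n F (s x)\<bar> powr q * W x)"
          by (rule reduction_plain(2)[symmetric]) measurable
        also have "\<dots> \<le> (LINT x:\<Omega>|lborel. 2 powr q * (\<bar>J.mean dl e n F (s x) - g x\<bar> powr q * W x + \<bar>g x\<bar> powr q * W x))"
        proof (rule set_integral_mono[OF mi'])
          show "set_integrable lborel \<Omega> (\<lambda>x. 2 powr q * (\<bar>J.mean dl e n F (s x) - g x\<bar> powr q * W x + \<bar>g x\<bar> powr q * W x))"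
            by (intro set_integrable_mult_right set_integral_add(1) di gi)
          fix x assume x: "x \<in> \<Omega>"
          have "\<bar>J.mean dl e n F (s x)\<bar> powr q * W x \<le> (2 powr q * (\<bar>J.mean dl e n F (s x) - g x\<bar> powr q + \<bar>g x\<bar> powr q)) * W x"
            using W_nonneg[OF x] by (intro mult_right_mono powr_abs_le_two q)
          then show "\<bar>J.mean dl e n F (s x)\<bar> powr q * W x \<le> 2 powr q * (\<bar>J.mean dl e n F (s x) - g x\<bar> powr q * W x + \<bar>g x\<bar> powr q * W x)"
            by (simp add: distrib_right mult.assoc)
        qed
        also have "\<dots> = 2 powr q * (D + Ig)"
          unfolding D_def Ig_def using di gi by (simp add: set_integral_add)
        also have "\<dots> \<le> 2 powr q * (mass + Ig)" using D by (intro mult_left_mono) auto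
        finally show "(LINT t|J.nu. \<bar>J.mean dl e n F t\<bar> powr q) \<le> 2 powr q * (mass + Ig) / fibre_const (\<lambda>_. 0)"
          using c0 by (simp add: field_simps)
      qed auto
      then show ?thesis using q by simp
    qed
    then show False using unb by blast
  qed
  then show ?thesis using fL by blast
qed

end

text \<open>A small ball inside both domains on which all coordinates are positive.\<close>

lemma positive_ball:
  fixes x :: "real ^ 'n::finite"
  assumes "x \<in> ball (\<chi> i. 1 / (2 * real CARD('n))) (1 / (4 * real CARD('n)))"
  shows "x $ i > 0" "(\<Sum>i\<in>UNIV. x $ i) < 1" "norm x < 1"
proof -
  define d where "d = real CARD('n)"
  have d: "d > 0" by (simp add: d_def)
  have b: "\<bar>x $ i - 1 / (2 * d)\<bar> < 1 / (4 * d)" for i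
  proof -
    have "\<bar>x $ i - 1 / (2 * d)\<bar> = \<bar>(x - (\<chi> i. 1 / (2 * d))) $ i\<bar>" by simp
    also have "\<dots> \<le> norm (x - (\<chi> i. 1 / (2 * d)))" by (rule component_le_norm_cart)
    also have "\<dots> < 1 / (4 * d)" using assms by (simp add: dist_norm norm_minus_commute d_def)
    finally show ?thesis .
  qed
  have pos: "x $ i > 0" for i
  proof -
    have "1 / (2 * d) = 2 * (1 / (4 * d))" by simp
    moreover have "1 / (4 * d) > 0" using d by simp
    ultimately show ?thesis using b[of i] by linarith
  qed
  then show "x $ i > 0" .
  have up: "x $ i \<le> 3 / (4 * d)" for i
  proof -
    have "1 / (2 * d) = 2 * (1 / (4 * d))" "3 / (4 * d) = 3 * (1 / (4 * d))" by simp_all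
    then show ?thesis using b[of i] by linarith
  qed
  have "(\<Sum>i\<in>UNIV. x $ i) \<le> (\<Sum>i\<in>(UNIV::'n set). 3 / (4 * d))" by (intro sum_mono up)
  also have "\<dots> = 3 / 4" using d by (simp add: d_def)
  finally show s: "(\<Sum>i\<in>UNIV. x $ i) < 1" by simp
  have "norm x \<le> (\<Sum>i\<in>UNIV. \<bar>x $ i\<bar>)" by (rule norm_le_l1_cart)
  also have "\<dots> = (\<Sum>i\<in>UNIV. x $ i)" using pos by (intro sum.cong refl) (simp add: less_imp_le)
  finally show "norm x < 1" using s by simp
qed

lemma barycentric_simplex:
  fixes \<kappa> :: "'n::finite option \<Rightarrow> real"
  assumes \<kappa>: "\<And>i. \<kappa> i \<ge> 0" and dim: "(\<Sum>i\<in>UNIV - {i0}. \<kappa> i + 1/2) > 1/2"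
  shows "barycentric_weight \<kappa> simplex_dom (simplex_weight \<kappa>) simplex_coord 1 i0"
proof
  have dom: "x $ i \<le> 1" if "x \<in> simplex_dom" for x :: "real ^ 'n" and i
    using that member_le_sum[of i UNIV "\<lambda>i. x $ i"] by (auto simp: simplex_dom_def)
  show "compact (simplex_dom :: (real ^ 'n) set)"
  proof -
    have "closed (simplex_dom :: (real ^ 'n) set)" unfolding simplex_dom_def
      by (intro closed_Collect_conj closed_Collect_all closed_Collect_le continuous_intros)
    moreover have "norm x \<le> 1" if "x \<in> simplex_dom" for x :: "real ^ 'n"
    proof -
      have "norm x \<le> (\<Sum>i\<in>UNIV. \<bar>x $ i\<bar>)" by (rule norm_le_l1_cart)
      also have "\<dots> = (\<Sum>i\<in>UNIV. x $ i)" using that by (intro sum.cong refl) (auto simp: simplex_dom_def)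
      finally show ?thesis using that by (simp add: simplex_dom_def)
    qed
    ultimately show ?thesis by (auto simp: compact_eq_bounded_closed bounded_iff)
  qed
  fix i and x :: "real ^ 'n"
  show "0 \<le> simplex_coord i x" "simplex_coord i x \<le> 1" if "x \<in> simplex_dom"
    using that dom[OF that] by (auto simp: simplex_coord_def simplex_dom_def sum_nonneg split: option.split)
next
  fix i :: "'n option"
  show "simplex_coord i \<in> polys_deg_le 1"
  proof (cases i)
    case None
    have "(\<lambda>x::real ^ 'n. 1 + (-1) * (\<Sum>j\<in>UNIV. x $ j)) \<in> polys_deg_le 1"
      by (intro polys_add polys_const polys_scale polys_sum polys_coord)
    then show ?thesis by (simp add: simplex_coord_def[abs_def] None)
  next
    case (Some j)
    then show ?thesis using polys_coord[of j] by (simp add: simplex_coord_def[abs_def])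
  qed
  then show "continuous_on UNIV (simplex_coord i)" by (rule polys_continuous)
next
  show "simplex_weight \<kappa> \<in> borel_measurable borel" unfolding simplex_weight_def by measurable
  show "0 \<le> simplex_weight \<kappa> x" for x by (simp add: simplex_weight_def prod_nonneg)
  show "has_bochner_integral lborel (\<lambda>x. indicator simplex_dom x * ((\<Prod>i\<in>UNIV. simplex_coord i x ^ m i) * simplex_weight \<kappa> x)) (dirichlet_value \<kappa> m)" for m
    by (rule dirichlet_simplex[OF \<kappa>])
next
  fix \<alpha> :: "'n \<Rightarrow> nat"
  define m where "m i = (case i of None \<Rightarrow> 0 | Some j \<Rightarrow> \<alpha> j)" for i
  have "1 * (\<Sum>i\<in>UNIV. m i) \<le> (\<Sum>i\<in>UNIV. \<alpha> i) \<and> (\<forall>x. (\<Prod>j\<in>UNIV. (x $ j) ^ \<alpha> j) = (\<Prod>i\<in>UNIV. simplex_coord i x ^ m i))"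
    unfolding sum_UNIV_option prod_UNIV_option by (simp add: m_def simplex_coord_def)
  then show "(\<exists>m. 1 * (\<Sum>i\<in>UNIV. m i) \<le> (\<Sum>i\<in>UNIV. \<alpha> i) \<and> (\<forall>x. (\<Prod>j\<in>UNIV. (x $ j) ^ \<alpha> j) = (\<Prod>i\<in>UNIV. simplex_coord i x ^ m i)))
        \<or> (\<forall>F\<in>borel_measurable borel. (LINT x:simplex_dom|lborel. F (simplex_coord i0 x) * (\<Prod>j\<in>UNIV. (x $ j) ^ \<alpha> j) * simplex_weight \<kappa> x) = 0)"
    by blast
next
  show "\<exists>y r. 0 < r \<and> ball y r \<subseteq> simplex_dom \<and> (\<forall>x\<in>ball y r. simplex_weight \<kappa> x > 0)"
  proof (intro exI conjI)
    show "0 < 1 / (4 * real CARD('n))" by simp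
    show "ball (\<chi> i. 1 / (2 * real CARD('n))) (1 / (4 * real CARD('n))) \<subseteq> (simplex_dom :: (real ^ 'n) set)"
    proof
      fix x :: "real ^ 'n" assume "x \<in> ball (\<chi> i. 1 / (2 * real CARD('n))) (1 / (4 * real CARD('n)))"
      from positive_ball[OF this] show "x \<in> simplex_dom" by (simp add: simplex_dom_def less_imp_le)
    qed
    show "\<forall>x\<in>ball (\<chi> i. 1 / (2 * real CARD('n))) (1 / (4 * real CARD('n))). simplex_weight \<kappa> x > 0"
    proof
      fix x :: "real ^ 'n" assume "x \<in> ball (\<chi> i. 1 / (2 * real CARD('n))) (1 / (4 * real CARD('n)))"
      note b = positive_ball[OF this]
      have "x $ i \<noteq> 0" for i using b(1)[of i] by simp
      then show "simplex_weight \<kappa> x > 0" unfolding simplex_weight_def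
        by (intro mult_pos_pos prod_pos) (use b(2) in auto)
    qed
  qed
qed (use \<kappa> dim in auto)

lemma barycentric_ball:
  fixes \<kappa> :: "'n::finite option \<Rightarrow> real"
  assumes \<kappa>: "\<And>i. \<kappa> i \<ge> 0" and dim: "(\<Sum>i\<in>UNIV - {i0}. \<kappa> i + 1/2) > 1/2"
  shows "barycentric_weight \<kappa> ball_dom (ball_weight \<kappa>) ball_coord 2 i0"
proof
  have dom: "(x $ i)\<^sup>2 \<le> 1" "(norm x)\<^sup>2 \<le> 1" if "x \<in> ball_dom" for x :: "real ^ 'n" and i
  proof -
    have "\<bar>x $ i\<bar> \<le> 1" using component_le_norm_cart[of x i] that by (simp add: ball_dom_def)
    then show "(x $ i)\<^sup>2 \<le> 1" by (simp add: abs_square_le_1)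
    show "(norm x)\<^sup>2 \<le> 1" using that by (simp add: ball_dom_def power_le_one)
  qed
  have ball_eq: "(ball_dom :: (real ^ 'n) set) = cball 0 1" by (auto simp: ball_dom_def)
  show "compact (ball_dom :: (real ^ 'n) set)" by (subst ball_eq) (rule compact_cball)
  fix i and x :: "real ^ 'n"
  show "0 \<le> ball_coord i x" "ball_coord i x \<le> 1" if "x \<in> ball_dom"
    using dom[OF that] by (auto simp: ball_coord_def split: option.split)
next
  fix i :: "'n option"
  have sq: "(\<lambda>x::real ^ 'n. (x $ j)\<^sup>2) \<in> polys_deg_le 2" for j
    using polys_power[OF polys_coord[of j], of 2] by simp
  show "ball_coord i \<in> polys_deg_le 2"
  proof (cases i)
    case None
    have "(\<lambda>x::real ^ 'n. 1 + (-1) * (\<Sum>j\<in>UNIV. (x $ j)\<^sup>2)) \<in> polys_deg_le 2"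
      by (intro polys_add polys_const polys_scale polys_sum sq)
    then show ?thesis by (simp add: ball_coord_def[abs_def] None norm_sq_vec)
  next
    case (Some j)
    then show ?thesis using sq[of j] by (simp add: ball_coord_def[abs_def])
  qed
  then show "continuous_on UNIV (ball_coord i)" by (rule polys_continuous)
next
  show "ball_weight \<kappa> \<in> borel_measurable borel" unfolding ball_weight_def by measurable
  show "0 \<le> ball_weight \<kappa> x" for x by (simp add: ball_weight_def prod_nonneg)
  show "has_bochner_integral lborel (\<lambda>x. indicator ball_dom x * ((\<Prod>i\<in>UNIV. ball_coord i x ^ m i) * ball_weight \<kappa> x)) (dirichlet_value \<kappa> m)" for m
    by (rule dirichlet_ball[OF \<kappa>])
next
  fix \<alpha> :: "'n \<Rightarrow> nat"
  show "(\<exists>m. 2 * (\<Sum>i\<in>UNIV. m i) \<le> (\<Sum>i\<in>UNIV. \<alpha> i) \<and> (\<forall>x. (\<Prod>j\<in>UNIV. (x $ j) ^ \<alpha> j) = (\<Prod>i\<in>UNIV. ball_coord i x ^ m i)))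
        \<or> (\<forall>F\<in>borel_measurable borel. (LINT x:ball_dom|lborel. F (ball_coord i0 x) * (\<Prod>j\<in>UNIV. (x $ j) ^ \<alpha> j) * ball_weight \<kappa> x) = 0)"
  proof (cases "\<forall>i. even (\<alpha> i)")
    case True
    define m where "m i = (case i of None \<Rightarrow> 0 | Some j \<Rightarrow> \<alpha> j div 2)" for i
    have "2 * (\<Sum>i\<in>UNIV. m i) = (\<Sum>i\<in>UNIV. \<alpha> i)"
      unfolding sum_UNIV_option using True by (simp add: m_def sum_distrib_left)
    moreover have "(\<Prod>j\<in>UNIV. (x $ j) ^ \<alpha> j) = (\<Prod>i\<in>UNIV. ball_coord i x ^ m i)" for x
      unfolding prod_UNIV_option using True by (simp add: m_def ball_coord_def flip: power_mult)
    ultimately show ?thesis by (intro disjI1 exI[of _ m] conjI allI) simp_all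
  next
    case False
    then obtain j where "odd (\<alpha> j)" by blast
    then show ?thesis by (intro disjI2 ballI odd_monomial_ball[where i = j])
  qed
next
  show "\<exists>y r. 0 < r \<and> ball y r \<subseteq> ball_dom \<and> (\<forall>x\<in>ball y r. ball_weight \<kappa> x > 0)"
  proof (intro exI conjI)
    show "0 < 1 / (4 * real CARD('n))" by simp
    show "ball (\<chi> i. 1 / (2 * real CARD('n))) (1 / (4 * real CARD('n))) \<subseteq> (ball_dom :: (real ^ 'n) set)"
    proof
      fix x :: "real ^ 'n" assume "x \<in> ball (\<chi> i. 1 / (2 * real CARD('n))) (1 / (4 * real CARD('n)))"
      from positive_ball(3)[OF this] show "x \<in> ball_dom" by (simp add: ball_dom_def)
    qed
    show "\<forall>x\<in>ball (\<chi> i. 1 / (2 * real CARD('n))) (1 / (4 * real CARD('n))). ball_weight \<kappa> x > 0"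
    proof
      fix x :: "real ^ 'n" assume "x \<in> ball (\<chi> i. 1 / (2 * real CARD('n))) (1 / (4 * real CARD('n)))"
      note b = positive_ball[OF this]
      have "(norm x)\<^sup>2 < 1" using b(3) by (simp add: power_less_one_iff)
      moreover have "x $ i \<noteq> 0" for i using b(1)[of i] by simp
      ultimately show "ball_weight \<kappa> x > 0" unfolding ball_weight_def
        by (intro mult_pos_pos prod_pos) auto
    qed
  qed
qed (use \<kappa> dim in auto)

theorem theorem3p6:
  fixes \<kappa> :: "'n::finite option \<Rightarrow> real"
    and \<Omega> :: "(real ^ 'n) set"
    and W :: "real ^ 'n \<Rightarrow> real"
    and p :: ennreal
    and \<delta> :: real
  assumes "\<And>i. \<kappa> i \<ge> 0"
    and "(\<Omega>, W) = (ball_dom, ball_weight \<kappa>) \<or> (\<Omega>, W) = (simplex_dom, simplex_weight \<kappa>)"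
    and "1 \<le> p"
    and "0 < \<delta>" and "\<delta> \<le> delta_kappa \<kappa> p"
  shows "\<exists>f\<in>Lp_space p \<Omega> W. \<not> converges_in_Lp p \<Omega> W (\<lambda>n. cesaro_mean \<Omega> W \<delta> n f)"
proof -
  have "Min (range \<kappa>) \<in> range \<kappa>" by (intro Min_in) auto
  then obtain i0 where "Min (range \<kappa>) = \<kappa> i0" by (rule rangeE)
  then have i0: "\<kappa> i0 = Min (range \<kappa>)" by (rule sym)
  define \<theta> where "\<theta> = enn2real (1 / p)"
  have \<theta>: "\<bar>\<theta> - 1/2\<bar> \<le> 1/2"
  proof -
    have "1 / p \<le> 1"
    proof (cases p)
      case (real r)
      then have "1 \<le> r" using assms(3) by (metis ennreal_1 ennreal_le_iff)
      moreover have "1 / p = ennreal (1 / r)" using real \<open>1 \<le> r\<close> by (simp flip: ennreal_1 add: divide_ennreal)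
      ultimately show ?thesis by (simp flip: ennreal_1 add: ennreal_le_iff)
    qed simp
    then have "\<theta> \<le> 1" unfolding \<theta>_def using enn2real_mono[of "1 / p" 1] by simp
    moreover have "\<theta> \<ge> 0" by (simp add: \<theta>_def)
    ultimately show ?thesis unfolding abs_le_iff by linarith
  qed
  have S: "2 * (\<Sum>i\<in>UNIV - {i0}. \<kappa> i + 1/2) = 2 * sigma_kappa \<kappa> + 1"
  proof -
    have "(\<Sum>i\<in>UNIV - {i0}. \<kappa> i + 1/2) = (\<Sum>i\<in>UNIV. \<kappa> i + 1/2) - (\<kappa> i0 + 1/2)"
      by (simp add: sum.remove[of UNIV i0])
    also have "(\<Sum>i\<in>UNIV. \<kappa> i + 1/2) = (\<Sum>i\<in>UNIV. \<kappa> i) + real CARD('n option) / 2" by (simp add: sum.distrib)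
    also have "real CARD('n option) = real CARD('n) + 1" by simp
    finally show ?thesis unfolding sigma_kappa_def i0 by (simp add: field_simps)
  qed
  have crit: "\<delta> \<le> 2 * (\<Sum>i\<in>UNIV - {i0}. \<kappa> i + 1/2) * \<bar>enn2real (1 / p) - 1/2\<bar> - 1/2"
    using assms(4,5) unfolding S delta_kappa_def by (simp add: max_def split: if_splits)
  have dim: "(\<Sum>i\<in>UNIV - {i0}. \<kappa> i + 1/2) > 1/2"
  proof -
    have "0 \<le> (\<Sum>i\<in>UNIV - {i0}. \<kappa> i + 1/2)" using assms(1) by (intro sum_nonneg) (simp add: add_nonneg_nonneg)
    then have "2 * (\<Sum>i\<in>UNIV - {i0}. \<kappa> i + 1/2) * \<bar>\<theta> - 1/2\<bar> \<le> 2 * (\<Sum>i\<in>UNIV - {i0}. \<kappa> i + 1/2) * (1/2)"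
      using \<theta> by (intro mult_left_mono) auto
    then show ?thesis using crit assms(4) unfolding \<theta>_def by linarith
  qed
  from assms(2) show ?thesis
  proof
    assume "(\<Omega>, W) = (ball_dom, ball_weight \<kappa>)"
    then show ?thesis
      using barycentric_weight.divergent_cesaro_means[OF barycentric_ball[OF assms(1) dim] assms(3,4) crit] by simp
  next
    assume "(\<Omega>, W) = (simplex_dom, simplex_weight \<kappa>)"
    then show ?thesis
      using barycentric_weight.divergent_cesaro_means[OF barycentric_simplex[OF assms(1) dim] assms(3,4) crit] by simp
  qed
qed

end
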